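(* Let $\delta>0$ be a sufficiently small absolute constant. Let $\phi=\phi(t,x)$, $x\in\mathbb{R}^3$, solve the inhomogeneous wave equation $\square\phi=f$, $\square=-\partial_t^2+\Delta$, with initial data $(\phi,\partial_t\phi)|_{t=0}=(\phi_0,\phi_1)$. (i) One has $$|\partial\phi(t,x)|\lesssim\delta^{-1}\Big[\langle t\rangle^{-1/2}\big(\langle t-|x|\rangle^{-1+\delta}\mathbf{1}_{|x|\le t}+\mathbf{1}_{|x|>t}\big)\|\partial\,\Gamma^{\le 3}\phi(t)\|_{L^2_x}+\langle t\rangle^{1/2}\|\Gamma^{\le 2}f(t)\|_{L^2_x}\Big].$$ (ii) If $\phi$ is frequency localized, i.e. $\operatorname{supp}\widehat{\phi}(t,\cdot)\subset\{\xi\in\mathbb{R}^3:|\xi|\sim2^k\}$ for some $k\in\mathbb{Z}$, then $$|\partial\phi(t,x)|\lesssim\langle t\rangle^{-1}2^{2k}\,\|\widehat{\partial\Gamma^{\le 2}\phi}(t,\xi)\|_{L^\infty_\xi}+\langle t\rangle^{1/2}2^k\,\|\Gamma^{\le 1}f(t,x)\|_{L^2_x}.$$ Moreover, for the homogeneous wave equation, i.e. $f=0$, one has $$\|\partial\phi(t,x)\|_{L^\infty_x}\lesssim\langle t\rangle^{-1}\big(\|\Gamma^{\le 4}\phi_0\|_{L^1_x}+\|\Gamma^{\le 4}\phi_1\|_{L^1_x}\big).$$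
   Context: Work on $\mathbb{R}^{1+3}$ with coordinates $(t,x)=(t,x^1,x^2,x^3)$. $\partial\psi=(\partial_t\psi,\partial_1\psi,\partial_2\psi,\partial_3\psi)$ is the spacetime gradient. $S=t\partial_t+\sum_{i=1}^3x^i\partial_i$ is the scaling vector field, and $\Gamma$ denotes any element of $\{S,\partial_1,\partial_2,\partial_3\}$. $\Gamma^{\le k}\psi$ is the collection of all compositions of at most $k$ such vector fields applied to $\psi$; norms of such collections are sums over the collection. On functions of $x$ only (the data at $t=0$), $S$ acts as $\sum_i x^i\partial_i$. $\widehat{\cdot}$ is the Fourier transform in the spatial variable $x$. $\langle a\rangle=(1+|a|^2)^{1/2}$; $\mathbf{1}$ denotes an indicator function. $A\lesssim B$ means $A\le CB$ with an absolute constant $C$ (independent of $\phi,f,t,x,k,\delta$); $A\sim B$ means $A\lesssim B$ and $B\lesssim A$. The time $t$ at which the estimates are stated is assumed to be larger than a fixed absolute constant. Solutions are understood to be sufficiently regular and decaying for the expressions to make sense. *)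

theory Defs
  imports "HOL-Analysis.Analysis" "HOL-Probability.Essential_Supremum"
begin

text \<open>
  Functions on spacetime are complex-valued, of the form \<open>\<psi> t x\<close>. Real-valued solutions are
  covered through the isometric embedding of the reals into the complex numbers.
\<close>

type_synonym space = "real ^ 3"
type_synonym field = "real \<Rightarrow> space \<Rightarrow> complex"

datatype coord = Time | Space 3

lemma UNIV_coord: "UNIV = insert Time (range Space)"
  by (auto intro: coord.exhaust)

instance coord :: finite
  by standard (simp add: UNIV_coord)

definition spatial_deriv :: "3 \<Rightarrow> (space \<Rightarrow> complex) \<Rightarrow> space \<Rightarrow> complex" where
  "spatial_deriv i u x = vector_derivative (\<lambda>h. u (x + h *\<^sub>R axis i 1)) (at 0)"

primrec pd :: "coord \<Rightarrow> field \<Rightarrow> field" where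
  "pd Time \<psi> = (\<lambda>t x. vector_derivative (\<lambda>s. \<psi> s x) (at t))"
| "pd (Space i) \<psi> = (\<lambda>t x. spatial_deriv i (\<psi> t) x)"

primrec C_k :: "nat \<Rightarrow> field \<Rightarrow> bool" where
  "C_k 0 \<psi> \<longleftrightarrow> continuous_on UNIV (\<lambda>(t, x). \<psi> t x)"
| "C_k (Suc k) \<psi> \<longleftrightarrow> (\<lambda>(t, x). \<psi> t x) differentiable_on UNIV \<and> (\<forall>\<mu>. C_k k (pd \<mu> \<psi>))"

text \<open>The spacetime gradient, as a vector indexed by the coordinates; its norm is Euclidean.\<close>

definition grad :: "field \<Rightarrow> real \<Rightarrow> space \<Rightarrow> complex ^ coord" where
  "grad \<psi> t x = (\<chi> \<mu>. pd \<mu> \<psi> t x)"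

definition box :: "field \<Rightarrow> field" where
  "box \<psi> t x = - pd Time (pd Time \<psi>) t x + (\<Sum>i\<in>UNIV. pd (Space i) (pd (Space i) \<psi>) t x)"

datatype vfield = Scaling | Transl 3

lemma UNIV_vfield: "UNIV = insert Scaling (range Transl)"
  by (auto intro: vfield.exhaust)

instance vfield :: finite
  by standard (simp add: UNIV_vfield)

primrec Gam :: "vfield \<Rightarrow> field \<Rightarrow> field" where
  "Gam Scaling \<psi> = (\<lambda>t x. t *\<^sub>R pd Time \<psi> t x + (\<Sum>i\<in>UNIV. (x $ i) *\<^sub>R pd (Space i) \<psi> t x))"
| "Gam (Transl i) \<psi> = pd (Space i) \<psi>"

primrec data_Gam :: "vfield \<Rightarrow> (space \<Rightarrow> complex) \<Rightarrow> space \<Rightarrow> complex" where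
  "data_Gam Scaling u = (\<lambda>x. \<Sum>i\<in>UNIV. (x $ i) *\<^sub>R spatial_deriv i u x)"
| "data_Gam (Transl i) u = spatial_deriv i u"

text \<open>
  A word \<open>[\<Gamma>\<^sub>1, \<dots>, \<Gamma>\<^sub>m]\<close> stands for the composition of the vector fields, the last one being
  applied first. The collection \<open>\<Gamma>\<^sup>\<le>\<^sup>k \<psi>\<close> is the family \<open>foldr Gam w \<psi>\<close>, \<open>w \<in> words k\<close>, and norms of
  it are sums over \<open>words k\<close>.
\<close>

definition words :: "nat \<Rightarrow> vfield list set" where
  "words k = {w. length w \<le> k}"

lemma finite_words: "finite (words k)"
  using finite_lists_length_le[of "UNIV :: vfield set" k] by (simp add: words_def)

text \<open>
  Norms over \<open>\<real>\<^sup>3\<close> take values in \<open>[0, \<infinity>]\<close>, so that an estimate carries no information when its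
  right-hand side is infinite.
\<close>

definition L1_norm :: "(space \<Rightarrow> 'b::real_normed_vector) \<Rightarrow> ennreal" where
  "L1_norm g = (\<integral>\<^sup>+ x. ennreal (norm (g x)) \<partial>lborel)"

definition L2_norm :: "(space \<Rightarrow> 'b::real_normed_vector) \<Rightarrow> ennreal" where
  "L2_norm g =
     (let I = (\<integral>\<^sup>+ x. ennreal ((norm (g x))\<^sup>2) \<partial>lborel)
      in if I = \<infinity> then \<infinity> else ennreal (sqrt (enn2real I)))"

definition Linf_norm :: "(space \<Rightarrow> 'b::real_normed_vector) \<Rightarrow> ennreal" where
  "Linf_norm g = esssup lborel (\<lambda>x. ennreal (norm (g x)))"

text \<open>The Fourier integral in \<open>x\<close>; only used for integrable functions.\<close>

definition fourier :: "(space \<Rightarrow> complex) \<Rightarrow> space \<Rightarrow> complex" where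
  "fourier g \<xi> = (LINT x|lborel. cis (- (x \<bullet> \<xi>)) * g x)"

definition fourier_vec :: "(space \<Rightarrow> complex ^ 'n) \<Rightarrow> space \<Rightarrow> complex ^ 'n" where
  "fourier_vec g \<xi> = (\<chi> \<mu>. fourier (\<lambda>x. g x $ \<mu>) \<xi>)"

text \<open>
  The relation \<open>|\<xi>| \<sim> 2\<^sup>k\<close> with implied constant \<open>A\<close>, required of the closed support of the
  Fourier transform at every time.
\<close>

definition freq_localized :: "real \<Rightarrow> int \<Rightarrow> field \<Rightarrow> bool" where
  "freq_localized A k \<phi> \<longleftrightarrow>
     (\<forall>s. closure {\<xi>. fourier (\<phi> s) \<xi> \<noteq> 0} \<subseteq>
          {\<xi>. norm \<xi> \<le> A * 2 powi k \<and> 2 powi k \<le> A * norm \<xi>})"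

text \<open>
  The decay under which the Fourier transforms of \<open>\<phi>\<close> and of the collection \<open>\<partial>\<Gamma>\<^sup>\<le>\<^sup>2 \<phi>\<close> are given by
  convergent integrals, and time derivatives of \<open>\<phi>\<close> up to third order commute with the Fourier
  transform. Some uniformity in time is indispensable: without it \<open>\<partial>\<^sub>t\<phi>\<close> need not inherit
  the frequency localization of \<open>\<phi>\<close>.
\<close>

definition locally_dominated :: "field \<Rightarrow> bool" where
  "locally_dominated \<psi> \<longleftrightarrow>
     (\<forall>a b. \<exists>G. integrable lborel G \<and> (\<forall>s\<in>{a..b}. \<forall>x. norm (\<psi> s x) \<le> G x))"

definition fourier_admissible :: "field \<Rightarrow> bool" where
  "fourier_admissible \<phi> \<longleftrightarrow>
     (\<forall>v. length v \<le> 3 \<longrightarrow> locally_dominated (foldr pd v \<phi>)) \<and>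
     (\<forall>w\<in>words 2. \<forall>\<mu>. locally_dominated (pd \<mu> (foldr Gam w \<phi>)))"

text \<open>
  Classical solutions on \<open>\<real>\<^sup>1\<^sup>+\<^sup>3\<close>. With five continuous derivatives, all members of the collections
  \<open>\<partial>\<Gamma>\<^sup>\<le>\<^sup>3 \<phi>\<close>, \<open>\<Gamma>\<^sup>\<le>\<^sup>2 f\<close>, \<open>\<Gamma>\<^sup>\<le>\<^sup>4 \<phi>\<^sub>0\<close> and \<open>\<Gamma>\<^sup>\<le>\<^sup>4 \<phi>\<^sub>1\<close> are continuous functions.
\<close>

definition solves_wave :: "field \<Rightarrow> field \<Rightarrow> (space \<Rightarrow> complex) \<Rightarrow> (space \<Rightarrow> complex) \<Rightarrow> bool" where
  "solves_wave \<phi> f \<phi>0 \<phi>1 \<longleftrightarrow>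
     C_k 5 \<phi> \<and> (\<forall>t x. box \<phi> t x = f t x) \<and>
     (\<forall>x. \<phi> 0 x = \<phi>0 x) \<and> (\<forall>x. pd Time \<phi> 0 x = \<phi>1 x)"

definition jap :: "real \<Rightarrow> real" where
  "jap a = sqrt (1 + \<bar>a\<bar>\<^sup>2)"

end

theory Submission
 imports Defs "HOL-Probability.Probability"
begin

text \<open>
For \<open>f = 0\<close> the bound follows from Kirchhoff's formula, with the spherical means estimated by
integrating the data and their derivatives outward along rays.

For the other bounds fix a direction \<open>\<omega>\<close>. The half waves \<open>FT \<partial>\<^sub>t\<phi> \<plusminus> \<omega> \<bullet> FT \<nabla>\<phi>\<close> at the frequency
\<open>l \<omega>\<close>, multiplied by \<open>exp (\<mp> i t l)\<close>, solve a first order equation in \<open>l\<close>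
whose right hand side consists of the half waves of \<open>S \<phi>\<close> and of \<open>t FT f\<close>. In the inverse Fourier
transform they are integrated against \<open>exp (i l \<sigma>)\<close> with \<open>\<sigma> = x \<bullet> \<omega> \<plusminus> t\<close>, so each of two integrations by parts in
\<open>l\<close> trades a power of \<open>\<sigma>\<close> for one \<open>S\<close>. Integrating the resulting decay in \<open>\<sigma>\<close> over the sphere of
directions gives the powers of \<open>t\<close> and \<open>t - \<bar>x\<bar>\<close>. Only the norms on the
right hand side are known to be finite, so Gaussian cutoffs of \<open>\<partial>\<phi>\<close> and \<open>\<partial> S \<phi>\<close> replace these functions
wherever their Fourier transforms need not exist.
\<close>

section \<open>Derivatives and the scaling vector field\<close>

text \<open>Neither rotations nor boosts belong to the \<Gamma>. The only weighted field is S, and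
  in frequency S acts as the radial derivative. The argument therefore runs on one ray at a time;
  directions are coupled only at the end, by Cauchy-Schwarz between the L^2 norms on the rays and an
  explicit function of \<sigma>. In (i) the second integration by parts meets functions that are
  merely square integrable on the ray and gains |\<sigma>|^(-1/2) instead of a full power. The total
  |\<sigma>|^(-3/2) has the square |\<sigma>|^(-3), whose integral over the directions is of order
  1/t times (1 + (t - |x|)^2)^(-1) inside the cone; the root of this is the factor in front of the
  energy. Forcing terms are credited with 1/|\<sigma>| only, and t times t^(-1/2) is the factor of
  f. In (ii) sup norms on a compact range of frequencies allow two full powers. A cut gradient is no
  longer a gradient, and the cutoff does not commute with S. Both errors tend to 0 for fixed t when
  the cutoff is removed, without any rate, so all other constants have to be independent of the
  cutoff.\<close>

primrec coord_dir :: "coord => real \<times> space" where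
 "coord_dir Time = (1, 0)"
| "coord_dir (Space i) = (0, axis i 1)"

primrec coord_fn :: "coord => real => space => real" where
 "coord_fn Time = (%t x. t)"
| "coord_fn (Space i) = (%t x. x $ i)"

lemma sum_coord: "(SUM mu:UNIV. g mu) = g Time + (SUM i:UNIV. g (Space i))"
 for g :: "coord => 'b::comm_monoid_add"
proof -
 have "(SUM mu:UNIV. g mu) = g Time + (SUM mu:range Space. g mu)"
  unfolding UNIV_coord by (subst sum.insert) auto
 also have "(SUM mu:range Space. g mu) = (SUM i:UNIV. g (Space i))"
  by (subst sum.reindex) (auto simp: inj_def)
 finally show ?thesis .
qed

definition smooth1 :: "field => bool" where
 "smooth1 psi \<longleftrightarrow> (%(t, x). psi t x) differentiable_on UNIV"

lemma space_decomp: "x = (SUM i:UNIV. (x $ i) *\<^sub>R axis i 1)" for x :: space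
 by (simp add: vec_eq_iff axis_def if_distrib [of "%z. _ * z"] cong: if_cong)

lemma coord_decomp: "p = (SUM mu:UNIV. coord_fn mu (fst p) (snd p) *\<^sub>R coord_dir mu)"
 by (simp add: sum_coord prod_eq_iff fst_sum snd_sum space_decomp [symmetric])

lemma has_vector_derivative_shift:
 "((%h. f (t + h)) has_vector_derivative D) (at 0) \<longleftrightarrow> (f has_vector_derivative D) (at t)"
 for f :: "real => 'b::real_normed_vector"
proof
 have a: "((%h. t + h) has_vector_derivative 1) (at (0::real))" "((%s. s - t) has_vector_derivative 1) (at t)"
  by (auto intro!: derivative_eq_intros simp: has_real_derivative_iff_has_vector_derivative[symmetric])
 {
  assume "(f has_vector_derivative D) (at t)"
  then show "((%h. f (t + h)) has_vector_derivative D) (at 0)"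
   using vector_diff_chain_at[OF a(1), of f D] by (simp add: o_def)
 next
  assume "((%h. f (t + h)) has_vector_derivative D) (at 0)"
  then show "(f has_vector_derivative D) (at t)"
   using vector_diff_chain_at[OF a(2), of "%h. f (t + h)" D] by (simp add: o_def)
 }
qed

lemma pd_eq: "pd mu psi t x = vector_derivative (%h. (%(t, x). psi t x) ((t, x) + h *\<^sub>R coord_dir mu)) (at 0)"
proof (cases mu)
 case Time
 then show ?thesis
  using has_vector_derivative_shift[of "%s. psi s x" t] by (simp add: vector_derivative_def)
next
 case (Space i)
 then show ?thesis by (simp add: spatial_deriv_def)
qed

text \<open>The partial derivatives \<open>pd\<close> are one dimensional limits and say nothing by
  themselves about a total derivative. Joint differentiability supplies some linear map; the chain
  rule along each coordinate line identifies its values on \<open>coord_dir\<close>, and linearity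
  does the rest.\<close>

lemma smooth1_has_derivative:
 assumes "smooth1 psi"
 shows "((%(t, x). psi t x) has_derivative
  (%p. SUM mu:UNIV. coord_fn mu (fst p) (snd p) *\<^sub>R pd mu psi t x)) (at (t, x))"
proof -
 let ?F = "%(t, x). psi t x"
 from assms obtain D where D: "(?F has_derivative D) (at (t, x))"
  unfolding smooth1_def differentiable_on_def differentiable_def by blast
 have l: "linear D" using D by (rule has_derivative_linear)
 have pd: "D (coord_dir mu) = pd mu psi t x" for mu
 proof -
  have "((%h. (t, x) + h *\<^sub>R coord_dir mu) has_derivative (%h. h *\<^sub>R coord_dir mu)) (at 0)"
   by (auto intro!: derivative_eq_intros)
  moreover have "(?F has_derivative D) (at ((t, x) + 0 *\<^sub>R coord_dir mu))"
   using D by simp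
  ultimately have "((%h. ?F ((t, x) + h *\<^sub>R coord_dir mu)) has_derivative (%h. D (h *\<^sub>R coord_dir mu))) (at 0)"
   by (rule has_derivative_compose)
  then have "((%h. ?F ((t, x) + h *\<^sub>R coord_dir mu)) has_vector_derivative D (coord_dir mu)) (at 0)"
   by (simp only: has_vector_derivative_def linear_cmul[OF l])
  then show ?thesis unfolding pd_eq by (rule vector_derivative_at[symmetric])
 qed
 have "D p = (SUM mu:UNIV. coord_fn mu (fst p) (snd p) *\<^sub>R pd mu psi t x)" for p
 proof -
  have "D p = D (SUM mu:UNIV. coord_fn mu (fst p) (snd p) *\<^sub>R coord_dir mu)"
   by (rule arg_cong[where f = D]) (rule coord_decomp)
  also have "... = (SUM mu:UNIV. coord_fn mu (fst p) (snd p) *\<^sub>R pd mu psi t x)"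
   by (simp only: linear_sum[OF l] linear_cmul[OF l] pd)
  finally show ?thesis .
 qed
 then have "D = (%p. SUM mu:UNIV. coord_fn mu (fst p) (snd p) *\<^sub>R pd mu psi t x)"
  by (rule ext)
 with D show ?thesis by (simp only:)
qed

lemma pd_line:
 assumes "smooth1 psi"
 shows "((%h. (%(t, x). psi t x) (p + h *\<^sub>R coord_dir mu)) has_vector_derivative
  (%(t, x). pd mu psi t x) (p + h *\<^sub>R coord_dir mu)) (at h)"
proof -
 obtain t x where tx: "p + h *\<^sub>R coord_dir mu = (t, x)" by fastforce
 let ?A = "%r. SUM nu:UNIV. coord_fn nu (fst (r *\<^sub>R coord_dir mu)) (snd (r *\<^sub>R coord_dir mu)) *\<^sub>R pd nu psi t x"
 have "((%h. (%(t, x). psi t x) (p + h *\<^sub>R coord_dir mu)) has_derivative 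
   ?A) (at h)"
  by (rule has_derivative_compose[where g = "%(t, x). psi t x" and f = "%h. p + h *\<^sub>R coord_dir mu"])
    (auto intro!: derivative_eq_intros smooth1_has_derivative assms simp: tx)
 also have "?A
   = (%r. r *\<^sub>R pd mu psi t x)"
  by (cases mu) (auto simp: sum_coord axis_def if_distrib [of "%z. _ * z"] if_distrib [of "%z. z *\<^sub>R _"] cong: if_cong)
 finally show ?thesis by (simp add: has_vector_derivative_def tx)
qed

declare pd.simps [simp del] Gam.simps(1) [simp del]

lemma pd_eqI:
 assumes "((%h. (%(t, x). psi t x) ((t, x) + h *\<^sub>R coord_dir mu)) has_vector_derivative d) (at 0)"
 shows "pd mu psi t x = d"
 unfolding pd_eq by (rule vector_derivative_at[OF assms])

lemma pd_line0:
 assumes "smooth1 psi"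
 shows "((%h. (%(t, x). psi t x) ((t, x) + h *\<^sub>R coord_dir mu)) has_vector_derivative pd mu psi t x) (at 0)"
 using pd_line[OF assms, of "(t, x)" mu 0] by simp

lemma smooth1_add: "smooth1 psi ==> smooth1 eta ==> smooth1 (%t x. psi t x + eta t x)"
 unfolding smooth1_def case_prod_beta by (rule differentiable_on_add)

lemma pd_add:
 assumes "smooth1 psi" "smooth1 eta"
 shows "pd mu (%t x. psi t x + eta t x) = (%t x. pd mu psi t x + pd mu eta t x)"
proof (intro ext pd_eqI)
 show "((%h. (%(t, x). psi t x + eta t x) ((t, x) + h *\<^sub>R coord_dir mu)) has_vector_derivative
     pd mu psi t x + pd mu eta t x) (at 0)" for t x
  using has_vector_derivative_add[OF pd_line0[OF assms(1)] pd_line0[OF assms(2)]]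
  by (simp add: case_prod_beta)
qed

lemma smooth1_coord: "smooth1 psi ==> smooth1 (%t x. coord_fn nu t x *\<^sub>R psi t x)"
proof -
 have "(%p. coord_fn nu (fst p) (snd p)) differentiable_on UNIV"
  by (cases nu) (auto intro!: bounded_linear_imp_differentiable bounded_linear_fst
     bounded_linear_compose[OF bounded_linear_vec_nth bounded_linear_snd] simp: differentiable_on_def)
 moreover assume "smooth1 psi"
 ultimately show ?thesis
  unfolding smooth1_def case_prod_beta by (rule differentiable_on_scaleR)
qed

lemma pd_coord:
 assumes "smooth1 psi"
 shows "pd mu (%t x. coord_fn nu t x *\<^sub>R psi t x) =
  (%t x. coord_fn nu t x *\<^sub>R pd mu psi t x + (if mu = nu then psi t x else 0))"
proof (intro ext pd_eqI)
 fix t x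
 have a: "((%h. (%(t, x). coord_fn nu t x) ((t, x) + h *\<^sub>R coord_dir mu)) has_field_derivative
   (if mu = nu then 1 else 0)) (at 0)"
  by (cases mu; cases nu) (auto intro!: derivative_eq_intros simp: axis_def)
 show "((%h. (%(t, x). coord_fn nu t x *\<^sub>R psi t x) ((t, x) + h *\<^sub>R coord_dir mu)) has_vector_derivative
     coord_fn nu t x *\<^sub>R pd mu psi t x + (if mu = nu then psi t x else 0)) (at 0)"
  using has_vector_derivative_scaleR[OF a pd_line0[OF assms, of t x mu]]
  by (cases "mu = nu") (simp_all add: case_prod_beta)
qed

lemma smooth1_const: "smooth1 (%t x. c)"
 unfolding smooth1_def case_prod_beta by simp

lemma pd_const: "pd mu (%t x. c) = (%t x. 0)"
 by (intro ext pd_eqI) simp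

lemma smooth1_sum: "finite I ==> (!!i. i : I ==> smooth1 (psi i)) ==> smooth1 (%t x. SUM i:I. psi i t x)"
 by (induction I rule: finite_induct) (auto intro: smooth1_const smooth1_add)

lemma pd_sum: "finite I ==> (!!i. i : I ==> smooth1 (psi i)) ==>
  pd mu (%t x. SUM i:I. psi i t x) = (%t x. SUM i:I. pd mu (psi i) t x)"
 by (induction I rule: finite_induct) (auto simp: pd_const pd_add smooth1_sum)

lemma smooth1_cmult: "smooth1 psi ==> smooth1 (%t x. c * psi t x)"
 unfolding smooth1_def case_prod_beta by (intro differentiable_on_mult differentiable_on_const)

lemma pd_cmult:
 assumes "smooth1 psi"
 shows "pd mu (%t x. c * psi t x) = (%t x. c * pd mu psi t x)"
proof (intro ext pd_eqI)
 show "((%h. (%(t, x). c * psi t x) ((t, x) + h *\<^sub>R coord_dir mu)) has_vector_derivative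
     c * pd mu psi t x) (at 0)" for t x
  using has_vector_derivative_mult_right[OF pd_line0[OF assms, of t x mu], of c] by (simp add: case_prod_beta)
qed

lemma C_k_Suc_iff: "C_k (Suc k) psi \<longleftrightarrow> smooth1 psi \<and> (\<forall>mu. C_k k (pd mu psi))"
 by (simp add: smooth1_def)

declare C_k.simps(2) [simp del]

lemma C_k_pd: "C_k (Suc k) psi ==> C_k k (pd mu psi)"
 by (simp add: C_k_Suc_iff)

lemma C_k_smooth1: "C_k (Suc k) psi ==> smooth1 psi"
 by (simp add: C_k_Suc_iff)

lemma C_k_Suc_D: "C_k (Suc k) psi ==> C_k k psi"
proof (induction k arbitrary: psi)
 case 0
 then show ?case
  by (simp add: C_k_Suc_iff smooth1_def differentiable_imp_continuous_on)
next
 case (Suc k)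
 then show ?case unfolding C_k_Suc_iff[of "Suc k"] C_k_Suc_iff[of k] by blast
qed

lemma C_k_mono: "C_k m psi ==> k <= m ==> C_k k psi"
 by (induction m) (auto simp: le_Suc_eq C_k_Suc_D)

lemma C_k_continuous: "C_k k psi ==> continuous_on UNIV (%(t, x). psi t x)"
 using C_k_mono[of k psi 0] by simp

lemma C_k_const: "C_k k (%t x. c)"
 by (induction k arbitrary: c) (auto simp: C_k_Suc_iff smooth1_const pd_const)

lemma C_k_add: "C_k k psi ==> C_k k eta ==> C_k k (%t x. psi t x + eta t x)"
proof (induction k arbitrary: psi eta)
 case 0
 then show ?case by (auto simp: case_prod_beta intro!: continuous_intros)
next
 case (Suc k)
 then show ?case by (simp add: C_k_Suc_iff smooth1_add pd_add)
qed

lemma C_k_cmult: "C_k k psi ==> C_k k (%t x. c * psi t x)"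
proof (induction k arbitrary: psi)
 case 0
 then show ?case by (auto simp: case_prod_beta intro!: continuous_intros)
next
 case (Suc k)
 then show ?case by (simp add: C_k_Suc_iff smooth1_cmult pd_cmult)
qed

lemma C_k_coord: "C_k k psi ==> C_k k (%t x. coord_fn nu t x *\<^sub>R psi t x)"
proof (induction k arbitrary: psi)
 case 0
 then show ?case by (cases nu) (auto simp: case_prod_beta intro!: continuous_intros)
next
 case (Suc k)
 have "C_k k psi" using Suc.prems by (rule C_k_Suc_D)
 then have "C_k k (%t x. coord_fn nu t x *\<^sub>R pd mu psi t x + (if mu = nu then psi t x else 0))" for mu
  using Suc by (cases "mu = nu") (auto intro!: C_k_add simp: C_k_Suc_iff C_k_const)
 then show ?case using Suc.prems by (simp add: C_k_Suc_iff smooth1_coord pd_coord)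
qed

lemma C_k_sum: "finite I ==> (!!i. i : I ==> C_k k (psi i)) ==> C_k k (%t x. SUM i:I. psi i t x)"
 by (induction I rule: finite_induct) (auto intro: C_k_const C_k_add)

lemma Gam_Scaling: "Gam Scaling psi = (%t x. SUM nu:UNIV. coord_fn nu t x *\<^sub>R pd nu psi t x)"
 by (simp add: sum_coord Gam.simps(1))

lemma C_k_Gam: "C_k (Suc k) psi ==> C_k k (Gam g psi)"
 by (cases g) (auto simp: Gam_Scaling C_k_pd intro!: C_k_sum C_k_coord)

text \<open>Clairaut's theorem by integration: on the plane of the two directions the increment of
  \<open>g a b\<close> in \<open>b\<close> is the integral of \<open>gb\<close>. Differentiating in
  \<open>a\<close> under the integral sign, and then in the endpoint \<open>b\<close>, compares the
  two orders.\<close>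

lemma pd_commute:
 assumes "C_k 2 psi"
 shows "pd mu (pd nu psi) = pd nu (pd mu psi)"
proof (intro ext)
 fix t x
 let ?B = "%(t, x). pd nu (pd mu psi) t x"
 have s1: "smooth1 psi" and s2: "!!kap. smooth1 (pd kap psi)" 
  and c: "!!kap rho. continuous_on UNIV (%(t, x). pd kap (pd rho psi) t x)"
  and c1: "!!rho. continuous_on UNIV (%(t, x). pd rho psi t x)"
  using assms by (auto simp: numeral_2_eq_2 C_k_Suc_iff smooth1_def intro: differentiable_imp_continuous_on)
 define P where "P a b = (t, x) + a *\<^sub>R coord_dir mu + b *\<^sub>R coord_dir nu" for a b
 define g where "g a b = (%(t, x). psi t x) (P a b)" for a b
 define ga where "ga a b = (%(t, x). pd mu psi t x) (P a b)" for a b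
 define gb where "gb a b = (%(t, x). pd nu psi t x) (P a b)" for a b
 define gab where "gab a b = (%(t, x). pd mu (pd nu psi) t x) (P a b)" for a b
 have Pa: "P a b = ((t, x) + b *\<^sub>R coord_dir nu) + a *\<^sub>R coord_dir mu" for a b by (simp add: P_def algebra_simps)
 have d1: "((%a. g a b) has_vector_derivative ga a b) (at a)" for a b
  unfolding g_def ga_def Pa by (rule pd_line[OF s1])
 have d2: "((%b. g a b) has_vector_derivative gb a b) (at b)" for a b
  unfolding g_def gb_def P_def by (rule pd_line[OF s1])
 have d3: "((%a. gb a b) has_vector_derivative gab a b) (at a)" for a b
  unfolding gab_def gb_def Pa by (rule pd_line[OF s2])
 have cP: "continuous_on A (%(a, b). P a b)" for A
  unfolding P_def case_prod_beta by (intro continuous_intros)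
 have cgab: "continuous_on A (%(a, b). gab a b)" for A
  using continuous_on_compose2[OF c cP] unfolding gab_def by (simp add: case_prod_beta)
 have cgb: "continuous_on A (%b. gb a b)" for A a
  unfolding gb_def P_def by (rule continuous_on_compose2[OF c1]) (auto intro!: continuous_intros)
 have I: "(gb a has_integral g a b - g a 0) {0..b}" if "0 <= b" for a b
  by (rule fundamental_theorem_of_calculus[OF that]) (rule has_vector_derivative_at_within[OF d2])
 have ga_eq: "ga 0 b - ga 0 0 = integral {0..b} (%s. gab 0 s)" if "0 <= b" for b
 proof -
  have "((%a. integral (cbox 0 b) (gb a)) has_vector_derivative integral (cbox 0 b) (gab 0)) (at 0 within UNIV)"
  proof (rule leibniz_rule_vector_derivative)
   show "((%a. gb a s) has_vector_derivative gab a s) (at a within UNIV)" for a s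
    by (rule has_vector_derivative_at_within[OF d3])
   show "gb a integrable_on cbox 0 b" for a
    by (rule integrable_continuous[OF cgb])
  qed (simp_all only: cgab UNIV_I convex_UNIV)
  moreover have "integral (cbox 0 b) (gb a) = g a b - g a 0" for a
   using I[OF that, of a] by (simp add: integral_unique)
  ultimately have 1: "((%a. g a b - g a 0) has_vector_derivative integral {0..b} (gab 0)) (at 0)"
   by simp
  have 2: "((%a. g a b - g a 0) has_vector_derivative ga 0 b - ga 0 0) (at 0)"
   by (intro has_vector_derivative_diff d1)
  show ?thesis using vector_derivative_unique_at[OF 2 1] .
 qed
 have d4: "((%b. ga 0 b) has_vector_derivative ?B (P 0 b)) (at b)" for b
  unfolding ga_def P_def by (rule pd_line[OF s2])
 have "continuous_on {0..1} (%s. gab 0 s)"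
  using continuous_on_compose2[OF cgab[of UNIV], of "{0..1}" "%s. (0, s)"] by (simp add: continuous_intros)
 \<comment> \<open>The integral identity is available for nonnegative \<open>b\<close> only, so
   one-sided derivatives at 0 are compared; these are unique as well.\<close>
 then have "((%b. integral {0..b} (%s. gab 0 s)) has_vector_derivative gab 0 0) (at 0 within {0..1})"
  by (rule integral_has_vector_derivative) simp
 then have 1: "((%b. ga 0 b - ga 0 0) has_vector_derivative gab 0 0) (at 0 within {0..1})"
  by (rule has_vector_derivative_transform[rotated 2]) (simp_all add: ga_eq)
 have 2: "((%b. ga 0 b - ga 0 0) has_vector_derivative ?B (P 0 0) - 0) (at 0 within {0..1})"
  by (intro has_vector_derivative_diff has_vector_derivative_const has_vector_derivative_at_within[OF d4])
 have "gab 0 0 = ?B (P 0 0) - 0"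
  by (rule vector_derivative_unique_within[OF _ 1 2]) (simp add: at_within_Icc_at_right)
 then show "pd mu (pd nu psi) t x = pd nu (pd mu psi) t x"
  by (simp add: gab_def P_def)
qed

text \<open>The extra term arises where the derivative hits its own coordinate in the coefficients
  of S.\<close>

lemma pd_Scaling:
 assumes "C_k 2 psi"
 shows "pd mu (Gam Scaling psi) = (%t x. Gam Scaling (pd mu psi) t x + pd mu psi t x)"
proof -
 have s2: "!!kap. smooth1 (pd kap psi)" 
  using assms by (auto simp: numeral_2_eq_2 C_k_Suc_iff)
 have "(SUM nu:UNIV. if mu = nu then g nu else 0) = (g mu :: complex)" for g
  by simp
 then show ?thesis unfolding Gam_Scaling
  by (simp add: pd_sum smooth1_coord pd_coord s2 sum.distrib pd_commute[OF assms, of mu])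
qed

text \<open>The commutator of \<open>pd_Scaling\<close> is collected twice. Hence S \<phi> is again
  a wave, with forcing S f + 2 f; this is the source of the factor 3 in the later bounds of
  \<open>box (Gam Scaling phi)\<close>.\<close>

lemma box_Scaling:
 assumes "C_k 3 psi"
 shows "box (Gam Scaling psi) = (%t x. Gam Scaling (box psi) t x + 2 * box psi t x)"
proof -
 let ?A = "pd Time (pd Time psi)"
 have c2: "C_k 2 psi" "!!mu. C_k 2 (pd mu psi)" "!!mu. C_k 1 (pd mu (pd mu psi))"
  using assms by (auto intro: C_k_mono simp: numeral_3_eq_3 numeral_2_eq_2 C_k_pd)
 have s: "smooth1 (Gam Scaling (pd mu psi))" "smooth1 (pd mu psi)" "smooth1 (pd mu (pd mu psi))" for mu
  using C_k_Gam[of 1 "pd mu psi" Scaling] c2(2)[of mu] c2(3)[of mu] C_k_smooth1 by (auto simp: numeral_2_eq_2)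
 have "pd mu (pd mu (Gam Scaling psi)) = (%t x. Gam Scaling (pd mu (pd mu psi)) t x + 2 * pd mu (pd mu psi) t x)" for mu
  
  by (simp add: pd_Scaling[OF c2(1)] pd_Scaling[OF c2(2)] pd_add s) (simp add: fun_eq_iff)
 moreover have "Gam Scaling (box psi) = (%t x. - Gam Scaling ?A t x + (SUM i:UNIV. Gam Scaling (pd (Space i) (pd (Space i) psi)) t x))"
 proof -
  have "box psi = (%t x. (-1) * ?A t x + (SUM i:UNIV. pd (Space i) (pd (Space i) psi) t x))"
   by (auto simp: box_def fun_eq_iff)
  moreover have "pd nu ... = (%t x. (-1) * pd nu ?A t x + (SUM i:UNIV. pd nu (pd (Space i) (pd (Space i) psi)) t x))" for nu
   by (subst pd_add; (subst pd_cmult)?; (subst pd_sum)?; intro smooth1_cmult smooth1_sum s refl finite)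
  ultimately have "pd nu (box psi) = (%t x. - pd nu ?A t x + (SUM i:UNIV. pd nu (pd (Space i) (pd (Space i) psi)) t x))" for nu
   by simp
  then show ?thesis
   unfolding Gam_Scaling
   by (subst sum.swap) (simp add: scaleR_right_diff_distrib scaleR_add_right sum.distrib sum_subtractf scaleR_sum_right sum_negf)
 qed
 ultimately show ?thesis
  by (simp add: box_def fun_eq_iff sum.distrib sum_distrib_left)
qed

text \<open>A C^1 function of x that carries its gradient along as data. This form also serves
  cutoffs, products and other functions that are not time slices of a field.\<close>

definition has_gradient :: "(space => complex) => (3 => space => complex) => bool" where
 "has_gradient u Du \<longleftrightarrow>
   (\<forall>x. (u has_derivative (%y. SUM i:UNIV. (y $ i) *\<^sub>R Du i x)) (at x)) \<and> (\<forall>i. continuous_on UNIV (Du i))"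

lemma C_k_continuous_slice: "C_k k psi ==> continuous_on UNIV (psi t)"
 using continuous_on_compose2[OF C_k_continuous, of k psi UNIV "%x. (t, x)"] by (simp add: continuous_intros)

lemma C_k_has_gradient:
 assumes "C_k 1 psi"
 shows "has_gradient (psi t) (%i. pd (Space i) psi t)"
proof -
 have s: "smooth1 psi" and c: "C_k 0 (pd (Space i) psi)" for i
  using assms by (auto simp: C_k_Suc_iff)
 have "((%x. (%(t, x). psi t x) (t, x)) has_derivative
   (%y. SUM mu:UNIV. coord_fn mu (fst (0::real, y)) (snd (0::real, y)) *\<^sub>R pd mu psi t x)) (at x)" for x
  by (rule has_derivative_compose[where g = "%(t, x). psi t x" and f = "%x. (t, x)"])
    (auto intro!: derivative_eq_intros smooth1_has_derivative s)
 then show ?thesis using c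
  unfolding has_gradient_def by (auto simp: sum_coord C_k_continuous_slice[OF c] simp del: C_k.simps)
qed

section \<open>Polar coordinates\<close>

lemma set_integral_continuous_Icc:
 fixes g :: "real => 'b::euclidean_space"
 assumes "continuous_on {a..b} g"
 shows "(LBINT r:{a..b}. g r) = integral {a..b} g"
 by (rule set_borel_integral_eq_integral(2)[OF borel_integrable_atLeastAtMost'[OF assms]])

text \<open>Fubini for \<open>F'\<close> on \<open>{a..b}\<close> times \<open>M\<close>. It asks
  only for L^1 norms of \<open>F' r\<close> that are bounded uniformly in \<open>r\<close>; a
  dominating function need not exist for the translates or dilates of an integrable
  function.\<close>

lemma (in sigma_finite_measure) integral_FTC_param:
 fixes F :: "real => 'a => complex"
 assumes ab: "a <= b"
  and deriv: "!!r x. x : space M ==> r : {a..b} ==> ((%r. F r x) has_vector_derivative F' r x) (at r within {a..b})"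
  and cont: "!!x. x : space M ==> continuous_on {a..b} (%r. F' r x)"
  and meas: "(%(r, x). F' r x) : borel_measurable (borel \<Otimes>\<^sub>M M)"
  and bnd: "!!r. r : {a..b} ==> (\<integral>\<^sup>+x. norm (F' r x) \<partial>M) <= ennreal C"
  and int: "integrable M (F a)" "integrable M (F b)"
 shows "(LINT x|M. F b x) - (LINT x|M. F a x) = (LBINT r:{a..b}. (LINT x|M. F' r x))"
proof -
 interpret P: pair_sigma_finite lborel M
  by (intro pair_sigma_finite.intro lborel.sigma_finite_measure_axioms sigma_finite_measure_axioms)
 let ?h = "%(r, x). indicator {a..b} r *\<^sub>R F' r x"
 have [measurable]: "(%(r, x). F' r x) : borel_measurable (lborel \<Otimes>\<^sub>M M)"
  using meas by (simp cong: measurable_cong_sets sets_pair_measure_cong)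
 have m: "?h : borel_measurable (lborel \<Otimes>\<^sub>M M)"
 proof -
  have "?h = (%p. indicator {a..b} (fst p) *\<^sub>R (%(r, x). F' r x) p)" by auto
  then show ?thesis by simp
 qed
 have "(\<integral>\<^sup>+p. norm (?h p) \<partial>(lborel \<Otimes>\<^sub>M M)) = (\<integral>\<^sup>+r. \<integral>\<^sup>+x. norm (?h (r, x)) \<partial>M \<partial>lborel)"
  using m by (intro nn_integral_fst[symmetric]) simp
 also have "... <= (\<integral>\<^sup>+r. ennreal C * indicator {a..b} r \<partial>lborel)"
  using bnd by (intro nn_integral_mono) (auto split: split_indicator)
 also have "... < \<infinity>"
  using ab by (simp add: nn_integral_cmult ennreal_mult_less_top)
 finally have i: "integrable (lborel \<Otimes>\<^sub>M M) ?h"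
  using m by (intro integrableI_bounded) auto
 have "(LINT x|M. F b x) - (LINT x|M. F a x) = (LINT x|M. F b x - F a x)"
  using int by simp
 also have "... = (LINT x|M. LINT r|lborel. ?h (r, x))"
 proof (rule Bochner_Integration.integral_cong[OF refl])
  fix x assume x: "x : space M"
  show "F b x - F a x = (LINT r|lborel. ?h (r, x))"
   using integral_FTC_atLeastAtMost[OF ab deriv[OF x] cont[OF x]] by simp
 qed
 also have "... = (LINT r|lborel. LINT x|M. ?h (r, x))"
  using P.Fubini_integral[of "%r x. ?h (r, x)"] i by simp
 also have "... = (LBINT r:{a..b}. (LINT x|M. F' r x))"
  by (simp add: set_lebesgue_integral_def)
 finally show ?thesis .
qed

text \<open>The integrated identity \<open>integral_FTC_param\<close> is differentiated at its upper
  endpoint; continuity of the integrated derivative takes the place of domination.\<close>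

lemma (in sigma_finite_measure) integral_has_vector_derivative_param:
 fixes F :: "real => 'a => complex"
 assumes ab: "a < r0" "r0 < b"
  and deriv: "!!r x. x : space M ==> r : {a..b} ==> ((%r. F r x) has_vector_derivative F' r x) (at r within {a..b})"
  and cont: "!!x. x : space M ==> continuous_on {a..b} (%r. F' r x)"
  and meas: "(%(r, x). F' r x) : borel_measurable (borel \<Otimes>\<^sub>M M)"
  and bnd: "!!r. r : {a..b} ==> (\<integral>\<^sup>+x. norm (F' r x) \<partial>M) <= ennreal C"
  and int: "!!r. r : {a..b} ==> integrable M (F r)"
  and c: "continuous_on {a..b} (%r. LINT x|M. F' r x)"
 shows "((%r. LINT x|M. F r x) has_vector_derivative (LINT x|M. F' r0 x)) (at r0)"
proof -
 have r0: "r0 : {a..b}" using ab by simp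
 have eq: "(LINT x|M. F r x) = (LINT x|M. F a x) + integral {a..r} (%r. LINT x|M. F' r x)" if "r : {a..b}" for r
 proof -
  have sub: "{a..r} \<subseteq> {a..b}" using that by auto
  have "(LINT x|M. F r x) - (LINT x|M. F a x) = (LBINT r:{a..r}. (LINT x|M. F' r x))"
   by (rule integral_FTC_param)
     (use that ab sub in \<open>auto intro!: meas bnd int has_vector_derivative_within_subset[OF deriv] continuous_on_subset[OF cont]\<close>)
  also have "... = integral {a..r} (%r. LINT x|M. F' r x)"
   by (rule set_integral_continuous_Icc[OF continuous_on_subset[OF c sub]])
  finally show ?thesis by (simp add: algebra_simps)
 qed
 have "((%r. (LINT x|M. F a x) + integral {a..r} (%r. LINT x|M. F' r x)) has_vector_derivative 0 + (LINT x|M. F' r0 x)) (at r0 within {a..b})"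
  using ab by (intro has_vector_derivative_add has_vector_derivative_const integral_has_vector_derivative c) auto
 then have "((%r. (LINT x|M. F a x) + integral {a..r} (%r. LINT x|M. F' r x)) has_vector_derivative (LINT x|M. F' r0 x)) (at r0 within {a..b})"
  by simp
 then have "((%r. LINT x|M. F r x) has_vector_derivative (LINT x|M. F' r0 x)) (at r0 within {a..b})"
  by (rule has_vector_derivative_transform[rotated 2]) (rule r0, rule eq)
 moreover have "at r0 within {a..b} = at r0" using ab by (intro at_within_Icc_at) auto
 ultimately show ?thesis by simp
qed

section \<open>Translations and dilations of Lebesgue measure\<close>

lemma nn_integral_lborel_translate:
 fixes g :: "space => ennreal"
 assumes [measurable]: "g : borel_measurable borel"
 shows "(\<integral>\<^sup>+x. g (x + c) \<partial>lborel) = (\<integral>\<^sup>+x. g x \<partial>lborel)"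
 by (subst lborel_distr_plus[of c, symmetric]) (simp add: nn_integral_distr add.commute)

lemma lborel_integral_translate:
 fixes g :: "space => 'b::{banach, second_countable_topology}"
 assumes [measurable]: "g : borel_measurable borel"
 shows "(LINT x|lborel. g (x + c)) = (LINT x|lborel. g x)"
 by (subst (2) lborel_distr_plus[of c, symmetric]) (simp add: integral_distr add.commute)

lemma lborel_integrable_translate:
 fixes g :: "space => 'b::{banach, second_countable_topology}"
 assumes "integrable lborel g"
 shows "integrable lborel (%x. g (x + c))"
proof -
 have "integrable (distr lborel borel ((+) c)) g" using assms by (simp add: lborel_distr_plus)
 then show ?thesis by (subst (asm) integrable_distr_eq) (use assms in \<open>auto simp: add.commute\<close>)
qed

lemma nn_integral_lborel_scale:
 fixes g :: "space => ennreal"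
 assumes [measurable]: "g : borel_measurable borel" and c: "c > 0"
 shows "(\<integral>\<^sup>+x. g x \<partial>lborel) = ennreal (c ^ 3) * (\<integral>\<^sup>+x. g (c *\<^sub>R x) \<partial>lborel)"
proof -
 have "(\<integral>\<^sup>+x. g x \<partial>lborel) = (\<integral>\<^sup>+x. ennreal (c ^ 3) * g (c *\<^sub>R x) \<partial>lborel)"
  by (subst lborel_affine[of c 0]) (use c in \<open>simp_all add: nn_integral_density nn_integral_distr\<close>)
 then show ?thesis by (simp add: nn_integral_cmult)
qed

lemma lborel_integral_scale:
 fixes g :: "space => complex"
 assumes [measurable]: "g : borel_measurable borel" and c: "c > 0"
 shows "(LINT x|lborel. g x) = c ^ 3 *\<^sub>R (LINT x|lborel. g (c *\<^sub>R x))"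
proof -
 have "(LINT x|lborel. g x) = (LINT x|lborel. c ^ 3 *\<^sub>R g (c *\<^sub>R x))"
  by (subst lborel_affine[of c 0]) (use c in \<open>simp_all add: integral_density integral_distr\<close>)
 then show ?thesis by simp
qed

lemma lborel_integrable_scale:
 fixes g :: "space => complex"
 assumes g: "integrable lborel g" and c: "c > 0"
 shows "integrable lborel (%x. g (c *\<^sub>R x))"
proof (rule integrableI_bounded)
 let ?A = "\<integral>\<^sup>+x. norm (g (c *\<^sub>R x)) \<partial>lborel"
 have [measurable]: "g : borel_measurable borel" using g by auto
 show "(%x. g (c *\<^sub>R x)) : borel_measurable lborel" by measurable
 have "(\<integral>\<^sup>+x. norm (g x) \<partial>lborel) = ennreal (c ^ 3) * ?A"
  by (rule nn_integral_lborel_scale) (use c in auto)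
 moreover have "(\<integral>\<^sup>+x. norm (g x) \<partial>lborel) < \<infinity>" using g by (simp add: integrable_iff_bounded)
 ultimately show "?A < \<infinity>"
  using c by (auto simp: ennreal_mult_less_top)
qed

text \<open>The integrals of \<open>h\<close> and of its translate by \<open>e\<close> agree, while
  the fundamental theorem of calculus along the segment expresses their difference as the integral
  of \<open>h'\<close>. No boundary terms at infinity appear.\<close>

lemma integral_derivative_eq_0:
 fixes h h' :: "space => complex"
 assumes deriv: "!!x. ((%r. h (x + r *\<^sub>R e)) has_vector_derivative h' x) (at 0)"
  and cont: "continuous_on UNIV h'"
  and h: "integrable lborel h" and h': "integrable lborel h'"
 shows "(LINT x|lborel. h' x) = 0"
proof -
 have [measurable]: "h' : borel_measurable borel" "h : borel_measurable borel" using h h' by auto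
 have d: "((%r. h (x + r *\<^sub>R e)) has_vector_derivative h' (x + r *\<^sub>R e)) (at r)" for x r
  using deriv[of "x + r *\<^sub>R e"] has_vector_derivative_shift[of "%r. h (x + r *\<^sub>R e)" r]
  by (simp add: algebra_simps)
 have "(LINT x|lborel. h (x + 1 *\<^sub>R e)) - (LINT x|lborel. h (x + 0 *\<^sub>R e)) = (LBINT r:{0..1}. (LINT x|lborel. h' (x + r *\<^sub>R e)))"
 proof (rule lborel.integral_FTC_param)
  show "((%r. h (x + r *\<^sub>R e)) has_vector_derivative h' (x + r *\<^sub>R e)) (at r within {0..1})" for x r
   by (rule has_vector_derivative_at_within[OF d])
  show "continuous_on {0..1} (%r. h' (x + r *\<^sub>R e))" for x
   by (rule continuous_on_compose2[OF cont]) (auto intro!: continuous_intros)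
  show "(%(r, x). h' (x + r *\<^sub>R e)) : borel_measurable (borel \<Otimes>\<^sub>M lborel)"
   by measurable
  show "(\<integral>\<^sup>+x. norm (h' (x + r *\<^sub>R e)) \<partial>lborel) <= ennreal (LINT x|lborel. norm (h' x))" for r
   using nn_integral_lborel_translate[of "%x. norm (h' x)" "r *\<^sub>R e"] nn_integral_eq_integral[of lborel "%x. norm (h' x)"] h'
   by simp
 qed (use lborel_integrable_translate[OF h] h in auto)
 moreover have t1: "(LINT x|lborel. h (x + c)) = (LINT x|lborel. h x)" for c
  by (rule lborel_integral_translate) auto
 moreover have t2: "(LINT x|lborel. h' (x + c)) = (LINT x|lborel. h' x)" for c
  by (rule lborel_integral_translate) auto
 ultimately have "0 = (LBINT r:{0..1::real}. (LINT x|lborel. h' x))"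
  by (simp only: t1 t2 diff_self)
 also have "... = (LINT x|lborel. h' x)"
  by (subst set_integral_continuous_Icc) auto
 finally show ?thesis by simp
qed

text \<open>The cone over a piece of the sphere has a third of its area as volume, hence the factor 3.\<close>

definition sphere_measure :: "space measure" where
 "sphere_measure = distr (density lborel (%y. 3 * indicator (ball 0 1) y)) borel sgn"

definition radial_measure :: "real measure" where
 "radial_measure = density lborel (%r. ennreal (r^2) * indicator {0<..} r)"

lemma sets_sphere_measure [simp, measurable_cong]: "sets sphere_measure = sets borel"
 and space_sphere_measure [simp]: "space sphere_measure = UNIV"
 by (simp_all add: sphere_measure_def)

lemma sets_radial_measure [simp, measurable_cong]: "sets radial_measure = sets borel"
 and space_radial_measure [simp]: "space radial_measure = UNIV"
 by (simp_all add: radial_measure_def)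

lemma sgn_measurable [measurable]: "(sgn :: space => space) : borel_measurable borel"
 unfolding sgn_div_norm by measurable

lemma ball_borel [measurable]: "ball (c::space) r : sets borel"
 by simp

lemma emeasure_sphere_measure: "emeasure sphere_measure UNIV = ennreal (4 * pi)"
proof -
 have "emeasure sphere_measure UNIV = 3 * emeasure lborel (ball (0::space) 1)"
  unfolding sphere_measure_def by (simp add: emeasure_distr emeasure_density nn_integral_cmult)
 also have "... = ennreal (3 * (4 / 3 * pi))"
  by (subst emeasure_ball) (simp_all only: ennreal_mult[symmetric] ennreal_numeral[symmetric] DIM_cart DIM_real, simp add: unit_ball_vol_3 ennreal_mult'[symmetric] flip: ennreal_numeral)
 finally show ?thesis by simp
qed

interpretation sphere: finite_measure sphere_measure
 by standard (simp add: emeasure_sphere_measure)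

lemma sphere_sigma_finite: "sigma_finite_measure sphere_measure"
 by (rule sphere.sigma_finite_measure)

interpretation radial: sigma_finite_measure radial_measure
 unfolding radial_measure_def
 by (subst sigma_finite_measure.sigma_finite_iff_density_finite[OF lborel.sigma_finite_measure_axioms]) (auto simp: ennreal_mult_eq_top_iff split: split_indicator)

interpretation polar: pair_sigma_finite sphere_measure radial_measure
 by (intro pair_sigma_finite.intro sphere.sigma_finite_measure_axioms radial.sigma_finite_measure_axioms)

lemma AE_sphere_measure: "AE w in sphere_measure. norm w = 1"
proof -
 have "AE y in (lborel :: space measure). y ~= 0" by (rule AE_lborel_singleton)
 then have "AE y in density lborel (%y. 3 * indicator (ball 0 1) (y::space)). norm (sgn y) = 1"
  by (subst AE_density) (auto simp: norm_sgn)
 then show ?thesis unfolding sphere_measure_def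
  by (subst AE_distr_iff) auto
qed

lemma nn_integral_sphere_measure:
 assumes [measurable]: "g : borel_measurable borel"
 shows "(\<integral>\<^sup>+w. g w \<partial>sphere_measure) = (\<integral>\<^sup>+y. 3 * indicator (ball 0 1) y * g (sgn y) \<partial>lborel)"
 unfolding sphere_measure_def by (simp add: nn_integral_distr nn_integral_density)

lemma nn_integral_radial_measure:
 assumes [measurable]: "g : borel_measurable borel"
 shows "(\<integral>\<^sup>+r. g r \<partial>radial_measure) = (\<integral>\<^sup>+r. ennreal (r^2) * indicator {0<..} r * g r \<partial>lborel)"
 unfolding radial_measure_def by (simp add: nn_integral_density)

lemma nn_integral_inverse_4:
 assumes "c > 0"
 shows "(\<integral>\<^sup>+r. ennreal (1 / r ^ 4) * indicator {c..} r \<partial>lborel) = ennreal (1 / (3 * c ^ 3))"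
proof -
 have "((%r. - 1 / (3 * r ^ 3)) \<longlongrightarrow> (0::real)) at_top"
  by real_asymp
 then have "(\<integral>\<^sup>+r. ennreal (1 / r ^ 4) * indicator {c..} r \<partial>lborel) = ennreal (0 - (- 1 / (3 * c ^ 3)))"
  using assms
  by (intro nn_integral_FTC_atLeast)
    (auto intro!: derivative_eq_intros simp: field_simps power2_eq_square eval_nat_numeral)
 then show ?thesis by simp
qed

text \<open>The sphere measure is built from the unit ball, so substitutions alone relate the two
  sides. After z = r y the ball condition becomes r > |z|, and the remaining weight 3 |z|^3 r^(-4)
  has integral 1 over these r by \<open>nn_integral_inverse_4\<close>.\<close>

lemma nn_integral_polar:
 fixes h :: "space => ennreal"
 assumes [measurable]: "h : borel_measurable borel"
 shows "(\<integral>\<^sup>+x. h x \<partial>lborel) = (\<integral>\<^sup>+w. \<integral>\<^sup>+r. h (r *\<^sub>R w) \<partial>radial_measure \<partial>sphere_measure)"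
proof -
 let ?B = "indicator (ball 0 1)"
 let ?A = "indicator {0<..}"
 have "(\<integral>\<^sup>+w. \<integral>\<^sup>+r. h (r *\<^sub>R w) \<partial>radial_measure \<partial>sphere_measure)
  = (\<integral>\<^sup>+y. 3 * ?B y * (\<integral>\<^sup>+r. ennreal (r^2) * ?A r * h (r *\<^sub>R sgn y) \<partial>lborel) \<partial>lborel)"
  by (simp add: nn_integral_sphere_measure nn_integral_radial_measure)
 \<comment> \<open>Replacing r by |y| r turns \<open>sgn y\<close> into \<open>y\<close> and
   contributes |y|^3: one factor from dr and two from r^2.\<close>
 also have "... = (\<integral>\<^sup>+y. \<integral>\<^sup>+r. 3 * ?B y * (ennreal (r^2) * ennreal (norm y ^ 3) * ?A r * h (r *\<^sub>R y)) \<partial>lborel \<partial>lborel)"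
 proof (rule nn_integral_cong_AE, rule AE_mp[OF AE_lborel_singleton[of 0]], intro AE_I2 impI)
  fix y :: space assume y: "y ~= 0"
  have "(\<integral>\<^sup>+r. ennreal (r^2) * ?A r * h (r *\<^sub>R sgn y) \<partial>lborel)
   = ennreal (norm y) * (\<integral>\<^sup>+r. ennreal ((0 + norm y * r)^2) * ?A (0 + norm y * r) * h ((0 + norm y * r) *\<^sub>R sgn y) \<partial>lborel)"
   using y by (subst nn_integral_real_affine[where c = "norm y" and t = 0]) auto
  also have "... = (\<integral>\<^sup>+r. ennreal (r^2) * ennreal (norm y ^ 3) * ?A r * h (r *\<^sub>R y) \<partial>lborel)"
  proof (subst nn_integral_cmult[symmetric], measurable, rule nn_integral_cong)
   fix r :: real
   have "ennreal (norm y) * ennreal ((0 + norm y * r)^2) = ennreal (r^2) * ennreal (norm y ^ 3)"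
    by (subst (1 2) ennreal_mult'[symmetric]) (simp_all add: power_mult_distrib power2_eq_square power3_eq_cube mult_ac)
   moreover have "?A (0 + norm y * r) = (?A r :: ennreal)"
    using y by (auto simp: zero_less_mult_iff split: split_indicator)
   moreover have "(0 + norm y * r) *\<^sub>R sgn y = r *\<^sub>R y"
    using y by (simp add: sgn_div_norm)
   ultimately show "ennreal (norm y) * (ennreal ((0 + norm y * r)^2) * ?A (0 + norm y * r) * h ((0 + norm y * r) *\<^sub>R sgn y))
     = ennreal (r^2) * ennreal (norm y ^ 3) * ?A r * h (r *\<^sub>R y)"
    by (simp only: mult.assoc[symmetric])
  qed
  finally show "3 * ?B y * (\<integral>\<^sup>+r. ennreal (r^2) * ?A r * h (r *\<^sub>R sgn y) \<partial>lborel)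
    = (\<integral>\<^sup>+r. 3 * ?B y * (ennreal (r^2) * ennreal (norm y ^ 3) * ?A r * h (r *\<^sub>R y)) \<partial>lborel)"
   by (simp add: nn_integral_cmult)
 qed
 also have "... = (\<integral>\<^sup>+r. \<integral>\<^sup>+y. 3 * ?B y * (ennreal (r^2) * ennreal (norm y ^ 3) * ?A r * h (r *\<^sub>R y)) \<partial>lborel \<partial>lborel)"
  by (rule lborel_pair.Fubini') measurable
 \<comment> \<open>Now z = r y for fixed r > 0: the Jacobian r^(-3), the factor |y|^3 = |z|^3 r^(-3)
   and r^2 combine to |z|^3 r^(-4).\<close>
 also have "... = (\<integral>\<^sup>+r. \<integral>\<^sup>+z. 3 * ennreal (norm z ^ 3) * h z * (ennreal (1 / r ^ 4) * indicator {norm z<..} r) \<partial>lborel \<partial>lborel)"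
 proof (rule nn_integral_cong)
  fix r :: real
  show "(\<integral>\<^sup>+y. 3 * ?B y * (ennreal (r^2) * ennreal (norm y ^ 3) * ?A r * h (r *\<^sub>R y)) \<partial>lborel)
    = (\<integral>\<^sup>+z. 3 * ennreal (norm z ^ 3) * h z * (ennreal (1 / r ^ 4) * indicator {norm z<..} r) \<partial>lborel)"
  proof (cases "r > 0")
   case True
   have "(\<integral>\<^sup>+z. 3 * ennreal (norm z ^ 3) * h z * (ennreal (1 / r ^ 4) * indicator {norm z<..} r) \<partial>lborel)
     = ennreal (r ^ 3) * (\<integral>\<^sup>+z. 3 * ennreal (norm (r *\<^sub>R z) ^ 3) * h (r *\<^sub>R z) * (ennreal (1 / r ^ 4) * indicator {norm (r *\<^sub>R z)<..} r) \<partial>lborel)"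
   proof (rule nn_integral_lborel_scale)
    have [measurable]: "Measurable.pred borel (%z::space. r : {norm z<..})"
     unfolding greaterThan_iff by measurable
    show "(%z. 3 * ennreal (norm z ^ 3) * h z * (ennreal (1 / r ^ 4) * indicator {norm z<..} r)) : borel_measurable borel"
     by measurable
   qed (rule True)
   also have "... = (\<integral>\<^sup>+y. 3 * ?B y * (ennreal (r^2) * ennreal (norm y ^ 3) * ?A r * h (r *\<^sub>R y)) \<partial>lborel)"
   proof (subst nn_integral_cmult[symmetric])
    have [measurable]: "Measurable.pred borel (%z::space. r : {norm (r *\<^sub>R z)<..})"
     unfolding greaterThan_iff by measurable
    show "(%z. 3 * ennreal (norm (r *\<^sub>R z) ^ 3) * h (r *\<^sub>R z) * (ennreal (1 / r ^ 4) * indicator {norm (r *\<^sub>R z)<..} r)) : borel_measurable lborel"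
     by measurable
   next
    show "(\<integral>\<^sup>+z. ennreal (r ^ 3) * (3 * ennreal (norm (r *\<^sub>R z) ^ 3) * h (r *\<^sub>R z) * (ennreal (1 / r ^ 4) * indicator {norm (r *\<^sub>R z)<..} r)) \<partial>lborel)
     = (\<integral>\<^sup>+y. 3 * ?B y * (ennreal (r^2) * ennreal (norm y ^ 3) * ?A r * h (r *\<^sub>R y)) \<partial>lborel)"
    proof (rule nn_integral_cong)
    fix z :: space
    have "ennreal (r ^ 3) * (ennreal (norm (r *\<^sub>R z) ^ 3) * ennreal (1 / r ^ 4)) = ennreal (r^2) * ennreal (norm z ^ 3)"
     using True by (simp add: ennreal_mult[symmetric] power_mult_distrib field_simps eval_nat_numeral)
    note 1 = this
    have 2: "indicator {norm (r *\<^sub>R z)<..} r = (?B z * ?A r :: ennreal)"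
     using True by (auto split: split_indicator simp: mult_less_cancel_left1)
    have "ennreal (r ^ 3) * (3 * ennreal (norm (r *\<^sub>R z) ^ 3) * h (r *\<^sub>R z) * (ennreal (1 / r ^ 4) * indicator {norm (r *\<^sub>R z)<..} r))
     = 3 * h (r *\<^sub>R z) * (ennreal (r ^ 3) * (ennreal (norm (r *\<^sub>R z) ^ 3) * ennreal (1 / r ^ 4))) * indicator {norm (r *\<^sub>R z)<..} r"
     by (simp only: mult_ac)
    also have "... = 3 * ?B z * (ennreal (r^2) * ennreal (norm z ^ 3) * ?A r * h (r *\<^sub>R z))"
     unfolding 1 2 by (simp only: mult_ac)
    finally show "ennreal (r ^ 3) * (3 * ennreal (norm (r *\<^sub>R z) ^ 3) * h (r *\<^sub>R z) * (ennreal (1 / r ^ 4) * indicator {norm (r *\<^sub>R z)<..} r))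
     = 3 * ?B z * (ennreal (r^2) * ennreal (norm z ^ 3) * ?A r * h (r *\<^sub>R z))" .
    qed
   qed
   finally show ?thesis by simp
  next
   case False
   then have "indicator {norm z<..} r = (0::ennreal)" for z :: space
    by (auto split: split_indicator) (meson less_le_trans norm_ge_zero not_less)
   then show ?thesis using False by simp
  qed
 qed
 also have "... = (\<integral>\<^sup>+z. \<integral>\<^sup>+r. 3 * ennreal (norm z ^ 3) * h z * (ennreal (1 / r ^ 4) * indicator {norm z<..} r) \<partial>lborel \<partial>lborel)"
 proof (rule lborel_pair.Fubini')
  have [measurable]: "Measurable.pred (borel \<Otimes>\<^sub>M borel) (%x. snd x : {norm (fst x :: space)<..})"
   unfolding greaterThan_iff by measurable
  show "(%(z, r). 3 * ennreal (norm z ^ 3) * h z * (ennreal (1 / r ^ 4) * indicator {norm z<..} r)) : borel_measurable (lborel \<Otimes>\<^sub>M lborel)"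
   by measurable
 qed
 also have "... = (\<integral>\<^sup>+z. h z \<partial>lborel)"
 proof (rule nn_integral_cong_AE, rule AE_mp[OF AE_lborel_singleton[of 0]], intro AE_I2 impI)
  fix z :: space assume z: "z ~= 0"
  have "(\<integral>\<^sup>+r. ennreal (1 / r ^ 4) * indicator {norm z<..} r \<partial>lborel) = (\<integral>\<^sup>+r. ennreal (1 / r ^ 4) * indicator {norm z..} r \<partial>lborel)"
   by (rule nn_integral_cong_AE, rule AE_mp[OF AE_lborel_singleton[of "norm z"]]) (auto split: split_indicator)
  also have "... = ennreal (1 / (3 * norm z ^ 3))"
   using z by (intro nn_integral_inverse_4) auto
  finally have "(\<integral>\<^sup>+r. 3 * ennreal (norm z ^ 3) * h z * (ennreal (1 / r ^ 4) * indicator {norm z<..} r) \<partial>lborel)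
   = 3 * ennreal (norm z ^ 3) * h z * ennreal (1 / (3 * norm z ^ 3))"
   by (simp add: nn_integral_cmult)
  also have "... = h z * (ennreal 3 * (ennreal (norm z ^ 3) * ennreal (1 / (3 * norm z ^ 3))))"
   by (simp add: mult_ac)
  also have "ennreal 3 * (ennreal (norm z ^ 3) * ennreal (1 / (3 * norm z ^ 3))) = 1"
   using z by (simp add: ennreal_mult[symmetric] del: ennreal_numeral)
  finally show "(\<integral>\<^sup>+r. 3 * ennreal (norm z ^ 3) * h z * (ennreal (1 / r ^ 4) * indicator {norm z<..} r) \<partial>lborel) = h z"
   by simp
 qed
 finally show ?thesis by simp
qed

lemma polar_measurable [measurable]: "(%p. snd p *\<^sub>R fst p) : borel_measurable (sphere_measure \<Otimes>\<^sub>M radial_measure)"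
 by (simp cong: measurable_cong_sets sets_pair_measure_cong)

lemma lborel_polar: "lborel = distr (sphere_measure \<Otimes>\<^sub>M radial_measure) borel (%p. snd p *\<^sub>R fst p)"
proof (rule measure_eqI)
 let ?B = "distr (sphere_measure \<Otimes>\<^sub>M radial_measure) borel (%p. snd p *\<^sub>R fst p)"
 fix A :: "space set" assume "A : sets lborel"
 then have [measurable]: "A : sets borel" by simp
 have "emeasure lborel A = (\<integral>\<^sup>+x. indicator A x \<partial>lborel)" by simp
 also have "... = (\<integral>\<^sup>+p. indicator A (snd p *\<^sub>R fst p) \<partial>(sphere_measure \<Otimes>\<^sub>M radial_measure))"
  by (subst nn_integral_polar) (simp_all add: radial.nn_integral_fst[symmetric])
 also have "... = emeasure ?B A"
  by (subst nn_integral_indicator[symmetric], simp, subst nn_integral_distr) auto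
 finally show "emeasure lborel A = emeasure ?B A" .
qed simp

lemma integral_polar:
 fixes h :: "space => complex"
 assumes h: "integrable lborel h"
 shows "(LINT x|lborel. h x) = (LINT w|sphere_measure. LINT r|radial_measure. h (r *\<^sub>R w))"
  and "integrable sphere_measure (%w. LINT r|radial_measure. h (r *\<^sub>R w))"
proof -
 have [measurable]: "h : borel_measurable borel" using h by auto
 have i: "integrable (sphere_measure \<Otimes>\<^sub>M radial_measure) (%p. h (snd p *\<^sub>R fst p))"
  using h by (subst (asm) lborel_polar, subst (asm) integrable_distr_eq) auto
 have "(LINT x|lborel. h x) = (LINT p|(sphere_measure \<Otimes>\<^sub>M radial_measure). h (snd p *\<^sub>R fst p))"
  by (subst lborel_polar, subst integral_distr) auto
 then show "(LINT x|lborel. h x) = (LINT w|sphere_measure. LINT r|radial_measure. h (r *\<^sub>R w))"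
  using polar.integral_fst'[OF i] by simp
 show "integrable sphere_measure (%w. LINT r|radial_measure. h (r *\<^sub>R w))"
  using polar.integrable_fst'[OF i] by simp
qed

lemma sphere_measurable [simp]: "borel_measurable sphere_measure = borel_measurable borel"
 by (intro measurable_cong_sets) simp_all

lemma sphere_uniform_bound:
 fixes G :: "real => space => complex"
 assumes "continuous_on UNIV (%(r, w). G r w)"
 obtains C where "C > 0" "!!r w. r : {a..b} ==> norm w = 1 ==> norm (G r w) <= C"
proof -
 have "compact ((%(r, w). G r w) ` ({a..b} \<times> sphere 0 1))"
  by (intro compact_continuous_image continuous_on_subset[OF assms] compact_Times) auto
 then obtain C where C: "!!z. z : (%(r, w). G r w) ` ({a..b} \<times> sphere 0 1) ==> norm z <= C"
  using compact_imp_bounded bounded_iff by metis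
 have "norm (G r w) <= max C 1" if "r : {a..b}" "norm w = 1" for r w
 proof -
  have "G r w : (%(r, w). G r w) ` ({a..b} \<times> sphere 0 1)" using that by force
  from C[OF this] show ?thesis by simp
 qed
 then show ?thesis by (intro that[of "max C 1"]) auto
qed

lemma sphere_nn_bound:
 fixes g :: "space => complex"
 assumes "!!w. norm w = 1 ==> norm (g w) <= C"
 shows "(\<integral>\<^sup>+w. norm (g w) \<partial>sphere_measure) <= ennreal (C * (4 * pi))"
proof -
 have "(\<integral>\<^sup>+w. norm (g w) \<partial>sphere_measure) <= (\<integral>\<^sup>+w. ennreal C \<partial>sphere_measure)"
  using AE_sphere_measure by (intro nn_integral_mono_AE) (auto elim!: eventually_mono intro!: ennreal_leI assms)
 then show ?thesis
  by (simp add: emeasure_sphere_measure ennreal_mult'')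
qed

lemma sphere_integrable_bounded:
 fixes g :: "space => complex"
 assumes "g : borel_measurable borel" "!!w. norm w = 1 ==> norm (g w) <= C"
 shows "integrable sphere_measure g"
proof (rule integrableI_bounded)
 let ?A = "\<integral>\<^sup>+w. norm (g w) \<partial>sphere_measure"
 have "?A <= ennreal (C * (4 * pi))"
  by (rule sphere_nn_bound) (rule assms(2))
 also have "... < \<infinity>" by simp
 finally show "?A < \<infinity>" .
qed (use assms in simp)

lemma sphere_integrable:
 fixes g :: "space => complex"
 assumes "continuous_on UNIV g"
 shows "integrable sphere_measure g"
proof -
 have "continuous_on UNIV (%(r::real, w). g w)"
  using continuous_on_compose2[OF assms, of UNIV snd] by (simp add: case_prod_beta continuous_on_snd)
 then obtain C where "!!(r::real) w. r : {0..1} ==> norm w = 1 ==> norm (g w) <= C"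
  by (rule sphere_uniform_bound) auto
 from this[of 0] have "!!w. norm w = 1 ==> norm (g w) <= C" by simp
 then show ?thesis
  using assms by (intro sphere_integrable_bounded[of g C] borel_measurable_continuous_onI) auto
qed

lemma gauss_moment_3: "(\<integral>\<^sup>+r. ennreal (r ^ 3 * exp (- r\<^sup>2)) * indicator {0..} r \<partial>lborel) = ennreal (1 / 2)"
proof -
 have "((%r. - (r^2 + 1) * exp (- r\<^sup>2) / 2) \<longlongrightarrow> (0::real)) at_top"
  by real_asymp
 then have "(\<integral>\<^sup>+r. ennreal (r ^ 3 * exp (- r\<^sup>2)) * indicator {0..} r \<partial>lborel) = ennreal (0 - (- (0^2 + 1) * exp (- 0\<^sup>2) / 2))"
  by (intro nn_integral_FTC_atLeast)
    (auto intro!: derivative_eq_intros simp: field_simps power2_eq_square power3_eq_cube)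
 then show ?thesis by simp
qed

lemma gauss_moment_5: "(\<integral>\<^sup>+r. ennreal (r ^ 5 * exp (- r\<^sup>2)) * indicator {0..} r \<partial>lborel) = ennreal 1"
proof -
 have "((%r. - (r ^ 4 + 2 * r^2 + 2) * exp (- r\<^sup>2) / 2) \<longlongrightarrow> (0::real)) at_top"
  by real_asymp
 then have "(\<integral>\<^sup>+r. ennreal (r ^ 5 * exp (- r\<^sup>2)) * indicator {0..} r \<partial>lborel) = ennreal (0 - (- (0 ^ 4 + 2 * 0^2 + 2) * exp (- 0\<^sup>2) / 2))"
  by (intro nn_integral_FTC_atLeast)
    (auto intro!: derivative_eq_intros simp: field_simps power2_eq_square eval_nat_numeral)
 then show ?thesis by simp
qed

lemma has_bochner_radial:
 assumes "!!r. r >= 0 ==> g r >= 0" "g : borel_measurable borel" "m >= 0"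
  and "(\<integral>\<^sup>+r. ennreal (r^2 * g r) * indicator {0..} r \<partial>lborel) = ennreal m"
 shows "has_bochner_integral radial_measure g m"
proof (rule has_bochner_integral_nn_integral)
 have [measurable]: "g : borel_measurable borel" by fact
 have "(\<integral>\<^sup>+r. ennreal (g r) \<partial>radial_measure) = (\<integral>\<^sup>+r. ennreal (r^2) * indicator {0<..} r * ennreal (g r) \<partial>lborel)"
  by (rule nn_integral_radial_measure) simp
 also have "... = (\<integral>\<^sup>+r. ennreal (r^2 * g r) * indicator {0..} r \<partial>lborel)"
  by (rule nn_integral_cong_AE, rule AE_mp[OF AE_lborel_singleton[of 0]])
    (auto split: split_indicator simp: ennreal_mult' assms(1))
 finally show "(\<integral>\<^sup>+r. ennreal (g r) \<partial>radial_measure) = ennreal m" using assms(4) by simp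
 show "AE r in radial_measure. 0 <= g r"
  unfolding radial_measure_def by (subst AE_density) (auto intro!: AE_I2 assms(1) split: split_indicator)
qed (use assms in \<open>auto simp: measurable_cong_sets[OF sets_radial_measure refl]\<close>)

text \<open>Handles the origin, where \<open>sgn\<close> is singular: a factor of quadratic size
  makes the derivative along a line exist and vanish there.\<close>

lemma deriv_zero_of_quadratic_bound:
 fixes g :: "real => complex"
 assumes "!!r. norm (g r) <= C * r^2"
 shows "(g has_vector_derivative 0) (at 0)"
proof -
 have g0: "g 0 = 0" using assms[of 0] by simp
 have "((%r. g r /\<^sub>R r) \<longlongrightarrow> 0) (at 0)"
 proof (rule Lim_null_comparison)
  have "norm (g r /\<^sub>R r) <= C * \<bar>r\<bar>" if "r ~= 0" for r
  proof -
   have "norm (g r /\<^sub>R r) = norm (g r) / \<bar>r\<bar>" by (simp add: divide_inverse mult.commute)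
   also have "... <= C * r^2 / \<bar>r\<bar>" by (rule divide_right_mono[OF assms]) simp
   also have "... = C * \<bar>r\<bar>" using that by (simp add: power2_eq_square field_simps)
   finally show ?thesis .
  qed
  then show "\<forall>\<^sub>F r in at 0. norm (g r /\<^sub>R r) <= C * \<bar>r\<bar>"
   by (simp add: eventually_at_filter)
  show "((%r. C * \<bar>r\<bar>) \<longlongrightarrow> 0) (at (0::real))" by real_asymp
 qed
 then have "((%r. norm (g r /\<^sub>R r)) \<longlongrightarrow> 0) (at 0)"
  by (rule tendsto_norm_zero)
 then have "((%r. norm (g r) / \<bar>r\<bar>) \<longlongrightarrow> 0) (at 0)"
  by (simp add: divide_inverse mult.commute)
 then show ?thesis
  unfolding has_vector_derivative_def has_derivative_at by (simp add: g0)
qed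

lemma sgn_line_derivative:
 fixes y :: space
 assumes "y ~= 0"
 shows "((%r. sgn (y + r *\<^sub>R axis i 1)) has_vector_derivative (1 / norm y) *\<^sub>R axis i 1 - (y $ i / norm y ^ 3) *\<^sub>R y) (at 0)"
proof -
 let ?A = "%r. norm (y + r *\<^sub>R axis i 1)"
 have n: "(?A has_vector_derivative y $ i / norm y) (at 0)"
 proof -
  have "(?A has_derivative (%h. (h *\<^sub>R axis i 1) \<bullet> sgn (y + 0 *\<^sub>R axis i 1))) (at 0)"
  proof (rule has_derivative_compose[where f = "%r. y + r *\<^sub>R axis i 1" and g = norm])
   show "((%r. y + r *\<^sub>R axis i 1) has_derivative (%h. h *\<^sub>R axis i 1)) (at 0)"
    by (auto intro!: derivative_eq_intros)
   show "(norm has_derivative (%h. h \<bullet> sgn (y + 0 *\<^sub>R axis i 1))) (at (y + 0 *\<^sub>R axis i 1))"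
    by (rule has_derivative_norm) (use assms in simp)
  qed
  then show ?thesis
   unfolding has_vector_derivative_def
   by (rule has_derivative_eq_rhs) (auto simp: inner_axis' sgn_div_norm divide_inverse mult_ac)
 qed
 have i: "((%r. inverse (norm (y + r *\<^sub>R axis i 1))) has_field_derivative - (y $ i / norm y ^ 3)) (at 0)"
 proof (rule DERIV_inverse'[THEN DERIV_cong])
  show "(?A has_field_derivative y $ i / norm y) (at 0)"
   using n by (simp add: has_real_derivative_iff_has_vector_derivative)
 qed (use assms in \<open>simp_all add: divide_inverse power3_eq_cube\<close>)
 have l: "((%r. y + r *\<^sub>R axis i 1) has_vector_derivative axis i 1) (at 0)"
  by (auto intro!: derivative_eq_intros)
 show ?thesis
  using has_vector_derivative_scaleR[OF i l]
  by (simp add: sgn_div_norm divide_inverse algebra_simps)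
qed

lemma has_gradient_chain:
 assumes "has_gradient u Du" and "(gam has_vector_derivative v) (at s)"
 shows "((%r. u (gam r)) has_vector_derivative (SUM k:UNIV. (v $ k) *\<^sub>R Du k (gam s))) (at s)"
proof -
 have "((%r. u (gam r)) has_derivative (%h. SUM k:UNIV. ((h *\<^sub>R v) $ k) *\<^sub>R Du k (gam s))) (at s)"
 proof (rule has_derivative_compose[of gam])
  show "(gam has_derivative (%h. h *\<^sub>R v)) (at s)"
   using assms(2) by (simp add: has_vector_derivative_def)
  show "(u has_derivative (%y. SUM k:UNIV. (y $ k) *\<^sub>R Du k (gam s))) (at (gam s))"
   using assms(1) by (simp add: has_gradient_def)
 qed
 then show ?thesis
  unfolding has_vector_derivative_def by (simp add: scaleR_sum_right)
qed

lemma has_gradient_continuous: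
 assumes "has_gradient u Du" shows "continuous_on UNIV u" "continuous_on UNIV (Du i)"
proof -
 have "u differentiable_on UNIV"
  using assms unfolding has_gradient_def differentiable_on_def differentiable_def by blast
 then show "continuous_on UNIV u" by (rule differentiable_imp_continuous_on)
qed (use assms in \<open>auto simp: has_gradient_def\<close>)

lemma has_gradient_line:
 assumes "has_gradient u Du"
 shows "((%r. u (x + r *\<^sub>R axis i 1)) has_vector_derivative Du i x) (at 0)"
proof -
 have "((%r. x + r *\<^sub>R axis i 1) has_vector_derivative axis i 1) (at 0)"
  by (auto intro!: derivative_eq_intros)
 from has_gradient_chain[OF assms this] show ?thesis
  by (simp add: axis_def if_distrib[of "%z. z *\<^sub>R _"] cong: if_cong)
qed

lemma AE_radial_measure: "AE r in radial_measure. r > 0"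
 unfolding radial_measure_def by (subst AE_density) (auto intro!: AE_I2 split: split_indicator)

lemma nn_integral_polar_radial:
 assumes [measurable]: "g : borel_measurable borel"
 shows "(\<integral>\<^sup>+y. g (norm (y::space)) \<partial>lborel) = ennreal (4 * pi) * (\<integral>\<^sup>+r. g r \<partial>radial_measure)"
proof -
 have "(\<integral>\<^sup>+y. g (norm (y::space)) \<partial>lborel) = (\<integral>\<^sup>+w. \<integral>\<^sup>+r. g (norm (r *\<^sub>R w :: space)) \<partial>radial_measure \<partial>sphere_measure)"
  by (rule nn_integral_polar) simp
 also have "... = (\<integral>\<^sup>+w. \<integral>\<^sup>+r. g r \<partial>radial_measure \<partial>sphere_measure)"
 proof (rule nn_integral_cong_AE)
  show "AE w in sphere_measure. (\<integral>\<^sup>+r. g (norm (r *\<^sub>R w)) \<partial>radial_measure) = (\<integral>\<^sup>+r. g r \<partial>radial_measure)"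
   using AE_sphere_measure
  proof eventually_elim
   case (elim w)
   then show ?case
    by (intro nn_integral_cong_AE eventually_mono[OF AE_radial_measure]) simp
  qed
 qed
 finally show ?thesis
  by (simp add: emeasure_sphere_measure mult.commute)
qed

text \<open>The test function on the sphere produces just the powers r and r^3 times the Gaussian;
  with the density r^2 these become its third and fifth moments.\<close>

lemma gauss_radial_integrals:
 "has_bochner_integral radial_measure (%r. r * exp (- r\<^sup>2)) (1 / 2)"
 "has_bochner_integral radial_measure (%r. r ^ 3 * exp (- r\<^sup>2)) 1"
 unfolding atomize_conj
proof (intro conjI)
 have m: "r^2 * (r * exp (- r\<^sup>2)) = r ^ 3 * exp (- r\<^sup>2)" "r^2 * (r ^ 3 * exp (- r\<^sup>2)) = r ^ 5 * exp (- r\<^sup>2)" for r :: real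
  by (simp_all add: eval_nat_numeral)
 show "has_bochner_integral radial_measure (%r. r * exp (- r\<^sup>2)) (1 / 2)"
  by (rule has_bochner_radial) (use gauss_moment_3 in \<open>auto simp: m\<close>)
 show "has_bochner_integral radial_measure (%r. r ^ 3 * exp (- r\<^sup>2)) 1"
  by (rule has_bochner_radial) (use gauss_moment_5 in \<open>auto simp: m\<close>)
qed

lemma gauss_norm_integrable:
 "integrable lborel (%y::space. (norm y + norm y ^ 3) * exp (- (norm y)\<^sup>2))"
proof (rule integrableI_bounded)
 let ?A = "(\<integral>\<^sup>+y. ennreal (norm ((norm (y::space) + norm y ^ 3) * exp (- (norm y)\<^sup>2))) \<partial>lborel)"
 have i: "integrable radial_measure (%r. (r + r ^ 3) * exp (- r\<^sup>2))"
  using gauss_radial_integrals by (auto simp: has_bochner_integral_iff distrib_right)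
 have "?A
   = ennreal (4 * pi) * (\<integral>\<^sup>+r. ennreal (norm ((r + r ^ 3) * exp (- r\<^sup>2))) \<partial>radial_measure)"
  by (subst nn_integral_polar_radial[symmetric]) simp_all
 also have "... < \<infinity>"
  using i by (simp add: integrable_iff_bounded ennreal_mult_less_top)
 finally show "?A < \<infinity>" .
qed measurable

text \<open>A derivative computed away from the origin may have the form |y| B(y), with B bounded
  but dependent on the direction near 0; the factor |y| restores continuity.\<close>

lemma continuous_on_norm_scaleR:
 fixes B :: "space => complex"
 assumes c: "continuous_on (- {0}) B" and b: "!!y. norm y <= 1 ==> norm (B y) <= M"
 shows "continuous_on UNIV (%y. norm y *\<^sub>R B y)"
 unfolding continuous_on_eq_continuous_at[OF open_UNIV]
proof
 fix x :: space
 show "isCont (%y. norm y *\<^sub>R B y) x"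
 proof (cases "x = 0")
  case True
  have "((%y. norm y *\<^sub>R B y) \<longlongrightarrow> 0) (at 0)"
  proof (rule Lim_null_comparison)
   have "norm (norm y *\<^sub>R B y) <= M * norm y" if "norm y <= 1" for y
    using mult_left_mono[OF b[OF that], of "norm y"] by (simp add: mult.commute)
   then show "\<forall>\<^sub>F y in at 0. norm (norm y *\<^sub>R B y) <= M * norm y"
    unfolding eventually_at by (intro exI[of _ 1]) (simp add: less_imp_le)
   show "((%y. M * norm y) \<longlongrightarrow> 0) (at (0::space))"
    by (intro tendsto_mult_right_zero tendsto_norm_zero tendsto_ident_at)
  qed
  then show ?thesis using True by (simp add: isCont_def)
 next
  case False
  then have "isCont B x"
   using c by (simp add: continuous_on_eq_continuous_at open_Compl)
  then show ?thesis by (intro continuous_intros)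
 qed
qed

text \<open>Integrate the derivative in direction \<open>i\<close> of \<open>y \<mapsto> \<bar>y\<bar>\<^sup>2 exp (- \<bar>y\<bar>\<^sup>2) u (\<rho> y / \<bar>y\<bar>)\<close> over space, in polar coordinates.\<close>

lemma sphere_tangential_derivative:
 assumes u: "has_gradient u Du"
 shows "(LINT w|sphere_measure. rho *\<^sub>R (Du i (rho *\<^sub>R w) - (SUM k:UNIV. (w $ i * w $ k) *\<^sub>R Du k (rho *\<^sub>R w))))
  = (LINT w|sphere_measure. (2 * (w $ i)) *\<^sub>R u (rho *\<^sub>R w))"
proof -
 let ?C = "borel_measurable borel"
 note cont = has_gradient_continuous[OF u]
 define U where "U w = u (rho *\<^sub>R w)" for w
 define W where "W w = (2 * (w $ i)) *\<^sub>R u (rho *\<^sub>R w)" for w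
 define R where "R w = rho *\<^sub>R (Du i (rho *\<^sub>R w) - (SUM k:UNIV. (w $ i * w $ k) *\<^sub>R Du k (rho *\<^sub>R w)))" for w
 have c: "continuous_on A U" "continuous_on A W" "continuous_on A R" for A
  unfolding U_def W_def R_def
  by (intro continuous_intros continuous_on_compose2[OF cont(1)] continuous_on_compose2[OF cont(2)]; simp)+
 have "bounded (U ` cball 0 1 \<union> (W ` cball 0 1 \<union> R ` cball 0 1))"
  by (intro bounded_Un[THEN iffD2] conjI compact_imp_bounded compact_continuous_image c) auto
 then obtain M where M': "\<forall>z\<in>U ` cball 0 1 \<union> (W ` cball 0 1 \<union> R ` cball 0 1). norm z <= M"
  unfolding bounded_iff by (rule exE)
 have M: "norm (U (sgn y)) <= M" "norm (W (sgn y)) <= M" "norm (R (sgn y)) <= M" for y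
  using M' by (auto simp: norm_sgn)
 have M0: "0 <= M" by (rule order_trans[OF norm_ge_zero M(1)])
 define e where "e y = exp (- (norm y)\<^sup>2)" for y :: space
 have e: "0 <= e y" "e y <= 1" for y by (simp_all add: e_def)
 \<comment> \<open>\<open>U (sgn y)\<close> is constant along rays. The factor |y|^2 repairs its
   singularity at 0 and the Gaussian makes it integrable, so \<open>integral_derivative_eq_0\<close>
   applies to \<open>h\<close>.\<close>
 define h where "h y = ((norm y)^2 * e y) *\<^sub>R U (sgn y)" for y
 \<comment> \<open>The derivative of \<open>h\<close> is |y| B: the \<open>W\<close> part comes from
   differentiating the radial factor, the \<open>R\<close> part from differentiating
   \<open>U (sgn y)\<close>.\<close>
 define B where "B y = ((1 - (norm y)^2) * e y) *\<^sub>R W (sgn y) + e y *\<^sub>R R (sgn y)" for y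
 define h' where "h' y = norm y *\<^sub>R B y" for y
 have Bb: "norm (B y) <= 2 * M * ((1 + (norm y)^2) * e y)" for y
 proof -
  have "\<bar>1 - (norm y)^2\<bar> * e y * norm (W (sgn y)) <= (1 + (norm y)^2) * e y * M"
   using M(2)[of y] e by (intro mult_mono) (auto simp: abs_le_iff)
  moreover have "e y * norm (R (sgn y)) <= (1 + (norm y)^2) * e y * M"
   using M(3)[of y] e(1)[of y] by (intro mult_mono) (auto simp: mult_le_cancel_right1)
  moreover have "norm (B y) <= \<bar>1 - (norm y)^2\<bar> * e y * norm (W (sgn y)) + e y * norm (R (sgn y))"
   unfolding B_def by (rule order_trans[OF norm_triangle_ineq]) (simp add: abs_mult e)
  ultimately have "norm (B y) <= (1 + (norm y)^2) * e y * M + (1 + (norm y)^2) * e y * M" by linarith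
  then show ?thesis by (simp add: algebra_simps)
 qed
 have cs: "continuous_on (- {0}) (%y::space. sgn y)" by (intro continuous_on_sgn continuous_on_id) auto
 have "continuous_on (- {0}) B"
  unfolding B_def e_def
  by (intro continuous_intros continuous_on_compose2[OF c(2)[of UNIV]] continuous_on_compose2[OF c(3)[of UNIV]] cs) auto
 then have ch': "continuous_on UNIV h'"
  unfolding h'_def
 proof (rule continuous_on_norm_scaleR)
  fix y :: space assume "norm y <= 1"
  then have "(1 + (norm y)^2) * e y <= 2 * 1" using e by (intro mult_mono) (auto simp: power_le_one)
  then show "norm (B y) <= 2 * M * (2 * 1)" by (intro order_trans[OF Bb] mult_left_mono) (auto simp: M0)
 qed
 have hb: "norm (h y) <= M * ((norm y)^2 * e y)" for y
  unfolding h_def using mult_left_mono[OF M(1)[of y], of "(norm y)^2 * e y"] e by (simp add: mult_ac)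
 have dh: "((%r. h (y + r *\<^sub>R axis i 1)) has_vector_derivative h' y) (at 0)" for y
 proof (cases "y = 0")
  case True
  have "norm (h (y + r *\<^sub>R axis i 1)) <= M * r^2" for r
   by (rule order_trans[OF hb]) (use True M0 e in \<open>simp add: mult_left_mono mult_left_le\<close>)
  then have "((%r. h (y + r *\<^sub>R axis i 1)) has_vector_derivative 0) (at 0)" by (rule deriv_zero_of_quadratic_bound)
  then show ?thesis using True by (simp add: h'_def)
 next
  case False
  let ?l = "%r. y + r *\<^sub>R axis i 1"
  let ?v = "rho *\<^sub>R ((1 / norm y) *\<^sub>R axis i 1 - (y $ i / norm y ^ 3) *\<^sub>R y)"
  have "(norm (?l r))^2 = (norm y)^2 + 2 * r * y $ i + r^2" for r
   using dot_norm[of y "r *\<^sub>R axis i 1"] by (simp add: inner_axis)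
  then have sq: "((%r. (norm (?l r))^2) has_field_derivative 2 * y $ i) (at 0)"
   by (auto intro!: derivative_eq_intros)
  have f1: "((%r. (norm (?l r))^2 * e (?l r)) has_field_derivative 2 * y $ i * (1 - (norm y)^2) * e y) (at 0)"
   unfolding e_def by (rule derivative_eq_intros sq refl)+ (simp add: algebra_simps)
  have "((%r. rho *\<^sub>R sgn (?l r)) has_vector_derivative ?v) (at 0)"
   using has_vector_derivative_scaleR[OF DERIV_const[of rho] sgn_line_derivative[OF False, of i]] by simp
  from has_gradient_chain[OF u this]
  have f3: "((%r. U (sgn (?l r))) has_vector_derivative (SUM k:UNIV. (?v $ k) *\<^sub>R Du k (rho *\<^sub>R sgn y))) (at 0)"
   unfolding U_def by simp
  have "?v $ k = (if k = i then rho / norm y else 0) - (rho / norm y) * (sgn y $ i * sgn y $ k)" for k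
   using False by (auto simp: axis_def sgn_div_norm divide_inverse power3_eq_cube algebra_simps)
  then have "(SUM k:UNIV. (?v $ k) *\<^sub>R Du k (rho *\<^sub>R sgn y)) =
   (SUM k:UNIV. (if k = i then (rho / norm y) *\<^sub>R Du i (rho *\<^sub>R sgn y) else 0) - (rho / norm y) *\<^sub>R ((sgn y $ i * sgn y $ k) *\<^sub>R Du k (rho *\<^sub>R sgn y)))"
   by (intro sum.cong) (auto simp: scaleR_diff_left)
  also have "... = (1 / norm y) *\<^sub>R R (sgn y)"
   by (simp add: R_def sum_subtractf scaleR_diff_right scaleR_sum_right divide_inverse mult_ac)
  finally have f4: "((%r. U (sgn (?l r))) has_vector_derivative (1 / norm y) *\<^sub>R R (sgn y)) (at 0)"
   using f3 by simp
  have "W (sgn y) = (2 * y $ i / norm y) *\<^sub>R U (sgn y)" by (simp add: W_def U_def sgn_div_norm divide_inverse mult.commute)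
  then have "((norm (?l 0))^2 * e (?l 0)) *\<^sub>R ((1 / norm y) *\<^sub>R R (sgn y)) + (2 * y $ i * (1 - (norm y)^2) * e y) *\<^sub>R U (sgn (?l 0)) = h' y"
   using False by (simp add: h'_def B_def scaleR_add_right power2_eq_square mult_ac)
  then show ?thesis using has_vector_derivative_scaleR[OF f1 f4] unfolding h_def by simp
 qed
 have dom: "integrable lborel f" if "f : ?C" "!!y. norm (f y) <= 2 * M * ((norm y + norm y ^ 3) * e y)" for f :: "space => complex"
 proof (rule Bochner_Integration.integrable_bound)
  show "integrable lborel (%y::space. 2 * M * ((norm y + norm y ^ 3) * e y))"
   unfolding e_def using gauss_norm_integrable by simp
  show "AE y in lborel. norm (f y) <= norm (2 * M * ((norm y + norm y ^ 3) * e y))"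
   by (rule AE_I2, rule order_trans[OF that(2)]) simp
 qed (use that in simp)
 have mh': "h' : ?C" by (rule borel_measurable_continuous_onI[OF ch'])
 have g1: "integrable lborel h"
 proof (rule dom)
  have [measurable]: "U : ?C" by (intro borel_measurable_continuous_onI c)
  show "h : ?C" unfolding h_def e_def by simp
  have "s^2 <= 2 * (s + s ^ 3)" if "s >= 0" for s :: real
  proof -
   have "0 <= s * (s - 1)^2" using that by auto
   also have "... = s + s ^ 3 - 2 * s^2" by (simp add: power2_eq_square power3_eq_cube algebra_simps)
   finally show ?thesis using zero_le_power2[of s] zero_le_power[OF that, of 3] that by (smt (verit) distrib_left)
  qed
  then have "M * ((norm y)^2 * e y) <= M * ((2 * (norm y + norm y ^ 3)) * e y)" for y :: space
   by (intro mult_left_mono mult_right_mono M0 e) auto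
  then show "norm (h y) <= 2 * M * ((norm y + norm y ^ 3) * e y)" for y
   by (intro order_trans[OF hb]) (simp add: mult_ac)
 qed
 have g2: "integrable lborel h'"
 proof (rule dom[OF mh'])
  show "norm (h' y) <= 2 * M * ((norm y + norm y ^ 3) * e y)" for y
   unfolding h'_def using mult_left_mono[OF Bb[of y], of "norm y"]
   by (simp add: algebra_simps power2_eq_square power3_eq_cube)
 qed
 have "0 = (LINT y|lborel. h' y)" by (rule integral_derivative_eq_0[OF dh ch' g1 g2, symmetric])
 also have "... = (LINT w|sphere_measure. (LINT r|radial_measure. h' (r *\<^sub>R w)))" by (rule integral_polar(1)[OF g2])
 also have "... = (LINT w|sphere_measure. (1/2) *\<^sub>R (R w - W w))"
 proof (rule integral_cong_AE)
  show "AE w in sphere_measure. (LINT r|radial_measure. h' (r *\<^sub>R w)) = (1/2) *\<^sub>R (R w - W w)"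
   using AE_sphere_measure
  proof eventually_elim
   fix w :: space assume w: "norm w = 1"
   let ?f = "%r. (r * exp (- r\<^sup>2)) *\<^sub>R (W w + R w) + (r ^ 3 * exp (- r\<^sup>2)) *\<^sub>R (- W w)"
   have "h' (r *\<^sub>R w) = ?f r" if "r > 0" for r
    using that w by (simp add: h'_def B_def e_def sgn_div_norm scaleR_add_right scaleR_diff_left algebra_simps power2_eq_square power3_eq_cube)
   then have "(LINT r|radial_measure. h' (r *\<^sub>R w)) = (LINT r|radial_measure. ?f r)"
    using mh' by (intro integral_cong_AE eventually_mono[OF AE_radial_measure]) auto
   \<comment> \<open>The moments 1/2 and 1 leave (W + R)/2 - W = (R - W)/2, so the vanishing of the
     whole integral equates the integrals of \<open>R\<close> and \<open>W\<close>.\<close>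
   also have "has_bochner_integral radial_measure ?f ((1/2) *\<^sub>R (W w + R w) + 1 *\<^sub>R (- W w))"
    by (intro has_bochner_integral_add has_bochner_integral_scaleR_left gauss_radial_integrals)
   then have "(LINT r|radial_measure. ?f r) = (1/2) *\<^sub>R (R w - W w)"
    by (simp add: has_bochner_integral_iff scaleR_conv_of_real field_simps)
   finally show "(LINT r|radial_measure. h' (r *\<^sub>R w)) = (1/2) *\<^sub>R (R w - W w)" .
  qed
  show "(%w. LINT r|radial_measure. h' (r *\<^sub>R w)) : borel_measurable sphere_measure"
   using integral_polar(2)[OF g2] by auto
  show "(%w. (1/2) *\<^sub>R (R w - W w)) : borel_measurable sphere_measure"
   unfolding sphere_measurable by (intro borel_measurable_continuous_onI continuous_intros c)
 qed
 also have "... = (1/2) *\<^sub>R ((LINT w|sphere_measure. R w) - (LINT w|sphere_measure. W w))"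
  by (simp add: sphere_integrable c)
 finally show ?thesis unfolding R_def W_def by simp
qed

text \<open>The integrand on the left is rho times the full divergence of V without its normal part,
  that is, the divergence along the sphere. Summing \<open>sphere_tangential_derivative\<close> over
  i gives the divergence theorem on the sphere; the 2 is the sum of the principal curvatures at
  radius 1.\<close>

lemma sphere_divergence:
 assumes V: "!!i. has_gradient (V i) (DV i)"
 shows "(LINT w|sphere_measure. rho *\<^sub>R ((SUM i:UNIV. DV i i (rho *\<^sub>R w)) - (SUM i:UNIV. SUM k:UNIV. (w $ i * w $ k) *\<^sub>R DV i k (rho *\<^sub>R w))))
  = 2 * (LINT w|sphere_measure. (SUM i:UNIV. (w $ i) *\<^sub>R V i (rho *\<^sub>R w)))"
proof -
 note cont = has_gradient_continuous[OF V]
 have cV: "continuous_on A (%w. V i (rho *\<^sub>R w))" "continuous_on A (%w. DV i k (rho *\<^sub>R w))" for A i k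
  by (auto intro!: continuous_on_compose2[OF cont(1)] continuous_on_compose2[OF cont(2)] continuous_intros)
 have i: "integrable sphere_measure (%w. rho *\<^sub>R (DV i i (rho *\<^sub>R w) - (SUM k:UNIV. (w $ i * w $ k) *\<^sub>R DV i k (rho *\<^sub>R w))))"
  "integrable sphere_measure (%w. (2 * (w $ i)) *\<^sub>R V i (rho *\<^sub>R w))" for i
  by (intro sphere_integrable continuous_intros cV)+
 have "(LINT w|sphere_measure. rho *\<^sub>R ((SUM i:UNIV. DV i i (rho *\<^sub>R w)) - (SUM i:UNIV. SUM k:UNIV. (w $ i * w $ k) *\<^sub>R DV i k (rho *\<^sub>R w))))
   = (SUM i:UNIV. LINT w|sphere_measure. (2 * (w $ i)) *\<^sub>R V i (rho *\<^sub>R w))"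
  unfolding sphere_tangential_derivative[OF V, symmetric]
  by (subst Bochner_Integration.integral_sum[symmetric], rule i) (simp add: sum_subtractf scaleR_sum_right scaleR_diff_right)
 also have "... = (LINT w|sphere_measure. 2 * (SUM i:UNIV. (w $ i) *\<^sub>R V i (rho *\<^sub>R w)))"
  by (subst Bochner_Integration.integral_sum[symmetric], rule i) (simp add: sum_distrib_left scaleR_conv_of_real mult_ac)
 finally show ?thesis by simp
qed

section \<open>Kirchhoff's formula and the decay of free waves\<close>

text \<open>For unit w the ray r -> (t - r, x + r w) lies on the backward light cone of (t,
  x).\<close>

lemma cone_chain:
 assumes "smooth1 psi"
 shows "((%r. psi (t - r) (x + r *\<^sub>R w)) has_vector_derivative
  (- pd Time psi (t - r) (x + r *\<^sub>R w) + (SUM k:UNIV. (w $ k) *\<^sub>R pd (Space k) psi (t - r) (x + r *\<^sub>R w)))) (at r)"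
proof -
 have "((%r. (%(t, x). psi t x) (t - r, x + r *\<^sub>R w)) has_derivative
   (%h. SUM mu:UNIV. coord_fn mu (fst (- h, h *\<^sub>R w)) (snd (- h, h *\<^sub>R w)) *\<^sub>R pd mu psi (t - r) (x + r *\<^sub>R w))) (at r)"
  by (rule has_derivative_compose[where g = "%(t, x). psi t x" and f = "%r. (t - r, x + r *\<^sub>R w)"])
    (auto intro!: derivative_eq_intros smooth1_has_derivative assms)
 then have "((%r. psi (t - r) (x + r *\<^sub>R w)) has_derivative
   (%h. SUM mu:UNIV. coord_fn mu (fst (- h, h *\<^sub>R w)) (snd (- h, h *\<^sub>R w)) *\<^sub>R pd mu psi (t - r) (x + r *\<^sub>R w))) (at r)"
  by simp
 then show ?thesis
  unfolding has_vector_derivative_def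
  by (rule has_derivative_eq_rhs) (auto simp: sum_coord scaleR_add_right scaleR_diff_right scaleR_sum_right)
qed

lemma cone_continuous:
 assumes "C_k k psi"
 shows "continuous_on UNIV (%p. psi (t - fst p) (x + fst p *\<^sub>R snd p))"
 using continuous_on_compose2[OF C_k_continuous[OF assms], of UNIV "%p. (t - fst p, x + fst p *\<^sub>R snd p)"]
 by (simp add: continuous_intros)

lemma has_gradient_translate:
 assumes "has_gradient u Du"
 shows "has_gradient (%y. u (x + y)) (%i y. Du i (x + y))"
 unfolding has_gradient_def
proof (intro conjI allI)
 fix y
 have u: "(u has_derivative (%h. SUM i:UNIV. (h $ i) *\<^sub>R Du i (x + y))) (at (x + y))"
  using assms by (simp add: has_gradient_def)
 show "((%y. u (x + y)) has_derivative (%h. SUM i:UNIV. (h $ i) *\<^sub>R Du i (x + y))) (at y)"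
  by (rule has_derivative_compose[where g = u and f = "%y. x + y"]) (auto intro!: derivative_eq_intros u)
 show "continuous_on UNIV (%y. Du i (x + y))" for i
  by (rule continuous_on_compose2[OF has_gradient_continuous(2)[OF assms]]) (auto intro!: continuous_intros)
qed

text \<open>The integral of \<open>F r\<close> over the directions does not depend on r. By
  \<open>sphere_divergence\<close> the first order term 2 X completes the radial second derivatives
  \<open>Q\<close> to the Laplacian, so the r-derivative is r times the integral of
  \<open>box phi\<close>, which is 0. The vertex r = 0 of the backward light cone gives 4 pi times
  the value at (t, x), its base r = t gives the data.\<close>

lemma kirchhoff:
 assumes C: "C_k 2 phi" and box: "!!t x. box phi t x = 0" and t: "t >= 0"
 shows "(4 * pi) *\<^sub>R phi t x = (LINT w|sphere_measure. t *\<^sub>R pd Time phi 0 (x + t *\<^sub>R w) + phi 0 (x + t *\<^sub>R w)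
   + t *\<^sub>R (SUM i:UNIV. (w $ i) *\<^sub>R pd (Space i) phi 0 (x + t *\<^sub>R w)))"
proof -
 let ?H = "integrable sphere_measure"
 let ?G = "borel \<Otimes>\<^sub>M sphere_measure"
 let ?E = "pd Time phi"
 have s0: "smooth1 phi" and s1: "smooth1 (pd mu phi)" and c1: "C_k 1 (pd mu phi)" and c2: "C_k 0 (pd nu (pd mu phi))" for mu nu
  using C by (auto simp: numeral_2_eq_2 C_k_Suc_iff)
 define F where "F r w = r *\<^sub>R pd Time phi (t - r) (x + r *\<^sub>R w) + phi (t - r) (x + r *\<^sub>R w)
   + r *\<^sub>R (SUM i:UNIV. (w $ i) *\<^sub>R pd (Space i) phi (t - r) (x + r *\<^sub>R w))" for r w
 let ?I = "LINT w|sphere_measure. F 0 w"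
 define Q where "Q r w = (SUM i:UNIV. SUM k:UNIV. (w $ i * w $ k) *\<^sub>R pd (Space k) (pd (Space i) phi) (t - r) (x + r *\<^sub>R w))" for r and w :: space
 define X where "X r w = (SUM i:UNIV. (w $ i) *\<^sub>R pd (Space i) phi (t - r) (x + r *\<^sub>R w))" for r and w :: space
 define F' where "F' r w = - (r *\<^sub>R pd Time ?E (t - r) (x + r *\<^sub>R w)) + 2 * X r w + r *\<^sub>R Q r w" for r w
 have dX: "((%r. X r w) has_vector_derivative - (SUM i:UNIV. (w $ i) *\<^sub>R pd Time (pd (Space i) phi) (t - r) (x + r *\<^sub>R w)) + Q r w) (at r)" for r w
 proof -
  have "((%r. X r w) has_vector_derivative (SUM i:UNIV. (w $ i) *\<^sub>R (- pd Time (pd (Space i) phi) (t - r) (x + r *\<^sub>R w) + (SUM k:UNIV. (w $ k) *\<^sub>R pd (Space k) (pd (Space i) phi) (t - r) (x + r *\<^sub>R w))))) (at r)"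
   unfolding X_def by (intro has_vector_derivative_sum bounded_linear.has_vector_derivative[OF bounded_linear_scaleR_right] cone_chain s1)
  then show ?thesis
   unfolding Q_def by (simp add: scaleR_add_right scaleR_diff_right sum.distrib sum_subtractf scaleR_sum_right sum_negf)
 qed
 have deriv: "((%r. F r w) has_vector_derivative F' r w) (at r)" for r w
 proof -
  have a: "((%r. r *\<^sub>R pd Time phi (t - r) (x + r *\<^sub>R w)) has_vector_derivative
    r *\<^sub>R (- pd Time ?E (t - r) (x + r *\<^sub>R w) + (SUM k:UNIV. (w $ k) *\<^sub>R pd (Space k) ?E (t - r) (x + r *\<^sub>R w)))
    + 1 *\<^sub>R pd Time phi (t - r) (x + r *\<^sub>R w)) (at r)"
   by (rule has_vector_derivative_scaleR[OF DERIV_ident cone_chain[OF s1]])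
  have b: "((%r. r *\<^sub>R X r w) has_vector_derivative
   r *\<^sub>R (- (SUM i:UNIV. (w $ i) *\<^sub>R pd Time (pd (Space i) phi) (t - r) (x + r *\<^sub>R w)) + Q r w) + 1 *\<^sub>R X r w) (at r)"
   by (rule has_vector_derivative_scaleR[OF DERIV_ident dX])
  have "((%r. F r w) has_vector_derivative (r *\<^sub>R (- pd Time ?E (t - r) (x + r *\<^sub>R w) + (SUM k:UNIV. (w $ k) *\<^sub>R pd (Space k) ?E (t - r) (x + r *\<^sub>R w)))
    + 1 *\<^sub>R pd Time phi (t - r) (x + r *\<^sub>R w)) + (- pd Time phi (t - r) (x + r *\<^sub>R w) + X r w) +
    (r *\<^sub>R (- (SUM i:UNIV. (w $ i) *\<^sub>R pd Time (pd (Space i) phi) (t - r) (x + r *\<^sub>R w)) + Q r w) + 1 *\<^sub>R X r w)) (at r)"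
   using has_vector_derivative_add[OF has_vector_derivative_add[OF a cone_chain[OF s0]] b]
   unfolding F_def X_def .
  \<comment> \<open>The mixed space-time derivatives of the first and the last term of
    \<open>F\<close> cancel, and so do the first time derivatives.\<close>
  moreover have cm: "pd Time (pd (Space i) phi) = pd (Space i) ?E" for i
   by (rule pd_commute[OF C])
  ultimately show ?thesis
   unfolding F'_def cm by (simp add: algebra_simps scaleR_add_right)
 qed
 have cF': "continuous_on UNIV (%(r, w). F' r w)"
  unfolding F'_def X_def Q_def case_prod_beta
  by (intro continuous_intros cone_continuous[OF c1] cone_continuous[OF c2])
 have slice: "continuous_on A (%w. F' r w)" "continuous_on B (%r. F' r w)" for A B r w
 proof -
  have p: "continuous_on A (%w. (r, w))" "continuous_on B (%r. (r, w))"
   by (intro continuous_intros)+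
  show "continuous_on A (%w. F' r w)" "continuous_on B (%r. F' r w)"
   using continuous_on_compose2[OF cF' p(1)] continuous_on_compose2[OF cF' p(2)] by simp_all
 qed
 obtain C0 where C0: "!!r w. r : {0..t} ==> norm w = 1 ==> norm (F' r w) <= C0"
  using sphere_uniform_bound[OF cF'] by metis
 have cF: "continuous_on UNIV (F r)" for r
  unfolding F_def
  by (intro continuous_intros continuous_on_compose2[OF C_k_continuous_slice[OF C]] continuous_on_compose2[OF C_k_continuous_slice[OF c1]]) auto
 have zero: "(LINT w|sphere_measure. F' r w) = 0" for r
 proof -
  define D where "D w = (SUM i:UNIV. pd (Space i) (pd (Space i) phi) (t - r) (x + r *\<^sub>R w))" for w
  have V: "has_gradient (%y. pd (Space i) phi (t - r) (x + y)) (%k y. pd (Space k) (pd (Space i) phi) (t - r) (x + y))" for i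
   by (intro has_gradient_translate C_k_has_gradient c1)
  have cc: "continuous_on UNIV (%w. pd nu (pd mu phi) (t - r) (x + r *\<^sub>R w))" "continuous_on UNIV (%w. pd mu phi (t - r) (x + r *\<^sub>R w))" for mu nu
   by (auto intro!: continuous_on_compose2[OF C_k_continuous_slice[OF c2]] continuous_on_compose2[OF C_k_continuous_slice[OF c1]] continuous_intros)
  have i: "?H (%w. - (r *\<^sub>R pd Time ?E (t - r) (x + r *\<^sub>R w)))" 
   "?H (X r)" "?H (Q r)" "?H D"
   unfolding X_def Q_def D_def by (auto intro!: sphere_integrable continuous_intros cc)
  have div: "(LINT w|sphere_measure. r *\<^sub>R (D w - Q r w)) = 2 * (LINT w|sphere_measure. X r w)"
   using sphere_divergence[OF V, of r] by (simp add: D_def Q_def X_def)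
  have "(LINT w|sphere_measure. F' r w) = (LINT w|sphere_measure. - (r *\<^sub>R pd Time ?E (t - r) (x + r *\<^sub>R w)))
   + 2 * (LINT w|sphere_measure. X r w) + r *\<^sub>R (LINT w|sphere_measure. Q r w)"
   unfolding F'_def using i by simp
  also have "... = (LINT w|sphere_measure. - (r *\<^sub>R pd Time ?E (t - r) (x + r *\<^sub>R w)) + r *\<^sub>R D w)"
   unfolding div[symmetric] using i by (simp add: scaleR_diff_right)
  also have "... = (LINT w|sphere_measure. r *\<^sub>R box phi (t - r) (x + r *\<^sub>R w))"
   by (simp add: D_def box_def scaleR_diff_right)
  also have "... = 0" by (simp add: box)
  finally show ?thesis .
 qed
 have "(LINT w|sphere_measure. F t w) - ?I = (LBINT r:{0..t}. (LINT w|sphere_measure. F' r w))"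
 proof (rule sphere.integral_FTC_param[OF t])
  show "((%r. F r w) has_vector_derivative F' r w) (at r within {0..t})" for r w
   by (rule has_vector_derivative_at_within[OF deriv])
  show "continuous_on {0..t} (%r. F' r w)" for w by (rule slice)
  show "(%(r, w). F' r w) : borel_measurable ?G"
  proof -
   have "sets ?G = sets (borel \<Otimes>\<^sub>M borel :: (real \<times> space) measure)"
    by (intro sets_pair_measure_cong) simp_all
   then have "borel_measurable ?G = (borel_measurable borel :: (real \<times> space => complex) set)"
    unfolding borel_prod by (intro measurable_cong_sets refl)
   then show ?thesis
    using borel_measurable_continuous_onI[OF cF'] by (simp only:)
  qed
  show "(\<integral>\<^sup>+w. norm (F' r w) \<partial>sphere_measure) <= ennreal (C0 * (4 * pi))" if "r : {0..t}" for r
   by (rule sphere_nn_bound) (rule C0[OF that])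
 qed (intro sphere_integrable cF)+
 also have "... = 0" by (simp add: zero)
 finally have "?I = (LINT w|sphere_measure. F t w)" by simp
 moreover have "?I = (4 * pi) *\<^sub>R phi t x"
  by (simp add: F_def measure_def emeasure_sphere_measure)
 ultimately show ?thesis by (simp add: F_def)
qed

section \<open>Plane waves and the projection of the sphere to a line\<close>

lemma plane_wave_smooth1:
 assumes "!!s. (q has_vector_derivative q' s) (at s)"
 shows "smooth1 (%t x. q (al * t + e \<bullet> x) :: complex)"
  and "pd mu (%t x. q (al * t + e \<bullet> x)) = (%t x. (case mu of Time => al | Space i => e $ i) *\<^sub>R q' (al * t + e \<bullet> x))"
proof -
 let ?B = "case mu of Time => al | Space i => e $ i"
 let ?A = "%t x. q (al * t + e \<bullet> x)"
 have d: "((%(t, x). q (al * t + e \<bullet> x)) has_derivative (%p. (al * fst p + e \<bullet> snd p) *\<^sub>R q' (al * t + e \<bullet> x))) (at (t, x))" for t x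
  unfolding case_prod_beta
  by (rule has_derivative_compose[where g = q and f = "%p. al * fst p + e \<bullet> snd p"])
   (use assms in \<open>auto intro!: derivative_eq_intros simp: has_vector_derivative_def\<close>)
 then show s: "smooth1 ?A"
  unfolding smooth1_def differentiable_on_def differentiable_def by auto
 show "pd mu ?A = (%t x. ?B *\<^sub>R q' (al * t + e \<bullet> x))"
 proof (intro ext)
  fix t x
  have "(%p. (al * fst p + e \<bullet> snd p) *\<^sub>R q' (al * t + e \<bullet> x)) =
   (%p. SUM nu:UNIV. coord_fn nu (fst p) (snd p) *\<^sub>R pd nu ?A t x)"
   by (rule has_derivative_unique[OF d smooth1_has_derivative[OF s]])
  from fun_cong[OF this, of "coord_dir mu"]
  show "pd mu ?A t x = ?B *\<^sub>R q' (al * t + e \<bullet> x)"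
   by (cases mu) (simp_all add: sum_coord axis_def inner_axis[unfolded axis_def] if_distrib[of "%z. z *\<^sub>R _"] cong: if_cong)
 qed
qed

text \<open>Kirchhoff's formula at x = 0 for the difference q(t + e.x) - q(-t + e.x) of two plane
  waves, whose data are 0 and 2 q'(e.x). The content is Archimedes' hat-box theorem: the area of the
  sphere projects to a uniform measure on a diameter.\<close>

lemma archimedes:
 fixes q q' q'' :: "real => complex" and e :: space
 assumes q: "!!s. (q has_vector_derivative q' s) (at s)" "!!s. (q' has_vector_derivative q'' s) (at s)"
  and c: "continuous_on UNIV q''" and e: "norm e = 1" and r: "r > 0"
 shows "(LINT w|sphere_measure. q' (r * (e \<bullet> w))) = (2 * pi / r) *\<^sub>R (q r - q (- r))"
proof -
 let ?A = "LINT w|sphere_measure. (2 * r) *\<^sub>R q' (r * (e \<bullet> w))"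
 define phi :: field where "phi = (%t x. q (1 * t + e \<bullet> x) + (-1) * q (-1 * t + e \<bullet> x))"
 note pw = plane_wave_smooth1[OF q(1)] plane_wave_smooth1[OF q(2)]
 have pd1: "pd mu phi = (%t x. (case mu of Time => 1 | Space i => e $ i) *\<^sub>R q' (1 * t + e \<bullet> x) + (-1) * ((case mu of Time => -1 | Space i => e $ i) *\<^sub>R q' (-1 * t + e \<bullet> x)))" for mu
  unfolding phi_def by (simp only: pd_add[OF pw(1) smooth1_cmult[OF pw(1)]] pd_cmult[OF pw(1)] pw(2))
 have sm: "smooth1 (%t x. a *\<^sub>R q' (al * t + e \<bullet> x))" and sp: "pd mu (%t x. a *\<^sub>R q' (al * t + e \<bullet> x)) = (%t x. a *\<^sub>R ((case mu of Time => al | Space i => e $ i) *\<^sub>R q'' (al * t + e \<bullet> x)))" for a al mu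
  using smooth1_cmult[OF pw(3), of "of_real a"] pd_cmult[OF pw(3), of mu "of_real a"] by (simp_all add: scaleR_conv_of_real pw(4))
 have pd2: "pd nu (pd mu phi) = (%t x. (case mu of Time => 1 | Space i => e $ i) *\<^sub>R ((case nu of Time => 1 | Space i => e $ i) *\<^sub>R q'' (1 * t + e \<bullet> x)) + (-1) * ((case mu of Time => -1 | Space i => e $ i) *\<^sub>R ((case nu of Time => -1 | Space i => e $ i) *\<^sub>R q'' (-1 * t + e \<bullet> x))))" for mu nu
  unfolding pd1 by (simp only: pd_add[OF sm smooth1_cmult[OF sm]] pd_cmult[OF sm] sp)
 have C: "C_k 2 phi"
 proof -
  have "smooth1 phi" unfolding phi_def by (intro smooth1_add smooth1_cmult pw)
  moreover have "smooth1 (pd mu phi)" for mu unfolding pd1 by (intro smooth1_add smooth1_cmult sm)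
  moreover have "C_k 0 (pd nu (pd mu phi))" for mu nu
   unfolding pd2 C_k.simps(1) case_prod_beta by (intro continuous_intros continuous_on_compose2[OF c]) auto
  ultimately show ?thesis by (simp add: numeral_2_eq_2 C_k_Suc_iff)
 qed
 have e2: "(SUM i:UNIV. (e $ i) * (e $ i)) = 1"
  using e by (simp add: norm_eq_1 inner_vec_def)
 have box: "box phi t x = 0" for t x
 proof -
  have "(SUM i:UNIV. (e $ i) *\<^sub>R (e $ i) *\<^sub>R z) = z" for z :: complex
   by (simp add: scaleR_sum_left[symmetric] e2)
  note z = this
  show ?thesis
   unfolding box_def pd2 coord.case sum.distrib sum_distrib_left[symmetric] z by simp
 qed
 have "(4 * pi) *\<^sub>R phi r 0 = ?A"
 proof -
  have 1: "pd Time phi 0 y = 2 * q' (e \<bullet> y)" "phi 0 y = 0" "pd (Space i) phi 0 y = 0" for y i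
   by (simp_all add: pd1) (simp add: phi_def)
  have "(4 * pi) *\<^sub>R phi r 0 = (LINT w|sphere_measure. r *\<^sub>R pd Time phi 0 (0 + r *\<^sub>R w) + phi 0 (0 + r *\<^sub>R w)
   + r *\<^sub>R (SUM i:UNIV. (w $ i) *\<^sub>R pd (Space i) phi 0 (0 + r *\<^sub>R w)))"
   by (rule kirchhoff[OF C box]) (use r in simp)
  also have "... = ?A"
  proof -
   have "r *\<^sub>R (2 * z) = (2 * r) *\<^sub>R z" for z :: complex
    by (simp add: scaleR_conv_of_real)
   then show ?thesis unfolding 1 by simp
  qed
  finally show ?thesis .
 qed
 then have "(2 * r) *\<^sub>R (LINT w|sphere_measure. q' (r * (e \<bullet> w))) = (4 * pi) *\<^sub>R (q r - q (- r))"
  by (simp add: phi_def)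
 then have "(1 / (2 * r)) *\<^sub>R ((2 * r) *\<^sub>R (LINT w|sphere_measure. q' (r * (e \<bullet> w)))) = (1 / (2 * r)) *\<^sub>R ((4 * pi) *\<^sub>R (q r - q (- r)))"
  by simp
 then show ?thesis using r by (simp add: scaleR_diff_right field_simps)
qed

text \<open>On each ray the value at distance r is at most the average of |u| over [r, r + 1] plus
  the integral of the partial derivatives there. Since r^2 <= s^2 on this segment, the weight is
  dominated by the density of polar coordinates centred at x, and an integral over space
  results.\<close>

lemma sphere_trace:
 assumes u: "has_gradient u Du" and r: "r > 0"
 shows "ennreal (r^2) * (\<integral>\<^sup>+w. norm (u (x + r *\<^sub>R w)) \<partial>sphere_measure) <= L1_norm u + (SUM i:UNIV. L1_norm (Du i))"
proof -
 let ?D = "indicator {r..r+1}"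
 let ?C = "ennreal (r^2)"
 let ?B = "integral {r..r+1}"
 note cont = has_gradient_continuous[OF u]
 have [measurable]: "u : borel_measurable borel" "Du i : borel_measurable borel" for i
  by (intro borel_measurable_continuous_onI cont)+
 define G where "G y = norm (u y) + (SUM i:UNIV. norm (Du i y))" for y
 have [measurable]: "G : borel_measurable borel" unfolding G_def by simp
 have G0: "G y >= 0" for y by (simp add: G_def sum_nonneg)
 have ray: "ennreal (norm (u (x + r *\<^sub>R w))) <= (\<integral>\<^sup>+s. ennreal (G (x + s *\<^sub>R w)) * ?D s \<partial>lborel)" if w: "norm w = 1" for w
 proof -
  define g where "g s = (SUM i:UNIV. norm (Du i (x + s *\<^sub>R w)))" for s
  have cg: "continuous_on A g" for A
   unfolding g_def by (intro continuous_intros continuous_on_compose2[OF cont(2)]) auto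
  have cu: "continuous_on A (%s. u (x + s *\<^sub>R w))" for A
   by (intro continuous_on_compose2[OF cont(1)] continuous_intros) auto
  have cD: "continuous_on A (%s. SUM i:UNIV. (w $ i) *\<^sub>R Du i (x + s *\<^sub>R w))" for A
   by (intro continuous_intros continuous_on_compose2[OF cont(2)]) auto
  have d: "((%s. u (x + s *\<^sub>R w)) has_vector_derivative (SUM i:UNIV. (w $ i) *\<^sub>R Du i (x + s *\<^sub>R w))) (at s)" for s
   by (rule has_gradient_chain[OF u]) (auto intro!: derivative_eq_intros)
  have le: "norm (u (x + r *\<^sub>R w)) <= norm (u (x + s *\<^sub>R w)) + ?B g" if s: "s : {r..r+1}" for s
  proof -
   have I: "((%s. SUM i:UNIV. (w $ i) *\<^sub>R Du i (x + s *\<^sub>R w)) has_integral u (x + s *\<^sub>R w) - u (x + r *\<^sub>R w)) {r..s}"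
    by (rule fundamental_theorem_of_calculus) (use s in \<open>auto intro: has_vector_derivative_at_within[OF d]\<close>)
   have "norm (integral {r..s} (%s. SUM i:UNIV. (w $ i) *\<^sub>R Du i (x + s *\<^sub>R w))) <= integral {r..s} g"
   proof (rule integral_norm_bound_integral)
    show "norm (SUM i:UNIV. (w $ i) *\<^sub>R Du i (x + s *\<^sub>R w)) <= g s" for s
    proof -
     have "\<bar>w $ i\<bar> * norm (Du i (x + s *\<^sub>R w)) <= 1 * norm (Du i (x + s *\<^sub>R w))" for i
      using component_le_norm_cart[of w i] w by (intro mult_right_mono) auto
     then show ?thesis unfolding g_def by (intro sum_norm_le) simp
    qed
   qed (auto intro!: integrable_continuous_interval cg cD)
   also have "... <= ?B g"
    using s by (intro integral_subset_le) (auto intro!: integrable_continuous_interval cg simp: g_def sum_nonneg)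
   finally have "norm (u (x + s *\<^sub>R w) - u (x + r *\<^sub>R w)) <= ?B g"
    using I by (simp add: integral_unique)
   then show ?thesis
    using norm_triangle_ineq3[of "u (x + s *\<^sub>R w)" "u (x + r *\<^sub>R w)"] by linarith
  qed
  have "norm (u (x + r *\<^sub>R w)) = ?B (%s. norm (u (x + r *\<^sub>R w)))" by simp
  also have "... <= ?B (%s. norm (u (x + s *\<^sub>R w)) + ?B g)"
   by (intro integral_le integrable_continuous_interval continuous_intros cu le) auto
  also have "... = ?B (%s. norm (u (x + s *\<^sub>R w))) + ?B g"
   by (subst Henstock_Kurzweil_Integration.integral_add) (auto intro!: integrable_continuous_interval continuous_intros cu)
  also have "... = ?B (%s. G (x + s *\<^sub>R w))"
   unfolding G_def g_def[symmetric]
   by (subst Henstock_Kurzweil_Integration.integral_add) (auto intro!: integrable_continuous_interval continuous_intros cu cg)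
  finally have "ennreal (norm (u (x + r *\<^sub>R w))) <= ennreal (?B (%s. G (x + s *\<^sub>R w)))"
   by (rule ennreal_leI)
  also have "... = (\<integral>\<^sup>+s\<in>{r..r+1}. ennreal (G (x + s *\<^sub>R w)) \<partial>lborel)"
  proof (rule set_nn_integral_lborel_eq_integral[symmetric])
   show "set_borel_measurable borel {r..r + 1} (%s. G (x + s *\<^sub>R w))"
    unfolding set_borel_measurable_def by measurable
   show "!!s. s : {r..r + 1} ==> 0 <= G (x + s *\<^sub>R w)" by (rule G0)
   have "continuous_on {r..r+1} (%s. G (x + s *\<^sub>R w))"
    unfolding G_def g_def[symmetric] by (intro continuous_intros cu cg)
   then have "set_integrable lborel {r..r+1} (%s. G (x + s *\<^sub>R w))"
    by (rule borel_integrable_atLeastAtMost')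
   then have "integrable lborel (%s. ?D s *\<^sub>R G (x + s *\<^sub>R w))"
    by (simp add: set_integrable_def)
   then have "(\<integral>\<^sup>+s. ennreal (norm (?D s *\<^sub>R G (x + s *\<^sub>R w))) \<partial>lborel) < \<infinity>"
    unfolding integrable_iff_bounded by simp
   also have "(\<integral>\<^sup>+s. ennreal (norm (?D s *\<^sub>R G (x + s *\<^sub>R w))) \<partial>lborel) = (\<integral>\<^sup>+s\<in>{r..r+1}. ennreal (G (x + s *\<^sub>R w)) \<partial>lborel)"
    by (intro nn_integral_cong) (auto split: split_indicator simp: G0)
   finally show "(\<integral>\<^sup>+s\<in>{r..r + 1}. ennreal (G (x + s *\<^sub>R w)) \<partial>lborel) < \<infinity>" .
  qed
  finally show ?thesis .
 qed
 have "?C * (\<integral>\<^sup>+w. norm (u (x + r *\<^sub>R w)) \<partial>sphere_measure)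
   = (\<integral>\<^sup>+w. ?C * norm (u (x + r *\<^sub>R w)) \<partial>sphere_measure)"
  by (subst nn_integral_cmult) auto
 also have "... <= (\<integral>\<^sup>+w. \<integral>\<^sup>+s. ennreal (G (x + s *\<^sub>R w)) \<partial>radial_measure \<partial>sphere_measure)"
 proof (rule nn_integral_mono_AE, rule eventually_mono[OF AE_sphere_measure])
  fix w :: space assume w: "norm w = 1"
  have "?C * ennreal (norm (u (x + r *\<^sub>R w))) <= ?C * (\<integral>\<^sup>+s. ennreal (G (x + s *\<^sub>R w)) * ?D s \<partial>lborel)"
   by (intro mult_left_mono ray w) auto
  also have "... = (\<integral>\<^sup>+s. ?C * (ennreal (G (x + s *\<^sub>R w)) * ?D s) \<partial>lborel)"
   by (subst nn_integral_cmult) auto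
  also have "... <= (\<integral>\<^sup>+s. ennreal (s^2) * indicator {0<..} s * ennreal (G (x + s *\<^sub>R w)) \<partial>lborel)"
  proof (rule nn_integral_mono)
   fix s :: real
   show "?C * (ennreal (G (x + s *\<^sub>R w)) * ?D s) <= ennreal (s^2) * indicator {0<..} s * ennreal (G (x + s *\<^sub>R w))"
    using r by (cases "s : {r..r+1}") (auto intro!: mult_right_mono ennreal_leI power_mono)
  qed
  also have "... = (\<integral>\<^sup>+s. ennreal (G (x + s *\<^sub>R w)) \<partial>radial_measure)"
   by (subst nn_integral_radial_measure) auto
  finally show "?C * ennreal (norm (u (x + r *\<^sub>R w))) <= (\<integral>\<^sup>+s. ennreal (G (x + s *\<^sub>R w)) \<partial>radial_measure)" .
 qed
 also have "... = (\<integral>\<^sup>+y. ennreal (G (x + y)) \<partial>lborel)"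
  by (rule nn_integral_polar[symmetric]) simp
 also have "... = (\<integral>\<^sup>+y. ennreal (G y) \<partial>lborel)"
  using nn_integral_lborel_translate[of "%y. ennreal (G y)" x] by (simp add: add.commute)
 also have "... = (\<integral>\<^sup>+y. ennreal (norm (u y)) + (SUM i:UNIV. ennreal (norm (Du i y))) \<partial>lborel)"
  unfolding G_def by (intro nn_integral_cong) (simp add: ennreal_plus sum_nonneg)
 also have "... = L1_norm u + (SUM i:UNIV. L1_norm (Du i))"
  unfolding L1_norm_def by (subst nn_integral_add) (simp_all add: nn_integral_sum del: sum_ennreal)
 finally show ?thesis .
qed

lemma L1_norm_add: 
 assumes [measurable]: "u : borel_measurable borel" "v : borel_measurable borel"
 shows "L1_norm (%x. u x + v x) <= L1_norm u + L1_norm (v :: space => complex)"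
proof -
 have "L1_norm (%x. u x + v x) <= (\<integral>\<^sup>+x. ennreal (norm (u x)) + ennreal (norm (v x)) \<partial>lborel)"
  unfolding L1_norm_def
  by (rule nn_integral_mono, rule order_trans[OF ennreal_leI[OF norm_triangle_ineq]]) simp
 then show ?thesis by (simp add: L1_norm_def nn_integral_add)
qed

lemma L1_norm_sum: 
 assumes m: "!!i. i : I ==> u i : borel_measurable borel" and I: "finite I"
 shows "L1_norm (%x. SUM i:I. u i x) <= (SUM i:I. L1_norm (u i :: space => complex))"
 using I m
proof (induction I rule: finite_induct)
 case empty
 then show ?case by (simp add: L1_norm_def)
next
 case (insert i I)
 have "L1_norm (%x. SUM i:insert i I. u i x) = L1_norm (%x. u i x + (SUM i:I. u i x))"
  using insert by simp
 also have "... <= L1_norm (u i) + L1_norm (%x. SUM i:I. u i x)"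
  using insert by (intro L1_norm_add) auto
 also have "... <= L1_norm (u i) + (SUM i:I. L1_norm (u i))"
  using insert by (intro add_left_mono) auto
 finally show ?case using insert by simp
qed

lemma box_pd:
 assumes C: "C_k 3 phi"
 shows "box (pd mu phi) = pd mu (box phi)"
proof -
 let ?A = "%t x. (-1) * pd Time (pd Time phi) t x + (SUM i:UNIV. pd (Space i) (pd (Space i) phi) t x)"
 have c2: "C_k 2 phi" "!!mu. C_k 2 (pd mu phi)" 
  using C by (auto intro: C_k_mono simp: numeral_3_eq_3 numeral_2_eq_2 C_k_pd)
 have s: "smooth1 (pd nu (pd nu phi))" for nu
  using c2(2)[of nu] by (auto simp: numeral_2_eq_2 C_k_Suc_iff)
 have 1: "pd nu (pd nu (pd mu phi)) = pd mu (pd nu (pd nu phi))" for nu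
  by (simp only: pd_commute[OF c2(1), of nu mu] pd_commute[OF c2(2), of nu mu])
 have 2: "box phi = ?A"
  by (auto simp: box_def fun_eq_iff)
 have 3: "pd mu ?A = (%t x. (-1) * pd mu (pd Time (pd Time phi)) t x + (SUM i:UNIV. pd mu (pd (Space i) (pd (Space i) phi)) t x))"
  by (subst pd_add; (subst pd_cmult)?; (subst pd_sum)?; intro smooth1_cmult smooth1_sum s refl finite)
 show ?thesis unfolding 2 3 by (simp add: box_def fun_eq_iff 1)
qed

lemma norm_grad_le: "norm (grad phi t x) <= (SUM mu:UNIV. norm (pd mu phi t x))"
 unfolding grad_def norm_vec_def by (rule order_trans[OF L2_set_le_sum]) auto

lemma card_coord: "CARD(coord) = 4"
proof -
 have "card (insert Time (range Space)) = Suc (card (range Space))"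
  by (rule card_insert_disjoint) auto
 also have "card (range Space) = CARD(3)"
  by (rule card_image) (simp add: inj_def)
 finally show ?thesis by (simp add: UNIV_coord)
qed

text \<open>In \<open>kirchhoff\<close> the data carry at most one factor t, while
  \<open>sphere_trace\<close> gains t^(-2). The undifferentiated data, which come without the factor
  t, are included by t >= 1.\<close>

lemma wave_L1_decay:
 assumes C: "C_k 3 psi" and box: "box psi = (%t x. 0)" and t: "t >= 1"
  and N: "L1_norm (psi 0) <= K" "!!i. L1_norm (pd (Space i) psi 0) <= K"
    "!!i j. L1_norm (pd (Space i) (pd (Space j) psi) 0) <= K"
    "L1_norm (pd Time psi 0) <= K" "!!i. L1_norm (pd (Space i) (pd Time psi) 0) <= K"
 shows "ennreal (norm (psi t x)) <= ennreal (20 / t) * K"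
proof -
 have C2: "C_k 2 psi" "C_k 1 psi" "!!mu. C_k 1 (pd mu psi)"
  using C_k_mono[OF C, of 2] C_k_mono[OF C, of 1] C_k_mono[of 2 "pd mu psi" 1 for mu] C
  by (simp_all add: numeral_3_eq_3 numeral_2_eq_2 C_k_pd)
 define T where "T u = (\<integral>\<^sup>+w. norm (u (x + t *\<^sub>R w)) \<partial>sphere_measure)" for u :: "space => complex"
 have tr: "T u <= ennreal (1 / t^2) * (4 * K)" if u: "has_gradient u Du" and k: "L1_norm u <= K" "!!i. L1_norm (Du i) <= K" for u Du
 proof -
  have "ennreal (t^2) * T u <= L1_norm u + (SUM i:UNIV. L1_norm (Du i))"
   unfolding T_def by (rule sphere_trace[OF u]) (use t in simp)
  also have "... <= K + (SUM i:(UNIV::3 set). K)"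
   by (intro add_mono k sum_mono)
  also have "... = 4 * K"
   by (simp add: distrib_right[of 1 3 K, simplified, symmetric])
  finally have "ennreal (1 / t^2) * (ennreal (t^2) * T u) <= ennreal (1 / t^2) * (4 * K)"
   by (rule mult_left_mono) simp
  moreover have "ennreal (1 / t^2) * (ennreal (t^2) * T u) = T u"
   using t by (simp add: mult.assoc[symmetric] ennreal_mult[symmetric])
  ultimately show ?thesis by simp
 qed
 have g: "has_gradient (pd mu psi 0) (%i. pd (Space i) (pd mu psi) 0)" "has_gradient (psi 0) (%i. pd (Space i) psi 0)" for mu
  by (intro C_k_has_gradient C2)+
 have m: "pd mu psi 0 : borel_measurable borel" "psi 0 : borel_measurable borel" for mu
  by (intro borel_measurable_continuous_onI has_gradient_continuous(1)[OF g(1)] has_gradient_continuous(1)[OF g(2)])+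
 note [measurable] = m
 have "ennreal (4 * pi) * ennreal (norm (psi t x)) = ennreal (norm ((4 * pi) *\<^sub>R psi t x))"
  by (simp add: ennreal_mult[symmetric])
 also have "... = ennreal (norm (LINT w|sphere_measure. t *\<^sub>R pd Time psi 0 (x + t *\<^sub>R w) + psi 0 (x + t *\<^sub>R w)
   + t *\<^sub>R (SUM i:UNIV. (w $ i) *\<^sub>R pd (Space i) psi 0 (x + t *\<^sub>R w))))"
  by (subst kirchhoff[OF C2(1)]) (use t box in auto)
 also have "... <= (\<integral>\<^sup>+w. norm (t *\<^sub>R pd Time psi 0 (x + t *\<^sub>R w) + psi 0 (x + t *\<^sub>R w)
   + t *\<^sub>R (SUM i:UNIV. (w $ i) *\<^sub>R pd (Space i) psi 0 (x + t *\<^sub>R w))) \<partial>sphere_measure)"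
  by (rule integral_norm_bound_ennreal) 
    (auto intro!: sphere_integrable continuous_intros continuous_on_compose2[OF has_gradient_continuous(1)[OF g(1)]] continuous_on_compose2[OF has_gradient_continuous(1)[OF g(2)]])
 also have "... <= (\<integral>\<^sup>+w. ennreal t * norm (pd Time psi 0 (x + t *\<^sub>R w)) + norm (psi 0 (x + t *\<^sub>R w))
   + ennreal t * (SUM i:UNIV. ennreal (norm (pd (Space i) psi 0 (x + t *\<^sub>R w)))) \<partial>sphere_measure)"
 proof (rule nn_integral_mono_AE, rule eventually_mono[OF AE_sphere_measure])
  fix w :: space assume w: "norm w = 1"
  have "norm ((w $ i) *\<^sub>R z) <= norm z" for i and z :: complex
   using component_le_norm_cart[of w i] w mult_right_mono[of "\<bar>w $ i\<bar>" 1 "norm z"] by simp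
  then have 1: "norm (SUM i:UNIV. (w $ i) *\<^sub>R pd (Space i) psi 0 (x + t *\<^sub>R w)) <= (SUM i:UNIV. norm (pd (Space i) psi 0 (x + t *\<^sub>R w)))"
   by (intro sum_norm_le) simp
  have "norm (t *\<^sub>R pd Time psi 0 (x + t *\<^sub>R w) + psi 0 (x + t *\<^sub>R w) + t *\<^sub>R (SUM i:UNIV. (w $ i) *\<^sub>R pd (Space i) psi 0 (x + t *\<^sub>R w)))
    <= norm (t *\<^sub>R pd Time psi 0 (x + t *\<^sub>R w)) + norm (psi 0 (x + t *\<^sub>R w)) + norm (t *\<^sub>R (SUM i:UNIV. (w $ i) *\<^sub>R pd (Space i) psi 0 (x + t *\<^sub>R w)))"
   by (intro norm_triangle_mono order_refl)
  also have "... <= t * norm (pd Time psi 0 (x + t *\<^sub>R w)) + norm (psi 0 (x + t *\<^sub>R w)) + t * (SUM i:UNIV. norm (pd (Space i) psi 0 (x + t *\<^sub>R w)))"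
   using t 1 by (simp add: mult_left_mono)
  finally show "ennreal (norm (t *\<^sub>R pd Time psi 0 (x + t *\<^sub>R w) + psi 0 (x + t *\<^sub>R w) + t *\<^sub>R (SUM i:UNIV. (w $ i) *\<^sub>R pd (Space i) psi 0 (x + t *\<^sub>R w))))
   <= ennreal t * norm (pd Time psi 0 (x + t *\<^sub>R w)) + norm (psi 0 (x + t *\<^sub>R w)) + ennreal t * (SUM i:UNIV. ennreal (norm (pd (Space i) psi 0 (x + t *\<^sub>R w))))"
   using t by (subst sum_ennreal) (auto simp: ennreal_mult[symmetric] ennreal_plus[symmetric] sum_nonneg simp del: ennreal_plus intro!: ennreal_leI)
 qed
 also have "... = ennreal t * T (pd Time psi 0) + T (psi 0) + ennreal t * (SUM i:UNIV. T (pd (Space i) psi 0))"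
  unfolding T_def by (simp add: nn_integral_add nn_integral_cmult nn_integral_sum del: sum_ennreal)
 also have "... <= ennreal t * (ennreal (1 / t^2) * (4 * K)) + ennreal t * (ennreal (1 / t^2) * (4 * K)) + ennreal t * (SUM i:(UNIV::3 set). ennreal (1 / t^2) * (4 * K))"
 proof (intro add_mono mult_left_mono sum_mono)
  have "T (psi 0) <= ennreal 1 * (ennreal (1 / t^2) * (4 * K))"
   using tr[OF g(2) N(1,2)] by simp
  also have "... <= ennreal t * (ennreal (1 / t^2) * (4 * K))"
   using t by (intro mult_right_mono ennreal_leI) auto
  finally show "T (psi 0) <= ennreal t * (ennreal (1 / t^2) * (4 * K))" .
 qed (auto intro!: tr[OF g(1)] N)
 \<comment> \<open>The 20 is 5 times 4: five spherical integrals (data, time derivative, three space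
   derivatives), each with the four L^1 norms of \<open>sphere_trace\<close>.\<close>
 also have "... = ennreal (20 / t) * K"
 proof -
  have 1: "ennreal t * (ennreal (1 / t^2) * (4 * K)) = ennreal (4 / t) * K"
   using t by (simp add: mult.assoc[symmetric] ennreal_mult[symmetric] ennreal_mult'[symmetric] power2_eq_square flip: ennreal_numeral)
  have 2: "ennreal (20 / t) = ennreal (4 / t) + ennreal (4 / t) + (ennreal (4 / t) + ennreal (4 / t) + ennreal (4 / t))"
   using t by (simp add: ennreal_plus[symmetric] del: ennreal_plus)
  have 3: "(SUM i:(UNIV::3 set). c) = c + c + c" for c :: ennreal
  proof -
   have "(3::ennreal) = 1 + 1 + 1" by simp
   moreover have "(SUM i:(UNIV::3 set). c) = 3 * c" by simp
   ultimately show ?thesis by (simp only: distrib_right mult_1_left)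
  qed
  show ?thesis
   unfolding sum_distrib_left[of "ennreal t"] 1 2 3 by (simp only: distrib_right distrib_left 1 add.assoc)
 qed
 finally have "ennreal (4 * pi) * ennreal (norm (psi t x)) <= ennreal (20 / t) * K" .
 moreover have "ennreal 1 * ennreal (norm (psi t x)) <= ennreal (4 * pi) * ennreal (norm (psi t x))"
  using pi_ge_two by (intro mult_right_mono ennreal_leI) auto
 ultimately show ?thesis by simp
qed

lemma jap_bounds:
 assumes "t >= 1"
 shows "t <= jap t" "jap t <= 2 * t" "jap t > 0"
proof -
 have 1: "1 <= t^2" using assms by (simp add: one_le_power)
 have "(2 * t)^2 = 4 * t^2" by (simp add: power_mult_distrib)
 with 1 have "1 + t^2 <= (2 * t)^2" by linarith
 then show "t <= jap t" "jap t <= 2 * t"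
  using assms unfolding jap_def power2_abs by (auto intro!: real_le_rsqrt real_le_lsqrt)
 then show "jap t > 0" using assms by linarith
qed

text \<open>Every component of \<partial>\<phi> is a free wave, so \<open>wave_L1_decay\<close>
  applies to it. Its data contain \<partial>_t^2 \<phi>, which the equation turns into three pure
  second derivatives of \<open>phi0\<close>; hence 3 N. The constant is 4 components times 20 times
  3, doubled because of \<open>jap t <= 2 * t\<close>.\<close>

lemma homogeneous_decay:
 assumes W: "solves_wave phi (%_ _. 0) phi0 phi1" and t: "t > 1"
 shows "Linf_norm (grad phi t) <= ennreal (480 * jap t powr (-1)) *
  ((SUM w:words 4. L1_norm (foldr data_Gam w phi0)) + (SUM w:words 4. L1_norm (foldr data_Gam w phi1)))"
  (is "_ <= _ * ?N")
proof -
 let ?B = "foldr data_Gam"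
 let ?A = "pd Time (pd Time phi)"
 define N where "N = ?N"
 have C5: "C_k 5 phi" and box: "box phi = (%t x. 0)" and i0: "phi 0 = phi0" and i1: "pd Time phi 0 = phi1"
  using W by (auto simp: solves_wave_def)
 have C4: "C_k 4 (pd mu phi)" and C3: "C_k 3 (pd mu (pd nu phi))" and C2: "C_k 2 (pd mu (pd nu (pd kap phi)))" for mu nu kap
  using C5 by (auto simp: eval_nat_numeral C_k_pd)
 have cm: "pd mu (pd nu phi) = pd nu (pd mu phi)" "pd mu (pd nu (pd kap phi)) = pd nu (pd mu (pd kap phi))" for mu nu kap
  by (intro pd_commute C_k_mono[OF C5] C_k_mono[OF C4]; simp)+
 have mem: "L1_norm (?B w phi0) <= N" "L1_norm (?B w phi1) <= N" if "length w <= 4" for w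
 proof -
  have "w : words 4" using that by (simp add: words_def)
  then have "L1_norm (?B w phi0) <= (SUM w:words 4. L1_norm (?B w phi0))"
   "L1_norm (?B w phi1) <= (SUM w:words 4. L1_norm (?B w phi1))"
   using sum_nonneg_leq_bound[OF finite_words] by (auto intro!: member_le_sum simp: finite_words)
  then show "L1_norm (?B w phi0) <= N" "L1_norm (?B w phi1) <= N"
   unfolding N_def by (auto intro: order_trans simp: add_increasing add_increasing2)
 qed
 have sp: "pd (Space i) psi 0 = spatial_deriv i (psi 0)" for i psi by (simp add: pd.simps)
 have a: "L1_norm phi0 <= N" "L1_norm (spatial_deriv i phi0) <= N" "L1_norm (spatial_deriv i (spatial_deriv j phi0)) <= N"
  "L1_norm (spatial_deriv i (spatial_deriv j (spatial_deriv k phi0))) <= N"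
  "L1_norm phi1 <= N" "L1_norm (spatial_deriv i phi1) <= N" "L1_norm (spatial_deriv i (spatial_deriv j phi1)) <= N" for i j k
  using mem[of "[]"] mem[of "[Transl i]"] mem[of "[Transl i, Transl j]"] mem(1)[of "[Transl i, Transl j, Transl k]"] by simp_all
 have tt: "?A = (%t x. SUM i:UNIV. pd (Space i) (pd (Space i) phi) t x)"
  using box by (auto simp: fun_eq_iff box_def)
 have m: "pd mu (pd nu phi) 0 : borel_measurable borel" "pd mu (pd nu (pd kap phi)) 0 : borel_measurable borel" for mu nu kap
  by (intro borel_measurable_continuous_onI C_k_continuous_slice[OF C3] C_k_continuous_slice[OF C2])+
 have K: "N <= 3 * N" using mult_right_mono[of 1 3 N] by simp
 note a3 = order_trans[OF _ K]
 have bt: "L1_norm (?A 0) <= 3 * N"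
 proof -
  have "L1_norm (?A 0) <= (SUM i:UNIV. L1_norm (pd (Space i) (pd (Space i) phi) 0))"
   unfolding tt by (rule L1_norm_sum) (auto simp: m)
  also have "... <= (SUM i:(UNIV::3 set). N)" by (intro sum_mono) (simp add: sp i0 a)
  finally show ?thesis by simp
 qed
 have bt1: "L1_norm (pd (Space j) ?A 0) <= 3 * N" for j
 proof -
  have eq: "pd (Space j) ?A = (%t x. SUM i:UNIV. pd (Space j) (pd (Space i) (pd (Space i) phi)) t x)"
   unfolding tt by (rule pd_sum) (use C3 in \<open>auto simp: eval_nat_numeral intro: C_k_smooth1\<close>)
  have "L1_norm (pd (Space j) ?A 0) <= (SUM i:UNIV. L1_norm (pd (Space j) (pd (Space i) (pd (Space i) phi)) 0))"
   unfolding eq by (rule L1_norm_sum) (auto simp: m)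
  also have "... <= (SUM i:(UNIV::3 set). N)" by (intro sum_mono) (simp add: sp i0 a)
  finally show ?thesis by simp
 qed
 have pt: "ennreal (norm (pd mu phi t x)) <= ennreal (20 / t) * (3 * N)" for mu x
 proof (rule wave_L1_decay)
  show "C_k 3 (pd mu phi)" using C_k_mono[OF C4] by simp
  show "box (pd mu phi) = (%t x. 0)"
   using box_pd[OF C_k_mono[OF C5, of 3]] box by (simp add: pd_const)
  show "L1_norm (pd mu phi 0) <= 3 * N" by (cases mu) (auto simp: sp i0 i1 intro!: a3 a)
  show "L1_norm (pd (Space i) (pd mu phi) 0) <= 3 * N" for i by (cases mu) (auto simp: sp i0 i1 intro!: a3 a)
  show "L1_norm (pd (Space i) (pd (Space j) (pd mu phi)) 0) <= 3 * N" for i j by (cases mu) (auto simp: sp i0 i1 intro!: a3 a)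
  show "L1_norm (pd Time (pd mu phi) 0) <= 3 * N"
  proof (cases mu)
   case (Space i)
   then show ?thesis by (subst cm) (auto simp: sp i0 i1 intro!: a3 a)
  qed (simp add: bt)
  show "L1_norm (pd (Space i) (pd Time (pd mu phi)) 0) <= 3 * N" for i
  proof (cases mu)
   case (Space j)
   then show ?thesis by (subst cm(1)) (auto simp: sp i0 i1 intro!: a3 a)
  qed (simp add: bt1)
 qed (use t in simp)
 have "ennreal (norm (grad phi t x)) <= ennreal (480 * jap t powr (-1)) * N" for x
 proof -
  have "ennreal (norm (grad phi t x)) <= ennreal (SUM mu:UNIV. norm (pd mu phi t x))"
   by (intro ennreal_leI norm_grad_le)
  also have "... = (SUM mu:UNIV. ennreal (norm (pd mu phi t x)))" by simp
  also have "... <= (SUM mu:(UNIV::coord set). ennreal (20 / t) * (3 * N))" by (intro sum_mono pt)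
  also have "... = ennreal 4 * (ennreal (20 / t) * (ennreal 3 * N))"
   by (simp add: card_coord)
  also have "... = ennreal (240 / t) * N"
  proof -
   have "ennreal 4 * (ennreal (20 / t) * ennreal 3) = ennreal (240 / t)"
    using t by (simp add: ennreal_mult[symmetric] del: ennreal_numeral)
   then show ?thesis by (simp only: mult.assoc[symmetric])
  qed
  also have "... <= ennreal (480 * jap t powr (-1)) * N"
   using jap_bounds[of t] t by (intro mult_right_mono ennreal_leI) (auto simp: powr_minus field_simps)
  finally show ?thesis .
 qed
 then show ?thesis
  unfolding Linf_norm_def N_def[symmetric] by (intro esssup_I AE_I2) 
   (auto simp: grad_def intro!: borel_measurable_continuous_onI continuous_intros C_k_continuous_slice[OF C4])
qed

section \<open>The Fourier transform\<close>

lemma gauss_fourier_1d: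
 "integrable lborel (%x. cis (- (x * t)) * complex_of_real (exp (- x\<^sup>2 / 2)))"
 "(LINT x|lborel. cis (- (x * t)) * complex_of_real (exp (- x\<^sup>2 / 2))) = sqrt (2 * pi) * exp (- t\<^sup>2 / 2)"
proof -
 let ?B = "LINT x|lborel. std_normal_density x *\<^sub>R iexp (- t * x)"
 let ?A = "LINT x|lborel. cis (- (x * t)) * complex_of_real (exp (- x\<^sup>2 / 2))"
 have i0: "integrable lborel (%x. exp (- x\<^sup>2 / 2) :: real)"
 proof -
  have "integrable lborel (%x. sqrt (2 * pi) * std_normal_density x)"
   using integrable_std_normal_moment[of 0] by (intro integrable_mult_right) simp
  then show ?thesis by (simp add: std_normal_density_def)
 qed
 show "integrable lborel (%x. cis (- (x * t)) * complex_of_real (exp (- x\<^sup>2 / 2)))"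
  by (rule Bochner_Integration.integrable_bound[OF i0]) (auto simp: norm_mult cis_conv_exp)
 have "?A
   = (LINT x|lborel. complex_of_real (sqrt (2 * pi)) * (std_normal_density x *\<^sub>R iexp (- t * x)))"
  by (intro Bochner_Integration.integral_cong) (auto simp: std_normal_density_def cis_conv_exp scaleR_conv_of_real mult_ac)
 also have "... = complex_of_real (sqrt (2 * pi)) * ?B"
  by (rule integral_mult_right_zero)
 also have "?B = (LINT x|std_normal_distribution. iexp (- t * x))"
  by (subst integral_density) auto
 also have "(LINT x|std_normal_distribution. iexp (- t * x)) = exp (- t\<^sup>2 / 2)"
  using fun_cong[OF char_std_normal_distribution, of "- t"] by (simp add: char_def)
 finally show "?A = sqrt (2 * pi) * exp (- t\<^sup>2 / 2)"
  by simp
qed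

text \<open>The parameter will tend to 0, and \<open>gauss eta\<close> to 1. It plays two roles: as
  a summation factor in frequency for inversion and Plancherel, and as the cutoff in space.\<close>

definition gauss :: "real => space => real" where
 "gauss eta x = exp (- (eta * norm x)\<^sup>2 / 2)"

lemma gauss_pos: "0 < gauss eta x" and gauss_le_1: "gauss eta x <= 1"
 by (simp_all add: gauss_def)

lemma gauss_borel [measurable]: "gauss eta : borel_measurable borel"
 unfolding gauss_def by measurable

lemma cis_sum: "finite A ==> cis (SUM i:A. f i) = (\<Prod>i\<in>A. cis (f i))"
 by (induction A rule: finite_induct) (auto simp: cis_mult[symmetric])

lemma gauss_fourier_unit:
 "integrable lborel (%x. cis (- (x \<bullet> xi)) * complex_of_real (gauss 1 x))"
 "(LINT x|lborel. cis (- (x \<bullet> xi)) * complex_of_real (gauss 1 x)) = sqrt (2 * pi) ^ 3 * gauss 1 xi"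
proof -
 let ?C = "LINT x|lborel. cis (- (x \<bullet> xi)) * complex_of_real (gauss 1 x)"
 let ?A = "(\<Prod>b\<in>(Basis :: space set). exp (- (xi \<bullet> b)\<^sup>2 / 2))"
 interpret product_sigma_finite "%_::space. lborel :: real measure" by standard
 let ?g = "%b x. cis (- (x * (xi \<bullet> b))) * complex_of_real (exp (- x\<^sup>2 / 2))"
 have eq: "cis (- (x \<bullet> xi)) * complex_of_real (gauss 1 x) = (\<Prod>b\<in>Basis. ?g b (x \<bullet> b))" for x
 proof -
  have "- (x \<bullet> xi) = (SUM b:Basis. - ((x \<bullet> b) * (xi \<bullet> b)))"
   by (subst euclidean_inner) (simp add: sum_negf)
  then have "cis (- (x \<bullet> xi)) = (\<Prod>b\<in>Basis. cis (- ((x \<bullet> b) * (xi \<bullet> b))))"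
   by (simp add: cis_sum)
  moreover have "gauss 1 x = (\<Prod>b\<in>Basis. exp (- (x \<bullet> b)\<^sup>2 / 2))"
  proof -
   have "(norm x)^2 = (SUM b:Basis. (x \<bullet> b)^2)"
    unfolding power2_norm_eq_inner by (subst euclidean_inner) (simp add: power2_eq_square)
   then have "- (1 * norm x)\<^sup>2 / 2 = (SUM b:Basis. - (x \<bullet> b)\<^sup>2 / 2)"
    by (simp add: sum_negf sum_divide_distrib)
   then show ?thesis unfolding gauss_def by (simp only: exp_sum finite_Basis)
  qed
  ultimately show ?thesis by (simp add: prod.distrib)
 qed
 let ?B = "%f::space => real. SUM b:Basis. f b *\<^sub>R b"
 have B: "(\<Prod>b\<in>Basis. ?g b (?B f \<bullet> b)) = (\<Prod>b\<in>Basis. ?g b (f b))" for f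
  by (intro prod.cong refl) simp
 have m: "(%x. \<Prod>b\<in>Basis. ?g b (x \<bullet> b)) : borel_measurable borel"
  by (intro borel_measurable_prod borel_measurable_times borel_measurable_continuous_onI)
   (auto intro!: continuous_intros simp: cis_conv_exp)
 have mB: "?B : measurable (\<Pi>\<^sub>M b\<in>Basis. lborel) borel" by measurable
 show "integrable lborel (%x. cis (- (x \<bullet> xi)) * complex_of_real (gauss 1 x))"
  unfolding eq
  by (subst lborel_eq, subst integrable_distr_eq[OF mB m])
    (simp only: B, rule product_integrable_prod, simp, rule gauss_fourier_1d)
 have "?C = (\<Prod>b\<in>Basis. LINT x|lborel. ?g b x)"
  unfolding eq
  by (subst lborel_eq, subst integral_distr[OF mB m])
    (simp only: B, rule product_integral_prod, simp, rule gauss_fourier_1d)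
 also have "... = (\<Prod>b\<in>(Basis :: space set). sqrt (2 * pi) * exp (- (xi \<bullet> b)\<^sup>2 / 2))"
  unfolding gauss_fourier_1d(2) by simp
 also have "... = sqrt (2 * pi) ^ 3 * ?A"
  by (simp add: prod.distrib)
 also have "?A = gauss 1 xi"
 proof -
  have "(norm xi)^2 = (SUM b:Basis. (xi \<bullet> b)^2)"
   unfolding power2_norm_eq_inner by (subst euclidean_inner) (simp add: power2_eq_square)
  then have "- (1 * norm xi)\<^sup>2 / 2 = (SUM b:Basis. - (xi \<bullet> b)\<^sup>2 / 2)"
   by (simp add: sum_negf sum_divide_distrib)
  then show ?thesis unfolding gauss_def by (simp only: exp_sum finite_Basis)
 qed
 finally show "?C = sqrt (2 * pi) ^ 3 * gauss 1 xi"
  by simp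
qed

text \<open>By \<open>gauss_fourier\<close> this is the Fourier transform of
  \<open>gauss eta\<close> in the unnormalized convention: an approximate identity of total mass (2
  pi)^3 as eta tends to 0.\<close>

definition gauss_kernel :: "real => space => real" where
 "gauss_kernel eta z = sqrt (2 * pi) ^ 3 / eta ^ 3 * gauss (1 / eta) z"

lemma gauss_kernel_borel [measurable]: "gauss_kernel eta : borel_measurable borel"
 unfolding gauss_kernel_def by measurable

lemma gauss_scale: "eta > 0 ==> gauss 1 (eta *\<^sub>R x) = gauss eta x"
 by (simp add: gauss_def)

lemma cis_inner_borel [measurable]: "(%x. cis (x \<bullet> xi)) : borel_measurable borel"
 by (intro borel_measurable_continuous_onI) (auto intro!: continuous_intros simp: cis_conv_exp)

lemma cis_minus_inner_borel [measurable]: "(%x. cis (- (x \<bullet> xi))) : borel_measurable borel"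
 by (intro borel_measurable_continuous_onI) (auto intro!: continuous_intros simp: cis_conv_exp)

lemma gauss_fourier:
 assumes eta: "eta > 0"
 shows "integrable lborel (%x. cis (- (x \<bullet> xi)) * complex_of_real (gauss eta x))"
  and "(LINT x|lborel. cis (- (x \<bullet> xi)) * complex_of_real (gauss eta x)) = gauss_kernel eta xi"
proof -
 let ?A = "LINT x|lborel. cis (- (x \<bullet> xi)) * complex_of_real (gauss eta x)"
 let ?h = "%x. cis (- (x \<bullet> ((1/eta) *\<^sub>R xi))) * complex_of_real (gauss 1 x)"
 have h: "?h (eta *\<^sub>R x) = cis (- (x \<bullet> xi)) * complex_of_real (gauss eta x)" for x
  using eta by (simp add: gauss_scale)
 show "integrable lborel (%x. cis (- (x \<bullet> xi)) * complex_of_real (gauss eta x))"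
  using lborel_integrable_scale[OF gauss_fourier_unit(1)[of "(1/eta) *\<^sub>R xi"] eta] unfolding h .
 have "(LINT x|lborel. ?h x) = eta ^ 3 *\<^sub>R (LINT x|lborel. ?h (eta *\<^sub>R x))"
  by (rule lborel_integral_scale) (use gauss_fourier_unit(1)[of "(1/eta) *\<^sub>R xi"] eta in auto)
 then have "complex_of_real (sqrt (2 * pi) ^ 3 * gauss 1 ((1/eta) *\<^sub>R xi)) = eta ^ 3 *\<^sub>R ?A"
  unfolding gauss_fourier_unit(2) h by simp
 then show "?A = gauss_kernel eta xi"
  using eta gauss_scale[of "1/eta" xi] by (simp add: gauss_kernel_def scaleR_conv_of_real field_simps)
qed

lemma gauss_integrable: "eta > 0 ==> integrable lborel (gauss eta)"
 using gauss_fourier(1)[of eta 0] by (simp add: complex_of_real_integrable_eq)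

lemma gauss_kernel_mass:
 assumes "eta > 0"
 shows "(\<integral>\<^sup>+z. ennreal (gauss_kernel eta z) \<partial>lborel) = ennreal ((2 * pi) ^ 3)"
proof -
 have i: "integrable lborel (gauss_kernel eta)"
  unfolding gauss_kernel_def using assms by (intro integrable_mult_right gauss_integrable) simp
 have "complex_of_real (LINT x|lborel. gauss (1/eta) x) = gauss_kernel (1/eta) 0"
  using gauss_fourier(2)[of "1/eta" 0] assms by simp
 then have "(LINT x|lborel. gauss (1/eta) x) = sqrt (2 * pi) ^ 3 * eta ^ 3"
  by (simp only: of_real_eq_iff) (simp add: gauss_kernel_def gauss_def power_divide)
 then have "(LINT z|lborel. gauss_kernel eta z) = sqrt (2 * pi) ^ 3 * sqrt (2 * pi) ^ 3"
  unfolding gauss_kernel_def using assms by simp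
 also have "... = (2 * pi) ^ 3"
  by (simp add: power_mult_distrib[symmetric])
 finally have "(LINT z|lborel. gauss_kernel eta z) = (2 * pi) ^ 3" .
 moreover have "AE z in lborel. 0 <= gauss_kernel eta z"
  using assms by (auto simp: gauss_kernel_def gauss_pos[THEN less_imp_le])
 ultimately show ?thesis
  by (simp only: nn_integral_eq_integral[OF i])
qed

section \<open>Plancherel bound, derivatives and inversion for integrable functions\<close>

lemma fourier_integrable:
 assumes "integrable lborel g"
 shows "integrable lborel (%x. cis (- (x \<bullet> xi)) * g x)"
 by (rule Bochner_Integration.integrable_bound[OF assms]) (use assms in \<open>auto simp: norm_mult\<close>)

lemma fourier_bound:
 assumes "integrable lborel g"
 shows "norm (fourier g xi) <= (LINT x|lborel. norm (g x))"
proof -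
 have "norm (fourier g xi) <= (LINT x|lborel. norm (cis (- (x \<bullet> xi)) * g x))"
  unfolding fourier_def by (rule integral_norm_bound)
 then show ?thesis by (simp add: norm_mult)
qed

lemma fourier_continuous:
 assumes g: "integrable lborel g"
 shows "continuous_on UNIV (fourier g)"
proof -
 have [measurable]: "g : borel_measurable borel" using g by auto
 have "(%n. fourier g (s n)) \<longlonglongrightarrow> fourier g xi" if s: "s \<longlonglongrightarrow> xi" for s xi
  unfolding fourier_def
 proof (rule integral_dominated_convergence)
  show "integrable lborel (%x. norm (g x))" using g by simp
  show "AE x in lborel. (%n. cis (- (x \<bullet> s n)) * g x) \<longlonglongrightarrow> cis (- (x \<bullet> xi)) * g x"
   using s by (intro AE_I2) (auto intro!: tendsto_intros simp: cis_conv_exp)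
 qed (auto simp: norm_mult)
 then show ?thesis
  by (auto simp: continuous_on_sequentially o_def)
qed

lemma fourier_borel: "integrable lborel g ==> fourier g : borel_measurable borel"
 by (intro borel_measurable_continuous_onI fourier_continuous)

lemma integrable_lborel_prod:
 fixes a b :: "space => real"
 assumes a: "integrable lborel a" and b: "integrable lborel b"
 shows "integrable (lborel \<Otimes>\<^sub>M lborel) (%p. a (fst p) * b (snd p))"
proof (rule lborel_pair.Fubini_integrable)
 have [measurable]: "a : borel_measurable borel" "b : borel_measurable borel" using a b by auto
 show "(%p. a (fst p) * b (snd p)) : borel_measurable (lborel \<Otimes>\<^sub>M lborel)" by measurable
qed (use a b in \<open>auto simp: abs_mult\<close>)

text \<open>Fubini, made legitimate by the Gaussian, moves the transform from \<open>g\<close> to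
  the Gaussian; what remains is a smoothing of \<open>g\<close> at x.\<close>

lemma gauss_inversion:
 assumes g: "integrable lborel g" and eta: "eta > 0"
 shows "(LINT xi|lborel. cis (x \<bullet> xi) * fourier g xi * complex_of_real (gauss eta xi)) = (LINT y|lborel. g y * complex_of_real (gauss_kernel eta (y - x)))"
proof -
 let ?C = "(%p::space \<times> space. cis (x \<bullet> fst p))"
 let ?B = "(%p::space \<times> space. cis (- (snd p \<bullet> fst p)))"
 let ?A = "lborel \<Otimes>\<^sub>M lborel"
 have [measurable]: "g : borel_measurable borel" using g by auto
 have [measurable]: "?C : borel_measurable borel" 
   "?B : borel_measurable borel"
  by (intro borel_measurable_continuous_onI; auto intro!: continuous_intros simp: cis_conv_exp)+
 let ?h = "%(xi, y). cis (x \<bullet> xi) * (cis (- (y \<bullet> xi)) * g y) * complex_of_real (gauss eta xi)"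
 have m: "?h : borel_measurable ?A"
 proof -
  have 1: "?C : borel_measurable ?A" 
   "?B : borel_measurable ?A"
   unfolding lborel_prod by simp_all
  note [measurable] = 1
  show ?thesis unfolding case_prod_beta by measurable
 qed
 have "integrable ?A (%p. gauss eta (fst p) * norm (g (snd p)))"
  by (rule integrable_lborel_prod) (use g gauss_integrable[OF eta] in auto)
 then have i: "integrable ?A ?h"
  by (rule Bochner_Integration.integrable_bound[OF _ m]) (auto simp: norm_mult gauss_def)
 have "(LINT xi|lborel. cis (x \<bullet> xi) * fourier g xi * complex_of_real (gauss eta xi)) = (LINT xi|lborel. LINT y|lborel. ?h (xi, y))"
  unfolding fourier_def by (intro Bochner_Integration.integral_cong) simp_all
 also have "... = (LINT y|lborel. LINT xi|lborel. ?h (xi, y))"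
  using lborel_pair.Fubini_integral[of "%xi y. ?h (xi, y)"] i by simp
 also have "... = (LINT y|lborel. g y * complex_of_real (gauss_kernel eta (y - x)))"
 proof (rule Bochner_Integration.integral_cong[OF refl])
  fix y
  have "(LINT xi|lborel. ?h (xi, y)) = (LINT xi|lborel. g y * (cis (- (xi \<bullet> (y - x))) * complex_of_real (gauss eta xi)))"
  proof (rule Bochner_Integration.integral_cong[OF refl])
   fix xi
   have "cis (- (xi \<bullet> (y - x))) = cis (x \<bullet> xi) * cis (- (y \<bullet> xi))"
    by (simp only: cis_mult) (simp add: inner_diff_right inner_commute)
   then show "?h (xi, y) = g y * (cis (- (xi \<bullet> (y - x))) * complex_of_real (gauss eta xi))"
    by (simp only: prod.case) (simp only: mult_ac)
  qed
  then show "(LINT xi|lborel. ?h (xi, y)) = g y * complex_of_real (gauss_kernel eta (y - x))"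
   using gauss_fourier(2)[OF eta, of "y - x"] by simp
 qed
 finally show ?thesis .
qed

lemma gauss_tendsto_1: "(%n. gauss (1 / real (Suc n)) x) \<longlonglongrightarrow> 1"
proof -
 have "(%n. exp (- (1 / real (Suc n) * norm x)\<^sup>2 / 2)) \<longlonglongrightarrow> exp (- (0 * norm x)\<^sup>2 / 2)"
  by (intro tendsto_intros LIMSEQ_Suc[OF lim_1_over_n]) simp
 then show ?thesis by (simp add: gauss_def)
qed

text \<open>With a Gaussian inserted, Fubini rewrites the left side as the pairing of
  \<open>g\<close> with its smoothing \<open>I\<close>. The kernel is positive, symmetric and of
  mass (2 pi)^3, so Schur's test bounds the pairing; Fatou's lemma then removes the
  Gaussian.\<close>

lemma plancherel_le:
 assumes g: "integrable lborel g"
 shows "(\<integral>\<^sup>+xi. ennreal ((norm (fourier g xi))^2) \<partial>lborel) <= ennreal ((2 * pi) ^ 3) * (\<integral>\<^sup>+x. ennreal ((norm (g x))^2) \<partial>lborel)"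
proof -
 let ?C = "borel_measurable borel"
 let ?B = "(%p::space \<times> space. cis (- (snd p \<bullet> fst p)))"
 let ?A = "ennreal ((2 * pi) ^ 3)"
 have [measurable]: "g : ?C" using g by auto
 have [measurable]: "fourier g : ?C" by (rule fourier_borel[OF g])
 let ?G = "?A * (\<integral>\<^sup>+x. ennreal ((norm (g x))^2) \<partial>lborel)"
 have main: "(\<integral>\<^sup>+xi. ennreal ((norm (fourier g xi))^2 * gauss eta xi) \<partial>lborel) <= ?G" if eta: "eta > 0" for eta
 proof -
  define M where "M = (LINT x|lborel. norm (g x))"
  have M: "norm (fourier g xi) <= M" for xi unfolding M_def by (rule fourier_bound[OF g])
  have M0: "M >= 0" using order_trans[OF norm_ge_zero M] .
  have i1: "integrable lborel (%xi. (norm (fourier g xi))^2 * gauss eta xi)"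
  proof (rule Bochner_Integration.integrable_bound)
   show "integrable lborel (%xi. M^2 * gauss eta xi)" using gauss_integrable[OF eta] by simp
   have "(norm (fourier g xi))^2 * gauss eta xi <= M^2 * gauss eta xi" for xi
    by (intro mult_right_mono power_mono M) (auto simp: gauss_def)
   then show "AE xi in lborel. norm ((norm (fourier g xi))^2 * gauss eta xi) <= norm (M^2 * gauss eta xi)"
    by (intro AE_I2) (simp add: abs_mult gauss_pos[THEN less_imp_le])
  qed measurable
  define I where "I x = (LINT y|lborel. g y * complex_of_real (gauss_kernel eta (y - x)))" for x
  let ?h = "%(xi, x). cis (- (x \<bullet> xi)) * g x * (cnj (fourier g xi) * complex_of_real (gauss eta xi))"
  have m: "?h : borel_measurable (lborel \<Otimes>\<^sub>M lborel)"
  proof -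
   have "?B : ?C"
    by (intro borel_measurable_continuous_onI; auto intro!: continuous_intros simp: cis_conv_exp)
   then have [measurable]: "?B : borel_measurable (lborel \<Otimes>\<^sub>M lborel)"
    unfolding lborel_prod by simp
   have [measurable]: "(%xi. cnj (fourier g xi)) : ?C"
    by (intro borel_measurable_continuous_onI continuous_on_cnj fourier_continuous g)
   show ?thesis unfolding case_prod_beta by measurable
  qed
  have "integrable (lborel \<Otimes>\<^sub>M lborel) (%p. (M * gauss eta (fst p)) * norm (g (snd p)))"
   by (rule integrable_lborel_prod) (use g gauss_integrable[OF eta] in auto)
  then have ih: "integrable (lborel \<Otimes>\<^sub>M lborel) ?h"
  proof (rule Bochner_Integration.integrable_bound[OF _ m], intro AE_I2)
   fix p :: "space \<times> space"
   have "norm (fourier g (fst p)) * gauss eta (fst p) * norm (g (snd p)) <= M * gauss eta (fst p) * norm (g (snd p))"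
    by (intro mult_right_mono M) (auto simp: gauss_def)
   then show "norm (?h p) <= norm (M * gauss eta (fst p) * norm (g (snd p)))"
    using M0 by (simp add: case_prod_beta norm_mult gauss_pos[THEN less_imp_le] mult_ac abs_mult)
  qed
  have "complex_of_real (LINT xi|lborel. (norm (fourier g xi))^2 * gauss eta xi) = (LINT xi|lborel. LINT x|lborel. ?h (xi, x))"
  proof (subst integral_complex_of_real[symmetric], rule Bochner_Integration.integral_cong[OF refl])
   fix xi
   have "(LINT x|lborel. ?h (xi, x)) = fourier g xi * (cnj (fourier g xi) * complex_of_real (gauss eta xi))"
    unfolding fourier_def by simp
   then have "(LINT x|lborel. ?h (xi, x)) = complex_of_real ((norm (fourier g xi))^2) * complex_of_real (gauss eta xi)"
    by (simp only: mult.assoc[symmetric] complex_norm_square[symmetric] of_real_power)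
   then show "complex_of_real ((norm (fourier g xi))^2 * gauss eta xi) = (LINT x|lborel. ?h (xi, x))"
    by (simp only: of_real_mult)
  qed
  also have "... = (LINT x|lborel. LINT xi|lborel. ?h (xi, x))"
   using lborel_pair.Fubini_integral[of "%xi y. ?h (xi, y)"] ih by simp
  also have "... = (LINT x|lborel. g x * cnj (I x))"
  proof (rule Bochner_Integration.integral_cong[OF refl])
   fix x
   have "(LINT xi|lborel. ?h (xi, x)) = (LINT xi|lborel. g x * cnj (cis (x \<bullet> xi) * fourier g xi * complex_of_real (gauss eta xi)))"
    by (intro Bochner_Integration.integral_cong) (auto simp: cis_cnj mult_ac)
   also have "... = g x * cnj (LINT xi|lborel. cis (x \<bullet> xi) * fourier g xi * complex_of_real (gauss eta xi))"
    by (simp add: integral_cnj[symmetric] del: complex_cnj_mult)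
   finally show "(LINT xi|lborel. ?h (xi, x)) = g x * cnj (I x)"
    unfolding I_def gauss_inversion[OF g eta] .
  qed
  finally have eq: "complex_of_real (LINT xi|lborel. (norm (fourier g xi))^2 * gauss eta xi) = (LINT x|lborel. g x * cnj (I x))" .
  have "(\<integral>\<^sup>+xi. ennreal ((norm (fourier g xi))^2 * gauss eta xi) \<partial>lborel) = ennreal (LINT xi|lborel. (norm (fourier g xi))^2 * gauss eta xi)"
   by (rule nn_integral_eq_integral[OF i1]) (simp add: gauss_pos[THEN less_imp_le])
  also have "... <= ennreal (norm (LINT x|lborel. g x * cnj (I x)))"
   unfolding eq[symmetric] by (intro ennreal_leI) simp
  \<comment> \<open>A Bochner integral that does not converge has the value 0, so the bound holds in
    either case.\<close>
  also have "... <= (\<integral>\<^sup>+x. ennreal (norm (g x * cnj (I x))) \<partial>lborel)"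
   by (cases "integrable lborel (%x. g x * cnj (I x))")
     (auto intro: integral_norm_bound_ennreal simp: not_integrable_integral_eq)
  also have "... <= (\<integral>\<^sup>+x. \<integral>\<^sup>+y. ennreal (norm (g x) * (norm (g y) * gauss_kernel eta (y - x))) \<partial>lborel \<partial>lborel)"
  proof (rule nn_integral_mono)
   fix x
   have "ennreal (norm (I x)) <= (\<integral>\<^sup>+y. ennreal (norm (g y * complex_of_real (gauss_kernel eta (y - x)))) \<partial>lborel)"
    unfolding I_def by (cases "integrable lborel (%y. g y * complex_of_real (gauss_kernel eta (y - x)))")
     (auto intro: integral_norm_bound_ennreal simp: not_integrable_integral_eq)
   also have "... = (\<integral>\<^sup>+y. ennreal (norm (g y) * gauss_kernel eta (y - x)) \<partial>lborel)"
   proof -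
    have "\<bar>gauss_kernel eta (y - x)\<bar> = gauss_kernel eta (y - x)" for y
     using eta by (simp add: gauss_kernel_def gauss_pos[THEN less_imp_le])
    then show ?thesis by (simp only: norm_mult norm_of_real)
   qed
   finally have "ennreal (norm (g x)) * ennreal (norm (I x)) <= ennreal (norm (g x)) * (\<integral>\<^sup>+y. ennreal (norm (g y) * gauss_kernel eta (y - x)) \<partial>lborel)"
    by (rule mult_left_mono) simp
   then show "ennreal (norm (g x * cnj (I x))) <= (\<integral>\<^sup>+y. ennreal (norm (g x) * (norm (g y) * gauss_kernel eta (y - x))) \<partial>lborel)"
    by (simp add: norm_mult ennreal_mult' nn_integral_cmult)
  qed
  also have "... <= (\<integral>\<^sup>+x. \<integral>\<^sup>+y. ennreal ((norm (g x))^2 / 2) * ennreal (gauss_kernel eta (y - x)) + ennreal ((norm (g y))^2 / 2) * ennreal (gauss_kernel eta (y - x)) \<partial>lborel \<partial>lborel)"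
  proof (intro nn_integral_mono)
   fix x y
   have k: "gauss_kernel eta (y - x) >= 0" using eta by (simp add: gauss_kernel_def gauss_pos[THEN less_imp_le])
   have "norm (g x) * norm (g y) <= (norm (g x))^2 / 2 + (norm (g y))^2 / 2"
    using sum_squares_bound[of "norm (g x)" "norm (g y)"] by (simp add: field_simps)
   from mult_right_mono[OF this k]
   have "norm (g x) * (norm (g y) * gauss_kernel eta (y - x)) <= (norm (g x))^2 / 2 * gauss_kernel eta (y - x) + (norm (g y))^2 / 2 * gauss_kernel eta (y - x)"
    by (simp add: algebra_simps)
   then show "ennreal (norm (g x) * (norm (g y) * gauss_kernel eta (y - x))) <= ennreal ((norm (g x))^2 / 2) * ennreal (gauss_kernel eta (y - x)) + ennreal ((norm (g y))^2 / 2) * ennreal (gauss_kernel eta (y - x))"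
    using k by (simp add: ennreal_mult[symmetric] ennreal_plus[symmetric] del: ennreal_plus)
  qed
  also have "... = (\<integral>\<^sup>+x. \<integral>\<^sup>+y. ennreal ((norm (g x))^2 / 2) * ennreal (gauss_kernel eta (y - x)) \<partial>lborel \<partial>lborel) + (\<integral>\<^sup>+x. \<integral>\<^sup>+y. ennreal ((norm (g y))^2 / 2) * ennreal (gauss_kernel eta (y - x)) \<partial>lborel \<partial>lborel)"
   by (simp add: nn_integral_add)
  also have "(\<integral>\<^sup>+x. \<integral>\<^sup>+y. ennreal ((norm (g y))^2 / 2) * ennreal (gauss_kernel eta (y - x)) \<partial>lborel \<partial>lborel)
    = (\<integral>\<^sup>+y. \<integral>\<^sup>+x. ennreal ((norm (g y))^2 / 2) * ennreal (gauss_kernel eta (y - x)) \<partial>lborel \<partial>lborel)"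
   by (rule lborel_pair.Fubini') measurable
  also have "... = (\<integral>\<^sup>+x. \<integral>\<^sup>+y. ennreal ((norm (g x))^2 / 2) * ennreal (gauss_kernel eta (y - x)) \<partial>lborel \<partial>lborel)"
   by (simp add: gauss_kernel_def gauss_def norm_minus_commute)
  also have "... = (\<integral>\<^sup>+x. ennreal ((norm (g x))^2 / 2) * ?A \<partial>lborel)"
  proof (rule nn_integral_cong)
   fix x
   have "(\<integral>\<^sup>+y. ennreal (gauss_kernel eta (y - x)) \<partial>lborel) = ?A"
    using nn_integral_lborel_translate[of "%y. ennreal (gauss_kernel eta y)" "- x"] gauss_kernel_mass[OF eta] by simp
   then show "(\<integral>\<^sup>+y. ennreal ((norm (g x))^2 / 2) * ennreal (gauss_kernel eta (y - x)) \<partial>lborel) = ennreal ((norm (g x))^2 / 2) * ?A"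
    by (simp add: nn_integral_cmult)
  qed
  also have "(\<integral>\<^sup>+x. ennreal ((norm (g x))^2 / 2) * ?A \<partial>lborel) + (\<integral>\<^sup>+x. ennreal ((norm (g x))^2 / 2) * ?A \<partial>lborel) = ?G"
  proof -
   have "ennreal ((norm (g x))^2 / 2) * ?A + ennreal ((norm (g x))^2 / 2) * ?A
     = ?A * ennreal ((norm (g x))^2)" for x
    by (simp add: ennreal_mult[symmetric] ennreal_plus[symmetric] del: ennreal_plus)
   then show ?thesis
    by (subst nn_integral_add[symmetric]) (simp_all add: nn_integral_cmult)
  qed
  finally show ?thesis .
 qed
 have "(\<integral>\<^sup>+xi. ennreal ((norm (fourier g xi))^2) \<partial>lborel) = (\<integral>\<^sup>+xi. liminf (%n. ennreal ((norm (fourier g xi))^2 * gauss (1 / real (Suc n)) xi)) \<partial>lborel)"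
 proof (rule nn_integral_cong)
  fix xi
  have "(%n. ennreal ((norm (fourier g xi))^2 * gauss (1 / real (Suc n)) xi)) \<longlonglongrightarrow> ennreal ((norm (fourier g xi))^2 * 1)"
   by (intro tendsto_intros gauss_tendsto_1) 
  from lim_imp_Liminf[OF _ this] show "ennreal ((norm (fourier g xi))^2) = liminf (%n. ennreal ((norm (fourier g xi))^2 * gauss (1 / real (Suc n)) xi))"
   by simp
 qed
 also have "... <= liminf (%n. \<integral>\<^sup>+xi. ennreal ((norm (fourier g xi))^2 * gauss (1 / real (Suc n)) xi) \<partial>lborel)"
  by (rule nn_integral_liminf) measurable
 also have "... <= ?G"
  by (rule Liminf_le, simp, rule always_eventually, rule allI, rule main, simp)
 finally show ?thesis .
qed

lemma fourier_deriv:
 assumes g: "has_gradient g Dg" and i: "integrable lborel g" "integrable lborel (Dg i)"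
 shows "fourier (Dg i) xi = \<i> * of_real (xi $ i) * fourier g xi"
proof -
 let ?A = "of_real (xi $ i)"
 let ?h = "%x. cis (- (x \<bullet> xi)) * g x"
 let ?h' = "%x. cis (- (x \<bullet> xi)) * Dg i x - \<i> * ?A * (cis (- (x \<bullet> xi)) * g x)"
 have int: "integrable lborel ?h'" "integrable lborel ?h" "integrable lborel (%x. cis (- (x \<bullet> xi)) * Dg i x)"
  using fourier_integrable[OF i(1)] fourier_integrable[OF i(2)] by auto
 have cc: "continuous_on UNIV (%x. cis (- (x \<bullet> xi)))"
  by (auto intro!: continuous_intros simp: cis_conv_exp)
 have "(LINT x|lborel. ?h' x) = 0"
 proof (rule integral_derivative_eq_0[where e = "axis i 1" and h = ?h])
  fix x
  have c: "((%r. cis (- ((x + r *\<^sub>R axis i 1) \<bullet> xi))) has_vector_derivative - (\<i> * ?A * cis (- (x \<bullet> xi)))) (at 0)"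
  proof -
   have eq: "cis (- ((x + r *\<^sub>R axis i 1) \<bullet> xi)) = exp (- \<i> * of_real (x \<bullet> xi) + - (\<i> * ?A) * of_real r)" for r
    by (simp add: cis_conv_exp inner_add_left inner_axis' algebra_simps)
   have "((%z. exp (- \<i> * of_real (x \<bullet> xi) + - (\<i> * ?A) * z)) has_field_derivative
     exp (- \<i> * of_real (x \<bullet> xi) + - (\<i> * ?A) * of_real 0) * - (\<i> * ?A)) (at (of_real 0))"
    by (auto intro!: derivative_eq_intros)
   from has_vector_derivative_real_field[OF this]
   show ?thesis unfolding eq by (simp add: cis_conv_exp mult_ac)
  qed
  show "((%r. ?h (x + r *\<^sub>R axis i 1)) has_vector_derivative ?h' x) (at 0)"
   using has_vector_derivative_mult[OF c has_gradient_line[OF g, of x i]] by (simp add: algebra_simps)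
 qed (use int in \<open>auto intro!: continuous_intros cc has_gradient_continuous[OF g]\<close>)
 then have "(LINT x|lborel. cis (- (x \<bullet> xi)) * Dg i x) - \<i> * ?A * (LINT x|lborel. cis (- (x \<bullet> xi)) * g x) = 0"
  using int by (simp add: Bochner_Integration.integral_diff)
 then show ?thesis by (simp add: fourier_def)
qed

lemma fourier_scaled:
 assumes "integrable lborel g" "r > 0"
 shows "(LINT y|lborel. cis (- (y \<bullet> xi)) * g ((1 / r) *\<^sub>R y)) = of_real (r ^ 3) * fourier g (r *\<^sub>R xi)"
  and "integrable lborel (%y. cis (- (y \<bullet> xi)) * g ((1 / r) *\<^sub>R y))"
proof -
 have [measurable]: "g : borel_measurable borel" using assms by auto
 show "(LINT y|lborel. cis (- (y \<bullet> xi)) * g ((1 / r) *\<^sub>R y)) = of_real (r ^ 3) * fourier g (r *\<^sub>R xi)"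
  by (subst lborel_integral_scale[OF _ assms(2)])
   (use assms(2) in \<open>auto simp: fourier_def scaleR_conv_of_real[of _ "z :: complex" for z]\<close>)
 show "integrable lborel (%y. cis (- (y \<bullet> xi)) * g ((1 / r) *\<^sub>R y))"
  by (rule fourier_integrable, rule lborel_integrable_scale) (use assms in auto)
qed

text \<open>Substituting y = r x moves the dependence on r from the phase to
  \<open>g ((1 / r) *\<^sub>R y)\<close>. The r-derivative is then a radial derivative of
  \<open>g\<close>, and the only weighted function that has to be integrable is x.grad g;
  differentiating the phase instead would require |x| g.\<close>

lemma fourier_radial_deriv:
 assumes g: "has_gradient g Dg" and i: "integrable lborel g" 
  and iD: "integrable lborel (%x. SUM i:UNIV. (x $ i) *\<^sub>R Dg i x)" and l: "l > 0"
 shows "((%r. of_real (r ^ 3) * fourier g (r *\<^sub>R ome)) has_vector_derivative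
   - of_real (l^2) * fourier (%x. SUM i:UNIV. (x $ i) *\<^sub>R Dg i x) (l *\<^sub>R ome)) (at l)"
proof -
 let ?B = "borel_measurable (borel \<Otimes>\<^sub>M lborel)"
 define D where "D x = (SUM i:UNIV. (x $ i) *\<^sub>R Dg i x)" for x
 let ?A = "LINT x|lborel. norm (D x)"
 have iD: "integrable lborel D" using iD by (simp add: D_def[abs_def])
 note cont = has_gradient_continuous[OF g]
 have cD: "continuous_on UNIV D" unfolding D_def by (intro continuous_intros cont)
 have [measurable]: "g : borel_measurable borel" "D : borel_measurable borel"
  using i iD by auto
 define F where "F r y = cis (- (y \<bullet> ome)) * g ((1 / r) *\<^sub>R y)" for r y
 define F' where "F' r y = of_real (- 1 / r) * (cis (- (y \<bullet> ome)) * D ((1 / r) *\<^sub>R y))" for r y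
 have F: "(LINT y|lborel. F r y) = of_real (r ^ 3) * fourier g (r *\<^sub>R ome)" "integrable lborel (F r)" if "r > 0" for r
  unfolding F_def using fourier_scaled[OF i that] by auto
 have F': "(LINT y|lborel. F' r y) = - of_real (r^2) * fourier D (r *\<^sub>R ome)" if "r > 0" for r
  unfolding F'_def using fourier_scaled[OF iD that] that by (simp add: power2_eq_square power3_eq_cube)
 have "((%r. LINT y|lborel. F r y) has_vector_derivative (LINT y|lborel. F' l y)) (at l)"
 proof (rule lborel.integral_has_vector_derivative_param[where a = "l / 2" and b = "2 * l"])
  fix r :: real and x :: space assume r: "r : {l / 2..2 * l}"
  then have r0: "r > 0" using l by auto
  have "((%r. (1 / r) *\<^sub>R x) has_vector_derivative (- 1 / r^2) *\<^sub>R x) (at r)"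
   using r0 has_vector_derivative_scaleR[of "%r. 1 / r" "- 1 / r^2" r UNIV "%r. x" 0]
   by (auto intro!: derivative_eq_intros simp: power2_eq_square)
  from has_gradient_chain[OF g this]
  have "((%r. g ((1 / r) *\<^sub>R x)) has_vector_derivative (SUM k:UNIV. (((- 1 / r^2) *\<^sub>R x) $ k) *\<^sub>R Dg k ((1 / r) *\<^sub>R x))) (at r)" .
  also have "(SUM k:UNIV. (((- 1 / r^2) *\<^sub>R x) $ k) *\<^sub>R Dg k ((1 / r) *\<^sub>R x)) = (- 1 / r) *\<^sub>R D ((1 / r) *\<^sub>R x)"
   unfolding D_def scaleR_sum_right by (intro sum.cong) (auto simp: power2_eq_square)
  finally have "((%r. cis (- (x \<bullet> ome)) * g ((1 / r) *\<^sub>R x)) has_vector_derivative cis (- (x \<bullet> ome)) * ((- 1 / r) *\<^sub>R D ((1 / r) *\<^sub>R x))) (at r)"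
   by (rule has_vector_derivative_mult_right)
  then have "((%r. F r x) has_vector_derivative F' r x) (at r)"
   unfolding F_def F'_def by (simp add: scaleR_conv_of_real[of _ "z :: complex" for z] mult_ac)
  then show "((%r. F r x) has_vector_derivative F' r x) (at r within {l / 2..2 * l})"
   by (rule has_vector_derivative_at_within)
 next
  show "continuous_on {l / 2..2 * l} (%r. F' r x)" for x
   unfolding F'_def using l by (intro continuous_intros continuous_on_compose2[OF cD]) auto
  show "(%(r, x). F' r x) : ?B"
  proof -
   have [measurable]: "(%x. cis (- (x \<bullet> ome))) : borel_measurable borel" by (rule cis_minus_inner_borel)
   have [measurable]: "(%p. D ((1 / fst p) *\<^sub>R snd p)) : ?B" by measurable
   have "(%p. cis (- (snd p \<bullet> ome))) : ?B"
    by measurable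
   then show ?thesis unfolding F'_def case_prod_beta by measurable
  qed
  show "(\<integral>\<^sup>+x. norm (F' r x) \<partial>lborel) <= ennreal ((2 * l)^2 * ?A)" if r: "r : {l / 2..2 * l}" for r
  proof -
   have r0: "r > 0" using r l by auto
   have "(\<integral>\<^sup>+x. norm (F' r x) \<partial>lborel) = ennreal (1 / r) * (\<integral>\<^sup>+x. norm (D ((1 / r) *\<^sub>R x)) \<partial>lborel)"
    unfolding F'_def using r0 by (subst nn_integral_cmult[symmetric]) (auto simp: norm_mult norm_divide norm_inverse ennreal_mult'[symmetric] divide_inverse mult.commute intro!: nn_integral_cong)
   also have "(\<integral>\<^sup>+x. norm (D ((1 / r) *\<^sub>R x)) \<partial>lborel) = ennreal (r ^ 3) * (\<integral>\<^sup>+x. norm (D x) \<partial>lborel)"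
    by (subst nn_integral_lborel_scale[OF _ r0]) (use r0 in auto)
   also have "(\<integral>\<^sup>+x. norm (D x) \<partial>lborel) = ennreal ?A"
    using iD by (intro nn_integral_eq_integral) auto
   also have "ennreal (1 / r) * (ennreal (r ^ 3) * ennreal ?A) = ennreal (r^2 * ?A)"
    using r0 by (simp add: ennreal_mult[symmetric] power2_eq_square power3_eq_cube)
   also have "... <= ennreal ((2 * l)^2 * ?A)"
    using r r0 by (intro ennreal_leI mult_right_mono power_mono) auto
   finally show ?thesis .
  qed
  show "integrable lborel (F r)" if "r : {l / 2..2 * l}" for r
   using F(2)[of r] that l by auto
  have "continuous_on {l / 2..2 * l} (%r. - of_real (r^2) * fourier D (r *\<^sub>R ome))"
   by (intro continuous_intros continuous_on_compose2[OF fourier_continuous[OF iD]]) auto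
  then show "continuous_on {l / 2..2 * l} (%r. LINT x|lborel. F' r x)"
   by (rule continuous_on_eq) (use F' l in auto)
 qed (use l in auto)
 then have "((%r. of_real (r ^ 3) * fourier g (r *\<^sub>R ome)) has_vector_derivative (LINT y|lborel. F' l y)) (at l)"
  by (rule has_vector_derivative_transform_within_open[of _ _ _ "{0<..}"]) (use l F(1) in auto)
 then show ?thesis
  unfolding F'[OF l] D_def[symmetric] .
qed

text \<open>Gaussian summation: dominated convergence in frequency, an approximate identity in
  space. As \<open>g\<close> may be unbounded, it is split. Near x (\<open>g1\<close>) it is bounded
  by compactness and the rescaled integrals converge; away from x (\<open>g2\<close>) the kernel
  tends to 0 uniformly.\<close>

lemma fourier_inversion:
 assumes g: "integrable lborel g" and c: "continuous_on UNIV g" and gh: "integrable lborel (fourier g)"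
 shows "(LINT xi|lborel. cis (x \<bullet> xi) * fourier g xi) = of_real ((2 * pi) ^ 3) * g x"
proof -
 let ?A = "borel_measurable borel"
 have [measurable]: "g : ?A" "fourier g : ?A" using g gh by auto
 define e where "e n = 1 / real (Suc n)" for n
 have e: "e n > 0" for n by (simp add: e_def)
 define I where "I n = (LINT xi|lborel. cis (x \<bullet> xi) * fourier g xi * complex_of_real (gauss (e n) xi))" for n
 have [measurable]: "(%xi. cis (x \<bullet> xi)) : ?A"
  using cis_inner_borel[of x] by (simp add: inner_commute)
 have L1: "I \<longlonglongrightarrow> (LINT xi|lborel. cis (x \<bullet> xi) * fourier g xi)"
  unfolding I_def
 proof (rule integral_dominated_convergence)
  show "integrable lborel (%xi. norm (fourier g xi))" using gh by simp
  have "(%n. cis (x \<bullet> xi) * fourier g xi * complex_of_real (gauss (e n) xi)) \<longlonglongrightarrow> cis (x \<bullet> xi) * fourier g xi * complex_of_real 1" for xi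
   unfolding e_def by (intro tendsto_intros gauss_tendsto_1)
  then show "AE xi in lborel. (%n. cis (x \<bullet> xi) * fourier g xi * complex_of_real (gauss (e n) xi)) \<longlonglongrightarrow> cis (x \<bullet> xi) * fourier g xi"
   by simp
  show "AE xi in lborel. norm (cis (x \<bullet> xi) * fourier g xi * complex_of_real (gauss (e n) xi)) <= norm (fourier g xi)" for n
   by (intro AE_I2) (simp add: norm_mult gauss_pos[THEN less_imp_le] mult_left_le gauss_le_1)
 qed measurable
 define g1 where "g1 y = indicator (ball x 1) y *\<^sub>R g y" for y
 define g2 where "g2 y = indicator (- ball x 1) y *\<^sub>R g y" for y
 have gi: "integrable lborel g1" "integrable lborel g2"
  unfolding g1_def g2_def by (rule Bochner_Integration.integrable_bound[OF g]; auto split: split_indicator)+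
 have [measurable]: "g1 : ?A" "g2 : ?A" using gi by auto
 have split: "g y = g1 y + g2 y" for y by (auto simp: g1_def g2_def split: split_indicator)
 have kb: "gauss_kernel (e n) z <= sqrt (2 * pi) ^ 3 / e n ^ 3" "0 <= gauss_kernel (e n) z" for n z
  using e[of n] gauss_le_1[of "1 / e n" z] gauss_pos[of "1 / e n" z] by (auto simp: gauss_kernel_def field_simps)
 have ik: "integrable lborel (%y. h y * complex_of_real (gauss_kernel (e n) (y - x)))" if "integrable lborel h" for h n
 proof (rule Bochner_Integration.integrable_bound)
  show "integrable lborel (%y. (sqrt (2 * pi) ^ 3 / e n ^ 3) *\<^sub>R h y)" using that by simp
  have [measurable]: "h : ?A" using that by auto
  show "(%y. h y * complex_of_real (gauss_kernel (e n) (y - x))) : borel_measurable lborel" by measurable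
  have "norm (h y) * gauss_kernel (e n) (y - x) <= norm (h y) * (sqrt (2 * pi) ^ 3 / e n ^ 3)" for y
   by (intro mult_left_mono kb) auto
  then show "AE y in lborel. norm (h y * complex_of_real (gauss_kernel (e n) (y - x))) <= norm ((sqrt (2 * pi) ^ 3 / e n ^ 3) *\<^sub>R h y)"
   using e by (intro AE_I2) (simp add: norm_mult kb mult.commute abs_of_pos less_imp_le)
 qed
 have I_eq: "I n = (LINT y|lborel. g1 y * complex_of_real (gauss_kernel (e n) (y - x))) + (LINT y|lborel. g2 y * complex_of_real (gauss_kernel (e n) (y - x)))" for n
  unfolding I_def gauss_inversion[OF g e]
  by (subst Bochner_Integration.integral_add[symmetric]) (auto intro!: ik gi simp: split distrib_right)
 have L2: "(%n. LINT y|lborel. g2 y * complex_of_real (gauss_kernel (e n) (y - x))) \<longlonglongrightarrow> 0"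
 proof (rule Lim_null_comparison)
  define c where "c n = sqrt (2 * pi) ^ 3 * (real (Suc n) ^ 3 * exp (- (real (Suc n))\<^sup>2 / 2))" for n
  have "c \<longlonglongrightarrow> sqrt (2 * pi) ^ 3 * 0"
   unfolding c_def by (intro tendsto_mult_left) real_asymp
  then show "(%n. c n * (LINT y|lborel. norm (g2 y))) \<longlonglongrightarrow> 0"
   using tendsto_mult_right[of c 0 sequentially "LINT y|lborel. norm (g2 y)"] by simp
  have "norm (LINT y|lborel. g2 y * complex_of_real (gauss_kernel (e n) (y - x))) <= c n * (LINT y|lborel. norm (g2 y))" for n
  proof -
   have "norm (LINT y|lborel. g2 y * complex_of_real (gauss_kernel (e n) (y - x))) <= (LINT y|lborel. c n * norm (g2 y))"
   proof (rule order_trans[OF integral_norm_bound], rule integral_mono)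
    fix y
    show "norm (g2 y * complex_of_real (gauss_kernel (e n) (y - x))) <= c n * norm (g2 y)"
    proof (cases "y : ball x 1")
     case False
     then have d: "1 <= norm (y - x)" by (simp add: dist_norm norm_minus_commute)
     have "gauss (1 / e n) (y - x) <= exp (- (real (Suc n))\<^sup>2 / 2)"
      using power_mono[OF mult_left_mono[OF d, of "real (Suc n)"], of 2] by (simp add: gauss_def e_def)
     then have "gauss_kernel (e n) (y - x) <= sqrt (2 * pi) ^ 3 / e n ^ 3 * exp (- (real (Suc n))\<^sup>2 / 2)"
      unfolding gauss_kernel_def using e[of n] by (intro mult_left_mono) auto
     also have "... = c n" by (simp add: c_def e_def power_divide)
     finally have "norm (g2 y) * gauss_kernel (e n) (y - x) <= norm (g2 y) * c n"
      by (rule mult_left_mono) simp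
     then show ?thesis by (simp add: norm_mult kb mult.commute)
    qed (simp add: g2_def)
   qed (use gi ik[OF gi(2)] in auto)
   then show ?thesis by simp
  qed
  then show "\<forall>\<^sub>F n in sequentially. norm (LINT y|lborel. g2 y * complex_of_real (gauss_kernel (e n) (y - x))) <= c n * (LINT y|lborel. norm (g2 y))"
   by simp
 qed
 have L3: "(%n. LINT y|lborel. g1 y * complex_of_real (gauss_kernel (e n) (y - x))) \<longlonglongrightarrow> of_real ((2 * pi) ^ 3) * g x"
 proof -
  have eq: "(LINT y|lborel. g1 y * complex_of_real (gauss_kernel (e n) (y - x))) = (LINT z|lborel. g1 (x + e n *\<^sub>R z) * complex_of_real (sqrt (2 * pi) ^ 3 * gauss 1 z))" for n
  proof -
   have "(LINT y|lborel. g1 y * complex_of_real (gauss_kernel (e n) (y - x))) = (LINT y|lborel. g1 (y + x) * complex_of_real (gauss_kernel (e n) y))"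
    using lborel_integral_translate[of "%y. g1 y * complex_of_real (gauss_kernel (e n) (y - x))" x] by simp
   also have "... = e n ^ 3 *\<^sub>R (LINT z|lborel. g1 (e n *\<^sub>R z + x) * complex_of_real (gauss_kernel (e n) (e n *\<^sub>R z)))"
    by (rule lborel_integral_scale) (use e in auto)
   also have "... = (LINT z|lborel. e n ^ 3 *\<^sub>R (g1 (e n *\<^sub>R z + x) * complex_of_real (gauss_kernel (e n) (e n *\<^sub>R z))))"
    by simp
   also have "... = (LINT z|lborel. g1 (x + e n *\<^sub>R z) * complex_of_real (sqrt (2 * pi) ^ 3 * gauss 1 z))"
    using e[of n] by (intro Bochner_Integration.integral_cong) (auto simp: gauss_kernel_def gauss_def scaleR_conv_of_real[of _ "z :: complex" for z] add.commute)
   finally show ?thesis .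
  qed
  have "compact (g ` cball x 1)" by (intro compact_continuous_image continuous_on_subset[OF c]) auto
  then obtain M where M: "!!z. z : g ` cball x 1 ==> norm z <= M"
   using compact_imp_bounded bounded_iff by metis
  have M1: "norm (g1 y) <= max M 0" for y
   using M[of "g y"] by (auto simp: g1_def le_max_iff_disj split: split_indicator)
  have "(%n. LINT z|lborel. g1 (x + e n *\<^sub>R z) * complex_of_real (sqrt (2 * pi) ^ 3 * gauss 1 z)) \<longlonglongrightarrow> (LINT z|lborel. g x * complex_of_real (sqrt (2 * pi) ^ 3 * gauss 1 z))"
  proof (rule integral_dominated_convergence)
   show "integrable lborel (%z. max M 0 * (sqrt (2 * pi) ^ 3 * gauss 1 z))"
    by (intro integrable_mult_right gauss_integrable) simp
   show "AE z in lborel. (%n. g1 (x + e n *\<^sub>R z) * complex_of_real (sqrt (2 * pi) ^ 3 * gauss 1 z)) \<longlonglongrightarrow> g x * complex_of_real (sqrt (2 * pi) ^ 3 * gauss 1 z)"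
   proof (intro AE_I2 tendsto_mult_right)
    fix z
    have l: "(%n. x + e n *\<^sub>R z) \<longlonglongrightarrow> x + 0 *\<^sub>R z"
     unfolding e_def by (intro tendsto_intros LIMSEQ_Suc[OF lim_1_over_n])
    then have l2: "(%n. g (x + e n *\<^sub>R z)) \<longlonglongrightarrow> g x"
     using c by (intro isCont_tendsto_compose[of x g]) (auto simp: continuous_on_eq_continuous_at)
    have "\<forall>\<^sub>F n in sequentially. x + e n *\<^sub>R z : ball x 1"
     using l by (intro topological_tendstoD[where l = x]) auto
    then have "\<forall>\<^sub>F n in sequentially. g (x + e n *\<^sub>R z) = g1 (x + e n *\<^sub>R z)"
     by eventually_elim (simp add: g1_def)
    with l2 show "(%n. g1 (x + e n *\<^sub>R z)) \<longlonglongrightarrow> g x"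
     by (rule Lim_transform_eventually)
   qed
   show "AE z in lborel. norm (g1 (x + e n *\<^sub>R z) * complex_of_real (sqrt (2 * pi) ^ 3 * gauss 1 z)) <= max M 0 * (sqrt (2 * pi) ^ 3 * gauss 1 z)" for n
    using M1 by (intro AE_I2) (auto simp: norm_mult norm_power abs_mult gauss_pos[THEN less_imp_le] intro!: mult_right_mono)
  qed measurable
  also have "(LINT z|lborel. g x * complex_of_real (sqrt (2 * pi) ^ 3 * gauss 1 z)) = g x * complex_of_real (sqrt (2 * pi) ^ 3 * (LINT z|lborel. gauss 1 z))"
   by simp
  also have "complex_of_real (LINT x|lborel. gauss 1 x) = gauss_kernel 1 0"
   using gauss_fourier(2)[of 1 0] by simp
  then have "(LINT x|lborel. gauss 1 x) = sqrt (2 * pi) ^ 3"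
   by (simp only: of_real_eq_iff) (simp add: gauss_kernel_def gauss_def)
  then have "g x * complex_of_real (sqrt (2 * pi) ^ 3 * (LINT z|lborel. gauss 1 z)) = of_real ((2 * pi) ^ 3) * g x"
   by (simp add: power_mult_distrib[symmetric] mult.commute)
  finally show ?thesis unfolding eq .
 qed
 have "I \<longlonglongrightarrow> of_real ((2 * pi) ^ 3) * g x + 0"
  unfolding I_eq by (intro tendsto_add L3 L2)
 from LIMSEQ_unique[OF L1 this] show ?thesis by simp
qed

section \<open>Oscillatory integrals along a ray\<close>

lemma cauchy_schwarz_interval:
 fixes f g :: "real => real"
 assumes c: "continuous_on {a..b} f" "continuous_on {a..b} g"
  and A: "integral {a..b} (%l. (f l)^2) <= A^2" "A >= 0"
  and B: "integral {a..b} (%l. (g l)^2) <= B^2" "B >= 0"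
 shows "integral {a..b} (%l. f l * g l) <= A * B"
proof -
 let ?C = "integral {a..b} (%l. f l * g l)"
 have main: "?C <= (A + e) * (B + e)" if e: "e > 0" for e
 proof -
  \<comment> \<open>The optimal weight in f g <= c f^2 / 2 + g^2 / (2 c) is B/A; adding
    \<open>e\<close> keeps it positive when A or B vanishes, and \<open>e\<close> tends to 0 at the
    end.\<close>
  define c where "c = (B + e) / (A + e)"
  have c0: "c > 0" using A B e by (auto simp: c_def)
  have "f l * g l <= c / 2 * (f l)^2 + 1 / (2 * c) * (g l)^2" for l
  proof -
   have "0 <= (c * f l - g l)^2 / (2 * c)" using c0 by simp
   also have "... = c / 2 * (f l)^2 + 1 / (2 * c) * (g l)^2 - f l * g l"
    using c0 by (simp add: field_simps power2_eq_square)
   finally show ?thesis by simp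
  qed
  then have "?C <= integral {a..b} (%l. c / 2 * (f l)^2 + 1 / (2 * c) * (g l)^2)"
   by (intro integral_le integrable_continuous_interval continuous_intros c) auto
  also have "... = c / 2 * integral {a..b} (%l. (f l)^2) + 1 / (2 * c) * integral {a..b} (%l. (g l)^2)"
   by (subst Henstock_Kurzweil_Integration.integral_add)
     (use c0 in \<open>auto intro!: integrable_continuous_interval continuous_intros c\<close>)
  also have "... <= c / 2 * (A + e)^2 + 1 / (2 * c) * (B + e)^2"
   using c0 e A B by (intro add_mono mult_left_mono order_trans[OF A(1)] order_trans[OF B(1)] power_mono) auto
  also have "... = (A + e) * (B + e)"
  proof -
   have *: "y / x / 2 * x^2 + 1 / (2 * (y / x)) * y^2 = x * y" if "x > 0" "y > 0" for x y :: real
    using that by (simp add: field_simps power2_eq_square)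
   show ?thesis unfolding c_def by (rule *) (use A B e in auto)
  qed
  finally show ?thesis .
 qed
 have "(%n. (A + 1 / real (Suc n)) * (B + 1 / real (Suc n))) \<longlonglongrightarrow> (A + 0) * (B + 0)"
  by (intro tendsto_intros LIMSEQ_Suc[OF lim_1_over_n])
 then show ?thesis
  using main by (intro LIMSEQ_le_const[where a = "?C"]) auto
qed

text \<open>Cauchy-Schwarz against 1/l, whose square has integral at most 1/a over any interval that
  starts at a.\<close>

lemma l1_bound_inverse:
 fixes u :: "real => complex"
 assumes ab: "0 < a" "a <= b" and c: "continuous_on {a..b} u" and A: "A >= 0"
  and n: "integral {a..b} (%l. (l * norm (u l))^2) <= A^2"
 shows "integral {a..b} (%l. norm (u l)) <= A / sqrt a"
proof -
 have "((%l. (1 / l)^2) has_integral (- 1 / b) - (- 1 / a)) {a..b}"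
  by (rule fundamental_theorem_of_calculus)
    (use ab in \<open>auto intro!: derivative_eq_intros simp: has_real_derivative_iff_has_vector_derivative[symmetric] power2_eq_square\<close>)
 then have i: "integral {a..b} (%l. (1 / l)^2) <= (1 / sqrt a)^2"
  using ab by (simp add: integral_unique power_divide)
 have "integral {a..b} (%l. norm (u l)) = integral {a..b} (%l. (l * norm (u l)) * (1 / l))"
  using ab by (intro Henstock_Kurzweil_Integration.integral_cong) auto
 also have "... <= A * (1 / sqrt a)"
  by (rule cauchy_schwarz_interval[OF _ _ n A i]) (use ab in \<open>auto intro!: continuous_intros c\<close>)
 finally show ?thesis by simp
qed

lemma l1_bound_length:
 fixes u :: "real => complex"
 assumes ab: "a <= b" and c: "continuous_on {a..b} u" and A: "A >= 0"
  and n: "integral {a..b} (%l. (norm (u l))^2) <= A^2"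
 shows "integral {a..b} (%l. norm (u l)) <= A * sqrt (b - a)"
proof -
 have "integral {a..b} (%l. norm (u l) * 1) <= A * sqrt (b - a)"
  by (rule cauchy_schwarz_interval[OF _ _ n A]) (use ab in \<open>auto intro!: continuous_intros c\<close>)
 then show ?thesis by simp
qed

text \<open>Cauchy-Schwarz against (1 + l^2)^(-1/2), whose square has total integral pi < 2^2; the
  bound is uniform over all intervals.\<close>

lemma l1_bound_japanese:
 fixes u :: "real => complex"
 assumes ab: "a <= b" and c: "continuous_on {a..b} u" and A: "A >= 0"
  and n: "integral {a..b} (%l. (sqrt (1 + l^2) * norm (u l))^2) <= A^2"
 shows "integral {a..b} (%l. norm (u l)) <= 2 * A"
proof -
 have pos: "0 < 1 + l^2" for l :: real by (simp add: add_pos_nonneg)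
 have "((%l. (1 / sqrt (1 + l^2))^2) has_integral arctan b - arctan a) {a..b}"
  by (rule fundamental_theorem_of_calculus[OF ab])
    (use pos in \<open>auto intro!: derivative_eq_intros simp: has_real_derivative_iff_has_vector_derivative[symmetric] power_divide less_imp_le inverse_eq_divide\<close>)
 moreover have "arctan b - arctan a <= 2^2"
  using arctan_bounded[of a] arctan_bounded[of b] pi_less_4 by simp
 ultimately have i: "integral {a..b} (%l. (1 / sqrt (1 + l^2))^2) <= 2^2"
  by (simp add: integral_unique)
 have "integral {a..b} (%l. norm (u l)) = integral {a..b} (%l. (sqrt (1 + l^2) * norm (u l)) * (1 / sqrt (1 + l^2)))"
  using pos by (intro Henstock_Kurzweil_Integration.integral_cong) (auto simp: less_imp_neq[symmetric])
 also have "... <= A * 2"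
  by (rule cauchy_schwarz_interval[OF _ _ n A i]) (use pos in \<open>auto intro!: continuous_intros c simp: less_imp_neq[symmetric]\<close>)
 finally show ?thesis by simp
qed

text \<open>The value at l differs from the average over [l, 2l] by at most the variation there. As
  the interval has length l, the bound scales correctly for small and for large l.\<close>

lemma pointwise_dyadic:
 fixes f f' :: "real => complex"
 assumes l: "l > 0" and d: "!!r. r > 0 ==> (f has_vector_derivative f' r) (at r)" and c: "continuous_on {0<..} f'"
 shows "norm (f l) <= integral {l..2*l} (%r. norm (f r)) / l + integral {l..2*l} (%r. norm (f' r))"
proof -
 let ?A = "integral {l..2*l} (%r. norm (f' r))"
 have sub: "{l..2*l} \<subseteq> {0<..}" using l by auto
 have cf': "continuous_on {l..2*l} f'" by (rule continuous_on_subset[OF c sub])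
 have cf: "continuous_on {l..2*l} f"
  by (rule continuous_on_vector_derivative) (use l in \<open>auto intro: has_vector_derivative_at_within[OF d]\<close>)
 have le: "norm (f l) <= norm (f r) + ?A" if r: "r : {l..2*l}" for r
 proof -
  have I: "(f' has_integral f r - f l) {l..r}"
   by (rule fundamental_theorem_of_calculus) (use r l in \<open>auto intro: has_vector_derivative_at_within[OF d]\<close>)
  have subr: "{l..r} \<subseteq> {l..2*l}" using r by auto
  have "norm (integral {l..r} f') <= integral {l..r} (%r. norm (f' r))"
   by (rule integral_norm_bound_integral)
    (auto intro!: integrable_continuous_interval continuous_intros continuous_on_subset[OF cf' subr])
  also have "... <= ?A"
   by (rule integral_subset_le[OF subr])
     (auto intro!: integrable_continuous_interval continuous_intros cf' continuous_on_subset[OF cf' subr])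
  finally have "norm (f r - f l) <= ?A"
   using I by (simp add: integral_unique)
  then show ?thesis using norm_triangle_ineq3[of "f r" "f l"] by linarith
 qed
 have "l * norm (f l) = integral {l..2*l} (%r. norm (f l))" using l by simp
 also have "... <= integral {l..2*l} (%r. norm (f r) + ?A)"
  by (intro integral_le integrable_continuous_interval continuous_intros cf le) auto
 also have "... = integral {l..2*l} (%r. norm (f r)) + l * ?A"
  using l by (subst Henstock_Kurzweil_Integration.integral_add) (auto intro!: integrable_continuous_interval continuous_intros cf)
 finally show ?thesis using l by (simp add: field_simps)
qed

lemma oscillatory_ibp:
 fixes f f' :: "real => complex"
 assumes ab: "a <= b" and d: "!!r. r : {a..b} ==> (f has_vector_derivative f' r) (at r)" and c: "continuous_on {a..b} f'"
 shows "\<i> * of_real s * integral {a..b} (%r. cis (r * s) * f r) = cis (b * s) * f b - cis (a * s) * f a - integral {a..b} (%r. cis (r * s) * f' r)"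
  and "\<bar>s\<bar> * norm (integral {a..b} (%r. cis (r * s) * f r)) <= norm (f b) + norm (f a) + norm (integral {a..b} (%r. cis (r * s) * f' r))"
proof -
 let ?C = "integral {a..b} (%r. cis (r * s) * f r)"
 let ?B = "integral {a..b} (%r. cis (r * s) * f' r)"
 have cf: "continuous_on {a..b} f"
  by (rule continuous_on_vector_derivative) (auto intro: has_vector_derivative_at_within[OF d])
 have ci: "((%r. cis (r * s)) has_vector_derivative \<i> * of_real s * cis (r * s)) (at r)" for r
 proof -
  have "((%z. exp (\<i> * of_real s * z)) has_field_derivative exp (\<i> * of_real s * of_real r) * (\<i> * of_real s)) (at (of_real r))"
   by (auto intro!: derivative_eq_intros)
  from has_vector_derivative_real_field[OF this] show ?thesis
   by (simp add: cis_conv_exp mult_ac)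
 qed
 have cc: "continuous_on A (%r. cis (r * s))" for A
  by (auto intro!: continuous_intros simp: cis_conv_exp)
 have 1: "((%r. cis (r * s) * f' r + \<i> * of_real s * cis (r * s) * f r) has_integral cis (b * s) * f b - cis (a * s) * f a) {a..b}"
  by (rule fundamental_theorem_of_calculus[OF ab], rule has_vector_derivative_at_within, rule has_vector_derivative_mult[OF ci d])
 have 2: "((%r. cis (r * s) * f' r) has_integral ?B) {a..b}"
  by (intro integrable_integral integrable_continuous_interval continuous_intros c cc)
 have "((%r. \<i> * of_real s * (cis (r * s) * f r)) has_integral cis (b * s) * f b - cis (a * s) * f a - ?B) {a..b}"
  using has_integral_diff[OF 1 2] by (simp add: mult.assoc)
 then have "integral {a..b} (%r. \<i> * of_real s * (cis (r * s) * f r)) = cis (b * s) * f b - cis (a * s) * f a - ?B"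
  by (rule integral_unique)
 then show eq: "\<i> * of_real s * ?C = cis (b * s) * f b - cis (a * s) * f a - ?B"
  by simp
 have "\<bar>s\<bar> * norm ?C = norm (cis (b * s) * f b - cis (a * s) * f a - ?B)"
  by (subst eq[symmetric]) (simp add: norm_mult)
 also have "... <= norm (cis (b * s) * f b) + norm (cis (a * s) * f a) + norm ?B"
  by (intro order_trans[OF norm_triangle_ineq4] add_right_mono norm_triangle_ineq4)
 finally show "\<bar>s\<bar> * norm ?C <= norm (f b) + norm (f a) + norm ?B"
  by (simp add: norm_mult)
qed

lemma norm_integral_cis_le:
 fixes f :: "real => complex"
 assumes "continuous_on {a..b} f"
 shows "norm (integral {a..b} (%r. cis (r * s) * f r)) <= integral {a..b} (%r. norm (f r))"
proof -
 have cc: "continuous_on A (%r. cis (r * s))" for A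
  by (auto intro!: continuous_intros simp: cis_conv_exp)
 show ?thesis
  by (rule integral_norm_bound_integral)
   (auto intro!: integrable_continuous_interval continuous_intros cc assms simp: norm_mult)
qed

text \<open>\<open>V0\<close>, \<open>V1\<close>, \<open>V2\<close> are the twisted half waves of \<open>\<psi>\<close>, \<open>S \<psi>\<close>, \<open>S^2 \<psi>\<close> as functions of the frequency on a ray, \<open>P0\<close> and \<open>P1\<close> come from the forcing terms of the first two.\<close>

locale ray =
 fixes V0 V1 V2 P0 P1 :: "real => complex" and t K al0 al1 al2 beta0 beta1 :: real
 assumes t: "t >= 0"
  and d0: "!!l. l > 0 ==> ((%l. of_real (l^2) * V0 l) has_vector_derivative - (of_real l * (V1 l + of_real t * P0 l))) (at l)"
  and d1: "!!l. l > 0 ==> ((%l. of_real l * V1 l) has_vector_derivative - (V1 l + V2 l + of_real t * P1 l)) (at l)"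
  and c: "continuous_on {0<..} V1" "continuous_on {0<..} V2" "continuous_on {0<..} P0" "continuous_on {0<..} P1"
  and K: "!!l. l > 0 ==> norm (V0 l) <= K"
  and al: "al0 >= 0" "al1 >= 0" "al2 >= 0" "beta0 >= 0" "beta1 >= 0"
  and b0: "!!a b. 0 < a ==> a <= b ==> integral {a..b} (%l. (l * (1 + l^2) * norm (V0 l))^2) <= al0^2"
  and b1: "!!a b. 0 < a ==> a <= b ==> integral {a..b} (%l. (sqrt (1 + l^2) * (l * norm (V1 l)))^2) <= al1^2"
  and b2: "!!a b. 0 < a ==> a <= b ==> integral {a..b} (%l. (l * norm (V2 l))^2) <= al2^2"
  and b3: "!!a b. 0 < a ==> a <= b ==> integral {a..b} (%l. (sqrt (1 + l^2) * (l * norm (P0 l)))^2) <= beta0^2"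
  and b4: "!!a b. 0 < a ==> a <= b ==> integral {a..b} (%l. (l * norm (P1 l))^2) <= beta1^2"
begin

lemma cV: "0 < a ==> continuous_on {a..b} V1" "0 < a ==> continuous_on {a..b} V2"
 "0 < a ==> continuous_on {a..b} P0" "0 < a ==> continuous_on {a..b} P1"
 by (rule continuous_on_subset[OF c(1)], auto) (rule continuous_on_subset[OF c(2)], auto,
   rule continuous_on_subset[OF c(3)], auto, rule continuous_on_subset[OF c(4)], auto)

lemma cV0: "0 < a ==> continuous_on {a..b} V0"
proof -
 assume a: "0 < a"
 have "continuous_on {a..b} (%l. of_real (l^2) * V0 l)"
  by (rule continuous_on_vector_derivative, rule has_vector_derivative_at_within, rule d0) (use a in auto)
 note c0 = this
 have "continuous_on {a..b} (%l. of_real (1 / l^2) :: complex)"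
  using a by (intro continuous_intros) auto
 from continuous_on_mult[OF this c0]
 have "continuous_on {a..b} (%l. of_real (1 / l^2) * (of_real (l^2) * V0 l))" .
 then show ?thesis
  by (rule continuous_on_eq) (use a in auto)
qed

lemma weaken:
 assumes "0 < a" "a <= b" "continuous_on {a..b} u" "integral {a..b} (%l. (sqrt (1 + l^2) * (l * norm (u l)))^2) <= A"
 shows "integral {a..b} (%l. (l * norm (u l :: complex))^2) <= A"
  "integral {a..b} (%l. (l * (l * norm (u l)))^2) <= A"
proof -
 have 1: "(sqrt (1 + l^2))^2 = 1 + l^2" for l :: real by simp
 have i: "(%l. (sqrt (1 + l^2) * (l * norm (u l)))^2) integrable_on {a..b}" 
  "(%l. (l * norm (u l))^2) integrable_on {a..b}" "(%l. (l * (l * norm (u l)))^2) integrable_on {a..b}"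
  by (intro integrable_continuous_interval continuous_intros assms)+
 have "(l * norm (u l))^2 <= (sqrt (1 + l^2) * (l * norm (u l)))^2" "(l * (l * norm (u l)))^2 <= (sqrt (1 + l^2) * (l * norm (u l)))^2" for l
  unfolding power_mult_distrib[of "sqrt _"] power_mult_distrib[of l "l * _"] 1
  by (auto simp: distrib_right)
 then show "integral {a..b} (%l. (l * norm (u l))^2) <= A" "integral {a..b} (%l. (l * (l * norm (u l)))^2) <= A"
  using integral_le[OF i(2,1)] integral_le[OF i(3,1)] assms(4) by (meson order_trans)+
qed

text \<open>The constant that governs l V1. The summand \<open>al1\<close> enters twice: through the
  size of l V1 and through its derivative.\<close>

definition "M = 2 * al1 + al2 + t * beta1"

lemma M0: "M >= 0" using al t by (simp add: M_def)

lemma deriv1_bound: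
 assumes "0 < a" "a <= b"
 shows "integral {a..b} (%l. norm (V1 l + V2 l + of_real t * P1 l)) <= (al1 + al2 + t * beta1) / sqrt a"
proof -
 note cc = cV[OF assms(1), of b]
 have "integral {a..b} (%l. norm (V1 l + V2 l + of_real t * P1 l)) <= integral {a..b} (%l. norm (V1 l) + norm (V2 l) + t * norm (P1 l))"
 proof (rule integral_le)
  fix l
  show "norm (V1 l + V2 l + of_real t * P1 l) <= norm (V1 l) + norm (V2 l) + t * norm (P1 l)"
   using norm_triangle_ineq[of "V1 l + V2 l" "of_real t * P1 l"] norm_triangle_ineq[of "V1 l" "V2 l"] t by (simp add: norm_mult)
 qed (intro integrable_continuous_interval continuous_intros cc)+
 also have "... = integral {a..b} (%l. norm (V1 l)) + integral {a..b} (%l. norm (V2 l)) + t * integral {a..b} (%l. norm (P1 l))"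
  by (subst Henstock_Kurzweil_Integration.integral_add, (auto intro!: integrable_continuous_interval continuous_intros cc)[2])+ simp
 also have "... <= al1 / sqrt a + al2 / sqrt a + t * (beta1 / sqrt a)"
  by (intro add_mono mult_left_mono t l1_bound_inverse assms cc al weaken(1)[OF assms cc(1) b1[OF assms]] b2[OF assms] b4[OF assms])
 finally show ?thesis by (simp add: add_divide_distrib)
qed

lemma V1_pointwise:
 assumes l: "l > 0"
 shows "norm (of_real l * V1 l) <= M / sqrt l"
proof -
 let ?A = "integral {l..2*l}"
 let ?B = "?A (%r. norm (- (V1 r + V2 r + of_real t * P1 r)))"
 have a: "0 < l" "l <= 2 * l" using l by auto
 note cc = cV[OF a(1), of "2 * l"]
 have "norm (of_real l * V1 l) <= ?A (%r. norm (of_real r * V1 r)) / l + ?B"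
  by (rule pointwise_dyadic[OF l d1]) (auto intro!: continuous_intros c)
 also have "?B <= (al1 + al2 + t * beta1) / sqrt l"
  unfolding norm_minus_cancel by (rule deriv1_bound[OF a])
 also have "?A (%r. norm (of_real r * V1 r)) <= al1 * sqrt (2 * l - l)"
 proof (rule l1_bound_length[OF a(2) _ al(2)])
  have "?A (%r. (norm (of_real r * V1 r))^2) = ?A (%r. (r * norm (V1 r))^2)"
   using l by (intro Henstock_Kurzweil_Integration.integral_cong) (auto simp: norm_mult)
  then show "?A (%r. (norm (of_real r * V1 r))^2) <= al1^2"
   using weaken(1)[OF a cc(1) b1[OF a]] by simp
 qed (intro continuous_intros cc)
 also have "al1 * sqrt (2 * l - l) / l = al1 / sqrt l"
  using sqrt_divide_self_eq[of l] l by (simp add: divide_inverse mult.assoc)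
 finally show ?thesis using l by (simp add: M_def add_divide_distrib divide_right_mono)
qed

text \<open>The split is at the frequency 1/|s|. Below it the phase does not oscillate, and an L^2
  bound on an interval of length at most 1/|s| gives |s|^(-1/2). Above it one integration by parts
  gains 1/|s| and loses |s|^(1/2) through \<open>V1_pointwise\<close> and
  \<open>deriv1_bound\<close>. The 4 is 1 for the low part and 3 for two boundary terms and an
  integral.\<close>

lemma V1_oscillation:
 assumes ab: "0 < a" "a <= b" and s: "s ~= 0"
 shows "norm (integral {a..b} (%l. cis (l * s) * (of_real l * V1 l))) <= 4 * M / sqrt \<bar>s\<bar>"
proof -
 let ?D = "%l. cis (l * s) * - (V1 l + V2 l + of_real t * P1 l)"
 let ?C = "sqrt (1 / \<bar>s\<bar>)"
 let ?B = "%l. cis (l * s) * (of_real l * V1 l)"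
 have low: "norm (integral {a..c} ?B) <= M / sqrt \<bar>s\<bar>" if ac: "0 < a" "a <= c" "c <= 1 / \<bar>s\<bar>" for a c
 proof -
  note cc = cV[OF ac(1), of c]
  have "norm (integral {a..c} ?B) <= integral {a..c} (%l. norm (of_real l * V1 l))"
   by (rule norm_integral_cis_le) (intro continuous_intros cc)
  also have "... <= al1 * sqrt (c - a)"
  proof (rule l1_bound_length[OF ac(2) _ al(2)])
   have "integral {a..c} (%r. (norm (of_real r * V1 r))^2) = integral {a..c} (%r. (r * norm (V1 r))^2)"
    using ac by (intro Henstock_Kurzweil_Integration.integral_cong) (auto simp: norm_mult)
   then show "integral {a..c} (%r. (norm (of_real r * V1 r))^2) <= al1^2"
    using weaken(1)[OF ac(1,2) cc(1) b1[OF ac(1,2)]] by simp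
  qed (intro continuous_intros cc)
  also have "... <= M * ?C"
   using ac al t by (intro mult_mono) (auto simp: M_def)
  finally show ?thesis by (simp add: real_sqrt_divide)
 qed
 have high: "norm (integral {c..b} ?B) <= 3 * M / sqrt \<bar>s\<bar>" if cb: "c <= b" "1 / \<bar>s\<bar> <= c" for c b
 proof -
  have c0: "0 < c" using cb(2) s by (meson less_le_trans zero_less_abs_iff zero_less_divide_1_iff)
  note cc = cV[OF c0, of b]
  have e: "1 / sqrt c <= sqrt \<bar>s\<bar>" "1 / sqrt b <= sqrt \<bar>s\<bar>"
  proof -
   have "1 / sqrt r <= sqrt \<bar>s\<bar>" if "1 / \<bar>s\<bar> <= r" for r
   proof -
    have "?C <= sqrt r" using that by simp
    moreover have "0 < ?C" using s by simp
    ultimately have "1 / sqrt r <= 1 / ?C" by (intro divide_left_mono mult_pos_pos) linarith+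
    then show ?thesis by (simp add: real_sqrt_divide)
   qed
   then show "1 / sqrt c <= sqrt \<bar>s\<bar>" "1 / sqrt b <= sqrt \<bar>s\<bar>" using cb by auto
  qed
  have "\<bar>s\<bar> * norm (integral {c..b} ?B) <= norm (of_real b * V1 b) + norm (of_real c * V1 c) + norm (integral {c..b} ?D)"
  proof (rule oscillatory_ibp(2)[OF cb(1)])
   show "((%l. of_real l * V1 l) has_vector_derivative - (V1 r + V2 r + of_real t * P1 r)) (at r)" if "r : {c..b}" for r
    by (rule d1) (use c0 that in auto)
  qed (intro continuous_intros cc)
  also have "norm (integral {c..b} ?D) <= integral {c..b} (%l. norm (- (V1 l + V2 l + of_real t * P1 l)))"
   by (rule norm_integral_cis_le) (intro continuous_intros cc)
  also have "... <= (al1 + al2 + t * beta1) / sqrt c"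
   unfolding norm_minus_cancel by (rule deriv1_bound[OF c0 cb(1)])
  also have "... <= M * (1 / sqrt c)"
   using al c0 by (simp add: M_def divide_right_mono)
  also have "... <= M * sqrt \<bar>s\<bar>" by (intro mult_left_mono e M0)
  also have "norm (of_real b * V1 b) <= M * (1 / sqrt b)" using V1_pointwise[of b] c0 cb by simp
  also have "... <= M * sqrt \<bar>s\<bar>" by (intro mult_left_mono e M0)
  also have "norm (of_real c * V1 c) <= M * (1 / sqrt c)" using V1_pointwise[of c] c0 by simp
  also have "... <= M * sqrt \<bar>s\<bar>" by (intro mult_left_mono e M0)
  finally have "\<bar>s\<bar> * norm (integral {c..b} ?B) <= 3 * M * sqrt \<bar>s\<bar>" by (simp add: mult_ac)
  then have "norm (integral {c..b} ?B) <= 3 * M * sqrt \<bar>s\<bar> / \<bar>s\<bar>"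
   using s by (simp add: field_simps)
  also have "... = 3 * M / sqrt \<bar>s\<bar>"
   using s real_div_sqrt[of "\<bar>s\<bar>"] by (simp add: field_simps)
  finally show ?thesis .
 qed
 have "norm (integral {a..b} ?B) <= M / sqrt \<bar>s\<bar> + 3 * M / sqrt \<bar>s\<bar>"
 proof -
  have nn: "0 <= M / sqrt \<bar>s\<bar>" using M0 by simp
  consider "b <= 1 / \<bar>s\<bar>" | "1 / \<bar>s\<bar> <= a" | "a <= 1 / \<bar>s\<bar>" "1 / \<bar>s\<bar> <= b" by linarith
  then show ?thesis
  proof cases
   case 1
   then show ?thesis using low[OF ab(1,2)] nn by linarith
  next
   case 2
   then show ?thesis using high[OF ab(2)] nn by linarith
  next
   case 3
   have cc: "continuous_on A (%r. cis (r * s))" for A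
    by (auto intro!: continuous_intros simp: cis_conv_exp)
   have "integral {a..1 / \<bar>s\<bar>} ?B + integral {1 / \<bar>s\<bar>..b} ?B
    = integral {a..b} ?B"
    by (rule Henstock_Kurzweil_Integration.integral_combine[OF 3]) (intro integrable_continuous_interval continuous_intros cc cV ab)
   then show ?thesis
    using low[OF ab(1) 3(1)] high[OF 3(2)]
     norm_triangle_ineq[of "integral {a..1 / \<bar>s\<bar>} ?B" "integral {1 / \<bar>s\<bar>..b} ?B"]
    by simp
  qed
 qed
 then show ?thesis by simp
qed

text \<open>The product of (1 + l^2)^(1/2) and l^2 is at most l (1 + l^2), so \<open>b0\<close>
  feeds \<open>l1_bound_japanese\<close>.\<close>

lemma l1_V0:
 assumes xy: "0 < x" "x <= y"
 shows "integral {x..y} (%l. norm (of_real (l^2) * V0 l)) <= 2 * al0"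
proof (rule l1_bound_japanese[OF xy(2) _ al(1)])
 let ?A = "integral {x..y} (%l. (sqrt (1 + l^2) * norm (of_real (l^2) * V0 l))^2)"
 show "continuous_on {x..y} (%l. of_real (l^2) * V0 l)" by (intro continuous_intros cV0 xy)
 have le: "(sqrt (1 + l^2) * norm (of_real (l^2) * V0 l))^2 <= (l * (1 + l^2) * norm (V0 l))^2" for l
 proof -
  have "(sqrt (1 + l^2) * norm (of_real (l^2) * V0 l))^2 = (1 + l^2) * (l^2 * (l^2 * (norm (V0 l))^2))"
   by (simp add: power_mult_distrib norm_mult norm_power power2_eq_square[of "l^2"])
  also have "... <= (1 + l^2) * ((1 + l^2) * (l^2 * (norm (V0 l))^2))"
   by (intro mult_left_mono mult_right_mono) auto
  also have "... = (l * (1 + l^2) * norm (V0 l))^2"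
   by (simp add: power_mult_distrib power2_eq_square[of "1 + l^2"] mult_ac)
  finally show ?thesis .
 qed
 have "?A <= integral {x..y} (%l. (l * (1 + l^2) * norm (V0 l))^2)"
  by (intro integral_le integrable_continuous_interval continuous_intros cV0 xy le)
 also have "... <= al0^2" by (rule b0[OF xy])
 finally show "?A <= al0^2" .
qed

text \<open>The first integration by parts. The boundary term at \<open>a\<close> is small because
  V0 is bounded, the one at \<open>b\<close> by a dyadic average; both disappear as a tends to 0 and
  b to infinity. In the remaining integral only the \<open>V1\<close> part is integrated by parts
  again, through \<open>V1_oscillation\<close>; the forcing \<open>P0\<close> is estimated in
  absolute value.\<close>

lemma ray_bound:
 assumes ab: "0 < a" "a <= b" and s: "s ~= 0"
 shows "\<bar>s\<bar> * norm (integral {a..b} (%l. cis (l * s) * (of_real (l^2) * V0 l)))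
   <= a^2 * K + (2 * al0 / b + (al1 + t * beta0) / sqrt b) + (4 * M / sqrt \<bar>s\<bar> + 2 * t * beta0)"
proof -
 let ?L = "norm (of_real (b^2) * V0 b)"
 let ?G = "integral {a..b}"
 let ?J = "?G (%l. (sqrt (1 + l^2) * norm (of_real l * P0 l))^2)"
 let ?E = "?G (%l. cis (l * s) * (of_real l * V1 l))"
 let ?D = "?G (%l. cis (l * s) * - (of_real l * (V1 l + of_real t * P0 l)))"
 let ?C = "integral {b..2*b}"
 let ?I = "?C (%r. norm (of_real r * P0 r))"
 let ?H = "?C (%r. norm (of_real r * V1 r))"
 let ?F = "?C (%r. norm (- (of_real r * (V1 r + of_real t * P0 r))))"
 let ?B = "?G (%l. cis (l * s) * (of_real l * P0 l))"
 have b: "0 < b" "b <= 2 * b" using ab by auto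
 note cc = cV[OF ab(1), of b] and ccb = cV[OF b(1), of "2 * b"]
 have ci: "continuous_on A (%r. cis (r * s))" for A
  by (auto intro!: continuous_intros simp: cis_conv_exp)
 have fa: "norm (of_real (a^2) * V0 a) <= a^2 * K"
  using K[OF ab(1)] by (simp add: norm_mult norm_power mult_left_mono)
 have fb: "?L <= 2 * al0 / b + (al1 + t * beta0) / sqrt b"
 proof -
  have "?L <= ?C (%r. norm (of_real (r^2) * V0 r)) / b + ?F"
   by (rule pointwise_dyadic[OF b(1) d0]) (auto intro!: continuous_intros c)
  note 0 = this
  have "?F <= ?C (%r. norm (of_real r * V1 r) + t * norm (of_real r * P0 r))"
  proof (rule integral_le)
   fix r
   show "norm (- (of_real r * (V1 r + of_real t * P0 r))) <= norm (of_real r * V1 r) + t * norm (of_real r * P0 r)"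
    unfolding norm_minus_cancel
    using norm_triangle_ineq[of "of_real r * V1 r" "of_real t * (of_real r * P0 r)"] t by (simp add: norm_mult algebra_simps)
  qed (intro integrable_continuous_interval continuous_intros ccb)+
  also have "... = ?H + t * ?I"
   by (subst Henstock_Kurzweil_Integration.integral_add) (auto intro!: integrable_continuous_interval continuous_intros ccb)
  finally have 1: "?F <= ?H + t * ?I" .
  have 2: "?H <= al1 / sqrt b"
  proof (rule l1_bound_inverse[OF b _ al(2)])
   have "?C (%l. (l * norm (of_real l * V1 l))^2) = ?C (%l. (l * (l * norm (V1 l)))^2)"
    using b by (intro Henstock_Kurzweil_Integration.integral_cong) (auto simp: norm_mult)
   then show "?C (%l. (l * norm (of_real l * V1 l))^2) <= al1^2"
    using weaken(2)[OF b ccb(1) b1[OF b]] by simp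
  qed (intro continuous_intros ccb)
  have 3: "?I <= beta0 / sqrt b"
  proof (rule l1_bound_inverse[OF b _ al(4)])
   have "?C (%l. (l * norm (of_real l * P0 l))^2) = ?C (%l. (l * (l * norm (P0 l)))^2)"
    using b by (intro Henstock_Kurzweil_Integration.integral_cong) (auto simp: norm_mult)
   then show "?C (%l. (l * norm (of_real l * P0 l))^2) <= beta0^2"
    using weaken(2)[OF b ccb(3) b3[OF b]] by simp
  qed (intro continuous_intros ccb)
  have 4: "?C (%r. norm (of_real (r^2) * V0 r)) / b <= 2 * al0 / b"
   by (rule divide_right_mono[OF l1_V0[OF b]]) (use b in simp)
  have "(al1 + t * beta0) / sqrt b = al1 / sqrt b + t * (beta0 / sqrt b)" by (simp add: add_divide_distrib)
  then show ?thesis using 0 1 2 4 mult_left_mono[OF 3 t] by linarith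
 qed
 have "norm ?D <= 4 * M / sqrt \<bar>s\<bar> + 2 * t * beta0"
 proof -
  have "?D
    = ?G (%l. - (cis (l * s) * (of_real l * V1 l)) - of_real t * (cis (l * s) * (of_real l * P0 l)))"
   by (simp add: algebra_simps)
  also have "... = - ?E - of_real t * ?B"
   by (subst Henstock_Kurzweil_Integration.integral_diff) (auto intro!: integrable_continuous_interval continuous_intros cc ci)
  also have "norm ... <= norm ?E + t * norm ?B"
   using norm_triangle_ineq4[of "- ?E" "of_real t * ?B"] t
   by (simp add: norm_mult)
  finally have 5: "norm ?D <= norm ?E + t * norm ?B" .
  have "norm ?B <= ?G (%l. norm (of_real l * P0 l))"
   by (rule norm_integral_cis_le) (intro continuous_intros cc)
  also have "... <= 2 * beta0"
  proof (rule l1_bound_japanese[OF ab(2) _ al(4)])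
   have "?J = ?G (%l. (sqrt (1 + l^2) * (l * norm (P0 l)))^2)"
    using ab by (intro Henstock_Kurzweil_Integration.integral_cong) (auto simp: norm_mult)
   then show "?J <= beta0^2"
    using b3[OF ab] by simp
  qed (intro continuous_intros cc)
  finally have 6: "norm ?B <= 2 * beta0" .
  show ?thesis using 5 V1_oscillation[OF ab s] mult_left_mono[OF 6 t] by linarith
 qed
 moreover have "\<bar>s\<bar> * norm (?G (%l. cis (l * s) * (of_real (l^2) * V0 l)))
   <= ?L + norm (of_real (a^2) * V0 a) + norm ?D"
 proof (rule oscillatory_ibp(2)[OF ab(2)])
  show "((%l. of_real (l^2) * V0 l) has_vector_derivative - (of_real r * (V1 r + of_real t * P0 r))) (at r)" if "r : {a..b}" for r
   by (rule d0) (use ab that in auto)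
 qed (intro continuous_intros cc)
 ultimately show ?thesis using fa fb by linarith
qed

lemma ray_trivial:
 assumes ab: "0 < a" "a <= b"
 shows "norm (integral {a..b} (%l. cis (l * s) * (of_real (l^2) * V0 l))) <= 2 * al0"
 by (rule order_trans[OF norm_integral_cis_le l1_V0]) (intro continuous_intros cV0 ab)+

end

section \<open>Half waves in polar frequency coordinates\<close>

text \<open>For p the gradient of a wave and w the direction of \<xi> this is the transform of
  \<partial>_t \<psi> plus i eps |\<xi>| times that of \<psi>, which evolves freely by the phase
  exp(i eps t |\<xi>|). Written through p alone, it also makes sense for cut gradients.\<close>

definition half_wave :: "real => (coord => space => complex) => space => space => complex" where
 "half_wave eps p w xi = fourier (p Time) xi + of_real eps * (SUM i:UNIV. of_real (w $ i) * fourier (p (Space i)) xi)"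

text \<open>The model is \<open>p = \<partial>\<psi>(t)\<close>, \<open>q = \<partial>(S \<psi>)(t)\<close> and \<open>F = \<box>\<psi>(t)\<close>: the wave equation removes the second time derivative from \<open>q\<close>, so that Gaussian cutoffs of \<open>p\<close> are admissible too.\<close>

definition wave_system :: "real => (coord => space => complex) => (coord => 3 => space => complex) =>
  (coord => space => complex) => (space => complex) => bool" where
 "wave_system t p Dp q F \<longleftrightarrow>
   (\<forall>mu. has_gradient (p mu) (Dp mu)) \<and> (\<forall>mu. integrable lborel (p mu)) \<and> (\<forall>mu i. integrable lborel (Dp mu i)) \<and>
   (\<forall>mu. integrable lborel (%x. SUM k:UNIV. (x $ k) *\<^sub>R Dp mu k x)) \<and> integrable lborel F \<and>
   (\<forall>i x. q (Space i) x = t *\<^sub>R Dp Time i x + p (Space i) x + (SUM k:UNIV. (x $ k) *\<^sub>R Dp (Space i) k x)) \<and>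
   (\<forall>x. q Time x = p Time x + t *\<^sub>R (SUM i:UNIV. Dp (Space i) i x) + (SUM k:UNIV. (x $ k) *\<^sub>R Dp Time k x) - t *\<^sub>R F x)"

lemma fourier_add: "integrable lborel f ==> integrable lborel g ==> fourier (%x. f x + g x) xi = fourier f xi + fourier g xi"
 unfolding fourier_def by (simp add: distrib_left fourier_integrable Bochner_Integration.integral_add)

lemma fourier_diff: "integrable lborel f ==> integrable lborel g ==> fourier (%x. f x - g x) xi = fourier f xi - fourier g xi"
 unfolding fourier_def by (simp add: right_diff_distrib fourier_integrable Bochner_Integration.integral_diff)

lemma fourier_scaleR: "fourier (%x. c *\<^sub>R f x) xi = of_real c * fourier f xi"
 unfolding fourier_def by (simp add: scaleR_conv_of_real mult.left_commute)

lemma fourier_sum: "(!!i. i : I ==> integrable lborel (f i)) ==> fourier (%x. SUM i:I. f i x) xi = (SUM i:I. fourier (f i) xi)"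
 unfolding fourier_def by (simp add: sum_distrib_left fourier_integrable)

lemma wave_system_q_integrable:
 assumes "wave_system t p Dp q F"
 shows "integrable lborel (q mu)"
proof -
 let ?A = "integrable lborel"
 have 1: "q (Space i) = (%x. t *\<^sub>R Dp Time i x + p (Space i) x + (SUM k:UNIV. (x $ k) *\<^sub>R Dp (Space i) k x))"
  "q Time = (%x. p Time x + t *\<^sub>R (SUM i:UNIV. Dp (Space i) i x) + (SUM k:UNIV. (x $ k) *\<^sub>R Dp Time k x) - t *\<^sub>R F x)" for i
  using assms by (auto simp: wave_system_def)
 have "?A (p mu)" "?A (Dp mu i)" "?A (%x. SUM k:UNIV. (x $ k) *\<^sub>R Dp mu k x)" "?A F" for mu i
  using assms by (auto simp: wave_system_def)
 note i = this
 have "?A (%x. SUM i:UNIV. Dp (Space i) i x)"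
  by (intro Bochner_Integration.integrable_sum i)
 with i show ?thesis
  by (cases mu) (auto simp only: 1 intro!: Bochner_Integration.integrable_add Bochner_Integration.integrable_diff integrable_scaleR_right)
qed

lemma fourier_ray_deriv:
 assumes g: "has_gradient g Dg" and i: "integrable lborel g" 
  and iD: "integrable lborel (%x. SUM i:UNIV. (x $ i) *\<^sub>R Dg i x)" and l: "l > 0"
 shows "((%r. fourier g (r *\<^sub>R ome)) has_vector_derivative
   - of_real (1 / l) * (3 * fourier g (l *\<^sub>R ome) + fourier (%x. SUM i:UNIV. (x $ i) *\<^sub>R Dg i x) (l *\<^sub>R ome))) (at l)"
proof -
 let ?A = "l *\<^sub>R ome"
 let ?d = "fourier (%x. SUM i:UNIV. (x $ i) *\<^sub>R Dg i x) ?A"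
 have "((%r. inverse (r ^ 3)) has_field_derivative - 3 / l ^ 4) (at l)"
  using l by (auto intro!: derivative_eq_intros simp: field_simps eval_nat_numeral)
 from has_vector_derivative_scaleR[OF this fourier_radial_deriv[OF g i iD l, of ome]]
 have "((%r. inverse (r ^ 3) *\<^sub>R (of_real (r ^ 3) * fourier g (r *\<^sub>R ome))) has_vector_derivative
   inverse (l ^ 3) *\<^sub>R (- of_real (l^2) * ?d) + (- 3 / l ^ 4) *\<^sub>R (of_real (l ^ 3) * fourier g ?A)) (at l)" .
 also have "inverse (l ^ 3) *\<^sub>R (- of_real (l^2) * ?d) + (- 3 / l ^ 4) *\<^sub>R (of_real (l ^ 3) * fourier g ?A)
   = - of_real (1 / l) * (3 * fourier g ?A + ?d)"
  using l by (simp add: scaleR_conv_of_real[of _ "z :: complex" for z] field_simps eval_nat_numeral)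
 finally show ?thesis
  by (rule has_vector_derivative_transform_within_open[of _ _ _ "{0<..}"])
   (use l in \<open>auto simp: scaleR_conv_of_real[of _ "z :: complex" for z]\<close>)
qed

text \<open>In frequency x.grad becomes -(3 + l d/dl), and \<open>wave_system\<close> expresses it
  through q, p, F and t times derivatives of p. The coefficient 2 is 3 minus the copy of p contained
  in q. The terms with t exchange the time component and the w-component of p; the half waves are
  the eigenvectors of this exchange, by eps^2 = 1.\<close>

lemma half_wave_deriv:
 assumes W: "wave_system t p Dp q F" and eps: "eps * eps = 1" and w: "norm w = 1" and l: "l > 0"
 shows "((%l. half_wave eps p w (l *\<^sub>R w)) has_vector_derivative
   \<i> * of_real (eps * t) * half_wave eps p w (l *\<^sub>R w)
   - of_real (1 / l) * (2 * half_wave eps p w (l *\<^sub>R w) + half_wave eps q w (l *\<^sub>R w) + of_real t * fourier F (l *\<^sub>R w))) (at l)"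
proof -
 let ?E = "integrable lborel"
 let ?A = "of_real eps"
 have g: "has_gradient (p mu) (Dp mu)" and ip: "?E (p mu)" and iDp: "?E (Dp mu i)"
  and iD: "?E (%x. SUM k:UNIV. (x $ k) *\<^sub>R Dp mu k x)" and iF: "?E F" for mu i
  using W by (auto simp: wave_system_def)
 have q: "q (Space i) = (%x. t *\<^sub>R Dp Time i x + p (Space i) x + (SUM k:UNIV. (x $ k) *\<^sub>R Dp (Space i) k x))"
  "q Time = (%x. p Time x + t *\<^sub>R (SUM i:UNIV. Dp (Space i) i x) + (SUM k:UNIV. (x $ k) *\<^sub>R Dp Time k x) - t *\<^sub>R F x)" for i
  using W by (auto simp: wave_system_def)
 define P where "P mu = fourier (p mu) (l *\<^sub>R w)" for mu
 define Q where "Q mu = fourier (q mu) (l *\<^sub>R w)" for mu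
 let ?B = "SUM i:UNIV. of_real (w $ i) * Q (Space i)"
 define D where "D mu = fourier (%x. SUM k:UNIV. (x $ k) *\<^sub>R Dp mu k x) (l *\<^sub>R w)" for mu
 let ?C = "SUM i:UNIV. of_real (w $ i) * D (Space i)"
 define FF where "FF = fourier F (l *\<^sub>R w)"
 have fd: "fourier (Dp mu i) (l *\<^sub>R w) = \<i> * of_real (l * (w $ i)) * P mu" for mu i
  unfolding P_def by (subst fourier_deriv[OF g ip iDp]) simp
 have Qs: "Q (Space i) = of_real t * (\<i> * of_real (l * (w $ i)) * P Time) + P (Space i) + D (Space i)" for i
  unfolding Q_def q P_def[of "Space i"] D_def
  by (subst fourier_add, intro Bochner_Integration.integrable_add integrable_scaleR_right iDp ip, rule iD,
    subst fourier_add, intro integrable_scaleR_right iDp, rule ip) (simp only: fourier_scaleR fd)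
 have iS: "?E (%x. SUM i:UNIV. Dp (Space i) i x)"
  by (intro Bochner_Integration.integrable_sum iDp)
 have Qt: "Q Time = P Time + of_real t * (SUM i:UNIV. \<i> * of_real (l * (w $ i)) * P (Space i)) + D Time - of_real t * FF"
  unfolding Q_def q P_def[of Time] D_def FF_def
  by (subst fourier_diff, intro Bochner_Integration.integrable_add integrable_scaleR_right ip iS, rule iD, intro integrable_scaleR_right iF,
    subst fourier_add, intro Bochner_Integration.integrable_add integrable_scaleR_right ip iS, rule iD,
    subst fourier_add, rule ip, intro integrable_scaleR_right iS)
    (simp only: fourier_scaleR fd fourier_sum[OF iDp])
 have d: "((%r. fourier (p mu) (r *\<^sub>R w)) has_vector_derivative - of_real (1 / l) * (3 * P mu + D mu)) (at l)" for mu
  unfolding P_def D_def by (rule fourier_ray_deriv[OF g ip iD l])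
 define s where "s = (SUM i:UNIV. of_real (w $ i) * P (Space i))"
 have ww: "(SUM i:UNIV. complex_of_real (w $ i) * complex_of_real (w $ i)) = 1"
 proof -
  have "(SUM i:UNIV. (w $ i) * (w $ i)) = 1" using w by (simp add: norm_eq_1 inner_vec_def)
  then show ?thesis by (simp only: of_real_mult[symmetric] of_real_sum[symmetric] of_real_1)
 qed
 have 0: "((%l. half_wave eps p w (l *\<^sub>R w)) has_vector_derivative
   - of_real (1 / l) * (3 * P Time + D Time) + ?A * (SUM i:UNIV. of_real (w $ i) * (- of_real (1 / l) * (3 * P (Space i) + D (Space i))))) (at l)"
  unfolding half_wave_def
  by (intro has_vector_derivative_add d has_vector_derivative_mult_right has_vector_derivative_sum)
 have U: "half_wave eps p w (l *\<^sub>R w) = P Time + ?A * s"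
  by (simp add: half_wave_def P_def s_def)
 have QU: "half_wave eps q w (l *\<^sub>R w) = Q Time + ?A * ?B"
  by (simp add: half_wave_def Q_def)
 have e1: "?C = ?B - \<i> * of_real (t * l) * P Time - s"
 proof -
  have "?B = (SUM i:UNIV. (\<i> * of_real (t * l) * P Time) * (of_real (w $ i) * of_real (w $ i)) + of_real (w $ i) * P (Space i) + of_real (w $ i) * D (Space i))"
   unfolding Qs by (intro sum.cong refl) (simp add: algebra_simps)
  also have "... = \<i> * of_real (t * l) * P Time + s + ?C"
   unfolding sum.distrib sum_distrib_left[symmetric] ww s_def by simp
  finally show ?thesis by simp
 qed
 have e2: "D Time = Q Time - P Time - \<i> * of_real (t * l) * s + of_real t * FF"
  unfolding Qt s_def by (simp add: sum_distrib_left mult_ac)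
 have e3: "(SUM i:UNIV. of_real (w $ i) * (- of_real (1 / l) * (3 * P (Space i) + D (Space i)))) = - of_real (1 / l) * (3 * s + ?C)"
  unfolding s_def by (simp add: sum_distrib_left sum.distrib[symmetric] sum_negf[symmetric] algebra_simps)
 have ee: "complex_of_real eps * complex_of_real eps = 1"
  using eps by (metis of_real_1 of_real_mult)
 have l0: "complex_of_real l ~= 0" using l by simp
 have fin: "- of_real (1 / l) * (3 * P Time + D Time) + ?A * (- of_real (1 / l) * (3 * s + ?C))
  = \<i> * of_real (eps * t) * (P Time + ?A * s)
   - of_real (1 / l) * (2 * (P Time + ?A * s) + half_wave eps q w (l *\<^sub>R w) + of_real t * FF)"
 proof -
  define R where "R = ?B"
  define c where "c = complex_of_real (1 / l)"
  have cl: "c * complex_of_real l = 1" using l by (simp add: c_def)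
  have "- c * (3 * P Time + D Time) + ?A * (- c * (3 * s + (R - \<i> * of_real (t * l) * P Time - s)))
   = - c * (2 * (P Time + ?A * s) + (Q Time + ?A * R) + of_real t * FF) 
    + \<i> * of_real t * (c * of_real l) * (s + ?A * P Time)"
   unfolding e2 by (simp add: algebra_simps)
  also have "s + ?A * P Time = ?A * (P Time + ?A * s)"
   using ee by (simp add: algebra_simps mult.assoc[symmetric])
  finally show ?thesis unfolding QU e1 R_def[symmetric] c_def[symmetric] cl by (simp add: algebra_simps)
 qed
 show ?thesis using 0 unfolding e3 fin U FF_def .
qed

text \<open>The phase removes the term i eps t, and the weight l^2 absorbs the coefficient 2
  altogether. After the first integration by parts the weight is l; it absorbs only half of the
  coefficient, whence the extra \<open>V l\<close> in the second form.\<close>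

lemma half_wave_twisted_deriv:
 assumes W: "wave_system t p Dp q F" and eps: "eps * eps = 1" and w: "norm w = 1" and l: "l > 0"
 defines "V \<equiv> %l. cis (- (eps * t * l)) * half_wave eps p w (l *\<^sub>R w)"
  and "VQ \<equiv> %l. cis (- (eps * t * l)) * half_wave eps q w (l *\<^sub>R w)"
  and "P \<equiv> %l. cis (- (eps * t * l)) * fourier F (l *\<^sub>R w)"
 shows "((%l. of_real (l^2) * V l) has_vector_derivative - (of_real l * (VQ l + of_real t * P l))) (at l)"
  and "((%l. of_real l * V l) has_vector_derivative - (V l + VQ l + of_real t * P l)) (at l)"
proof -
 let ?A = "\<i> * of_real (eps * t)"
 have c: "((%l. cis (- (eps * t * l))) has_vector_derivative - ?A * cis (- (eps * t * l))) (at l)"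
 proof -
  have "((%z. exp (- ?A * z)) has_field_derivative exp (- ?A * of_real l) * - ?A) (at (of_real l))"
   by (auto intro!: derivative_eq_intros)
  from has_vector_derivative_real_field[OF this] show ?thesis
   by (simp add: cis_conv_exp mult_ac)
 qed
 have l0: "complex_of_real l ~= 0" using l by simp
 have V: "(V has_vector_derivative - (of_real (1 / l) * (2 * V l + VQ l + of_real t * P l))) (at l)"
  using has_vector_derivative_mult[OF c half_wave_deriv[OF W eps w l]]
  unfolding V_def VQ_def P_def by (simp add: algebra_simps)
 have a: "((%l. complex_of_real (l^2)) has_vector_derivative of_real (2 * l)) (at l)"
  by (rule has_vector_derivative_of_real)
   (auto intro!: derivative_eq_intros simp: has_real_derivative_iff_has_vector_derivative[symmetric])
 have b: "((%l. complex_of_real l) has_vector_derivative 1) (at l)"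
  using has_vector_derivative_of_real[of "%x. x" 1 "at l"] by (simp add: has_real_derivative_iff_has_vector_derivative[symmetric])
 show "((%l. of_real (l^2) * V l) has_vector_derivative - (of_real l * (VQ l + of_real t * P l))) (at l)"
 proof -
  have "of_real (l^2) * - (of_real (1 / l) * (2 * V l + VQ l + of_real t * P l)) + of_real (2 * l) * V l = - (of_real l * (VQ l + of_real t * P l))"
   using l0 by (simp add: field_simps power2_eq_square)
  with has_vector_derivative_mult[OF a V] show ?thesis by (simp only:)
 qed
 show "((%l. of_real l * V l) has_vector_derivative - (V l + VQ l + of_real t * P l)) (at l)"
 proof -
  have "of_real l * - (of_real (1 / l) * (2 * V l + VQ l + of_real t * P l)) + 1 * V l = - (V l + VQ l + of_real t * P l)"
   using l0 by (simp add: field_simps)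
  with has_vector_derivative_mult[OF b V] show ?thesis by (simp only:)
 qed
qed

section \<open>Passage between rays and space, and integrals over the directions\<close>

lemma radial_slice:
 fixes u h :: "real => real"
 assumes ab: "0 < a" and c: "continuous_on {a..b} u" and le: "!!l. l : {a..b} ==> \<bar>u l\<bar> <= l * h l"
  and m: "h : borel_measurable borel" and n: "(\<integral>\<^sup>+r. ennreal ((h r)^2) \<partial>radial_measure) <= ennreal (A^2)"
 shows "integral {a..b} (%l. (u l)^2) <= A^2"
proof -
 have cu: "continuous_on {a..b} (%l. (u l)^2)" by (intro continuous_intros c)
 have si: "set_integrable lborel {a..b} (%l. (u l)^2)" by (rule borel_integrable_atLeastAtMost'[OF cu])
 have "ennreal (integral {a..b} (%l. (u l)^2)) = ennreal (LINT l|lborel. indicator {a..b} l *\<^sub>R (u l)^2)"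
  using set_integral_continuous_Icc[OF cu] by (simp add: set_lebesgue_integral_def)
 also have "... = (\<integral>\<^sup>+l. ennreal (indicator {a..b} l *\<^sub>R (u l)^2) \<partial>lborel)"
  using si unfolding set_integrable_def by (intro nn_integral_eq_integral[symmetric]) (auto split: split_indicator)
 also have "... <= (\<integral>\<^sup>+r. ennreal (r^2) * indicator {0<..} r * ennreal ((h r)^2) \<partial>lborel)"
 proof (rule nn_integral_mono)
  fix r :: real
  show "ennreal (indicator {a..b} r *\<^sub>R (u r)^2) <= ennreal (r^2) * indicator {0<..} r * ennreal ((h r)^2)"
  proof (cases "r : {a..b}")
   case True
   then have "(u r)^2 <= (r * h r)^2" using power_mono[OF le[OF True], of 2] by simp
   then show ?thesis using True ab by (simp add: ennreal_mult[symmetric] power_mult_distrib ennreal_leI)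
  qed simp
 qed
 also have "... = (\<integral>\<^sup>+r. ennreal ((h r)^2) \<partial>radial_measure)"
  using m by (subst nn_integral_radial_measure) auto
 also note n
 finally show ?thesis by (simp add: ennreal_le_iff)
qed

lemma radial_integral_limit:
 fixes f :: "real => complex"
 assumes f: "integrable radial_measure f" and c: "continuous_on {0<..} f"
 shows "(%n. integral {1 / real (Suc n)..real (Suc n)} (%r. of_real (r^2) * f r)) \<longlonglongrightarrow> (LINT r|radial_measure. f r)"
proof -
 let ?A = "indicator {0<..}"
 have m[measurable]: "f : borel_measurable borel"
  using f by (auto simp: measurable_cong_sets[OF sets_radial_measure refl])
 have dens: "radial_measure = density lborel (%r. ennreal (r^2 * ?A r))"
  unfolding radial_measure_def by (intro density_cong AE_I2) (auto split: split_indicator)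
 have i: "integrable lborel (%r. (r^2 * ?A r) *\<^sub>R f r)"
  using f unfolding dens by (subst (asm) integrable_density) auto
 have I: "(LINT r|radial_measure. f r) = (LINT r|lborel. (r^2 * ?A r) *\<^sub>R f r)"
  unfolding dens by (subst integral_density) auto
 have eq: "integral {1 / real (Suc n)..real (Suc n)} (%r. of_real (r^2) * f r)
   = (LINT r|lborel. indicator {1 / real (Suc n)..real (Suc n)} r *\<^sub>R (of_real (r^2) * f r))" for n
 proof -
  have "continuous_on {1 / real (Suc n)..real (Suc n)} f"
  proof (rule continuous_on_subset[OF c])
   have "0 < 1 / real (Suc n)" by simp
   then show "{1 / real (Suc n)..real (Suc n)} \<subseteq> {0<..}"
    unfolding subset_iff greaterThan_iff atLeastAtMost_iff by (metis less_le_trans)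
  qed
  then have "continuous_on {1 / real (Suc n)..real (Suc n)} (%r. of_real (r^2) * f r)" by (intro continuous_intros)
  from set_integral_continuous_Icc[OF this] show ?thesis by (simp add: set_lebesgue_integral_def)
 qed
 show ?thesis unfolding I eq
 proof (rule integral_dominated_convergence)
  show "integrable lborel (%r. norm ((r^2 * ?A r) *\<^sub>R f r))" using i by (rule integrable_norm)
  show "AE r in lborel. (%n. indicator {1 / real (Suc n)..real (Suc n)} r *\<^sub>R (of_real (r^2) * f r)) \<longlonglongrightarrow> (r^2 * ?A r) *\<^sub>R f r"
  proof (intro AE_I2)
   fix r :: real
   show "(%n. indicator {1 / real (Suc n)..real (Suc n)} r *\<^sub>R (of_real (r^2) * f r)) \<longlonglongrightarrow> (r^2 * ?A r) *\<^sub>R f r"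
   proof (cases "r > 0")
    case True
    obtain N1 where N1: "r <= real N1" using real_arch_simple by blast
    obtain N2 where N2: "1 / r <= real N2" using real_arch_simple by blast
    have "\<forall>\<^sub>F n in sequentially. indicator {1 / real (Suc n)..real (Suc n)} r *\<^sub>R (of_real (r^2) * f r) = (r^2 * ?A r) *\<^sub>R f r"
    proof (rule eventually_sequentiallyI[of "max N1 N2"])
     fix n assume n: "max N1 N2 <= n"
     have "r <= real (Suc n)" using N1 n by simp
     moreover have "1 / r <= real (Suc n)" using N2 n by simp
     then have "1 / real (Suc n) <= r" using True by (simp add: field_simps)
     ultimately show "indicator {1 / real (Suc n)..real (Suc n)} r *\<^sub>R (of_real (r^2) * f r) = (r^2 * ?A r) *\<^sub>R f r"
      using True by (simp add: scaleR_conv_of_real)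
    qed
    then show ?thesis by (rule tendsto_eventually)
   next
    case False
    have "r \<notin> {1 / real (Suc n)..real (Suc n)}" for n
    proof -
     have "0 < 1 / real (Suc n)" by simp
     then show ?thesis using False unfolding atLeastAtMost_iff by linarith
    qed
    then show ?thesis using False by (simp del: of_nat_Suc)
   qed
  qed
  show "AE r in lborel. norm (indicator {1 / real (Suc n)..real (Suc n)} r *\<^sub>R (of_real (r^2) * f r)) <= norm ((r^2 * ?A r) *\<^sub>R f r)" for n
  proof (intro AE_I2)
   fix r :: real
   have "0 < 1 / real (Suc n)" by simp
   then have "r > 0" if "r : {1 / real (Suc n)..real (Suc n)}" using that unfolding atLeastAtMost_iff by linarith
   then show "norm (indicator {1 / real (Suc n)..real (Suc n)} r *\<^sub>R (of_real (r^2) * f r)) <= norm ((r^2 * ?A r) *\<^sub>R f r)"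
    by (cases "r : {1 / real (Suc n)..real (Suc n)}") (auto simp: norm_mult norm_power simp del: of_nat_Suc)
  qed
 qed measurable
qed

lemma cauchy_schwarz_nn:
 assumes m: "f : borel_measurable M" "g : borel_measurable M"
  and nn: "!!x. f x >= 0" "!!x. g x >= (0::real)"
  and f: "(\<integral>\<^sup>+x. ennreal ((f x)^2) \<partial>M) <= ennreal (A^2)" and g: "(\<integral>\<^sup>+x. ennreal ((g x)^2) \<partial>M) <= ennreal (B^2)"
  and AB: "A >= 0" "B >= 0"
 shows "(\<integral>\<^sup>+x. ennreal (f x * g x) \<partial>M) <= ennreal (A * B)"
proof -
 have "(\<integral>\<^sup>+x. ennreal (f x) * ennreal (g x) \<partial>M)^2 <= (\<integral>\<^sup>+x. (ennreal (f x))^2 \<partial>M) * (\<integral>\<^sup>+x. (ennreal (g x))^2 \<partial>M)"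
  by (rule Cauchy_Schwarz_nn_integral) (use m in auto)
 also have "... <= ennreal (A^2) * ennreal (B^2)"
  using f g nn by (intro mult_mono) (simp_all add: ennreal_power)
 also have "... = (ennreal (A * B))^2"
  using AB by (simp add: ennreal_mult[symmetric] ennreal_power power_mult_distrib)
 finally have "(\<integral>\<^sup>+x. ennreal (f x * g x) \<partial>M)^2 <= (ennreal (A * B))^2"
  using nn by (simp add: ennreal_mult)
 note sq = this
 show ?thesis
 proof (cases "\<integral>\<^sup>+x. ennreal (f x * g x) \<partial>M" rule: ennreal_cases)
  case (real r)
  have e: "(ennreal r)^2 = ennreal (r^2)" "(ennreal (A * B))^2 = ennreal ((A * B)^2)"
   using real AB by (simp_all only: ennreal_power mult_nonneg_nonneg)
  have "ennreal (r^2) <= ennreal ((A * B)^2)" using sq unfolding real(2) e .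
  then have "r^2 <= (A * B)^2" by (simp only: ennreal_le_iff zero_le_power2)
  then have "r <= A * B" by (rule power2_le_imp_le) (simp add: AB)
  then show ?thesis using real by (simp add: ennreal_leI)
 next
  case top
  have "(ennreal (A * B))^2 = ennreal ((A * B)^2)"
   using AB by (simp only: ennreal_power mult_nonneg_nonneg)
  with sq top show ?thesis by (simp add: top_power_ennreal top_unique)
 qed
qed

text \<open>By \<open>archimedes\<close>, x.w is uniformly distributed on [-|x|, |x|] with density 2
  pi / |x|. This factor 1/|x| is where a power of t is gained when |x| is comparable with t or
  larger.\<close>

lemma angular_bound:
 fixes k Q :: "real => real"
 assumes k: "!!y. (Q has_field_derivative k y) (at y)" and k': "!!y. (k has_field_derivative k' y) (at y)"
  and c: "continuous_on UNIV k'" and pos: "!!y. k y >= 0"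
  and x: "x ~= 0" 
 shows "(\<integral>\<^sup>+w. ennreal (k (x \<bullet> w)) \<partial>sphere_measure) = ennreal (2 * pi / norm x * (Q (norm x) - Q (- norm x)))"
proof -
 define q where "q s = complex_of_real (Q s)" for s
 define q1 where "q1 s = complex_of_real (k s)" for s
 define q2 where "q2 s = complex_of_real (k' s)" for s
 have d: "(q has_vector_derivative q1 s) (at s)" "(q1 has_vector_derivative q2 s) (at s)" for s
  unfolding q_def q1_def q2_def
  by (rule has_vector_derivative_of_real, use k k' in \<open>simp add: has_real_derivative_iff_has_vector_derivative\<close>)+
 have cq: "continuous_on UNIV q2" unfolding q2_def by (intro continuous_intros c)
 have e: "norm (sgn x) = 1" using x by (simp add: norm_sgn)
 have xe: "norm x * (sgn x \<bullet> w) = x \<bullet> w" for w using x by (simp add: sgn_div_norm)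
 have ck: "continuous_on UNIV k"
  using k' by (intro continuous_at_imp_continuous_on) (auto intro: DERIV_isCont)
 have A: "(LINT w|sphere_measure. q1 (x \<bullet> w)) = (2 * pi / norm x) *\<^sub>R (q (norm x) - q (- norm x))"
  using archimedes[OF d cq e, of "norm x"] x by (simp add: xe)
 have i: "integrable sphere_measure (%w. q1 (x \<bullet> w))"
  unfolding q1_def by (intro sphere_integrable continuous_on_of_real continuous_on_compose2[OF ck] continuous_intros) auto
 then have i2: "integrable sphere_measure (%w. k (x \<bullet> w))"
  unfolding q1_def by (simp add: complex_of_real_integrable_eq)
 have "complex_of_real (LINT w|sphere_measure. k (x \<bullet> w)) = complex_of_real (2 * pi / norm x * (Q (norm x) - Q (- norm x)))"
  using A unfolding q1_def q_def by (simp add: scaleR_conv_of_real)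
 then have "(LINT w|sphere_measure. k (x \<bullet> w)) = 2 * pi / norm x * (Q (norm x) - Q (- norm x))"
  by (simp only: of_real_eq_iff)
 then show ?thesis
  using nn_integral_eq_integral[OF i2] pos by simp
qed

lemma sphere_sup_bound:
 assumes "!!w. norm w = 1 ==> k w <= C" "C >= 0"
 shows "(\<integral>\<^sup>+w. ennreal (k w) \<partial>sphere_measure) <= ennreal (4 * pi * C)"
proof -
 have "(\<integral>\<^sup>+w. ennreal (k w) \<partial>sphere_measure) <= (\<integral>\<^sup>+w. ennreal C \<partial>sphere_measure)"
  using AE_sphere_measure by (intro nn_integral_mono_AE) (auto elim!: eventually_mono intro!: ennreal_leI assms)
 also have "... = ennreal (4 * pi * C)"
  using assms(2) by (simp add: emeasure_sphere_measure ennreal_mult[symmetric] mult.commute)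
 finally show ?thesis .
qed

lemma cone_distance:
 assumes "norm w = 1" "norm x <= t / 2" "eps = 1 \<or> eps = -1" "t >= 0"
 shows "(t / 2)^2 <= (x \<bullet> w + eps * t)^2"
proof -
 have "\<bar>x \<bullet> w\<bar> <= t / 2"
  using Cauchy_Schwarz_ineq2[of x w] assms by simp
 then have "\<bar>t / 2\<bar> <= \<bar>x \<bullet> w + eps * t\<bar>" using assms by (auto simp: abs_if split: if_splits)
 then show ?thesis by (simp only: abs_le_square_iff)
qed

text \<open>For |x| <= t/2 the argument keeps the distance t/2 from 0, and the integrand itself is
  at most 1/(b t). Otherwise 1/|x| < 2/t, and the antiderivative arctan is bounded independently of
  x. The parameter b is a frequency scale; b = 1 serves the case without localization.\<close>

lemma angular_2:
 assumes t: "t > 0" and b: "b > 0" and eps: "eps = 1 \<or> eps = -1"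
 shows "(\<integral>\<^sup>+w. ennreal (1 / (1 + (b * (x \<bullet> w + eps * t))^2)) \<partial>sphere_measure) <= ennreal (64 / (b * t))"
proof (cases "norm x <= t / 2")
 case True
 have "(\<integral>\<^sup>+w. ennreal (1 / (1 + (b * (x \<bullet> w + eps * t))^2)) \<partial>sphere_measure) <= ennreal (4 * pi * (1 / (b * t)))"
 proof (rule sphere_sup_bound)
  fix w :: space assume w: "norm w = 1"
  have "0 <= (b * t / 2 - 1)^2" by simp
  then have "b * t <= 1 + (b * t / 2)^2" by (simp add: power2_eq_square algebra_simps)
  also have "(b * t / 2)^2 = b^2 * (t / 2)^2" by (simp add: power_mult_distrib power_divide)
  also have "b^2 * (t / 2)^2 <= b^2 * (x \<bullet> w + eps * t)^2"
   using cone_distance[OF w True eps] t by (intro mult_left_mono) auto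
  finally have "b * t <= 1 + (b * (x \<bullet> w + eps * t))^2" by (simp add: power_mult_distrib)
  then show "1 / (1 + (b * (x \<bullet> w + eps * t))^2) <= 1 / (b * t)"
   using t b by (intro divide_left_mono mult_pos_pos) (auto simp: add_pos_nonneg)
 qed (use t b in simp)
 also have "... <= ennreal (64 / (b * t))"
  using pi_less_4 t b by (intro ennreal_leI) (simp add: divide_right_mono)
 finally show ?thesis .
next
 case False
 then have x: "x ~= 0" and x2: "t / 2 < norm x" using t by auto
 define Q where "Q y = arctan (b * (y + eps * t)) / b" for y
 have p: "0 < 1 + y^2" for y :: real by (simp add: add_pos_nonneg)
 have "(\<integral>\<^sup>+w. ennreal (1 / (1 + (b * (x \<bullet> w + eps * t))^2)) \<partial>sphere_measure) = ennreal (2 * pi / norm x * (Q (norm x) - Q (- norm x)))"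
 proof (rule angular_bound[OF _ _ _ _ x])
  show "(Q has_field_derivative 1 / (1 + (b * (y + eps * t))^2)) (at y)" for y
  proof -
   have "(Q has_field_derivative inverse (1 + (b * (y + eps * t))^2) * b / b) (at y)"
    unfolding Q_def by (auto intro!: derivative_eq_intros)
   then show ?thesis using b by (simp add: inverse_eq_divide)
  qed
  show "((%y. 1 / (1 + (b * (y + eps * t))^2)) has_field_derivative - (2 * b * (b * (y + eps * t))) / (1 + (b * (y + eps * t))^2)^2) (at y)" for y
   using p[of "b * (y + eps * t)"] by (auto intro!: derivative_eq_intros simp: power2_eq_square[of "1 + _"])
  show "continuous_on UNIV (%y. - (2 * b * (b * (y + eps * t))) / (1 + (b * (y + eps * t))^2)^2)"
   using p by (intro continuous_intros) (auto simp: less_imp_neq[symmetric])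
 qed simp
 also have "... <= ennreal (64 / (b * t))"
 proof (rule ennreal_leI)
  have "Q (norm x) - Q (- norm x) <= 4 / b"
   using arctan_bounded[of "b * (norm x + eps * t)"] arctan_bounded[of "b * (- norm x + eps * t)"] pi_less_4 b
   unfolding Q_def by (simp add: diff_divide_distrib[symmetric] divide_right_mono)
  then have "2 * pi / norm x * (Q (norm x) - Q (- norm x)) <= 2 * pi / norm x * (4 / b)"
   by (intro mult_left_mono) auto
  also have "... <= 2 * 4 / (t / 2) * (4 / b)"
   using x2 t b pi_less_4 by (intro mult_right_mono frac_le) auto
  also have "... = 64 / (b * t)" by (simp add: mult.commute)
  finally show "2 * pi / norm x * (Q (norm x) - Q (- norm x)) <= 64 / (b * t)" .
 qed
 finally show ?thesis .
qed

text \<open>The function (1 + y^2)^(-3/2) has the antiderivative S(y) = y (1 + y^2)^(-1/2). For t/2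
  < |x| <= t the difference S(t + |x|) - S(t - |x|) is at most 1 - S(t - |x|), which is bounded by
  (1 + (t - |x|)^2)^(-1). Outside the cone only the boundedness of S remains, and for |x| <= t/2 the
  integrand itself is of order t^(-3).\<close>

lemma angular_3:
 assumes t: "t >= 1" and eps: "eps = 1 \<or> eps = -1"
 shows "(\<integral>\<^sup>+w. ennreal (1 / ((1 + (x \<bullet> w + eps * t)^2) * sqrt (1 + (x \<bullet> w + eps * t)^2))) \<partial>sphere_measure)
  <= ennreal (256 / t * (if norm x <= t then 1 / (1 + (t - norm x)^2) else 1))"
proof -
 let ?A = "if norm x <= t then 1 / (1 + (t - norm x)^2) else 1"
 have p: "0 < 1 + y^2" for y :: real by (simp add: add_pos_nonneg)
 show ?thesis
 proof (cases "norm x <= t / 2")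
  case True
  have "(\<integral>\<^sup>+w. ennreal (1 / ((1 + (x \<bullet> w + eps * t)^2) * sqrt (1 + (x \<bullet> w + eps * t)^2))) \<partial>sphere_measure) <= ennreal (4 * pi * (8 / t ^ 3))"
  proof (rule sphere_sup_bound)
   fix w :: space assume w: "norm w = 1"
   have d: "(t / 2)^2 <= 1 + (x \<bullet> w + eps * t)^2"
    using cone_distance[OF w True eps] t by simp
   then have "sqrt ((t / 2)^2) <= sqrt (1 + (x \<bullet> w + eps * t)^2)" by (simp only: real_sqrt_le_iff)
   then have "t / 2 <= sqrt (1 + (x \<bullet> w + eps * t)^2)" using t by simp
   with d have "(t / 2)^2 * (t / 2) <= (1 + (x \<bullet> w + eps * t)^2) * sqrt (1 + (x \<bullet> w + eps * t)^2)"
    using t by (intro mult_mono) auto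
   moreover have "(t / 2)^2 * (t / 2) = t ^ 3 / 8" by (simp add: power2_eq_square power3_eq_cube)
   ultimately have "t ^ 3 / 8 <= (1 + (x \<bullet> w + eps * t)^2) * sqrt (1 + (x \<bullet> w + eps * t)^2)" by (simp only:)
   then have "1 / ((1 + (x \<bullet> w + eps * t)^2) * sqrt (1 + (x \<bullet> w + eps * t)^2)) <= 1 / (t ^ 3 / 8)"
    using t p by (intro divide_left_mono mult_pos_pos) auto
   then show "1 / ((1 + (x \<bullet> w + eps * t)^2) * sqrt (1 + (x \<bullet> w + eps * t)^2)) <= 8 / t ^ 3" by simp
  qed (use t in simp)
  also have "... <= ennreal (256 / t * ?A)"
  proof (rule ennreal_leI)
   have "(t - norm x)^2 <= t^2" using True t by (intro power_mono) auto
   moreover have "1 <= t^2" using t by (simp add: one_le_power)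
   ultimately have "1 + (t - norm x)^2 <= 2 * t^2" by linarith
   then have "1 / (2 * t^2) <= 1 / (1 + (t - norm x)^2)"
    using t p[of "t - norm x"] by (intro divide_left_mono mult_pos_pos) auto
   then have "256 / t * (1 / (2 * t^2)) <= 256 / t * (1 / (1 + (t - norm x)^2))"
    using t by (intro mult_left_mono) auto
   moreover have "4 * pi * (8 / t ^ 3) <= 256 / t * (1 / (2 * t^2))"
   proof -
    have "4 * pi * (8 / t ^ 3) = 32 * pi / t ^ 3" "256 / t * (1 / (2 * t^2)) = 128 / t ^ 3"
     using t by (simp_all add: power2_eq_square power3_eq_cube)
    then show ?thesis using t pi_less_4 by (simp add: divide_right_mono)
   qed
   ultimately show "4 * pi * (8 / t ^ 3) <= 256 / t * ?A"
    using True t by simp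
  qed
  finally show ?thesis .
 next
  case False
  then have x: "x ~= 0" and x2: "t / 2 < norm x" using t by auto
  define S where "S y = y / sqrt (1 + y^2)" for y :: real
  define k where "k y = 1 / ((1 + y^2) * sqrt (1 + y^2))" for y :: real
  have S': "(S has_field_derivative k y) (at y)" for y
  proof -
   have s: "sqrt (1 + y^2) > 0" using p by simp
   have s2: "sqrt (1 + y^2) * sqrt (1 + y^2) = 1 + y^2" using p[of y] by (simp add: less_imp_le)
   have "(S has_field_derivative (1 * sqrt (1 + y^2) - y * (inverse (sqrt (1 + y^2)) / 2 * (2 * y))) / (sqrt (1 + y^2) * sqrt (1 + y^2))) (at y)"
    unfolding S_def using p[of y] s by (auto intro!: derivative_eq_intros)
   moreover have "(1 * sqrt (1 + y^2) - y * (inverse (sqrt (1 + y^2)) / 2 * (2 * y))) / (sqrt (1 + y^2) * sqrt (1 + y^2)) = k y"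
   proof -
    have "1 * sqrt (1 + y^2) - y * (inverse (sqrt (1 + y^2)) / 2 * (2 * y)) = (sqrt (1 + y^2) * sqrt (1 + y^2) - y^2) / sqrt (1 + y^2)"
     using s by (simp add: field_simps power2_eq_square[of y])
    also have "... = 1 / sqrt (1 + y^2)" unfolding s2 by simp
    finally show ?thesis unfolding s2 k_def by (simp add: mult.commute)
   qed
   ultimately show ?thesis by simp
  qed
  have k': "(k has_field_derivative - (3 * y) / ((1 + y^2)^2 * sqrt (1 + y^2))) (at y)" for y
  proof -
   have s: "sqrt (1 + y^2) > 0" using p by simp
   define J where "J = 1 + y^2"
   define r where "r = sqrt J"
   have J0: "J > 0" and r0: "r > 0" and rr: "r * r = J" using p[of y] s by (auto simp: J_def r_def less_imp_le)
   have "(k has_field_derivative - (((2 * y) * sqrt (1 + y^2) + (inverse (sqrt (1 + y^2)) / 2 * (2 * y)) * (1 + y^2)) / (((1 + y^2) * sqrt (1 + y^2)) * ((1 + y^2) * sqrt (1 + y^2))))) (at y)"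
    unfolding k_def using p[of y] s by (auto intro!: derivative_eq_intros) (simp add: diff_divide_distrib add_divide_distrib)
   moreover have "((2 * y) * r + (inverse r / 2 * (2 * y)) * J) / ((J * r) * (J * r)) = (3 * y) / (J^2 * r)"
   proof -
    have "inverse r * J = r" using r0 unfolding rr[symmetric] by simp
    then have "(2 * y) * r + (inverse r / 2 * (2 * y)) * J = 3 * y * r"
     by (simp add: mult.assoc mult.left_commute[of _ y])
    then have "((2 * y) * r + (inverse r / 2 * (2 * y)) * J) / ((J * r) * (J * r)) = 3 * y * r / ((J * r) * (J * r))"
     by (simp only:)
    also have "... = (3 * y) / (J^2 * r)"
     using r0 J0 by (simp add: power2_eq_square)
    finally show ?thesis .
   qed
   ultimately show ?thesis unfolding J_def r_def by simp
  qed
  have "(\<integral>\<^sup>+w. ennreal (k (x \<bullet> w + eps * t)) \<partial>sphere_measure) = ennreal (2 * pi / norm x * (S (norm x + eps * t) - S (- norm x + eps * t)))"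
  proof (rule angular_bound[OF _ _ _ _ x])
   show "((%y. S (y + eps * t)) has_field_derivative k (y + eps * t)) (at y)" for y
    using S'[of "y + eps * t"] by (simp add: DERIV_shift)
   show "((%y. k (y + eps * t)) has_field_derivative - (3 * (y + eps * t)) / ((1 + (y + eps * t)^2)^2 * sqrt (1 + (y + eps * t)^2))) (at y)" for y
    using k'[of "y + eps * t"] by (simp add: DERIV_shift)
   show "continuous_on UNIV (%y. - (3 * (y + eps * t)) / ((1 + (y + eps * t)^2)^2 * sqrt (1 + (y + eps * t)^2)))"
    using p by (intro continuous_intros) (auto simp: less_imp_neq[symmetric])
   show "k (y + eps * t) >= 0" for y using p by (simp add: k_def less_imp_le)
  qed
  \<comment> \<open>S is odd, so both signs of eps lead to the same difference.\<close>
  also have "S (norm x + eps * t) - S (- norm x + eps * t) = S (t + norm x) - S (t - norm x)"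
  proof -
   have "S (- y) = - S y" for y by (simp add: S_def)
   from this[of "t + norm x"] this[of "t - norm x"] eps show ?thesis by (auto simp: algebra_simps)
  qed
  also have "ennreal (2 * pi / norm x * (S (t + norm x) - S (t - norm x))) <= ennreal (256 / t * ?A)"
  proof (rule ennreal_leI)
   have S1: "\<bar>S y\<bar> <= 1" for y
   proof -
    have "\<bar>y\<bar> <= sqrt (1 + y^2)" by (rule real_le_rsqrt) simp
    then show ?thesis using p[of y] by (simp add: S_def abs_divide)
   qed
   have S2: "1 - S a <= 1 / (1 + a^2)" if a: "a >= 0" for a
   proof -
    define r where "r = sqrt (1 + a^2)"
    have rr: "r * r = 1 + a * a" and r0: "r > 0" using p[of a] by (auto simp: r_def less_imp_le power2_eq_square)
    have ar: "a <= r" using a by (simp add: r_def real_le_rsqrt)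
    have "(r - a) * (r + a) = 1" using rr by (simp add: algebra_simps)
    moreover have "(r - a) * r <= (r - a) * (r + a)" using ar a by (intro mult_left_mono) auto
    ultimately have "(r - a) * r <= 1" by simp
    then have "((r - a) * r) / (r * r) <= 1 / (r * r)" using r0 by (intro divide_right_mono) auto
    then have "(r - a) / r <= 1 / (r * r)" using r0 by simp
    moreover have "1 - S a = (r - a) / r" using r0 by (simp add: S_def r_def[symmetric] diff_divide_distrib)
    ultimately show ?thesis by (simp add: rr power2_eq_square)
   qed
   have "S (t + norm x) - S (t - norm x) <= 2 * ?A"
    using S1[of "t + norm x"] S1[of "t - norm x"] S2[of "t - norm x"] p[of "t - norm x"] by auto
   then have "2 * pi / norm x * (S (t + norm x) - S (t - norm x)) <= 2 * pi / norm x * (2 * ?A)"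
    by (intro mult_left_mono) auto
   also have "... <= 2 * 4 / (t / 2) * (2 * ?A)"
    using x2 t pi_less_4 p[of "t - norm x"] by (intro mult_right_mono frac_le) auto
   also have "... <= 256 / t * ?A"
    using t p[of "t - norm x"] by (auto simp: divide_right_mono field_simps)
   finally show "2 * pi / norm x * (S (t + norm x) - S (t - norm x)) <= 256 / t * ?A" .
  qed
  finally show ?thesis by (simp add: k_def)
 qed
qed

text \<open>A common majorant of the half waves for both signs and all directions, see
  \<open>half_wave_le_amp\<close>; its L^2 bounds can be derived in space, without reference to
  rays.\<close>

definition amp :: "(coord => space => complex) => space => real" where
 "amp p xi = (SUM mu:UNIV. norm (fourier (p mu) xi))"

lemma amp_nonneg: "amp p xi >= 0" by (simp add: amp_def sum_nonneg)

lemma amp_continuous: "(!!mu. integrable lborel (p mu)) ==> continuous_on UNIV (amp p)"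
 unfolding amp_def by (intro continuous_intros fourier_continuous)

lemma half_wave_le_amp:
 assumes "norm w = 1" "eps = 1 \<or> eps = -1"
 shows "norm (half_wave eps p w xi) <= amp p xi"
proof -
 have "norm (of_real (w $ i) * fourier (p (Space i)) xi) <= norm (fourier (p (Space i)) xi)" for i
  using component_le_norm_cart[of w i] assms(1) mult_right_mono[of "\<bar>w $ i\<bar>" 1 "norm (fourier (p (Space i)) xi)"] by (simp add: norm_mult)
 then have "norm (SUM i:UNIV. of_real (w $ i) * fourier (p (Space i)) xi) <= (SUM i:UNIV. norm (fourier (p (Space i)) xi))"
  by (rule sum_norm_le)
 moreover have "norm (of_real eps * z) = norm z" for z :: complex using assms(2) by auto
 ultimately show ?thesis
  unfolding half_wave_def amp_def sum_coord by (intro order_trans[OF norm_triangle_ineq]) simp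
qed

text \<open>Polar coordinates turn one L^2 bound in space into bounds on almost every ray that are
  square integrable over the directions. Where the norm on the ray is infinite,
  \<open>enn2real\<close> makes \<open>al\<close> equal to 0; these directions form a null
  set.\<close>

lemma slice_norm:
 assumes m: "h : borel_measurable borel" and N: "(\<integral>\<^sup>+xi. ennreal ((h xi)^2) \<partial>lborel) <= ennreal (N^2)"
 obtains al :: "space => real" where "al : borel_measurable borel" "!!w. al w >= 0"
  "AE w in sphere_measure. (\<integral>\<^sup>+r. ennreal ((h (r *\<^sub>R w))^2) \<partial>radial_measure) <= ennreal ((al w)^2)"
  "(\<integral>\<^sup>+w. ennreal ((al w)^2) \<partial>sphere_measure) <= ennreal (N^2)"
proof -
 note m[measurable]
 define n where "n w = (\<integral>\<^sup>+r. ennreal ((h (r *\<^sub>R w))^2) \<partial>radial_measure)" for w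
 have mn: "n : borel_measurable sphere_measure"
  unfolding n_def by (rule radial.borel_measurable_nn_integral) (simp cong: measurable_cong_sets sets_pair_measure_cong)
 then have mn'[measurable]: "n : borel_measurable borel" by simp
 have tot: "(\<integral>\<^sup>+w. n w \<partial>sphere_measure) = (\<integral>\<^sup>+xi. ennreal ((h xi)^2) \<partial>lborel)"
  unfolding n_def by (rule nn_integral_polar[symmetric]) simp
 then have "(\<integral>\<^sup>+w. n w \<partial>sphere_measure) ~= \<infinity>" using N by (metis ennreal_less_top infinity_ennreal_def leD)
 then have fin: "AE w in sphere_measure. n w ~= \<infinity>" by (rule nn_integral_noteq_infinite[OF mn])
 define al where "al w = sqrt (enn2real (n w))" for w
 have sq: "AE w in sphere_measure. ennreal ((al w)^2) = n w"
  using fin by eventually_elim (simp add: al_def less_top)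
 show ?thesis
 proof
  show "al : borel_measurable borel" unfolding al_def by measurable
  show "al w >= 0" for w by (simp add: al_def)
  show "AE w in sphere_measure. (\<integral>\<^sup>+r. ennreal ((h (r *\<^sub>R w))^2) \<partial>radial_measure) <= ennreal ((al w)^2)"
   using sq by eventually_elim (simp add: n_def)
  have "(\<integral>\<^sup>+w. ennreal ((al w)^2) \<partial>sphere_measure) = (\<integral>\<^sup>+w. n w \<partial>sphere_measure)"
   by (rule nn_integral_cong_AE[OF sq])
  then show "(\<integral>\<^sup>+w. ennreal ((al w)^2) \<partial>sphere_measure) <= ennreal (N^2)" using tot N by simp
 qed
qed

text \<open>The numbers in the names are the exponents of the squares: \<open>decay3\<close> is of
  size |s|^(-3/2) and \<open>decay2\<close> of size |s|^(-1) for large s, and Cauchy-Schwarz over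
  the directions squares them.\<close>

definition decay3 :: "real => real" where "decay3 s = 1 / (sqrt (1 + s^2) * sqrt (sqrt (1 + s^2)))"
definition decay2 :: "real => real" where "decay2 s = 1 / sqrt (1 + s^2)"

lemma decay_pos: "0 < decay3 s" "0 < decay2 s" "decay3 s <= decay2 s"
proof -
 let ?A = "sqrt (1 + s^2)"
 have p: "1 <= ?A" by simp
 then have p2: "1 <= sqrt ?A" by simp
 from p p2 show "0 < decay3 s" "0 < decay2 s" unfolding decay3_def decay2_def by (auto simp: less_le_trans[OF zero_less_one])
 have "?A * 1 <= ?A * sqrt ?A"
  using p p2 by (intro mult_left_mono) auto
 then show "decay3 s <= decay2 s"
  unfolding decay3_def decay2_def using p p2 by (intro divide_left_mono mult_pos_pos) linarith+
qed

lemma decay3_square: "(decay3 s)^2 = 1 / ((1 + s^2) * sqrt (1 + s^2))"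
 and decay2_square: "(decay2 s)^2 = 1 / (1 + s^2)"
 by (simp_all add: decay3_def decay2_def power_divide power_mult_distrib)

lemma decay_large:
 assumes "\<bar>s\<bar> >= 1"
 shows "1 / (\<bar>s\<bar> * sqrt \<bar>s\<bar>) <= 4 * decay3 s" "1 / \<bar>s\<bar> <= 2 * decay2 s"
proof -
 let ?B = "2 * \<bar>s\<bar>"
 let ?A = "sqrt (1 + s^2)"
 have s0: "\<bar>s\<bar> > 0" using assms by simp
 have p: "1 <= ?A" by simp
 then have p2: "1 <= sqrt ?A" by simp
 have "1 <= s^2" using assms by (metis abs_1 abs_le_square_iff one_power2)
 then have 1: "?A <= 2 * \<bar>s\<bar>"
  by (intro real_le_lsqrt) (auto simp: power_mult_distrib)
 then have "sqrt ?A <= sqrt ?B" by simp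
 also have "... <= sqrt (4 * \<bar>s\<bar>)" by simp
 also have "... = 2 * sqrt \<bar>s\<bar>" by (simp add: real_sqrt_mult)
 finally have 2: "sqrt ?A <= 2 * sqrt \<bar>s\<bar>" .
 have "1 / ?B <= 1 / ?A" using p 1 s0 by (intro divide_left_mono mult_pos_pos) linarith+
 then show "1 / \<bar>s\<bar> <= 2 * decay2 s" by (simp add: decay2_def)
 have "?A * sqrt ?A <= ?B * (2 * sqrt \<bar>s\<bar>)"
  using p p2 1 2 by (intro mult_mono) auto
 moreover have "0 < ?A * sqrt ?A" using p p2 by (intro mult_pos_pos) linarith+
 moreover have "0 < ?B * (2 * sqrt \<bar>s\<bar>)" using s0 by simp
 ultimately have "1 / (?B * (2 * sqrt \<bar>s\<bar>)) <= 1 / (?A * sqrt ?A)"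
  by (intro frac_le) auto
 then show "1 / (\<bar>s\<bar> * sqrt \<bar>s\<bar>) <= 4 * decay3 s" by (simp add: decay3_def)
qed

lemma decay_small:
 assumes "\<bar>s\<bar> <= 1"
 shows "1 <= 4 * decay3 s"
proof -
 let ?A = "sqrt (1 + s^2)"
 have p: "1 <= ?A" by simp
 then have p2: "1 <= sqrt ?A" by simp
 have "s^2 <= 1" using assms by (metis abs_1 abs_le_square_iff one_power2)
 then have 1: "?A <= 2" by (intro real_le_lsqrt) auto
 then have "sqrt ?A <= 2" using real_sqrt_le_mono[of "?A" 4] by simp
 with 1 have "?A * sqrt ?A <= 2 * 2" using p2 by (intro mult_mono) auto
 moreover have "0 < ?A * sqrt ?A" using p p2 by (intro mult_pos_pos) linarith+
 ultimately show ?thesis by (simp add: decay3_def divide_simps)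
qed

context ray
begin

text \<open>The truncation of \<open>ray_bound\<close> to [1/n, n] is removed, which kills the
  boundary terms. For |s| <= 1 the oscillation is not exploited and \<open>ray_trivial\<close>
  suffices.\<close>

lemma ray_final:
 assumes i: "integrable radial_measure (%r. cis (r * s) * V0 r)"
 shows "norm (LINT r|radial_measure. cis (r * s) * V0 r) <= 32 * ((al0 + al1 + al2) * decay3 s + t * (beta0 + beta1) * decay2 s)"
proof -
 let ?D = "(al0 + al1 + al2) * decay3 s + t * (beta0 + beta1) * decay2 s"
 let ?C = "4 * M / sqrt \<bar>s\<bar> + 2 * t * beta0"
 let ?G = "LINT r|radial_measure. cis (r * s) * V0 r"
 let ?I = "%n. integral {1 / real (Suc n)..real (Suc n)} (%l. cis (l * s) * (of_real (l^2) * V0 l))"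
 have cV: "continuous_on {0<..} V0"
  unfolding continuous_on_eq_continuous_at[OF open_greaterThan]
 proof
  fix l :: real assume "l : {0<..}"
  then have "continuous_on {l / 2..2 * l} V0" "l : interior {l / 2..2 * l}" by (auto intro: cV0)
  then show "isCont V0 l" using continuous_on_interior by blast
 qed
 have cc: "continuous_on A (%r. cis (r * s))" for A
  by (auto intro!: continuous_intros simp: cis_conv_exp)
 have "(%n. integral {1 / real (Suc n)..real (Suc n)} (%r. of_real (r^2) * (cis (r * s) * V0 r))) \<longlonglongrightarrow> ?G"
  by (rule radial_integral_limit[OF i]) (intro continuous_intros cc cV)
 then have lim: "?I \<longlonglongrightarrow> ?G" by (simp only: mult.left_commute)
 have ab: "0 < 1 / real (Suc n)" "1 / real (Suc n) <= real (Suc n)" for n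
  by (simp_all add: divide_le_eq del: of_nat_Suc) (simp add: mult_ge1_I)
 have d: "0 < decay3 s" "0 < decay2 s" "decay3 s <= decay2 s" by (rule decay_pos)+
 note tn = t al
 show ?thesis
 proof (cases "\<bar>s\<bar> <= 1")
  case True
  have "norm ?G <= 2 * al0"
   by (rule LIMSEQ_le_const2[OF tendsto_norm[OF lim]]) (use ray_trivial[OF ab] in auto)
  also have "... <= 2 * al0 * (4 * decay3 s)" using decay_small[OF True] al mult_left_mono[of 1 "4 * decay3 s" "2 * al0"] by simp
  also have "... <= 32 * (al0 * decay3 s)" using al d by simp
  also have "... <= 32 * ?D"
   using tn d by (simp add: distrib_right add_nonneg_nonneg)
  finally show ?thesis .
 next
  case False
  then have s: "s ~= 0" "1 <= \<bar>s\<bar>" by auto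
  define B where "B n = (1 / real (Suc n))^2 * K + (2 * al0 / real (Suc n) + (al1 + t * beta0) / sqrt (real (Suc n)))" for n
  have "B \<longlonglongrightarrow> 0\<^sup>2 * K + (0 + 0)"
   unfolding B_def
  proof (intro tendsto_intros LIMSEQ_Suc[OF lim_1_over_n])
   show "(%n. 2 * al0 / real (Suc n)) \<longlonglongrightarrow> 0" by real_asymp
   show "(%n. (al1 + t * beta0) / sqrt (real (Suc n))) \<longlonglongrightarrow> 0"
    by (rule tendsto_divide_0[OF tendsto_const], rule filterlim_at_top_imp_at_infinity) real_asymp
  qed
  then have "(%n. B n + ?C) \<longlonglongrightarrow> 0 + ?C"
   by (intro tendsto_intros) simp
  moreover have "(%n. \<bar>s\<bar> * norm (?I n)) \<longlonglongrightarrow> \<bar>s\<bar> * norm ?G" by (intro tendsto_intros lim)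
  moreover have "\<bar>s\<bar> * norm (?I n) <= B n + ?C" for n
   unfolding B_def by (rule ray_bound[OF ab s(1)])
  ultimately have "\<bar>s\<bar> * norm ?G <= 0 + ?C"
   by (intro LIMSEQ_le[of _ _ "%n. B n + ?C"]) auto
  then have "norm ?G <= ?C / \<bar>s\<bar>" using s by (simp add: field_simps)
  also have "... = 4 * M * (1 / (\<bar>s\<bar> * sqrt \<bar>s\<bar>)) + 2 * t * beta0 * (1 / \<bar>s\<bar>)" by (simp add: add_divide_distrib mult.commute)
  also have "... <= 4 * M * (4 * decay3 s) + 2 * t * beta0 * (2 * decay2 s)"
   using decay_large[OF s(2)] M0 tn by (intro add_mono mult_left_mono) auto
  also have "... = 32 * al1 * decay3 s + 16 * al2 * decay3 s + 16 * (t * beta1) * decay3 s + 4 * (t * beta0) * decay2 s"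
   by (simp add: M_def algebra_simps)
  \<comment> \<open>By \<open>decay3 <= decay2\<close> the term with \<open>beta1\<close>, which has
    the better decay, is counted together with the one of \<open>beta0\<close>.\<close>
  also have "... <= 32 * al1 * decay3 s + 32 * al2 * decay3 s + 32 * (t * beta1) * decay2 s + 32 * (t * beta0) * decay2 s"
   using d tn by (intro add_mono mult_mono) auto
  also have "... <= 32 * ?D"
   using tn d by (simp add: algebra_simps)
  finally show ?thesis .
 qed
qed

end

lemma half_wave_add:
 assumes "!!mu. integrable lborel (p mu)" "!!mu. integrable lborel (p' mu)"
 shows "half_wave eps (%mu x. p mu x + p' mu x) w xi = half_wave eps p w xi + half_wave eps p' w xi"
 unfolding half_wave_def by (simp add: fourier_add assms distrib_left sum.distrib)

text \<open>\<open>ray_final\<close> is applied in almost every direction, with the ray norms from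
  \<open>slice_norm\<close>; Cauchy-Schwarz in w against \<open>decay3\<close> and
  \<open>decay2\<close> restores the norms in space. The commutator \<open>E\<close> of the cutoff
  is counted as a forcing E/t, because forcing enters the ray equation with a factor t.\<close>

lemma core_energy:
 assumes W0: "wave_system t p0 Dp0 q0 F0" and W1: "wave_system t p1 Dp1 q1 F1"
  and q0: "q0 = (%mu x. p1 mu x + E mu x)" and iE: "!!mu. integrable lborel (E mu)"
  and ih: "!!mu. integrable lborel (fourier (p0 mu))"
  and t: "t >= 1" and eps: "eps = 1 \<or> eps = -1"
  and N: "N0 >= 0" "N1 >= 0" "N2 >= 0" "M0 >= 0" "M1 >= 0"
  and b0: "(\<integral>\<^sup>+xi. ennreal (((1 + (norm xi)^2) * amp p0 xi)^2) \<partial>lborel) <= ennreal (N0^2)"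
  and b1: "(\<integral>\<^sup>+xi. ennreal ((sqrt (1 + (norm xi)^2) * amp p1 xi)^2) \<partial>lborel) <= ennreal (N1^2)"
  and b2: "(\<integral>\<^sup>+xi. ennreal ((amp q1 xi)^2) \<partial>lborel) <= ennreal (N2^2)"
  and b3: "(\<integral>\<^sup>+xi. ennreal ((sqrt (1 + (norm xi)^2) * (norm (fourier F0 xi) + amp E xi / t))^2) \<partial>lborel) <= ennreal (M0^2)"
  and b4: "(\<integral>\<^sup>+xi. ennreal ((norm (fourier F1 xi))^2) \<partial>lborel) <= ennreal (M1^2)"
  and K: "K3 >= 0" "K2 >= 0"
   "(\<integral>\<^sup>+w. ennreal ((decay3 (x \<bullet> w + eps * t))^2) \<partial>sphere_measure) <= ennreal (K3^2)"
   "(\<integral>\<^sup>+w. ennreal ((decay2 (x \<bullet> w + eps * t))^2) \<partial>sphere_measure) <= ennreal (K2^2)"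
 shows "(\<integral>\<^sup>+w. norm (LINT r|radial_measure. cis (r * (x \<bullet> w)) * half_wave eps p0 w (r *\<^sub>R w)) \<partial>sphere_measure)
  <= ennreal (32 * ((N0 + N1 + N2) * K3 + t * (M0 + M1) * K2))"
proof -
 let ?F = "integrable lborel"
 let ?D = "continuous_on UNIV"
 let ?C = "borel_measurable borel"
 have ee: "eps * eps = 1" using eps by auto
 have ip0: "?F (p0 mu)" and ip1: "?F (p1 mu)" and iF0: "?F F0" and iF1: "?F F1" for mu
  using W0 W1 by (auto simp: wave_system_def)
 have iq1: "?F (q1 mu)" for mu by (rule wave_system_q_integrable[OF W1])
 have cf: "?D (fourier (p0 mu))" "?D (fourier (p1 mu))" "?D (fourier (q1 mu))"
   "?D (fourier (E mu))" "?D (fourier F0)" "?D (fourier F1)" for mu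
  by (intro fourier_continuous ip0 ip1 iq1 iE iF0 iF1)+
 define h0 where "h0 xi = (1 + (norm xi)^2) * amp p0 xi" for xi
 define h1 where "h1 xi = sqrt (1 + (norm xi)^2) * amp p1 xi" for xi
 define h3 where "h3 xi = sqrt (1 + (norm xi)^2) * (norm (fourier F0 xi) + amp E xi / t)" for xi
 define h4 where "h4 xi = norm (fourier F1 xi)" for xi
 have ca: "?D (amp p0)" "?D (amp p1)" "?D (amp q1)" "?D (amp E)"
  by (intro amp_continuous ip0 ip1 iq1 iE)+
 have mh: "h0 : ?C" "h1 : ?C" "amp q1 : ?C" "h3 : ?C" "h4 : ?C"
  unfolding h0_def h1_def h3_def h4_def using t
  by (intro borel_measurable_continuous_onI continuous_intros ca cf; simp)+
 obtain al0 where a0: "al0 : ?C" "!!w. al0 w >= 0"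
   "AE w in sphere_measure. (\<integral>\<^sup>+r. ennreal ((h0 (r *\<^sub>R w))^2) \<partial>radial_measure) <= ennreal ((al0 w)^2)" "(\<integral>\<^sup>+w. ennreal ((al0 w)^2) \<partial>sphere_measure) <= ennreal (N0^2)"
  by (rule slice_norm[OF mh(1) b0[folded h0_def]]) (rule that)
 obtain al1 where a1: "al1 : ?C" "!!w. al1 w >= 0"
   "AE w in sphere_measure. (\<integral>\<^sup>+r. ennreal ((h1 (r *\<^sub>R w))^2) \<partial>radial_measure) <= ennreal ((al1 w)^2)" "(\<integral>\<^sup>+w. ennreal ((al1 w)^2) \<partial>sphere_measure) <= ennreal (N1^2)"
  by (rule slice_norm[OF mh(2) b1[folded h1_def]]) (rule that)
 obtain al2 where a2: "al2 : ?C" "!!w. al2 w >= 0"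
   "AE w in sphere_measure. (\<integral>\<^sup>+r. ennreal ((amp q1 (r *\<^sub>R w))^2) \<partial>radial_measure) <= ennreal ((al2 w)^2)" "(\<integral>\<^sup>+w. ennreal ((al2 w)^2) \<partial>sphere_measure) <= ennreal (N2^2)"
  by (rule slice_norm[OF mh(3) b2]) (rule that)
 obtain beta0 where a3: "beta0 : ?C" "!!w. beta0 w >= 0"
   "AE w in sphere_measure. (\<integral>\<^sup>+r. ennreal ((h3 (r *\<^sub>R w))^2) \<partial>radial_measure) <= ennreal ((beta0 w)^2)" "(\<integral>\<^sup>+w. ennreal ((beta0 w)^2) \<partial>sphere_measure) <= ennreal (M0^2)"
  by (rule slice_norm[OF mh(4) b3[folded h3_def]]) (rule that)
 obtain beta1 where a4: "beta1 : ?C" "!!w. beta1 w >= 0"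
   "AE w in sphere_measure. (\<integral>\<^sup>+r. ennreal ((h4 (r *\<^sub>R w))^2) \<partial>radial_measure) <= ennreal ((beta1 w)^2)" "(\<integral>\<^sup>+w. ennreal ((beta1 w)^2) \<partial>sphere_measure) <= ennreal (M1^2)"
  by (rule slice_norm[OF mh(5) b4[folded h4_def]]) (rule that)
 have ir: "AE w in sphere_measure. integrable radial_measure (%r. fourier (p0 mu) (r *\<^sub>R w))" for mu
 proof -
  have [measurable]: "fourier (p0 mu) : ?C" using ih by auto
  have "integrable (sphere_measure \<Otimes>\<^sub>M radial_measure) (%p. fourier (p0 mu) (snd p *\<^sub>R fst p))"
   using ih[of mu] by (subst (asm) lborel_polar, subst (asm) integrable_distr_eq) auto
  from polar.AE_integrable_fst'[OF this] show ?thesis by simp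
 qed
 have ir': "AE w in sphere_measure. \<forall>mu. integrable radial_measure (%r. fourier (p0 mu) (r *\<^sub>R w))"
  by (rule eventually_all_finite[OF ir])
 have main: "AE w in sphere_measure. norm (LINT r|radial_measure. cis (r * (x \<bullet> w)) * half_wave eps p0 w (r *\<^sub>R w))
  <= 32 * ((al0 w + al1 w + al2 w) * decay3 (x \<bullet> w + eps * t) + t * (beta0 w + beta1 w) * decay2 (x \<bullet> w + eps * t))"
  using AE_sphere_measure a0(3) a1(3) a2(3) a3(3) a4(3) ir'
 proof eventually_elim
  fix w :: space
  assume w: "norm w = 1"
   and s0: "(\<integral>\<^sup>+r. ennreal ((h0 (r *\<^sub>R w))^2) \<partial>radial_measure) <= ennreal ((al0 w)^2)"
   and s1: "(\<integral>\<^sup>+r. ennreal ((h1 (r *\<^sub>R w))^2) \<partial>radial_measure) <= ennreal ((al1 w)^2)"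
   and s2: "(\<integral>\<^sup>+r. ennreal ((amp q1 (r *\<^sub>R w))^2) \<partial>radial_measure) <= ennreal ((al2 w)^2)"
   and s3: "(\<integral>\<^sup>+r. ennreal ((h3 (r *\<^sub>R w))^2) \<partial>radial_measure) <= ennreal ((beta0 w)^2)"
   and s4: "(\<integral>\<^sup>+r. ennreal ((h4 (r *\<^sub>R w))^2) \<partial>radial_measure) <= ennreal ((beta1 w)^2)"
   and irw: "\<forall>mu. integrable radial_measure (%r. fourier (p0 mu) (r *\<^sub>R w))"
  define V where "V p l = cis (- (eps * t * l)) * half_wave eps p w (l *\<^sub>R w)" for p l
  define P0 where "P0 l = cis (- (eps * t * l)) * fourier F0 (l *\<^sub>R w) + of_real (1 / t) * V E l" for l
  define P1 where "P1 l = cis (- (eps * t * l)) * fourier F1 (l *\<^sub>R w)" for l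
  have cc: "continuous_on A (%l. cis (- (eps * t * l)))" for A
   by (auto intro!: continuous_intros simp: cis_conv_exp)
  have cw: "continuous_on A (%l. f (l *\<^sub>R w))" if "?D f" for A and f :: "space => complex"
   by (rule continuous_on_compose2[OF that]) (auto intro!: continuous_intros)
  have cV: "continuous_on A (V p)" if "!!mu. ?D (fourier (p mu))" for A p
   unfolding V_def half_wave_def by (intro continuous_intros cc cw that)
  have Vle: "norm (V p l) <= amp p (l *\<^sub>R w)" for p l
   unfolding V_def by (simp add: norm_mult half_wave_le_amp[OF w eps])
  have nw: "(norm (l *\<^sub>R w))^2 = l^2" for l by (simp add: w)
  have mr: "(%r. h (r *\<^sub>R w)) : ?C" if "h : ?C" for h :: "space => real"
   using measurable_compose[OF _ that, of "%r. r *\<^sub>R w" borel] by simp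
  have cP: "continuous_on A P0" "continuous_on A P1" for A
   unfolding P0_def P1_def by (intro continuous_intros cc cw cV cf)+
  \<comment> \<open>A crude bound of the transform by L^1 norms. Only its finiteness matters, since
    it gets multiplied by a^2 with a tending to 0.\<close>
  define Kb where "Kb = (SUM mu:UNIV. LINT x|lborel. norm (p0 mu x))"
  interpret ray "V p0" "V p1" "V q1" P0 P1 t Kb "al0 w" "al1 w" "al2 w" "beta0 w" "beta1 w"
  proof
   show "t >= 0" using t by simp
   fix l :: real assume l: "l > 0"
   have "V q0 l = V p1 l + V E l"
    unfolding V_def q0 by (simp add: half_wave_add ip1 iE distrib_left)
   then have "V q0 l + of_real t * (cis (- (eps * t * l)) * fourier F0 (l *\<^sub>R w)) = V p1 l + of_real t * P0 l"
    using t by (simp add: P0_def distrib_left)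
   then show "((%l. of_real (l^2) * V p0 l) has_vector_derivative - (of_real l * (V p1 l + of_real t * P0 l))) (at l)"
    using half_wave_twisted_deriv(1)[OF W0 ee w l] unfolding V_def by (simp only:)
   show "((%l. of_real l * V p1 l) has_vector_derivative - (V p1 l + V q1 l + of_real t * P1 l)) (at l)"
    using half_wave_twisted_deriv(2)[OF W1 ee w l] unfolding V_def P1_def .
   show "norm (V p0 l) <= Kb"
    unfolding Kb_def by (rule order_trans[OF Vle]) (auto simp: amp_def intro!: sum_mono fourier_bound ip0)
  next
   show "continuous_on {0<..} (V p1)" "continuous_on {0<..} (V q1)" "continuous_on {0<..} P0" "continuous_on {0<..} P1"
    by (intro cV cP cf)+
   show "0 <= al0 w" "0 <= al1 w" "0 <= al2 w" "0 <= beta0 w" "0 <= beta1 w" by (rule a0 a1 a2 a3 a4)+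
  next
   fix a b :: real assume ab: "0 < a" "a <= b"
   show "integral {a..b} (%l. (l * (1 + l^2) * norm (V p0 l))^2) <= (al0 w)^2"
   proof (rule radial_slice[OF ab(1) _ _ mr[OF mh(1)] s0])
    show "continuous_on {a..b} (%l. l * (1 + l^2) * norm (V p0 l))" by (intro continuous_intros cV cf)
    fix l assume l: "l : {a..b}"
    have "l * (1 + l^2) * norm (V p0 l) <= l * (1 + l^2) * amp p0 (l *\<^sub>R w)"
     using ab l by (intro mult_left_mono Vle) auto
    then show "\<bar>l * (1 + l^2) * norm (V p0 l)\<bar> <= l * h0 (l *\<^sub>R w)"
     using ab l unfolding h0_def nw by (simp add: abs_mult mult.assoc)
   qed
   show "integral {a..b} (%l. (sqrt (1 + l^2) * (l * norm (V p1 l)))^2) <= (al1 w)^2"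
   proof (rule radial_slice[OF ab(1) _ _ mr[OF mh(2)] s1])
    show "continuous_on {a..b} (%l. sqrt (1 + l^2) * (l * norm (V p1 l)))" by (intro continuous_intros cV cf)
    fix l assume l: "l : {a..b}"
    have "sqrt (1 + l^2) * (l * norm (V p1 l)) <= sqrt (1 + l^2) * (l * amp p1 (l *\<^sub>R w))"
     using ab l by (intro mult_left_mono Vle) auto
    then show "\<bar>sqrt (1 + l^2) * (l * norm (V p1 l))\<bar> <= l * h1 (l *\<^sub>R w)"
     using ab l unfolding h1_def nw by (simp add: abs_mult mult.left_commute)
   qed
   show "integral {a..b} (%l. (l * norm (V q1 l))^2) <= (al2 w)^2"
   proof (rule radial_slice[OF ab(1) _ _ mr[OF mh(3)] s2])
    show "continuous_on {a..b} (%l. l * norm (V q1 l))" by (intro continuous_intros cV cf)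
    fix l assume l: "l : {a..b}"
    then show "\<bar>l * norm (V q1 l)\<bar> <= l * amp q1 (l *\<^sub>R w)"
     using ab Vle[of q1 l] by (auto simp: abs_mult intro!: mult_left_mono)
   qed
   show "integral {a..b} (%l. (sqrt (1 + l^2) * (l * norm (P0 l)))^2) <= (beta0 w)^2"
   proof (rule radial_slice[OF ab(1) _ _ mr[OF mh(4)] s3])
    show "continuous_on {a..b} (%l. sqrt (1 + l^2) * (l * norm (P0 l)))" by (intro continuous_intros cP)
    fix l assume l: "l : {a..b}"
    have "norm (P0 l) <= norm (fourier F0 (l *\<^sub>R w)) + amp E (l *\<^sub>R w) / t"
    proof -
     have "norm (P0 l) <= norm (cis (- (eps * t * l)) * fourier F0 (l *\<^sub>R w)) + norm (of_real (1 / t) * V E l)"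
      unfolding P0_def by (rule norm_triangle_ineq)
     also have "norm (of_real (1 / t) * V E l) = norm (V E l) / t" using t by (simp add: norm_divide)
     also have "... <= amp E (l *\<^sub>R w) / t" using t by (intro divide_right_mono Vle) auto
     finally show ?thesis by (simp add: norm_mult)
    qed
    then have "sqrt (1 + l^2) * (l * norm (P0 l)) <= sqrt (1 + l^2) * (l * (norm (fourier F0 (l *\<^sub>R w)) + amp E (l *\<^sub>R w) / t))"
     using ab l by (intro mult_left_mono) auto
    then show "\<bar>sqrt (1 + l^2) * (l * norm (P0 l))\<bar> <= l * h3 (l *\<^sub>R w)"
     using ab l unfolding h3_def nw by (simp add: abs_mult mult.left_commute)
   qed
   show "integral {a..b} (%l. (l * norm (P1 l))^2) <= (beta1 w)^2"
   proof (rule radial_slice[OF ab(1) _ _ mr[OF mh(5)] s4])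
    show "continuous_on {a..b} (%l. l * norm (P1 l))" by (intro continuous_intros cP)
    fix l assume l: "l : {a..b}"
    then show "\<bar>l * norm (P1 l)\<bar> <= l * h4 (l *\<^sub>R w)"
     using ab by (simp add: abs_mult h4_def P1_def norm_mult)
   qed
  qed
  define s where "s = x \<bullet> w + eps * t"
  have eq: "cis (r * s) * V p0 r = cis (r * (x \<bullet> w)) * half_wave eps p0 w (r *\<^sub>R w)" for r
   unfolding V_def s_def mult.assoc[symmetric] cis_mult by (simp add: algebra_simps)
  have "integrable radial_measure (%r. half_wave eps p0 w (r *\<^sub>R w))"
   unfolding half_wave_def using irw by auto
  then have "integrable radial_measure (%r. cis (r * (x \<bullet> w)) * half_wave eps p0 w (r *\<^sub>R w))"
  proof (rule Bochner_Integration.integrable_bound)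
   have "(%r. cis (r * (x \<bullet> w)) * half_wave eps p0 w (r *\<^sub>R w)) : ?C"
   proof (intro borel_measurable_continuous_onI continuous_on_mult)
    show "?D (%r. cis (r * (x \<bullet> w)))" by (auto intro!: continuous_intros simp: cis_conv_exp)
    show "?D (%r. half_wave eps p0 w (r *\<^sub>R w))"
     unfolding half_wave_def by (intro continuous_intros cw cf)
   qed
   then show "(%r. cis (r * (x \<bullet> w)) * half_wave eps p0 w (r *\<^sub>R w)) : borel_measurable radial_measure"
    by (simp add: measurable_cong_sets[OF sets_radial_measure refl])
  qed (simp add: norm_mult)
  then show "norm (LINT r|radial_measure. cis (r * (x \<bullet> w)) * half_wave eps p0 w (r *\<^sub>R w))
   <= 32 * ((al0 w + al1 w + al2 w) * decay3 (x \<bullet> w + eps * t) + t * (beta0 w + beta1 w) * decay2 (x \<bullet> w + eps * t))"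
   using ray_final[of s, unfolded eq] unfolding s_def by blast
 qed
 define d3 where "d3 w = decay3 (x \<bullet> w + eps * t)" for w
 define d2 where "d2 w = decay2 (x \<bullet> w + eps * t)" for w
 have md[measurable]: "d3 : ?C" "d2 : ?C"
  unfolding d3_def d2_def decay3_def decay2_def by measurable
 note [measurable] = a0(1) a1(1) a2(1) a3(1) a4(1)
 have dn: "d3 w >= 0" "d2 w >= 0" for w unfolding d3_def d2_def using decay_pos less_imp_le by blast+
 note nn = a0(2) a1(2) a2(2) a3(2) a4(2) dn
 have cs: "(\<integral>\<^sup>+w. ennreal (al w * d w) \<partial>sphere_measure) <= ennreal (A * B)"
  if "al : ?C" "d : ?C" "!!w. al w >= 0" "!!w. d w >= 0" "A >= 0" "B >= 0"
   "(\<integral>\<^sup>+w. ennreal ((al w)^2) \<partial>sphere_measure) <= ennreal (A^2)" "(\<integral>\<^sup>+w. ennreal ((d w)^2) \<partial>sphere_measure) <= ennreal (B^2)" for al d :: "space => real" and A B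
  by (rule cauchy_schwarz_nn) (use that in auto)
 have "(\<integral>\<^sup>+w. norm (LINT r|radial_measure. cis (r * (x \<bullet> w)) * half_wave eps p0 w (r *\<^sub>R w)) \<partial>sphere_measure)
  <= (\<integral>\<^sup>+w. ennreal 32 * ((ennreal (al0 w * d3 w) + ennreal (al1 w * d3 w) + ennreal (al2 w * d3 w)) + ennreal t * (ennreal (beta0 w * d2 w) + ennreal (beta1 w * d2 w))) \<partial>sphere_measure)"
 proof (rule nn_integral_mono_AE, rule eventually_mono[OF main])
  fix w assume *: "norm (LINT r|radial_measure. cis (r * (x \<bullet> w)) * half_wave eps p0 w (r *\<^sub>R w))
   <= 32 * ((al0 w + al1 w + al2 w) * decay3 (x \<bullet> w + eps * t) + t * (beta0 w + beta1 w) * decay2 (x \<bullet> w + eps * t))"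
  have "ennreal 32 * ((ennreal (al0 w * d3 w) + ennreal (al1 w * d3 w) + ennreal (al2 w * d3 w)) + ennreal t * (ennreal (beta0 w * d2 w) + ennreal (beta1 w * d2 w)))
   = ennreal (32 * ((al0 w * d3 w + al1 w * d3 w + al2 w * d3 w) + t * (beta0 w * d2 w + beta1 w * d2 w)))"
   using nn t by (simp add: ennreal_plus ennreal_mult distrib_left add.assoc del: ennreal_numeral)
  also have "... = ennreal (32 * ((al0 w + al1 w + al2 w) * decay3 (x \<bullet> w + eps * t) + t * (beta0 w + beta1 w) * decay2 (x \<bullet> w + eps * t)))"
   by (simp add: d3_def d2_def algebra_simps)
  finally show "ennreal (norm (LINT r|radial_measure. cis (r * (x \<bullet> w)) * half_wave eps p0 w (r *\<^sub>R w)))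
   <= ennreal 32 * ((ennreal (al0 w * d3 w) + ennreal (al1 w * d3 w) + ennreal (al2 w * d3 w)) + ennreal t * (ennreal (beta0 w * d2 w) + ennreal (beta1 w * d2 w)))"
   using * by (simp add: ennreal_leI)
 qed
 also have "... = ennreal 32 * (((\<integral>\<^sup>+w. ennreal (al0 w * d3 w) \<partial>sphere_measure) + (\<integral>\<^sup>+w. ennreal (al1 w * d3 w) \<partial>sphere_measure) + (\<integral>\<^sup>+w. ennreal (al2 w * d3 w) \<partial>sphere_measure))
   + ennreal t * ((\<integral>\<^sup>+w. ennreal (beta0 w * d2 w) \<partial>sphere_measure) + (\<integral>\<^sup>+w. ennreal (beta1 w * d2 w) \<partial>sphere_measure)))"
  by (subst nn_integral_cmult nn_integral_add, measurable)+
 also have "... <= ennreal 32 * ((ennreal (N0 * K3) + ennreal (N1 * K3) + ennreal (N2 * K3)) + ennreal t * (ennreal (M0 * K2) + ennreal (M1 * K2)))"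
  by (intro mult_left_mono add_mono cs nn N K a0 a1 a2 a3 a4 md K(3)[folded d3_def] K(4)[folded d2_def]) auto
 also have "... = ennreal (32 * ((N0 * K3 + N1 * K3 + N2 * K3) + t * (M0 * K2 + M1 * K2)))"
  using N K t by (simp add: ennreal_plus ennreal_mult distrib_left add.assoc del: ennreal_numeral)
 also have "... = ennreal (32 * ((N0 + N1 + N2) * K3 + t * (M0 + M1) * K2))"
  by (simp add: algebra_simps)
 finally show ?thesis .
qed

lemma cis_borel [measurable]: "cis : borel_measurable borel"
 by (intro borel_measurable_continuous_onI) (auto intro!: continuous_intros simp: cis_conv_exp)

lemma slice_integrable:
 fixes h :: "space => complex"
 assumes h: "integrable lborel h"
 shows "AE w in sphere_measure. integrable radial_measure (%r. h (r *\<^sub>R w))"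
proof -
 have [measurable]: "h : borel_measurable borel" using h by auto
 have "integrable (sphere_measure \<Otimes>\<^sub>M radial_measure) (%p. h (snd p *\<^sub>R fst p))"
  using h by (subst (asm) lborel_polar, subst (asm) integrable_distr_eq) auto
 from polar.AE_integrable_fst'[OF this] show ?thesis by simp
qed

text \<open>Exact up to the deviation of the spatial components from being curl free.\<close>

lemma reconstruct:
 assumes ip: "!!mu. integrable lborel (p mu)" and cp: "!!mu. continuous_on UNIV (p mu)"
  and ih: "!!mu. integrable lborel (fourier (p mu))"
  and B: "!!eps. eps = 1 \<or> eps = -1 ==>
   (\<integral>\<^sup>+w. norm (LINT r|radial_measure. cis (r * (x \<bullet> w)) * half_wave eps p w (r *\<^sub>R w)) \<partial>sphere_measure) <= ennreal B" "B >= 0"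
  and R: "!!i. (\<integral>\<^sup>+xi. norm (fourier (p (Space i)) xi - of_real (sgn xi $ i) * (SUM j:UNIV. of_real (sgn xi $ j) * fourier (p (Space j)) xi)) \<partial>lborel) <= ennreal R" "R >= 0"
 shows "norm (p mu x) <= B + R"
proof -
 let ?A = "borel_measurable borel"
 have fb[measurable]: "fourier (p mu) : ?A" for mu using ih by auto
 have [measurable]: "(%w::space. w $ i) : ?A" for i
  by (intro borel_measurable_continuous_onI continuous_intros)
 have [measurable]: "(%q. fourier (p mu) (snd q *\<^sub>R fst q)) : borel_measurable (sphere_measure \<Otimes>\<^sub>M radial_measure)" for mu
  by (rule measurable_compose[OF polar_measurable fb])
 define h where "h mu xi = cis (x \<bullet> xi) * fourier (p mu) xi" for mu xi
 have hm[measurable]: "h mu : ?A" for mu unfolding h_def by measurable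
 have hi: "integrable lborel (h mu)" for mu
  by (rule Bochner_Integration.integrable_bound[OF ih[of mu]]) (auto simp: h_def norm_mult)
 define J where "J mu w = (LINT r|radial_measure. h mu (r *\<^sub>R w))" for mu w
 define I where "I eps w = (LINT r|radial_measure. cis (r * (x \<bullet> w)) * half_wave eps p w (r *\<^sub>R w))" for eps w
 have Im[measurable]: "I eps : borel_measurable sphere_measure" for eps
  unfolding I_def half_wave_def by (rule radial.borel_measurable_lebesgue_integral) measurable
 define c where "c i xi = h (Space i) xi - of_real (sgn xi $ i) * (SUM j:UNIV. of_real (sgn xi $ j) * h (Space j) xi)" for i xi
 have cm[measurable]: "c i : ?A" for i unfolding c_def by measurable
 have cn: "norm (c i xi) = norm (fourier (p (Space i)) xi - of_real (sgn xi $ i) * (SUM j:UNIV. of_real (sgn xi $ j) * fourier (p (Space j)) xi))" for i xi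
 proof -
  have "c i xi = cis (x \<bullet> xi) * (fourier (p (Space i)) xi - of_real (sgn xi $ i) * (SUM j:UNIV. of_real (sgn xi $ j) * fourier (p (Space j)) xi))"
   unfolding c_def h_def by (simp add: algebra_simps sum_distrib_left)
  then show ?thesis by (simp add: norm_mult)
 qed
 define S where "S w = (SUM j:UNIV. of_real (w $ j) * J (Space j) w)" for w
 define N where "N i w = (\<integral>\<^sup>+r. norm (c i (r *\<^sub>R w)) \<partial>radial_measure)" for i w
 have Nm[measurable]: "N i : borel_measurable sphere_measure" for i
  unfolding N_def by (rule radial.borel_measurable_nn_integral) measurable
 have NR: "(\<integral>\<^sup>+w. N i w \<partial>sphere_measure) <= ennreal R" for i
  unfolding N_def using R(1)[of i] by (subst nn_integral_polar[symmetric]) (simp_all add: cn)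
 have "AE w in sphere_measure. \<forall>mu. integrable radial_measure (%r. h mu (r *\<^sub>R w))"
  by (rule eventually_all_finite[OF slice_integrable[OF hi]])
 then have main: "AE w in sphere_measure. I 1 w = J Time w + S w \<and> I (-1) w = J Time w - S w \<and>
   (\<forall>i. norm (J (Space i) w) <= ennreal (norm (S w)) + N i w)"
  using AE_sphere_measure
 proof eventually_elim
  fix w :: space assume i: "\<forall>mu. integrable radial_measure (%r. h mu (r *\<^sub>R w))" and w: "norm w = 1"
  have eq: "cis (r * (x \<bullet> w)) * half_wave eps p w (r *\<^sub>R w) = h Time (r *\<^sub>R w) + of_real eps * (SUM j:UNIV. of_real (w $ j) * h (Space j) (r *\<^sub>R w))" for eps r
   by (simp add: half_wave_def h_def algebra_simps sum_distrib_left)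
  \<comment> \<open>The signs 1 and -1 recover the time component and the w-component
    \<open>S\<close> as half sum and half difference.\<close>
  have Ie: "I eps w = J Time w + of_real eps * S w" for eps
   unfolding I_def eq J_def S_def using i by simp
  have "norm (J (Space k) w) <= ennreal (norm (S w)) + N k w" for k
  proof -
   \<comment> \<open>The transform of a curl free field is parallel to \<xi>, so its component k
     would be w_k times the w-component; \<open>c\<close> is the deviation from this.\<close>
   have "AE r in radial_measure. c k (r *\<^sub>R w) = h (Space k) (r *\<^sub>R w) - of_real (w $ k) * (SUM j:UNIV. of_real (w $ j) * h (Space j) (r *\<^sub>R w))"
    using AE_radial_measure by eventually_elim (use w in \<open>simp add: c_def sgn_div_norm\<close>)
   note ae = this
   have ic: "integrable radial_measure (%r. c k (r *\<^sub>R w))"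
    by (subst integrable_cong_AE[OF _ _ ae]) (use i in auto)
   from ae have "(LINT r|radial_measure. c k (r *\<^sub>R w)) = (LINT r|radial_measure. (h (Space k) (r *\<^sub>R w) - of_real (w $ k) * (SUM j:UNIV. of_real (w $ j) * h (Space j) (r *\<^sub>R w))))"
    by (intro integral_cong_AE) (auto)
   also have "... = J (Space k) w - of_real (w $ k) * S w"
    unfolding J_def S_def using i by simp
   finally have e: "J (Space k) w = of_real (w $ k) * S w + (LINT r|radial_measure. c k (r *\<^sub>R w))" by simp
   have "norm (of_real (w $ k) * S w) <= norm (S w)"
    using component_le_norm_cart[of w k] w mult_right_mono[of "\<bar>w $ k\<bar>" 1 "norm (S w)"] by (simp add: norm_mult)
   then have "ennreal (norm (J (Space k) w)) <= ennreal (norm (S w) + norm (LINT r|radial_measure. c k (r *\<^sub>R w)))"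
    unfolding e by (intro ennreal_leI order_trans[OF norm_triangle_ineq]) simp
   also have "... = ennreal (norm (S w)) + ennreal (norm (LINT r|radial_measure. c k (r *\<^sub>R w)))" by simp
   also have "... <= ennreal (norm (S w)) + N k w"
    unfolding N_def by (intro add_mono order_refl integral_norm_bound_ennreal ic)
   finally show ?thesis .
  qed
  then show "I 1 w = J Time w + S w \<and> I (-1) w = J Time w - S w \<and> (\<forall>i. norm (J (Space i) w) <= ennreal (norm (S w)) + N i w)"
   using Ie[of 1] Ie[of "-1"] by simp
 qed
 have half: "(\<integral>\<^sup>+w. ennreal (norm (I 1 w) / 2) + ennreal (norm (I (-1) w) / 2) \<partial>sphere_measure) <= ennreal B"
 proof -
  have e: "ennreal (y / 2) = ennreal (1/2) * ennreal y" if "y >= 0" for y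
   using that ennreal_mult[of "1/2" y] by simp
  have "(\<integral>\<^sup>+w. ennreal (norm (I 1 w) / 2) + ennreal (norm (I (-1) w) / 2) \<partial>sphere_measure)
   = (\<integral>\<^sup>+w. ennreal (1/2) * ennreal (norm (I 1 w)) + ennreal (1/2) * ennreal (norm (I (-1) w)) \<partial>sphere_measure)"
   by (simp only: e[OF norm_ge_zero])
  also have "... = ennreal (1/2) * (\<integral>\<^sup>+w. norm (I 1 w) \<partial>sphere_measure) + ennreal (1/2) * (\<integral>\<^sup>+w. norm (I (-1) w) \<partial>sphere_measure)"
   by (simp add: nn_integral_add nn_integral_cmult)
  also have "... <= ennreal (1/2) * ennreal B + ennreal (1/2) * ennreal B"
   unfolding I_def by (intro add_mono mult_left_mono B) auto
  also have "... = ennreal B" using B(2) by (simp only: e[symmetric] ennreal_plus[symmetric] divide_nonneg_nonneg zero_le_numeral) simp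
  finally show ?thesis .
 qed
 have "(\<integral>\<^sup>+w. norm (J mu w) \<partial>sphere_measure) <= ennreal (B + R)"
 proof (cases mu)
  case Time
  have "(\<integral>\<^sup>+w. norm (J mu w) \<partial>sphere_measure) <= (\<integral>\<^sup>+w. ennreal (norm (I 1 w) / 2) + ennreal (norm (I (-1) w) / 2) \<partial>sphere_measure)"
  proof (rule nn_integral_mono_AE, rule eventually_mono[OF main])
   fix w assume "I 1 w = J Time w + S w \<and> I (-1) w = J Time w - S w \<and> (\<forall>i. norm (J (Space i) w) <= ennreal (norm (S w)) + N i w)"
   then have e: "I 1 w = J Time w + S w" "I (-1) w = J Time w - S w" by auto
   have "J Time w = I 1 w / 2 + I (-1) w / 2" unfolding e by (simp add: field_simps)
   then have "norm (J mu w) <= norm (I 1 w) / 2 + norm (I (-1) w) / 2"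
    using norm_triangle_ineq[of "I 1 w / 2" "I (-1) w / 2"] Time by (simp add: norm_divide)
   then show "ennreal (norm (J mu w)) <= ennreal (norm (I 1 w) / 2) + ennreal (norm (I (-1) w) / 2)"
    by (simp add: ennreal_plus[symmetric] ennreal_leI del: ennreal_plus)
  qed
  also note half
  also have "ennreal B <= ennreal (B + R)" using R(2) by (intro ennreal_leI) simp
  finally show ?thesis .
 next
  case (Space i)
  have "(\<integral>\<^sup>+w. norm (J mu w) \<partial>sphere_measure) <= (\<integral>\<^sup>+w. (ennreal (norm (I 1 w) / 2) + ennreal (norm (I (-1) w) / 2)) + N i w \<partial>sphere_measure)"
  proof (rule nn_integral_mono_AE, rule eventually_mono[OF main])
   fix w assume *: "I 1 w = J Time w + S w \<and> I (-1) w = J Time w - S w \<and> (\<forall>i. norm (J (Space i) w) <= ennreal (norm (S w)) + N i w)"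
   then have e: "I 1 w = J Time w + S w" "I (-1) w = J Time w - S w" by auto
   have "S w = I 1 w / 2 - I (-1) w / 2" unfolding e by (simp add: field_simps)
   then have "norm (S w) <= norm (I 1 w) / 2 + norm (I (-1) w) / 2"
    using norm_triangle_ineq4[of "I 1 w / 2" "I (-1) w / 2"] by (simp add: norm_divide)
   then have "ennreal (norm (S w)) <= ennreal (norm (I 1 w) / 2) + ennreal (norm (I (-1) w) / 2)"
    by (simp add: ennreal_plus[symmetric] ennreal_leI del: ennreal_plus)
   then show "ennreal (norm (J mu w)) <= (ennreal (norm (I 1 w) / 2) + ennreal (norm (I (-1) w) / 2)) + N i w"
    using * unfolding Space by (meson add_right_mono order_trans)
  qed
  also have "... = (\<integral>\<^sup>+w. ennreal (norm (I 1 w) / 2) + ennreal (norm (I (-1) w) / 2) \<partial>sphere_measure) + (\<integral>\<^sup>+w. N i w \<partial>sphere_measure)"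
   by (rule nn_integral_add) measurable
  also have "... <= ennreal B + ennreal R" by (intro add_mono half NR)
  finally show ?thesis using B(2) R(2) by simp
 qed
 moreover have "ennreal ((2 * pi) ^ 3 * norm (p mu x)) <= (\<integral>\<^sup>+w. norm (J mu w) \<partial>sphere_measure)"
 proof -
  have "(2 * pi) ^ 3 * norm (p mu x) = norm (LINT xi|lborel. h mu xi)"
   unfolding h_def fourier_inversion[OF ip cp ih] by (simp add: norm_mult norm_power)
  also have "... = norm (LINT w|sphere_measure. J mu w)" unfolding integral_polar(1)[OF hi] J_def ..
  finally show ?thesis 
   using integral_norm_bound_ennreal[of sphere_measure "J mu"] integral_polar(2)[OF hi[of mu]] unfolding J_def by simp
 qed
 ultimately have "ennreal ((2 * pi) ^ 3 * norm (p mu x)) <= ennreal (B + R)" by (rule order_trans[rotated])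
 then have 1: "(2 * pi) ^ 3 * norm (p mu x) <= B + R" using B(2) R(2) by (subst (asm) ennreal_le_iff) auto
 have "1 * norm (p mu x) <= (2 * pi) ^ 3 * norm (p mu x)"
  using pi_gt3 by (intro mult_right_mono one_le_power) auto
 with 1 show ?thesis by simp
qed

section \<open>Sobolev weights in frequency\<close>

lemma weight_integral: "(\<integral>\<^sup>+xi. ennreal (1 / ((norm (xi::space))^2 * (1 + (norm xi)^2))) \<partial>lborel) <= ennreal (8 * pi ^ 2)"
proof -
 have "(\<integral>\<^sup>+xi. ennreal (1 / ((norm (xi::space))^2 * (1 + (norm xi)^2))) \<partial>lborel)
  = (\<integral>\<^sup>+w. \<integral>\<^sup>+r. ennreal (1 / ((norm (r *\<^sub>R w))^2 * (1 + (norm (r *\<^sub>R w))^2))) \<partial>radial_measure \<partial>sphere_measure)"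
  by (rule nn_integral_polar) simp
 also have "... <= (\<integral>\<^sup>+w. ennreal (pi / 2) \<partial>sphere_measure)"
 proof (rule nn_integral_mono_AE, rule eventually_mono[OF AE_sphere_measure])
  fix w :: space assume w: "norm w = 1"
  have "(\<integral>\<^sup>+r. ennreal (1 / ((norm (r *\<^sub>R w))^2 * (1 + (norm (r *\<^sub>R w))^2))) \<partial>radial_measure)
    = (\<integral>\<^sup>+r. ennreal (r^2) * indicator {0<..} r * ennreal (1 / (r^2 * (1 + r^2))) \<partial>lborel)"
   using w by (subst nn_integral_radial_measure) auto
  also have "... <= (\<integral>\<^sup>+r. ennreal (1 / (1 + r^2)) * indicator {0..} r \<partial>lborel)"
   by (intro nn_integral_mono) (auto simp: ennreal_mult[symmetric] split: split_indicator)
  also have "... = ennreal (pi / 2 - arctan 0)"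
   by (rule nn_integral_FTC_atLeast) (auto intro!: derivative_eq_intros tendsto_arctan_at_top simp: add_nonneg_eq_0_iff field_simps)
  finally show "(\<integral>\<^sup>+r. ennreal (1 / ((norm (r *\<^sub>R w))^2 * (1 + (norm (r *\<^sub>R w))^2))) \<partial>radial_measure) <= ennreal (pi / 2)" by simp
 qed
 also have "... = ennreal (2 * pi ^ 2)"
  by (simp add: emeasure_sphere_measure ennreal_mult[symmetric] power2_eq_square)
 also have "... <= ennreal (8 * pi ^ 2)" by (intro ennreal_leI) simp
 finally show ?thesis .
qed

lemma L2_sum:
 assumes J: "finite J" and m: "!!j. j : J ==> h j : borel_measurable M" and A: "A >= 0"
  and b: "!!j. j : J ==> (\<integral>\<^sup>+x. ennreal ((h j x)^2) \<partial>M) <= ennreal (A^2)"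
 shows "(\<integral>\<^sup>+x. ennreal ((SUM j:J. h j x)^2) \<partial>M) <= ennreal ((real (card J) * A)^2)"
proof -
 have "(SUM j:J. h j x)^2 <= real (card J) * (SUM j:J. (h j x)^2)" for x
  using Cauchy_Schwarz_ineq_sum[of "%_. 1" "%j. h j x" J] by simp
 then have "(\<integral>\<^sup>+x. ennreal ((SUM j:J. h j x)^2) \<partial>M) <= (\<integral>\<^sup>+x. ennreal (card J) * (SUM j:J. ennreal ((h j x)^2)) \<partial>M)"
  by (intro nn_integral_mono) (simp add: ennreal_mult[symmetric] sum_ennreal sum_nonneg ennreal_leI)
 also have "... = ennreal (card J) * (SUM j:J. \<integral>\<^sup>+x. ennreal ((h j x)^2) \<partial>M)"
  using m by (subst nn_integral_cmult, measurable, subst nn_integral_sum) auto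
 also have "... <= ennreal (card J) * (SUM j:J. ennreal (A^2))"
  by (intro mult_left_mono sum_mono b) auto
 also have "... = ennreal ((real (card J) * A)^2)"
  using A by (simp add: sum_ennreal ennreal_mult[symmetric] power2_eq_square mult_ac del: sum_constant) (simp add: ennreal_mult[symmetric] ennreal_of_nat_eq_real_of_nat mult_ac)
 finally show ?thesis .
qed

text \<open>The 23 is the root of Plancherel's constant, rounded up: 2 pi < 8 and 8^3 = 512 < 529 =
  23^2.\<close>

lemma L2_fourier:
 assumes g: "integrable lborel g" and le: "!!x. norm (g x) <= G x" and G: "(\<integral>\<^sup>+x. ennreal ((G x)^2) \<partial>lborel) <= ennreal (N^2)"
 shows "(\<integral>\<^sup>+xi. ennreal ((norm (fourier g xi))^2) \<partial>lborel) <= ennreal ((23 * N)^2)"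
proof -
 let ?A = "\<integral>\<^sup>+x. ennreal ((norm (g x))^2) \<partial>lborel"
 have "?A <= (\<integral>\<^sup>+x. ennreal ((G x)^2) \<partial>lborel)"
  by (intro nn_integral_mono ennreal_leI power_mono le) auto
 with G have "?A <= ennreal (N^2)" by (rule order_trans[rotated])
 with plancherel_le[OF g] have "(\<integral>\<^sup>+xi. ennreal ((norm (fourier g xi))^2) \<partial>lborel) <= ennreal ((2 * pi) ^ 3) * ennreal (N^2)"
  by (meson mult_left_mono order_trans zero_le)
 also have "... = ennreal ((2 * pi) ^ 3 * N^2)" by (simp add: ennreal_mult)
 also have "... <= ennreal ((23 * N)^2)"
 proof (intro ennreal_leI)
  have "(2 * pi) ^ 3 <= (2 * 4) ^ 3" using pi_less_4 by (intro power_mono) auto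
  then have "(2 * pi) ^ 3 * N^2 <= 23^2 * N^2" by (intro mult_right_mono) auto
  then show "(2 * pi) ^ 3 * N^2 <= (23 * N)^2" by (simp add: power_mult_distrib)
 qed
 finally show ?thesis .
qed

lemma fourier_H1:
 assumes g: "has_gradient g Dg" and i: "integrable lborel g" "!!i. integrable lborel (Dg i)"
 shows "sqrt (1 + (norm xi)^2) * norm (fourier g xi) <= norm (fourier g xi) + (SUM i:UNIV. norm (fourier (Dg i) xi))"
proof -
 have "sqrt (1 + (norm xi)^2) <= 1 + norm xi" by (intro real_le_lsqrt) (auto simp: power2_eq_square algebra_simps)
 also have "... <= 1 + (SUM i:UNIV. \<bar>xi $ i\<bar>)" by (simp add: norm_le_l1_cart)
 finally have "sqrt (1 + (norm xi)^2) * norm (fourier g xi) <= (1 + (SUM i:UNIV. \<bar>xi $ i\<bar>)) * norm (fourier g xi)"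
  by (rule mult_right_mono) simp
 then show ?thesis by (simp add: fourier_deriv[OF g i] norm_mult distrib_right sum_distrib_right)
qed

lemma fourier_H2:
 assumes g: "has_gradient g Dg" and i: "integrable lborel g" "!!i. integrable lborel (Dg i)"
  and g2: "!!i. has_gradient (Dg i) (DDg i)" and i2: "!!i. integrable lborel (DDg i i)"
 shows "(1 + (norm xi)^2) * norm (fourier g xi) <= norm (fourier g xi) + (SUM i:UNIV. norm (fourier (DDg i i) xi))"
proof -
 have "(norm xi)^2 = (SUM i:UNIV. xi $ i * xi $ i)" 
  by (simp add: power2_norm_eq_inner inner_vec_def)
 moreover have "norm (fourier (DDg k k) xi) = xi $ k * xi $ k * norm (fourier g xi)" for k
  unfolding fourier_deriv[OF g2 i(2) i2] fourier_deriv[OF g i] by (simp add: norm_mult mult.assoc[symmetric])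
 ultimately show ?thesis by (simp add: distrib_right sum_distrib_right)
qed

lemma L2_scaled_mono:
 assumes "!!x. 0 <= f x" "!!x. f x <= g x" "(\<integral>\<^sup>+x. ennreal ((g x)^2) \<partial>M) <= ennreal (A^2)"
 shows "(\<integral>\<^sup>+x. ennreal ((f x)^2) \<partial>M) <= ennreal (A^2)"
 by (rule order_trans[OF nn_integral_mono assms(3)]) (use assms in \<open>auto intro!: ennreal_leI power_mono\<close>)

lemma L2_norm_fourier_sum:
 fixes f :: "'j => space => complex"
 assumes J: "finite J" and i: "!!j. j : J ==> integrable lborel (f j)" and N: "N >= 0"
  and le: "!!j x. j : J ==> norm (f j x) <= G x" and G: "(\<integral>\<^sup>+x. ennreal ((G x)^2) \<partial>lborel) <= ennreal (N^2)"
  and h: "!!xi. 0 <= h xi" "!!xi. h xi <= (SUM j:J. norm (fourier (f j) xi))"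
 shows "(\<integral>\<^sup>+xi. ennreal ((h xi)^2) \<partial>lborel) <= ennreal ((real (card J) * (23 * N))^2)"
proof (rule L2_scaled_mono[OF h L2_sum[OF J]])
 show "(%xi. norm (fourier (f j) xi)) : borel_measurable lborel" if "j : J" for j
  using fourier_borel[OF i[OF that]] by simp
 show "(\<integral>\<^sup>+xi. ennreal ((norm (fourier (f j) xi))^2) \<partial>lborel) <= ennreal ((23 * N)^2)" if "j : J" for j
  by (rule L2_fourier[OF i[OF that] le[OF that] G])
qed (use N in auto)

text \<open>Cauchy-Schwarz against 1 / (|\<xi>| (1 + |\<xi>|^2)^(1/2)), which is square integrable
  in three dimensions by \<open>weight_integral\<close>; 3 pi comes from 8 pi^2 <= 9 pi^2. The
  division by |\<xi>| is needed for the curl defect, where a derivative has to be undone.\<close>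

lemma weighted_L1:
 assumes m: "h : borel_measurable borel" and h: "!!xi::space. 0 <= h xi" and N: "N >= 0"
  and b: "(\<integral>\<^sup>+xi. ennreal ((sqrt (1 + (norm xi)^2) * h xi)^2) \<partial>lborel) <= ennreal (N^2)"
 shows "(\<integral>\<^sup>+xi. ennreal (h xi / norm xi) \<partial>lborel) <= ennreal (N * (3 * pi))"
proof -
 note [measurable] = m
 have "(\<integral>\<^sup>+xi. ennreal (h xi / norm xi) \<partial>lborel) = (\<integral>\<^sup>+xi. ennreal (sqrt (1 + (norm xi)^2) * h xi * (1 / (norm xi * sqrt (1 + (norm xi)^2)))) \<partial>lborel)"
 proof (rule nn_integral_cong)
  fix xi :: space
  have "sqrt (1 + (norm xi)^2) > 0" by (simp add: add_pos_nonneg)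
  then show "ennreal (h xi / norm xi) = ennreal (sqrt (1 + (norm xi)^2) * h xi * (1 / (norm xi * sqrt (1 + (norm xi)^2))))"
   by simp
 qed
 also have "... <= ennreal (N * (3 * pi))"
 proof (rule cauchy_schwarz_nn[OF _ _ _ _ b])
  have "(\<integral>\<^sup>+xi. ennreal ((1 / (norm (xi::space) * sqrt (1 + (norm xi)^2)))^2) \<partial>lborel) = (\<integral>\<^sup>+xi. ennreal (1 / ((norm (xi::space))^2 * (1 + (norm xi)^2))) \<partial>lborel)"
   by (simp add: power_divide power_mult_distrib)
  also note weight_integral
  also have "ennreal (8 * pi^2) <= ennreal ((3 * pi)^2)" by (intro ennreal_leI) (simp add: power_mult_distrib)
  finally show "(\<integral>\<^sup>+xi. ennreal ((1 / (norm (xi::space) * sqrt (1 + (norm xi)^2)))^2) \<partial>lborel) <= ennreal ((3 * pi)^2)" .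
 qed (use h N in auto)
 finally show ?thesis .
qed

text \<open>In three dimensions H^2 functions have integrable transforms. \<open>weighted_L1\<close>
  is applied to (1 + |\<xi>|^2)^(1/2) times the transform, as |\<xi>| is at most this root.\<close>

lemma fourier_L1:
 assumes g: "integrable lborel g" and N: "N >= 0"
  and b: "(\<integral>\<^sup>+xi. ennreal (((1 + (norm xi)^2) * norm (fourier g xi))^2) \<partial>lborel) <= ennreal (N^2)"
 shows "integrable lborel (fourier g)"
proof -
 note [measurable] = fourier_borel[OF g]
 have "(\<integral>\<^sup>+xi. ennreal (norm (fourier g xi)) \<partial>lborel) <= (\<integral>\<^sup>+xi. ennreal (sqrt (1 + (norm xi)^2) * norm (fourier g xi) / norm xi) \<partial>lborel)"
 proof (rule nn_integral_mono_AE, rule eventually_mono[OF AE_lborel_singleton[of 0]])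
  fix xi :: space assume "xi ~= 0"
  then have p: "norm xi > 0" by simp
  have "norm xi <= sqrt (1 + (norm xi)^2)" by (intro real_le_rsqrt) simp
  then have "norm (fourier g xi) * norm xi <= norm (fourier g xi) * sqrt (1 + (norm xi)^2)" by (intro mult_left_mono) auto
  with p show "ennreal (norm (fourier g xi)) <= ennreal (sqrt (1 + (norm xi)^2) * norm (fourier g xi) / norm xi)"
   by (intro ennreal_leI) (simp add: field_simps)
 qed
 also have "... <= ennreal (N * (3 * pi))"
 proof (rule weighted_L1)
  have q: "sqrt (1 + (norm xi)^2) * (sqrt (1 + (norm xi)^2) * y) = (1 + (norm xi)^2) * y" for xi :: space and y
   by (simp add: mult.assoc[symmetric])
  show "(\<integral>\<^sup>+xi. ennreal ((sqrt (1 + (norm xi)^2) * (sqrt (1 + (norm xi)^2) * norm (fourier g xi)))^2) \<partial>lborel) <= ennreal (N^2)"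
   unfolding q by (rule b)
 qed (use N in auto)
 finally show ?thesis by (intro integrableI_bounded) (auto simp: ennreal_less_top order.strict_trans1)
qed

section \<open>Gaussian cutoffs\<close>

lemma has_gradient_mult:
 assumes "has_gradient u Du" "has_gradient v Dv"
 shows "has_gradient (%x. u x * v x) (%i x. Du i x * v x + u x * Dv i x)"
 unfolding has_gradient_def
proof (intro conjI allI)
 fix x
 have "((%x. u x * v x) has_derivative (%y. u x * (SUM i:UNIV. (y $ i) *\<^sub>R Dv i x) + (SUM i:UNIV. (y $ i) *\<^sub>R Du i x) * v x)) (at x)"
  using assms unfolding has_gradient_def by (intro has_derivative_mult) auto
 moreover have "u x * (SUM i:UNIV. (y $ i) *\<^sub>R Dv i x) + (SUM i:UNIV. (y $ i) *\<^sub>R Du i x) * v x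
   = (SUM i:UNIV. (y $ i) *\<^sub>R (Du i x * v x + u x * Dv i x))" for y :: space
  by (simp add: sum_distrib_left sum_distrib_right sum.distrib scaleR_add_right add.commute)
 ultimately show "((%x. u x * v x) has_derivative (%y. SUM i:UNIV. (y $ i) *\<^sub>R (Du i x * v x + u x * Dv i x))) (at x)"
  by simp
next
 show "continuous_on UNIV (%x. Du i x * v x + u x * Dv i x)" for i
  using has_gradient_continuous[OF assms(1)] has_gradient_continuous[OF assms(2)] by (intro continuous_intros) auto
qed

lemma has_gradient_add:
 assumes "has_gradient u Du" "has_gradient v Dv"
 shows "has_gradient (%x. u x + v x) (%i x. Du i x + Dv i x)"
 using assms unfolding has_gradient_def
 by (auto intro!: continuous_intros derivative_eq_intros simp: scaleR_add_right sum.distrib)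

lemma has_gradient_const: "has_gradient (%x. c) (%i x. 0)"
 unfolding has_gradient_def by auto

lemma has_gradient_sum:
 "finite K ==> (!!k. k : K ==> has_gradient (u k) (Du k)) ==> has_gradient (%x. SUM k:K. u k x) (%i x. SUM k:K. Du k i x)"
 by (induction K rule: finite_induct) (auto intro: has_gradient_add has_gradient_const)

lemma has_gradient_of_real:
 assumes "!!x. (m has_derivative (%y. SUM i:UNIV. (y $ i) * Dm i x)) (at x)" "!!i. continuous_on UNIV (Dm i)"
 shows "has_gradient (%x. of_real (m x)) (%i x. of_real (Dm i x))"
 unfolding has_gradient_def
proof (intro conjI allI)
 fix x
 from has_derivative_of_real[OF assms(1)[of x]]
 show "((%x. complex_of_real (m x)) has_derivative (%y. SUM i:UNIV. (y $ i) *\<^sub>R complex_of_real (Dm i x))) (at x)"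
  by (simp add: scaleR_conv_of_real)
qed (auto intro!: continuous_intros assms)

lemma has_gradient_coord: "has_gradient (%x. of_real (x $ k)) (%i x. if i = k then 1 else 0)"
proof -
 have "((%x::space. x $ k) has_derivative (%y. SUM i:UNIV. (y $ i) * (if i = k then 1 else 0))) (at x)" for x
  using bounded_linear_imp_has_derivative[OF bounded_linear_vec_nth[of k]] by (simp add: if_distrib cong: if_cong)
 from has_gradient_of_real[OF this] show ?thesis by (simp add: if_distrib cong: if_cong)
qed

text \<open>\<open>cut1\<close> and \<open>cut2\<close> are first and second partial derivatives of \<open>cut\<close>, \<open>cutd\<close> is its radial derivative and \<open>cutd1\<close> the gradient of the latter.\<close>

definition cut :: "real => space => complex" where "cut eta x = of_real (gauss eta x)"
definition cut1 :: "real => 3 => space => complex" where "cut1 eta i x = - of_real (eta^2) * (of_real (x $ i) * cut eta x)"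
definition cut2 :: "real => 3 => 3 => space => complex" where
 "cut2 eta i j x = - of_real (eta^2) * ((if j = i then cut eta x else 0) + of_real (x $ i) * cut1 eta j x)"
definition cutd :: "real => space => complex" where "cutd eta x = (SUM k:UNIV. of_real (x $ k) * cut1 eta k x)"
definition cutd1 :: "real => 3 => space => complex" where "cutd1 eta j x = cut1 eta j x + (SUM k:UNIV. of_real (x $ k) * cut2 eta k j x)"

lemma gauss_continuous [continuous_intros]: "continuous_on A (gauss eta)"
 unfolding gauss_def by (intro continuous_intros) auto

lemma has_gradient_cut: "has_gradient (cut eta) (cut1 eta)"
proof -
 let ?A = "%x. exp (- (eta^2 * (x \<bullet> x) / 2))"
 have "(gauss eta has_derivative (%y. SUM i:UNIV. (y $ i) * (- (eta^2 * ((x $ i) * gauss eta x))))) (at x)" for x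
 proof -
  have g: "gauss eta = ?A"
   by (rule ext) (simp add: gauss_def power_mult_distrib power2_norm_eq_inner)
  have "(?A has_derivative (%y. exp (- (eta^2 * (x \<bullet> x) / 2)) * (- (eta^2 * (x \<bullet> y + y \<bullet> x) / 2)))) (at x)"
   by (auto intro!: derivative_eq_intros)
  moreover have "exp (- (eta^2 * (x \<bullet> x) / 2)) * (- (eta^2 * (x \<bullet> y + y \<bullet> x) / 2)) = (SUM i:UNIV. (y $ i) * (- (eta^2 * ((x $ i) * exp (- (eta^2 * (x \<bullet> x) / 2))))))" for y
  proof -
   have "x \<bullet> y + y \<bullet> x = 2 * (SUM i:UNIV. x $ i * y $ i)" by (simp add: inner_commute[of y x]) (simp add: inner_vec_def)
   then show ?thesis by (simp add: sum_distrib_left mult_ac sum_negf)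
  qed
  ultimately show ?thesis unfolding g by simp
 qed
 moreover have "continuous_on UNIV (%x. - (eta^2 * ((x $ i) * gauss eta x)))" for i
  by (intro continuous_intros)
 ultimately have "has_gradient (%x. complex_of_real (gauss eta x)) (%i x. complex_of_real (- (eta^2 * ((x $ i) * gauss eta x))))"
  by (rule has_gradient_of_real)
 then show ?thesis unfolding cut_def[abs_def] cut1_def[abs_def] by (simp add: cut_def[abs_def])
qed

lemma has_gradient_cut1: "has_gradient (cut1 eta i) (cut2 eta i)"
proof -
 let ?A = "%x. - of_real (eta^2) * (of_real (x $ i) * cut eta x)"
 have "has_gradient ?A (%j x. 0 * (of_real (x $ i) * cut eta x) + (- of_real (eta^2)) * ((if j = i then 1 else 0) * cut eta x + of_real (x $ i) * cut1 eta j x))"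
  by (intro has_gradient_mult has_gradient_const has_gradient_coord has_gradient_cut)
 moreover have "cut1 eta i = ?A" by (rule ext) (rule cut1_def)
 moreover have "(if P then 1 else 0) * z = (if P then z else 0)" for P and z :: complex by simp
 ultimately show ?thesis unfolding cut2_def[abs_def] by simp
qed

lemma has_gradient_cutd: "has_gradient (cutd eta) (cutd1 eta)"
proof -
 have "has_gradient (cutd eta) (%j x. SUM k:UNIV. (if j = k then 1 else 0) * cut1 eta k x + of_real (x $ k) * cut2 eta k j x)"
  unfolding cutd_def[abs_def] by (intro has_gradient_sum has_gradient_mult has_gradient_coord has_gradient_cut1) simp
 moreover have "(SUM k:UNIV. (if j = k then 1 else 0) * cut1 eta k x + of_real (x $ k) * cut2 eta k j x) = cutd1 eta j x" for j x
 proof -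
  have "(SUM k:UNIV. (if j = k then 1 else 0) * cut1 eta k x) = (SUM k:UNIV. if j = k then cut1 eta k x else 0)"
   by (intro sum.cong) auto
  then show ?thesis by (simp add: cutd1_def sum.distrib)
 qed
 ultimately show ?thesis by simp
qed

text \<open>Gaussian decay of unspecified width. The class is stable under multiplication by
  coordinates, hence contains all derivatives of the cutoff, and products with continuous square
  integrable functions are integrable.\<close>

definition rapid :: "(space => complex) => bool" where
 "rapid m \<longleftrightarrow> continuous_on UNIV m \<and> (\<exists>K\<ge>0. \<exists>c>0. \<forall>x. norm (m x) <= K * gauss c x)"

lemma rapidI: "continuous_on UNIV m ==> K >= 0 ==> c > 0 ==> (!!x. norm (m x) <= K * gauss c x) ==> rapid m"
 unfolding rapid_def by blast

lemma rapid_continuous: "rapid m ==> continuous_on UNIV m" by (simp add: rapid_def)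

lemma gauss_antimono: "0 <= c ==> c <= d ==> gauss d x <= gauss c x"
 unfolding gauss_def by (auto intro!: power_mono mult_right_mono)

lemma rapid_cut: "eta > 0 ==> rapid (cut eta)"
 by (rule rapidI[of _ 1 eta]) (auto simp: cut_def[abs_def] less_imp_le[OF gauss_pos] intro!: continuous_intros)

lemma rapid_add: assumes "rapid m" "rapid n" shows "rapid (%x. m x + n x)"
proof -
 obtain K c L d where *: "K >= 0" "c > 0" "L >= 0" "d > 0" "!!x. norm (m x) <= K * gauss c x" "!!x. norm (n x) <= L * gauss d x"
  using assms unfolding rapid_def by blast
 have "norm (m x + n x) <= (K + L) * gauss (min c d) x" for x
 proof -
  have "norm (m x) <= K * gauss (min c d) x" "norm (n x) <= L * gauss (min c d) x"
   using * by (auto intro!: order_trans[OF *(5)] order_trans[OF *(6)] mult_left_mono gauss_antimono)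
  then show ?thesis using norm_triangle_ineq[of "m x" "n x"] by (simp add: distrib_right)
 qed
 then show ?thesis using *(1-4) rapid_continuous[OF assms(1)] rapid_continuous[OF assms(2)]
  by (intro rapidI[of _ "K + L" "min c d"] continuous_intros) auto
qed

lemma rapid_cmult: assumes "rapid m" shows "rapid (%x. c * m x)"
proof -
 obtain K d where *: "K >= 0" "d > 0" "!!x. norm (m x) <= K * gauss d x"
  using assms unfolding rapid_def by blast
 then have "norm (c * m x) <= (norm c * K) * gauss d x" for x
  using mult_left_mono[OF *(3), of "norm c" x] by (simp add: norm_mult mult.assoc)
 then show ?thesis using *(1,2) rapid_continuous[OF assms]
  by (intro rapidI[of _ "norm c * K" d] continuous_intros) auto
qed

lemma rapid_sum: "finite J ==> (!!j. j : J ==> rapid (m j)) ==> rapid (%x. SUM j:J. m j x)"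
proof (induction J rule: finite_induct)
 case empty
 show ?case using rapid_cmult[OF rapid_cut[of 1], of 0] by simp
qed (simp add: rapid_add)

lemma rapid_coord: assumes "rapid m" shows "rapid (%x. of_real (x $ k) * m x)"
proof -
 obtain K d where *: "K >= 0" "d > 0" "!!x. norm (m x) <= K * gauss d x"
  using assms unfolding rapid_def by blast
 have "norm (of_real (x $ k) * m x) <= (2 * K / d) * gauss (d / 2) x" for x
 proof -
  define z where "z = d * norm x"
  have z: "z >= 0" using *(2) by (simp add: z_def)
  \<comment> \<open>Completing the square gives z/2 <= 1 + 3 z^2/8, so z <= 2 exp(3 z^2/8). The
    exponent 3/8 = 1/2 - 1/8 is what halving the parameter \<open>d\<close> of the Gaussian sets
    free.\<close>
  have "0 <= (1 - z / 4)^2 + (5 / 16) * z^2" by simp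
  also have "... = 1 + 3 * z^2 / 8 - z / 2" by (simp add: power2_eq_square algebra_simps)
  also have "1 + 3 * z^2 / 8 <= exp (3 * z^2 / 8)" by (rule exp_ge_add_one_self)
  finally have "z <= 2 * exp (3 * z^2 / 8)" by simp
  then have "z * exp (- (3 * z^2 / 8)) <= 2" by (simp add: exp_minus field_simps)
  then have "z * exp (- (3 * z^2 / 8)) * gauss (d / 2) x <= 2 * gauss (d / 2) x"
   using gauss_pos[of "d / 2" x] by (intro mult_right_mono) auto
  moreover have "exp (- (3 * z^2 / 8)) * gauss (d / 2) x = gauss d x"
   unfolding gauss_def exp_add[symmetric] z_def by (simp add: power_mult_distrib power_divide field_simps)
  ultimately have "z * gauss d x <= 2 * gauss (d / 2) x" by (simp add: mult.assoc)
  then have 1: "norm x * gauss d x <= 2 / d * gauss (d / 2) x" using *(2) by (simp add: z_def field_simps)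
  have "norm (of_real (x $ k) * m x) <= norm x * (K * gauss d x)"
   unfolding norm_mult using * by (intro mult_mono) (auto simp: component_le_norm_cart)
  also have "... = K * (norm x * gauss d x)" by simp
  also have "... <= K * (2 / d * gauss (d / 2) x)" using 1 *(1) by (rule mult_left_mono)
  finally show ?thesis by (simp add: mult_ac)
 qed
 then show ?thesis using *(1,2) rapid_continuous[OF assms]
  by (intro rapidI[of _ "2 * K / d" "d / 2"] continuous_intros) auto
qed

lemma rapid_cuts:
 assumes "eta > 0" shows "rapid (cut1 eta i)" "rapid (cut2 eta i j)" "rapid (cutd eta)" "rapid (cutd1 eta j)"
proof -
 have 0: "rapid (%x. 0)" using rapid_cmult[OF rapid_cut[of 1], of 0] by simp
 show 1: "rapid (cut1 eta i)" for i
  unfolding cut1_def[abs_def] by (intro rapid_cmult rapid_coord rapid_cut assms)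
 have "rapid (%x. if j = i then cut eta x else 0)" for i j by (cases "j = i") (simp_all add: 0 rapid_cut assms)
 then show 2: "rapid (cut2 eta i j)" for i j
  unfolding cut2_def[abs_def] by (intro rapid_cmult rapid_coord rapid_add 1)
 show "rapid (cutd eta)" unfolding cutd_def[abs_def] by (intro rapid_sum rapid_coord 1) simp
 show "rapid (cutd1 eta j)" unfolding cutd1_def[abs_def] by (intro rapid_sum rapid_coord rapid_add 1 2) simp
qed

lemma rapid_integrable:
 assumes m: "rapid m" and v: "continuous_on UNIV v" and f: "(\<integral>\<^sup>+x. ennreal ((norm (v x))^2) \<partial>lborel) < \<infinity>"
 shows "integrable lborel (%x. m x * v x)"
proof -
 obtain K d where *: "K >= 0" "d > 0" "!!x. norm (m x) <= K * gauss d x" and cm: "continuous_on UNIV m"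
  using m unfolding rapid_def by blast
 have [measurable]: "v : borel_measurable borel" "m : borel_measurable borel"
  using v cm by (auto intro: borel_measurable_continuous_onI)
 have iv: "integrable lborel (%x. (norm (v x))^2)"
  using f by (intro integrableI_bounded) auto
 show ?thesis
 proof (rule Bochner_Integration.integrable_bound)
  show "integrable lborel (%x. K^2 * gauss d x + (norm (v x))^2)"
   by (intro Bochner_Integration.integrable_add integrable_mult_right gauss_integrable iv *)
  have "norm (m x * v x) <= K^2 * gauss d x + (norm (v x))^2" for x
  proof -
   have "norm (m x) * norm (v x) <= (norm (m x))^2 + (norm (v x))^2"
    using sum_squares_bound[of "norm (m x)" "norm (v x)"] mult_nonneg_nonneg[OF norm_ge_zero norm_ge_zero, of "m x" "v x"] by linarith
   moreover have "(norm (m x))^2 <= (K * gauss d x)^2" using * by (intro power_mono) auto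
   moreover have "(K * gauss d x)^2 <= K^2 * gauss d x"
    unfolding power_mult_distrib using gauss_pos[of d x] gauss_le_1[of d x] by (intro mult_left_mono) (auto simp: power2_eq_square mult_le_cancel_left1)
   ultimately show ?thesis by (simp add: norm_mult)
  qed
  then show "AE x in lborel. norm (m x * v x) <= norm (K^2 * gauss d x + (norm (v x))^2)"
   by (intro AE_I2) (smt (verit) real_norm_def)
 qed measurable
qed

text \<open>exp z >= 1 + z + z^2/2 with z = (eta |x|)^2/2: the Gaussian absorbs a quartic polynomial
  in eta |x|. In \<open>cut_bounds\<close> the fact \<open>gle\<close> reads the constants for the
  derivatives off this inequality.\<close>

lemma gauss_poly: "(1 + (eta * norm x)^2 / 2 + (eta * norm x) ^ 4 / 8) * gauss eta x <= 1"
proof -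
 define z where "z = (eta * norm x)^2 / 2"
 have "1 + z + z^2 / 2 <= exp z" by (rule exp_lower_Taylor_quadratic) (simp add: z_def)
 then have "(1 + z + z^2 / 2) * exp (- z) <= exp z * exp (- z)" by (rule mult_right_mono) simp
 also have "... = 1" by (simp add: exp_add[symmetric])
 finally have "(1 + z + z^2 / 2) * exp (- z) <= 1" .
 moreover have "z^2 / 2 = (eta * norm x) ^ 4 / 8" by (simp add: z_def power2_eq_square eval_nat_numeral)
 moreover have "exp (- z) = gauss eta x" by (simp add: gauss_def z_def)
 ultimately show ?thesis unfolding z_def by (simp only:)
qed

text \<open>Up to constants this majorizes every derivative of the cutoff that occurs. Partial
  derivatives are of size eta; the radial derivative is invariant under scaling and so not uniformly
  small, but it is bounded and tends to 0 at each x, which suits dominated convergence.\<close>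

definition cutoff_error :: "real => space => real" where "cutoff_error eta x = eta + min 1 ((eta * norm x)^2)"

lemma cut_bounds:
 assumes eta: "0 < eta" "eta <= 1"
 shows "norm (cut eta x) <= 1" "norm (cut1 eta i x) <= eta" "norm (cut2 eta i j x) <= 2 * eta"
  "norm (cutd eta x) <= 2 * min 1 ((eta * norm x)^2)" "norm (cutd1 eta j x) <= 6 * eta"
proof -
 define y where "y = eta * norm x"
 let ?A = "1 + y^2 / 2 + y ^ 4 / 8"
 define g where "g = gauss eta x"
 have g: "0 < g" "g <= 1" using gauss_pos gauss_le_1 by (auto simp: g_def)
 have y: "y >= 0" using eta by (simp add: y_def)
 have gp: "?A * g <= 1" using gauss_poly[of eta x] by (simp add: y_def g_def)
 have gle: "q * g <= C" if "q <= C * ?A" "C >= 0" for q C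
 proof -
  have "q * g <= C * ?A * g" using that g by (intro mult_right_mono) auto
  also have "... <= C * 1" unfolding mult.assoc using gp that by (intro mult_left_mono) auto
  finally show ?thesis by simp
 qed
 have xk: "eta * \<bar>x $ k\<bar> <= y" for k unfolding y_def using eta by (intro mult_left_mono) (auto simp: component_le_norm_cart)
 have y4: "y ^ 4 >= 0" by simp
 have ys: "2 * y <= 1 + y^2" using sum_squares_bound[of 1 y] by simp
 have yq: "1 + y * y <= 2 * ?A" 
 proof -
  have "2 * ?A = 2 + y * y + y ^ 4 / 4" by (simp add: power2_eq_square)
  then show ?thesis using y4 by linarith
 qed
 show "norm (cut eta x) <= 1" using g by (simp add: cut_def g_def[symmetric])
 have n1: "norm (cut1 eta k x) = eta * (eta * \<bar>x $ k\<bar>) * g" for k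
  using eta g by (simp add: cut1_def cut_def g_def[symmetric] norm_mult power2_eq_square norm_power)
 have "(eta * \<bar>x $ i\<bar>) * g <= 1"
 proof (rule gle)
  show "eta * \<bar>x $ i\<bar> <= 1 * ?A"
   unfolding mult_1 by (rule order_trans[OF xk[of i]]) (use ys y4 in linarith)
 qed simp
 then show "norm (cut1 eta i x) <= eta" unfolding n1 mult.assoc using eta by simp
 have "norm (cut2 eta i j x) <= eta^2 * (g + (eta * \<bar>x $ i\<bar>) * (eta * \<bar>x $ j\<bar>) * g)"
 proof -
  have "norm ((if j = i then cut eta x else 0) + of_real (x $ i) * cut1 eta j x) <= g + norm (of_real (x $ i) * cut1 eta j x)"
   by (rule order_trans[OF norm_triangle_ineq]) (use g in \<open>auto simp: cut_def g_def[symmetric]\<close>)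
  also have "norm (of_real (x $ i) * cut1 eta j x) = (eta * \<bar>x $ i\<bar>) * (eta * \<bar>x $ j\<bar>) * g" by (simp add: norm_mult n1)
  finally show ?thesis unfolding cut2_def norm_mult by (simp add: norm_power mult_left_mono)
 qed
 also have "... = eta^2 * ((1 + (eta * \<bar>x $ i\<bar>) * (eta * \<bar>x $ j\<bar>)) * g)" by (simp add: algebra_simps)
 also have "... <= eta^2 * 2"
 proof (intro mult_left_mono gle)
  have "(eta * \<bar>x $ i\<bar>) * (eta * \<bar>x $ j\<bar>) <= y * y" using eta y xk by (intro mult_mono) auto
  then show "1 + (eta * \<bar>x $ i\<bar>) * (eta * \<bar>x $ j\<bar>) <= 2 * ?A" by (rule order_trans[OF add_left_mono yq])
 qed auto
 also have "... <= eta * 2" using eta by (simp add: power2_eq_square mult_left_le)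
 finally show "norm (cut2 eta i j x) <= 2 * eta" by simp
 have x2: "(SUM k:UNIV. x $ k * x $ k) = norm x * norm x" by (simp only: power2_eq_square[symmetric] power2_norm_eq_inner) (simp add: inner_vec_def power2_eq_square)
 have cd: "cutd eta x = of_real (- (eta^2 * ((norm x * norm x) * g)))"
  unfolding cutd_def cut1_def cut_def x2[symmetric] g_def[symmetric]
  by (simp add: sum_distrib_left sum_distrib_right sum_negf mult_ac)
 have "norm (cutd eta x) = y^2 * g" using g unfolding cd norm_of_real by (simp add: y_def power2_eq_square abs_mult)
 moreover have "y^2 * g <= 2" by (rule gle) (use yq in \<open>simp_all add: power2_eq_square\<close>)
 moreover have "y^2 * g <= 2 * y^2" using mult_left_mono[of g 2 "y^2"] g by simp
 ultimately show "norm (cutd eta x) <= 2 * min 1 ((eta * norm x)^2)" by (simp add: y_def[symmetric] min_def)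
 have "(SUM k:UNIV. of_real (x $ k) * cut2 eta k j x) = of_real (- eta\<^sup>2 * (x $ j * g)) + of_real (- eta\<^sup>2 * ((norm x * norm x) * (- eta\<^sup>2 * (x $ j * g))))"
 proof -
  have "(SUM k:UNIV. of_real (x $ k) * cut2 eta k j x) = (SUM k:UNIV. if j = k then of_real (- eta\<^sup>2 * (x $ k * g)) else 0) + (SUM k:UNIV. of_real (- eta\<^sup>2 * ((x $ k * x $ k) * (- eta\<^sup>2 * (x $ j * g)))))"
   unfolding sum.distrib[symmetric] cut2_def cut1_def cut_def g_def[symmetric]
   by (intro sum.cong refl) (simp add: algebra_simps)
  also have "(SUM k:UNIV. complex_of_real (- eta\<^sup>2 * ((x $ k * x $ k) * (- eta\<^sup>2 * (x $ j * g))))) = of_real (- eta\<^sup>2 * ((norm x * norm x) * (- eta\<^sup>2 * (x $ j * g))))"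
   unfolding x2[symmetric] of_real_sum[symmetric] by (simp only: sum_distrib_left sum_distrib_right)
  finally show ?thesis by simp
 qed
 then have "cutd1 eta j x = of_real (- (eta^2 * (x $ j * g)) + (- eta\<^sup>2 * (x $ j * g) + (- eta\<^sup>2 * ((norm x * norm x) * (- eta\<^sup>2 * (x $ j * g))))))"
  unfolding cutd1_def by (simp add: cut1_def cut_def g_def)
 also have "... = of_real (eta * ((eta * x $ j) * (y^2 - 2) * g))"
  by (simp add: y_def power2_eq_square algebra_simps)
 finally have "norm (cutd1 eta j x) = eta * ((eta * \<bar>x $ j\<bar>) * \<bar>y^2 - 2\<bar> * g)"
  using eta g by (simp add: norm_mult abs_mult del: of_real_mult of_real_diff of_real_power)
 also have "... <= eta * 6"
 proof (intro mult_left_mono gle)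
  have "(eta * \<bar>x $ j\<bar>) * \<bar>y^2 - 2\<bar> <= y * (y^2 + 2)"
   using xk y eta by (intro mult_mono) (auto simp: abs_if)
  also have "... = y * y^2 + 2 * y" by (simp add: algebra_simps)
  also have "... <= 6 * ?A"
  proof -
   have e: "6 * ?A = 6 + 3 * y^2 + 3 / 4 * y ^ 4" by simp
   have "y * y^2 <= (y^2 + y ^ 4) / 2"
    using sum_squares_bound[of y "y^2"] by (simp add: power2_eq_square eval_nat_numeral algebra_simps)
   then show ?thesis unfolding e using ys y4 zero_le_power2[of y] by argo
  qed
  finally show "(eta * \<bar>x $ j\<bar>) * \<bar>y^2 - 2\<bar> <= 6 * ?A" .
 qed (use eta in auto)
 finally show "norm (cutd1 eta j x) <= 6 * eta" by simp
qed

lemma sum_UNIV_option: "(SUM j:UNIV. f j) = f None + (SUM i:UNIV. f (Some (i :: 3)))" for f :: "3 option => 'b::comm_monoid_add"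
 by (simp add: UNIV_option_conv sum.reindex)

text \<open>One pointwise majorant G is shared by all members of a collection, and the estimates are
  stated through the bound N of its L^2 norm instead of the individual norms.\<close>

definition square_mass :: "(space => real) => real => bool" where
 "square_mass G N \<longleftrightarrow> N >= 0 \<and> G : borel_measurable borel \<and> (\<integral>\<^sup>+x. ennreal ((G x)^2) \<partial>lborel) <= ennreal (N^2)"

lemma square_mass_scale:
 assumes "square_mass G N" "c >= 0" shows "square_mass (%x. c * G x) (c * N)"
proof -
 have [measurable]: "G : borel_measurable borel" using assms by (simp add: square_mass_def)
 have "(\<integral>\<^sup>+x. ennreal ((c * G x)^2) \<partial>lborel) = ennreal (c^2) * (\<integral>\<^sup>+x. ennreal ((G x)^2) \<partial>lborel)"
  by (subst nn_integral_cmult[symmetric]) (auto simp: ennreal_mult[symmetric] power_mult_distrib)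
 also have "... <= ennreal (c^2) * ennreal (N^2)" using assms by (intro mult_left_mono) (auto simp: square_mass_def)
 finally show ?thesis using assms by (simp add: square_mass_def ennreal_mult[symmetric] power_mult_distrib)
qed

lemma L2_fourier_family:
 fixes f :: "'j => space => complex"
 assumes G: "square_mass G N" and c: "c >= 0" and J: "finite J"
  and i: "!!j. j : J ==> integrable lborel (f j)" and le: "!!j x. j : J ==> norm (f j x) <= c * G x" 
  and h: "!!xi. 0 <= h xi" "!!xi. h xi <= (SUM j:J. norm (fourier (f j) xi))"
 shows "(\<integral>\<^sup>+xi. ennreal ((h xi)^2) \<partial>lborel) <= ennreal ((real (card J) * (23 * (c * N)))^2)"
 by (rule L2_norm_fourier_sum[OF J i _ le _ h]) (use square_mass_scale[OF G c] in \<open>auto simp: square_mass_def\<close>)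

text \<open>92 is 4 times 23: the function and its three partial derivatives, each estimated by
  \<open>L2_fourier\<close>.\<close>

lemma L2_H1:
 assumes G: "square_mass G N" and c: "c >= 0"
  and g: "has_gradient g Dg" and i: "integrable lborel g" "!!i. integrable lborel (Dg i)" 
  and le: "!!x. norm (g x) <= c * G x" "!!i x. norm (Dg i x) <= c * G x" 
 shows "(\<integral>\<^sup>+xi. ennreal ((sqrt (1 + (norm xi)^2) * norm (fourier g xi))^2) \<partial>lborel) <= ennreal ((92 * (c * N))^2)"
proof -
 let ?f = "%j. case j of None => g | Some i => Dg i"
 have "(\<integral>\<^sup>+xi. ennreal ((sqrt (1 + (norm xi)^2) * norm (fourier g xi))^2) \<partial>lborel) <= ennreal ((real (card (UNIV :: 3 option set)) * (23 * (c * N)))^2)"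
  by (rule L2_fourier_family[OF G c, of _ ?f])
   (use i le fourier_H1[OF g i] in \<open>auto simp: sum_UNIV_option split: option.splits\<close>)
 then show ?thesis by (simp add: card_UNIV_option mult.assoc[symmetric])
qed

text \<open>|\<xi>|^2 is the sum of the squared coordinates, so the pure second derivatives control
  the full weight; again 92 is 4 times 23.\<close>

lemma L2_H2:
 assumes G: "square_mass G N" and c: "c >= 0"
  and g: "has_gradient g Dg" and i: "integrable lborel g" "!!i. integrable lborel (Dg i)" 
  and g2: "!!i. has_gradient (Dg i) (DDg i)" and i2: "!!i. integrable lborel (DDg i i)"
  and le: "!!x. norm (g x) <= c * G x" "!!i x. norm (DDg i i x) <= c * G x" 
 shows "(\<integral>\<^sup>+xi. ennreal (((1 + (norm xi)^2) * norm (fourier g xi))^2) \<partial>lborel) <= ennreal ((92 * (c * N))^2)"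
proof -
 let ?f = "%j. case j of None => g | Some i => DDg i i"
 have "(\<integral>\<^sup>+xi. ennreal (((1 + (norm xi)^2) * norm (fourier g xi))^2) \<partial>lborel) <= ennreal ((real (card (UNIV :: 3 option set)) * (23 * (c * N)))^2)"
  by (rule L2_fourier_family[OF G c, of _ ?f])
   (use i i2 le fourier_H2[OF g i g2 i2] in \<open>auto simp: sum_UNIV_option split: option.splits\<close>)
 then show ?thesis by (simp add: card_UNIV_option mult.assoc[symmetric])
qed

lemma L2_amp_weighted:
 assumes N: "N >= 0" and i: "!!mu. integrable lborel (p mu)" and m: "k : borel_measurable borel"
  and b: "!!mu. (\<integral>\<^sup>+xi. ennreal ((k xi * norm (fourier (p mu) xi))^2) \<partial>lborel) <= ennreal (N^2)"
 shows "(\<integral>\<^sup>+xi. ennreal ((k xi * amp p xi)^2) \<partial>lborel) <= ennreal ((4 * N)^2)"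
 using L2_sum[of "UNIV :: coord set" "%mu xi. k xi * norm (fourier (p mu) xi)" lborel N] N b m fourier_borel[OF i]
 by (simp add: amp_def sum_distrib_left card_coord)

lemma rapid_integrable_majorized:
 assumes G: "square_mass G N" and m: "rapid m" and v: "continuous_on UNIV v" and le: "!!x. norm (v x) <= c * G x" and c: "c >= 0"
 shows "integrable lborel (%x. m x * v x)"
proof (rule rapid_integrable[OF m v])
 let ?A = "\<integral>\<^sup>+x. ennreal ((norm (v x))^2) \<partial>lborel"
 have "?A <= (\<integral>\<^sup>+x. ennreal ((c * G x)^2) \<partial>lborel)"
  by (intro nn_integral_mono ennreal_leI power_mono le) auto
 also have "... <= ennreal ((c * N)^2)" using square_mass_scale[OF G c] by (simp add: square_mass_def)
 also have "... < \<infinity>" by simp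
 finally show "?A < \<infinity>" .
qed

text \<open>The terms of \<open>q\<close> for \<open>p = cut \<cdot> \<partial>\<psi>\<close> in which a derivative falls on the cutoff.\<close>

definition cutE :: "real => field => real => coord => space => complex" where
 "cutE eta psi t mu x = (case mu of Space i => of_real t * (cut1 eta i x * pd Time psi t x) + cutd eta x * pd (Space i) psi t x
   | Time => of_real t * (SUM i:UNIV. cut1 eta i x * pd (Space i) psi t x) + cutd eta x * pd Time psi t x)"

text \<open>\<partial>_t S \<psi> contains t \<partial>_t^2 \<psi>. It is rewritten through
  \<open>box psi\<close>, so integrability is asked of the space derivatives of \<partial>\<psi> and
  of the cut \<open>box psi\<close>, but not of \<partial>_t^2 \<psi>.\<close>

lemma cutoff_system_general:
 assumes C: "C_k 2 psi" and eta: "eta > 0"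
  and iv: "!!m mu. rapid m ==> integrable lborel (%x. m x * pd mu psi t x)"
   "!!m i mu. rapid m ==> integrable lborel (%x. m x * pd (Space i) (pd mu psi) t x)"
  and ib: "integrable lborel (%x. cut eta x * box psi t x)"
 shows "wave_system t (%mu x. cut eta x * pd mu psi t x) (%mu i x. cut1 eta i x * pd mu psi t x + cut eta x * pd (Space i) (pd mu psi) t x)
   (%mu x. cut eta x * pd mu (Gam Scaling psi) t x + cutE eta psi t mu x) (%x. cut eta x * box psi t x)"
 and "integrable lborel (cutE eta psi t mu)"
proof -
 let ?D = "pd Time psi"
 let ?B = "cutE eta psi t"
 let ?A = "integrable lborel"
 have C1: "C_k 1 (pd mu psi)" for mu
  using C by (auto simp: numeral_2_eq_2 C_k_Suc_iff)
 note rc = rapid_cut[OF eta] rapid_cuts[OF eta]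
 have iE: "?A (?B mu)" for mu
  unfolding cutE_def[abs_def]
  by (cases mu) (auto intro!: Bochner_Integration.integrable_add integrable_mult_right Bochner_Integration.integrable_sum iv rc)
 then show "?A (?B mu)" .
 have com: "pd Time (pd mu psi) = pd mu ?D" for mu by (rule pd_commute[OF C])
 have Sc: "pd mu (Gam Scaling psi) t x = (t *\<^sub>R pd Time (pd mu psi) t x + (SUM i:UNIV. (x $ i) *\<^sub>R pd (Space i) (pd mu psi) t x)) + pd mu psi t x" for mu x
  unfolding pd_Scaling[OF C] by (simp add: Gam.simps(1))
 have dsum: "(SUM k:UNIV. (x $ k) *\<^sub>R (cut1 eta k x * pd mu psi t x + cut eta x * pd (Space k) (pd mu psi) t x))
  = cutd eta x * pd mu psi t x + (SUM k:UNIV. (of_real (x $ k) * cut eta x) * pd (Space k) (pd mu psi) t x)" for mu x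
  by (simp add: cutd_def scaleR_conv_of_real[of _ "z :: complex" for z] distrib_left sum.distrib sum_distrib_right mult.assoc)
 show "wave_system t (%mu x. cut eta x * pd mu psi t x) (%mu i x. cut1 eta i x * pd mu psi t x + cut eta x * pd (Space i) (pd mu psi) t x)
   (%mu x. cut eta x * pd mu (Gam Scaling psi) t x + ?B mu x) (%x. cut eta x * box psi t x)"
  unfolding wave_system_def
 proof (intro conjI allI)
  show "has_gradient (%x. cut eta x * pd mu psi t x) (%i x. cut1 eta i x * pd mu psi t x + cut eta x * pd (Space i) (pd mu psi) t x)" for mu
   by (rule has_gradient_mult[OF has_gradient_cut C_k_has_gradient[OF C1]])
  show "?A (%x. cut eta x * pd mu psi t x)" for mu by (rule iv(1)[OF rc(1)])
  show "?A (%x. cut1 eta i x * pd mu psi t x + cut eta x * pd (Space i) (pd mu psi) t x)" for mu i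
   by (intro Bochner_Integration.integrable_add iv rc)
  show "?A (%x. SUM k:UNIV. (x $ k) *\<^sub>R (cut1 eta k x * pd mu psi t x + cut eta x * pd (Space k) (pd mu psi) t x))" for mu
   unfolding dsum by (intro Bochner_Integration.integrable_add Bochner_Integration.integrable_sum iv rc rapid_coord)
  show "?A (%x. cut eta x * box psi t x)" by (rule ib)
 next
  fix i x
  show "cut eta x * pd (Space i) (Gam Scaling psi) t x + ?B (Space i) x =
   t *\<^sub>R (cut1 eta i x * ?D t x + cut eta x * pd (Space i) ?D t x) + cut eta x * pd (Space i) psi t x +
    (SUM k:UNIV. (x $ k) *\<^sub>R (cut1 eta k x * pd (Space i) psi t x + cut eta x * pd (Space k) (pd (Space i) psi) t x))"
   unfolding dsum Sc com cutE_def
   by (simp add: scaleR_conv_of_real[of _ "z :: complex" for z] algebra_simps sum_distrib_left)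
 next
  fix x
  show "cut eta x * pd Time (Gam Scaling psi) t x + ?B Time x =
   cut eta x * ?D t x + t *\<^sub>R (SUM i:UNIV. cut1 eta i x * pd (Space i) psi t x + cut eta x * pd (Space i) (pd (Space i) psi) t x) +
    (SUM k:UNIV. (x $ k) *\<^sub>R (cut1 eta k x * ?D t x + cut eta x * pd (Space k) ?D t x)) - t *\<^sub>R (cut eta x * box psi t x)"
   unfolding dsum Sc cutE_def box_def
   by (simp add: scaleR_conv_of_real[of _ "z :: complex" for z] algebra_simps sum_distrib_left sum.distrib)
 qed
qed

lemma cutoff_system:
 assumes C: "C_k 2 psi" and eta: "eta > 0" and G: "square_mass G N" 
  and le: "!!mu x. norm (pd mu psi t x) <= G x" "!!mu i x. norm (pd (Space i) (pd mu psi) t x) <= G x"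
  and H: "square_mass H M" and leH: "!!x. norm (box psi t x) <= c * H x" "c >= 0"
 shows "wave_system t (%mu x. cut eta x * pd mu psi t x) (%mu i x. cut1 eta i x * pd mu psi t x + cut eta x * pd (Space i) (pd mu psi) t x)
   (%mu x. cut eta x * pd mu (Gam Scaling psi) t x + cutE eta psi t mu x) (%x. cut eta x * box psi t x)"
 and "integrable lborel (cutE eta psi t mu)"
proof -
 have C0: "C_k 1 (pd mu psi)" "C_k 0 (pd nu (pd mu psi))" for mu nu
  using C by (auto simp: numeral_2_eq_2 C_k_Suc_iff)
 have cv: "continuous_on UNIV (pd mu psi t)" "continuous_on UNIV (pd nu (pd mu psi) t)" for mu nu
  by (rule C_k_continuous_slice[OF C0(1)] C_k_continuous_slice[OF C0(2)])+
 have cb: "continuous_on UNIV (box psi t)"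
  unfolding box_def[abs_def] by (intro continuous_intros cv)
 have iv: "integrable lborel (%x. m x * pd mu psi t x)" "integrable lborel (%x. m x * pd (Space i) (pd mu psi) t x)" if "rapid m" for m mu i
  by (rule rapid_integrable_majorized[OF G that cv(1), where c = 1], use le in simp_all)
    (rule rapid_integrable_majorized[OF G that cv(2), where c = 1], use le in simp_all)
 have ib: "integrable lborel (%x. cut eta x * box psi t x)"
  by (rule rapid_integrable_majorized[OF H rapid_cut[OF eta] cb leH])
 note * = cutoff_system_general[OF C eta iv ib]
 show "wave_system t (%mu x. cut eta x * pd mu psi t x) (%mu i x. cut1 eta i x * pd mu psi t x + cut eta x * pd (Space i) (pd mu psi) t x)
   (%mu x. cut eta x * pd mu (Gam Scaling psi) t x + cutE eta psi t mu x) (%x. cut eta x * box psi t x)" by (rule *(1))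
 show "integrable lborel (cutE eta psi t mu)" by (rule *(2))
qed

definition cutDE :: "real => field => real => coord => 3 => space => complex" where
 "cutDE eta psi t mu j x = (case mu of
    Space i => of_real t * (cut2 eta i j x * pd Time psi t x + cut1 eta i x * pd (Space j) (pd Time psi) t x)
     + (cutd1 eta j x * pd (Space i) psi t x + cutd eta x * pd (Space j) (pd (Space i) psi) t x)
   | Time => of_real t * (SUM i:UNIV. cut2 eta i j x * pd (Space i) psi t x + cut1 eta i x * pd (Space j) (pd (Space i) psi) t x)
     + (cutd1 eta j x * pd Time psi t x + cutd eta x * pd (Space j) (pd Time psi) t x))"

lemma has_gradient_cmult: "has_gradient v Dv ==> has_gradient (%x. c * v x) (%i x. c * Dv i x)"
 using has_gradient_mult[OF has_gradient_const[of c], of v Dv] by simp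

lemma has_gradient_cutE:
 assumes "C_k 2 psi"
 shows "has_gradient (cutE eta psi t mu) (cutDE eta psi t mu)"
proof -
 have v: "has_gradient (pd nu psi t) (%j. pd (Space j) (pd nu psi) t)" for nu
  by (rule C_k_has_gradient) (use assms in \<open>auto simp: numeral_2_eq_2 C_k_Suc_iff\<close>)
 show ?thesis unfolding cutE_def[abs_def] cutDE_def[abs_def]
  by (cases mu) (auto intro!: has_gradient_add has_gradient_cmult has_gradient_sum has_gradient_mult v has_gradient_cut1 has_gradient_cutd)
qed

text \<open>For fixed t the first two bounds become small in L^2 as eta tends to 0 and treat the
  commutator as an error. The third, for eta t <= 1, is uniform in eta and t; in the energy estimate
  it serves the level S^2 \<phi>, where boundedness is enough.\<close>

lemma cutE_bounds:
 assumes eta: "0 < eta" "eta <= 1" and t: "t >= 1"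
  and le: "!!mu. norm (pd mu psi t x) <= G"
 shows "norm (cutE eta psi t mu x) <= 17 * t * (cutoff_error eta x * G)" 
  "(!!mu i. norm (pd (Space i) (pd mu psi) t x) <= G) ==> norm (cutDE eta psi t mu j x) <= 17 * t * (cutoff_error eta x * G)"
  "eta * t <= 1 ==> norm (cutE eta psi t mu x) <= 5 * G"
proof -
 let ?B = "cutoff_error eta x"
 let ?A = "3 * (eta * G)"
 define e where "e = min 1 ((eta * norm x)^2)"
 have e: "0 <= e" "e <= 1" by (auto simp: e_def)
 have th: "?B = eta + e" by (simp add: cutoff_error_def e_def)
 have G0: "G >= 0" using le[of Time] norm_ge_zero order_trans by blast
 note b = cut_bounds[OF eta, where x = x, folded e_def]
 have p: "norm (m * v) <= c * G" if "norm m <= c" "norm v <= G" for m v :: complex and c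
  unfolding norm_mult using that G0 by (intro mult_mono) (auto intro: order_trans[OF norm_ge_zero])
 have p1: "norm (cut1 eta i x * v) <= eta * G" "norm (cut2 eta i k x * v) <= 2 * eta * G" "norm (cutd eta x * v) <= 2 * e * G" "norm (cutd1 eta i x * v) <= 6 * eta * G"
  if "norm v <= G" for v i k by (rule p[OF b(2) that] p[OF b(3) that] p[OF b(4) that] p[OF b(5) that])+
 have nt: "norm (of_real t * z) <= t * c" if "norm z <= c" for z :: complex and c
  using t that by (simp add: norm_mult)
 have s3: "norm (SUM i:UNIV. z i) <= 3 * c" if "!!i. norm (z i) <= c" for z :: "3 => complex" and c
  using sum_norm_le[of UNIV z "%_. c"] that by simp
 have E: "norm (cutE eta psi t mu x) <= t * ?A + 2 * e * G"
 proof (cases mu)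
  case Time
  show ?thesis unfolding Time cutE_def coord.case
   by (rule order_trans[OF norm_triangle_ineq add_mono[OF nt[OF s3] p1(3)]]) (use p1(1) le in auto)
 next
  case (Space i)
  have "norm (cutE eta psi t mu x) <= t * (eta * G) + 2 * e * G"
   unfolding Space cutE_def coord.case
   by (rule order_trans[OF norm_triangle_ineq add_mono[OF nt p1(3)]]) (use p1(1) le in auto)
  also have "... <= t * ?A + 2 * e * G" using t G0 eta by (simp add: mult_nonneg_nonneg)
  finally show ?thesis .
 qed
 have a: "norm (z1 + z2) <= 3 * (eta * G)" if "norm z1 <= 2 * eta * G" "norm z2 <= eta * G" for z1 z2 :: complex
  using norm_triangle_ineq[of z1 z2] that by linarith
 have a': "norm (z1 + z2) <= 6 * eta * G + 2 * e * G" if "norm z1 <= 6 * eta * G" "norm z2 <= 2 * e * G" for z1 z2 :: complex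
  using norm_triangle_ineq[of z1 z2] that by linarith
 have DE: "norm (cutDE eta psi t mu j x) <= t * (3 * ?A) + (6 * eta * G + 2 * e * G)"
  if le2: "!!mu i. norm (pd (Space i) (pd mu psi) t x) <= G"
 proof (cases mu)
  case Time
  show ?thesis unfolding Time cutDE_def coord.case
   by (rule order_trans[OF norm_triangle_ineq add_mono[OF nt[OF s3[OF a]] a']]) (use p1 le le2 in auto)
 next
  case (Space i)
  have "norm (cutDE eta psi t mu j x) <= t * ?A + (6 * eta * G + 2 * e * G)"
   unfolding Space cutDE_def coord.case
   by (rule order_trans[OF norm_triangle_ineq add_mono[OF nt[OF a] a']]) (use p1 le le2 in auto)
  also have "... <= t * (3 * ?A) + (6 * eta * G + 2 * e * G)" using t G0 eta by (simp add: mult_nonneg_nonneg)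
  finally show ?thesis .
 qed
 have q: "0 <= eta * G" "0 <= e * G" using eta e G0 by auto
 have q1: "eta * G <= t * (eta * G)" "e * G <= t * (e * G)" using mult_right_mono[OF t q(1)] mult_right_mono[OF t q(2)] by auto
 have tot: "17 * t * (?B * G) = 17 * (t * (eta * G)) + 17 * (t * (e * G))" unfolding th by (simp add: algebra_simps)
 show "norm (cutE eta psi t mu x) <= 17 * t * (?B * G)"
  unfolding tot using E q q1 by linarith
 show "norm (cutDE eta psi t mu j x) <= 17 * t * (?B * G)"
  if "!!mu i. norm (pd (Space i) (pd mu psi) t x) <= G"
  unfolding tot using DE[OF that] q q1 by linarith
 assume "eta * t <= 1"
 then have "(eta * t) * G <= 1 * G" using G0 by (rule mult_right_mono)
 moreover have "e * G <= 1 * G" using e(2) G0 by (rule mult_right_mono)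
 moreover have "t * ?A = 3 * (eta * t * G)" by simp
 ultimately show "norm (cutE eta psi t mu x) <= 5 * G" using E by linarith
qed

lemma C_k_box: "C_k (Suc (Suc k)) psi ==> C_k k (box psi)"
proof -
 assume C: "C_k (Suc (Suc k)) psi"
 have eq: "box psi = (%t x. (-1) * pd Time (pd Time psi) t x + (SUM i:UNIV. pd (Space i) (pd (Space i) psi) t x))"
  by (auto simp: box_def fun_eq_iff)
 show ?thesis by (subst eq, intro C_k_add C_k_cmult C_k_sum C_k_pd C) simp
qed

text \<open>G majorizes members of \<partial>\<Gamma>^(<=3) \<phi> and H members of \<Gamma>^(<=2)
  f. Second space derivatives occur in pure form only, as in \<open>L2_H2\<close>. The 3 in
  \<open>HS\<close> stems from the commutator in \<open>box_Scaling\<close>.\<close>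

locale energy_data =
 fixes phi :: field and t N M :: real and G H :: "space => real"
 assumes C: "C_k 5 phi" and t: "t >= 1"
  and G: "square_mass G N" and H: "square_mass H M"
  and G0: "norm (pd mu phi t x) <= G x"
  and G1: "norm (pd (Space i) (pd mu phi) t x) <= G x"
  and G2: "norm (pd (Space i) (pd (Space i) (pd mu phi)) t x) <= G x"
  and S0: "norm (pd mu (Gam Scaling phi) t x) <= G x"
  and S1: "norm (pd (Space i) (pd mu (Gam Scaling phi)) t x) <= G x"
  and SS: "norm (pd mu (Gam Scaling (Gam Scaling phi)) t x) <= G x"
  and H0: "norm (box phi t x) <= H x"
  and H1: "norm (pd (Space i) (box phi) t x) <= H x"
  and HS: "norm (box (Gam Scaling phi) t x) <= 3 * H x"
begin

lemma N0: "N >= 0" "M >= 0" using G H by (auto simp: square_mass_def)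

lemma Cs: "C_k 4 (Gam Scaling phi)" "C_k 4 (pd mu phi)" "C_k 3 (pd nu (pd mu phi))" "C_k 3 (pd mu (Gam Scaling phi))"
 "C_k 3 (box phi)" "C_k 2 (pd nu (pd mu (Gam Scaling phi)))" "C_k 2 (pd mu (Gam Scaling (Gam Scaling phi)))"
proof -
 let ?A = "Gam Scaling phi"
 have C': "C_k (Suc 4) phi" using C by (simp add: numeral_eq_Suc)
 show 1: "C_k 4 ?A" "C_k 4 (pd mu phi)" by (rule C_k_Gam[OF C'] C_k_pd[OF C'])+
 have 2: "C_k (Suc 3) ?A" "C_k (Suc 3) (pd mu phi)" using 1 by (simp_all add: numeral_eq_Suc)
 show 3: "C_k 3 (pd nu (pd mu phi))" "C_k 3 (pd mu ?A)" by (rule C_k_pd[OF 2(1)] C_k_pd[OF 2(2)])+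
 have "C_k (Suc 2) (pd mu ?A)" "C_k (Suc 2) (Gam Scaling ?A)"
  using 3(2) C_k_Gam[OF 2(1)] by (simp_all add: numeral_eq_Suc)
 then show "C_k 2 (pd nu (pd mu ?A))" "C_k 2 (pd mu (Gam Scaling ?A))" by (auto intro: C_k_pd simp del: C_k.simps)
 show "C_k 3 (box phi)" by (rule C_k_box) (use C in \<open>simp add: numeral_eq_Suc\<close>)
qed

lemma cont:
 "continuous_on UNIV (pd mu phi t)" "continuous_on UNIV (pd nu (pd mu phi) t)" "continuous_on UNIV (pd kap (pd nu (pd mu phi)) t)"
 "continuous_on UNIV (pd mu (Gam Scaling phi) t)" "continuous_on UNIV (pd nu (pd mu (Gam Scaling phi)) t)" "continuous_on UNIV (pd mu (Gam Scaling (Gam Scaling phi)) t)"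
 "continuous_on UNIV (box phi t)" "continuous_on UNIV (pd mu (box phi) t)" 
proof -
 let ?A = "continuous_on UNIV"
 have "C_k 2 (pd kap (pd nu (pd mu phi)))" "C_k 2 (pd mu (box phi))"
  using C_k_pd[of 2] Cs(3)[of nu mu] Cs(5) by (auto simp: numeral_eq_Suc simp del: C_k.simps)
 note c = C_k_continuous_slice[OF this(1)] C_k_continuous_slice[OF this(2)] Cs[THEN C_k_continuous_slice]
 show "?A (pd mu phi t)" "?A (pd nu (pd mu phi) t)" "?A (pd kap (pd nu (pd mu phi)) t)"
 "?A (pd mu (Gam Scaling phi) t)" "?A (pd nu (pd mu (Gam Scaling phi)) t)" "?A (pd mu (Gam Scaling (Gam Scaling phi)) t)"
 "?A (box phi t)" "?A (pd mu (box phi) t)"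
  by (rule c)+
qed

lemma grads:
 "has_gradient (pd mu phi t) (%i. pd (Space i) (pd mu phi) t)"
 "has_gradient (pd nu (pd mu phi) t) (%i. pd (Space i) (pd nu (pd mu phi)) t)"
 "has_gradient (pd mu (Gam Scaling phi) t) (%i. pd (Space i) (pd mu (Gam Scaling phi)) t)"
 "has_gradient (box phi t) (%i. pd (Space i) (box phi) t)"
 by (rule C_k_has_gradient, rule C_k_mono, rule Cs, simp)+

lemma G_nonneg: "0 <= G x" using G0[of Time x] norm_ge_zero order_trans by blast
lemma H_nonneg: "0 <= H x" using H0[of x] norm_ge_zero order_trans by blast

text \<open>The estimate for a fixed cutoff, with errors proportional to \<open>e\<close>. The
  constants are 1840 = 4 * 92 * 5, 736 = 4 * 92 * 2, 552 = 4 * 23 * 6, 184 = 92 * 2, 6256 = 4 * 92 *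
  17 and 69 = 23 * 3: the 4 counts components, 92 and 23 come from the Fourier bounds, the last
  factors from the product rule, \<open>cutE_bounds\<close> and \<open>HS\<close>. In the curl term
  552 is 92 * 6.\<close>

lemma cutoff_estimate:
 assumes eta: "0 < eta" "eta <= 1" "eta * t <= 1" 
  and e: "square_mass (%x. cutoff_error eta x * G x) e"
  and K: "K3 >= 0" "K2 >= 0"
   "!!eps. eps = 1 \<or> eps = -1 ==> (\<integral>\<^sup>+w. ennreal ((decay3 (x \<bullet> w + eps * t))^2) \<partial>sphere_measure) <= ennreal (K3^2)"
   "!!eps. eps = 1 \<or> eps = -1 ==> (\<integral>\<^sup>+w. ennreal ((decay2 (x \<bullet> w + eps * t))^2) \<partial>sphere_measure) <= ennreal (K2^2)"
 shows "norm (cut eta x * pd mu phi t x) <= 32 * ((1840 * N + 736 * N + 552 * N) * K3 + t * ((2 * (184 * M + 6256 * t * e)) + 69 * M) * K2) + 3 * (552 * e * (3 * pi))"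
proof -
 let ?I = "Gam Scaling phi"
 let ?F = "184 * M + 6256 * t * e"
 let ?J = "(4 * (92 * (5 * N)) + 4 * (92 * (2 * N)) + 4 * (23 * (6 * N))) * K3 + t * ((2 * ?F) + 23 * (3 * M)) * K2"
 let ?D = "cutoff_error eta"
 let ?A = "integrable lborel"
 define p0 where "p0 mu x = cut eta x * pd mu phi t x" for mu x
 define Dp0 where "Dp0 mu i x = cut1 eta i x * pd mu phi t x + cut eta x * pd (Space i) (pd mu phi) t x" for mu i x
 define p1 where "p1 mu x = cut eta x * pd mu ?I t x" for mu x
 define Dp1 where "Dp1 mu i x = cut1 eta i x * pd mu ?I t x + cut eta x * pd (Space i) (pd mu ?I) t x" for mu i x
 define q1 where "q1 mu x = cut eta x * pd mu (Gam Scaling ?I) t x + cutE eta ?I t mu x" for mu x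
 define E where "E = cutE eta phi t"
 define F0 where "F0 x = cut eta x * box phi t x" for x
 let ?B = "\<integral>\<^sup>+xi. ennreal ((sqrt (1 + (norm xi)^2) * (norm (fourier F0 xi) + amp E xi / t))^2) \<partial>lborel"
 define DF0 where "DF0 i x = cut1 eta i x * box phi t x + cut eta x * pd (Space i) (box phi) t x" for i x
 define F1 where "F1 x = cut eta x * box ?I t x" for x
 define q0 where "q0 = (%mu x. p1 mu x + E mu x)"
 have C2: "C_k 2 phi" "C_k 2 ?I" by (rule C_k_mono[OF C] C_k_mono[OF Cs(1)], simp)+
 have W0: "wave_system t p0 Dp0 q0 F0" and iE: "?A (E mu)" for mu
  unfolding p0_def[abs_def] Dp0_def[abs_def] q0_def p1_def E_def F0_def[abs_def]
  by (rule cutoff_system(1)[OF C2(1) eta(1) G G0 G1 H, where c = 1] cutoff_system(2)[OF C2(1) eta(1) G G0 G1 H, where c = 1]; use H0 in simp)+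
 have W1: "wave_system t p1 Dp1 q1 F1"
  unfolding p1_def[abs_def] Dp1_def[abs_def] q1_def[abs_def] F1_def[abs_def]
  by (rule cutoff_system(1)[OF C2(2) eta(1) G S0 S1 H HS]) simp
 have ip0: "?A (p0 mu)" and iDp0: "?A (Dp0 mu i)" and iF0: "?A F0" and gp0: "has_gradient (p0 mu) (Dp0 mu)" for mu i
  using W0 by (auto simp: wave_system_def)
 have ip1: "?A (p1 mu)" and iDp1: "?A (Dp1 mu i)" and iF1: "?A F1" and gp1: "has_gradient (p1 mu) (Dp1 mu)" for mu i
  using W1 by (auto simp: wave_system_def)
 note b = cut_bounds[OF eta(1,2)]
 note rc = rapid_cut[OF eta(1)] rapid_cuts[OF eta(1)]
 have prod: "norm (m * v) <= c * G x" if "norm m <= c" "norm v <= G x" for m v :: complex and c x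
  unfolding norm_mult using that by (intro mult_mono) (auto intro: order_trans[OF norm_ge_zero])
 have prodH: "norm (m * v) <= c * H x" if "norm m <= c" "norm v <= H x" for m v :: complex and c x
  unfolding norm_mult using that by (intro mult_mono) (auto intro: order_trans[OF norm_ge_zero])
 have b1: "norm (cut1 eta i x) <= 1" "norm (cut2 eta i j x) <= 2" for i j x
  using b(2)[of i x] b(3)[of i j x] eta by auto
 have tri: "norm (u + v) <= (c + d) * y" if "norm u <= c * y" "norm v <= d * y" for u v :: complex and c d y :: real
  using norm_triangle_ineq[of u v] that unfolding distrib_right by linarith

 define DDp0 where "DDp0 mu i j x = (cut2 eta i j x * pd mu phi t x + cut1 eta i x * pd (Space j) (pd mu phi) t x)
   + (cut1 eta j x * pd (Space i) (pd mu phi) t x + cut eta x * pd (Space j) (pd (Space i) (pd mu phi)) t x)" for mu i j x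
 have gDp0: "has_gradient (Dp0 mu i) (DDp0 mu i)" for mu i
  unfolding Dp0_def[abs_def] DDp0_def[abs_def]
  by (intro has_gradient_add has_gradient_mult has_gradient_cut has_gradient_cut1 grads)
 have int: "?A (%x. m x * v x)" if "rapid m" "continuous_on UNIV v" "!!x. norm (v x) <= G x" for m v
  by (rule rapid_integrable_majorized[OF G that(1,2), where c = 1]) (use that in simp_all)
 have iDDp0: "?A (DDp0 mu i i)" for mu i
  unfolding DDp0_def[abs_def] by (intro Bochner_Integration.integrable_add int rc cont G0 G1 G2)
 have B0: "(\<integral>\<^sup>+xi. ennreal (((1 + (norm xi)^2) * norm (fourier (p0 mu) xi))^2) \<partial>lborel) <= ennreal ((92 * (5 * N))^2)" for mu
 proof (rule L2_H2[OF G _ gp0 ip0 iDp0 gDp0 iDDp0])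
  show "norm (p0 mu x) <= 5 * G x" for x
   using prod[OF b(1)[of x] G0[of mu x]] G_nonneg[of x] unfolding p0_def by linarith
  show "norm (DDp0 mu i i x) <= 5 * G x" for i x
  proof -
   have "norm (DDp0 mu i i x) <= ((2 + 1) + (1 + 1)) * G x"
    unfolding DDp0_def by (intro tri prod b b1 G0 G1 G2)
   then show ?thesis by simp
  qed
 qed simp
 have b0: "(\<integral>\<^sup>+xi. ennreal (((1 + (norm xi)^2) * amp p0 xi)^2) \<partial>lborel) <= ennreal ((4 * (92 * (5 * N)))^2)"
  by (rule L2_amp_weighted[OF _ ip0 _ B0]) (use N0 in auto)
 have ih: "?A (fourier (p0 mu))" for mu by (rule fourier_L1[OF ip0 _ B0]) (use N0 in auto)
 have B1: "(\<integral>\<^sup>+xi. ennreal ((sqrt (1 + (norm xi)^2) * norm (fourier (p1 mu) xi))^2) \<partial>lborel) <= ennreal ((92 * (2 * N))^2)" for mu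
 proof (rule L2_H1[OF G _ gp1 ip1 iDp1])
  show "norm (p1 mu x) <= 2 * G x" for x
   using prod[OF b(1)[of x] S0[of mu x]] G_nonneg[of x] unfolding p1_def by linarith
  show "norm (Dp1 mu i x) <= 2 * G x" for i x
  proof -
   have "norm (Dp1 mu i x) <= (1 + 1) * G x"
    unfolding Dp1_def by (intro tri prod b b1 S0 S1)
   then show ?thesis by simp
  qed
 qed simp
 have b1': "(\<integral>\<^sup>+xi. ennreal ((sqrt (1 + (norm xi)^2) * amp p1 xi)^2) \<partial>lborel) <= ennreal ((4 * (92 * (2 * N)))^2)"
  by (rule L2_amp_weighted[OF _ ip1 _ B1]) (use N0 in auto)
 have iq1: "?A (q1 mu)" for mu by (rule wave_system_q_integrable[OF W1])
 have b2: "(\<integral>\<^sup>+xi. ennreal ((1 * amp q1 xi)^2) \<partial>lborel) <= ennreal ((4 * (23 * (6 * N)))^2)"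
 proof (rule L2_amp_weighted[OF _ iq1])
  fix mu
  have le: "norm (q1 mu x) <= 6 * G x" for x
  proof -
   have "norm (q1 mu x) <= (1 + 5) * G x"
    unfolding q1_def by (intro tri prod b cutE_bounds(3) eta t S0 S1 SS)
   then show ?thesis by simp
  qed
  show "(\<integral>\<^sup>+xi. ennreal ((1 * norm (fourier (q1 mu) xi))^2) \<partial>lborel) <= ennreal ((23 * (6 * N))^2)"
   unfolding mult_1 by (rule L2_fourier[OF iq1 le]) (use square_mass_scale[OF G, of 6] in \<open>simp add: square_mass_def\<close>)
 qed (use N0 in auto)
 have BF: "(\<integral>\<^sup>+xi. ennreal ((sqrt (1 + (norm xi)^2) * norm (fourier F0 xi))^2) \<partial>lborel) <= ennreal ((92 * (2 * M))^2)"
 proof (rule L2_H1[OF H])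
  show "has_gradient F0 DF0" unfolding F0_def[abs_def] DF0_def[abs_def] by (intro has_gradient_mult has_gradient_cut grads)
  show "?A (DF0 i)" for i
   unfolding DF0_def[abs_def]
   by (intro Bochner_Integration.integrable_add rapid_integrable_majorized[OF H, where c = 1] rc cont) (use H0 H1 in auto)
  show "norm (F0 x) <= 2 * H x" for x
   using prodH[OF b(1)[of x] H0[of x]] H_nonneg[of x] unfolding F0_def by linarith
  show "norm (DF0 i x) <= 2 * H x" for i x
  proof -
   have "norm (DF0 i x) <= (1 + 1) * H x"
    unfolding DF0_def by (intro tri prodH b b1 H0 H1)
   then show ?thesis by simp
  qed
 qed (use iF0 in auto)
 have BE: "(\<integral>\<^sup>+xi. ennreal ((sqrt (1 + (norm xi)^2) * norm (fourier (E mu) xi))^2) \<partial>lborel) <= ennreal ((92 * (17 * t * e))^2)" for mu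
 proof (rule L2_H1[OF e])
  show "has_gradient (E mu) (cutDE eta phi t mu)" unfolding E_def by (rule has_gradient_cutE[OF C2(1)])
  show "?A (cutDE eta phi t mu i)" for i
   unfolding cutDE_def[abs_def]
   by (cases mu) (auto intro!: Bochner_Integration.integrable_add integrable_mult_right Bochner_Integration.integrable_sum int rc cont G0 G1)
  show "norm (E mu x) <= 17 * t * (?D x * G x)" for x
   unfolding E_def by (rule cutE_bounds(1)[OF eta(1,2) t G0])
  show "norm (cutDE eta phi t mu i x) <= 17 * t * (?D x * G x)" for i x
   by (rule cutE_bounds(2)[OF eta(1,2) t G0 G1])
 qed (use iE t in auto)
 have e0: "e >= 0" using e by (simp add: square_mass_def)
 have BE': "(\<integral>\<^sup>+xi. ennreal ((sqrt (1 + (norm xi)^2) * amp E xi)^2) \<partial>lborel) <= ennreal ((4 * (92 * (17 * t * e)))^2)"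
  by (rule L2_amp_weighted[OF _ iE _ BE]) (use e0 t in auto)
 have mE: "amp E : borel_measurable borel" by (intro borel_measurable_continuous_onI amp_continuous iE)
 note [measurable] = mE fourier_borel[OF iF0]
 \<comment> \<open>As t >= 1, the division of \<open>amp E\<close> by t is dropped; both summands
   are bounded by the same \<open>?F\<close>, and \<open>L2_sum\<close> over two terms gives the
   2.\<close>
 have b3: "?B <= ennreal ((2 * ?F)^2)"
 proof -
  define h where "h b xi = sqrt (1 + (norm xi)^2) * (if b then norm (fourier F0 xi) else amp E xi)" for b :: bool and xi
  have "(\<integral>\<^sup>+xi. ennreal ((SUM b:UNIV. h b xi)^2) \<partial>lborel) <= ennreal ((real (card (UNIV :: bool set)) * ?F)^2)"
  proof (rule L2_sum)
   show "(\<integral>\<^sup>+xi. ennreal ((h b xi)^2) \<partial>lborel) <= ennreal (?F^2)" for b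
   proof (cases b)
    case True
    have "ennreal ((92 * (2 * M))^2) <= ennreal (?F^2)"
     using N0 e0 t by (intro ennreal_leI power_mono) auto
    with BF True show ?thesis unfolding h_def by (auto intro: order_trans)
   next
    case False
    have "ennreal ((4 * (92 * (17 * t * e)))^2) <= ennreal (?F^2)"
     using N0 e0 t by (intro ennreal_leI power_mono) auto
    with BE' False show ?thesis unfolding h_def by (auto intro: order_trans)
   qed
   show "h b : borel_measurable lborel" for b unfolding h_def[abs_def] by (cases b) simp_all
  qed (use N0 e0 t in auto)
  moreover have "?B <= (\<integral>\<^sup>+xi. ennreal ((SUM b:UNIV. h b xi)^2) \<partial>lborel)"
  proof (intro nn_integral_mono ennreal_leI power_mono)
   fix xi :: space
   have "amp E xi / t <= amp E xi" using t amp_nonneg[of E xi] by (simp add: divide_le_eq mult_le_cancel_left1)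
   then have "sqrt (1 + (norm xi)^2) * (norm (fourier F0 xi) + amp E xi / t) <= sqrt (1 + (norm xi)^2) * (norm (fourier F0 xi) + amp E xi)"
    by (intro mult_left_mono) auto
   then show "sqrt (1 + (norm xi)^2) * (norm (fourier F0 xi) + amp E xi / t) <= (SUM b:UNIV. h b xi)"
    by (simp add: UNIV_bool h_def distrib_left add.commute)
  qed (use t amp_nonneg[of E] in auto)
  ultimately show ?thesis by (simp only: card_UNIV_bool of_nat_numeral)
 qed
 have b4: "(\<integral>\<^sup>+xi. ennreal ((norm (fourier F1 xi))^2) \<partial>lborel) <= ennreal ((23 * (3 * M))^2)"
 proof (rule L2_fourier[OF iF1])
  show "norm (F1 x) <= 3 * H x" for x
   unfolding F1_def norm_mult using mult_mono[OF b(1)[of x] HS[of x]] by simp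
  show "(\<integral>\<^sup>+x. ennreal ((3 * H x)^2) \<partial>lborel) <= ennreal ((3 * M)^2)" using square_mass_scale[OF H, of 3] by (simp add: square_mass_def)
 qed
 \<comment> \<open>The cutoff destroys curl freeness, but in the antisymmetric combinations
   \<open>c j\<close> the second derivatives of \<phi> cancel and only derivatives of the cutoff
   remain. Passing from the curl back to the field costs 1/|\<xi>|, which \<open>weighted_L1\<close>
   affords.\<close>
 have curl: "(\<integral>\<^sup>+xi. norm (fourier (p0 (Space i)) xi - of_real (sgn xi $ i) * (SUM j:UNIV. of_real (sgn xi $ j) * fourier (p0 (Space j)) xi)) \<partial>lborel) <= ennreal (3 * (552 * e * (3 * pi)))" for i
 proof -
  define c where "c j x = cut1 eta j x * pd (Space i) phi t x + (- cut1 eta i x) * pd (Space j) phi t x" for j x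
  define Dc where "Dc j k x = (cut2 eta j k x * pd (Space i) phi t x + cut1 eta j x * pd (Space k) (pd (Space i) phi) t x)
    + ((- cut2 eta i k x) * pd (Space j) phi t x + (- cut1 eta i x) * pd (Space k) (pd (Space j) phi) t x)" for j k x
  have gneg: "has_gradient (%x. - m x) (%i x. - Dm i x)" if "has_gradient m Dm" for m Dm
   using has_gradient_cmult[OF that, of "-1"] by simp
  have rneg: "rapid (%x. - m x)" if "rapid m" for m using rapid_cmult[OF that, of "-1"] by simp
  have ic: "?A (c j)" and iDc: "?A (Dc j k)" for j k
   unfolding c_def[abs_def] Dc_def[abs_def] by (intro Bochner_Integration.integrable_add int rc rneg cont G0 G1)+
  have [measurable]: "fourier (c j) : borel_measurable borel" for j by (rule fourier_borel[OF ic])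
  have gc: "has_gradient (c j) (Dc j)" for j
   unfolding c_def[abs_def] Dc_def[abs_def] by (intro has_gradient_add has_gradient_mult gneg has_gradient_cut1 grads)
  have cc: "c j = (%x. Dp0 (Space i) j x - Dp0 (Space j) i x)" for j
   using pd_commute[OF C2(1), of "Space j" "Space i"] by (simp add: c_def Dp0_def fun_eq_iff)
  have fc: "fourier (c j) xi = \<i> * (of_real (xi $ j) * fourier (p0 (Space i)) xi - of_real (xi $ i) * fourier (p0 (Space j)) xi)" for j xi
   unfolding cc by (simp add: fourier_diff iDp0 fourier_deriv[OF gp0 ip0 iDp0] algebra_simps)
  have th: "eta <= ?D x" for x by (simp add: cutoff_error_def)
  have le: "norm (m * v) <= k * (?D x * G x)" if "norm m <= k * eta" "norm v <= G x" "k >= 0" for m v :: complex and k x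
  proof -
   have "norm (m * v) <= k * eta * G x" by (rule prod[OF that(1,2)])
   also have "... <= k * (?D x * G x)"
    unfolding mult.assoc using that(3) G_nonneg th[of x] by (intro mult_left_mono mult_right_mono) auto
   finally show ?thesis .
  qed
  have L: "(\<integral>\<^sup>+xi. ennreal ((sqrt (1 + (norm xi)^2) * norm (fourier (c j) xi))^2) \<partial>lborel) <= ennreal ((92 * (6 * e))^2)" for j
  proof (rule L2_H1[OF e _ gc ic iDc])
   show "norm (Dc j k x) <= 6 * (?D x * G x)" for k x
   proof -
    have "norm (Dc j k x) <= ((2 + 1) + (2 + 1)) * (?D x * G x)"
     unfolding Dc_def using b(2)[of _ x] b(3)[of _ _ x] by (intro tri le G0 G1) auto
    then show ?thesis by simp
   qed
   show "norm (c j x) <= 6 * (?D x * G x)" for x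
   proof -
    have "norm (c j x) <= (3 + 3) * (?D x * G x)"
     unfolding c_def
    proof (intro tri le G0)
     have "norm (cut1 eta k x) <= 3 * eta" for k using b(2)[of k x] eta(1) by linarith
     then show "norm (cut1 eta j x) <= 3 * eta" "norm (- cut1 eta i x) <= 3 * eta" by simp_all
    qed auto
    then show ?thesis by simp
   qed
  qed simp
  have "(\<integral>\<^sup>+xi. norm (fourier (p0 (Space i)) xi - of_real (sgn xi $ i) * (SUM j:UNIV. of_real (sgn xi $ j) * fourier (p0 (Space j)) xi)) \<partial>lborel)
    <= (\<integral>\<^sup>+xi. (SUM j:UNIV. ennreal (norm (fourier (c j) xi) / norm xi)) \<partial>lborel)"
  proof (rule nn_integral_mono_AE, rule eventually_mono[OF AE_lborel_singleton[of 0]])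
   fix xi :: space assume "xi ~= 0"
   then have n: "norm xi > 0" by simp
   have s: "of_real (sgn xi $ j) = complex_of_real (xi $ j) / of_real (norm xi)" for j by (simp add: sgn_div_norm divide_inverse)
   have "(SUM j:UNIV. (sgn xi $ j) * (sgn xi $ j)) = 1"
    using \<open>xi ~= 0\<close> norm_sgn[of xi] by (simp add: norm_eq_1 inner_vec_def)
   then have one: "(SUM j:UNIV. complex_of_real (sgn xi $ j) * of_real (sgn xi $ j)) = 1"
    by (simp only: of_real_mult[symmetric] of_real_sum[symmetric] of_real_1)
   \<comment> \<open>Multiplying component i by the sum of the squares of the coordinates of
     \<open>sgn xi\<close>, which is 1, turns the defect into a sum of the antisymmetric
     \<open>c j\<close>.\<close>
   have "fourier (p0 (Space i)) xi - of_real (sgn xi $ i) * (SUM j:UNIV. of_real (sgn xi $ j) * fourier (p0 (Space j)) xi)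
    = (SUM j:UNIV. complex_of_real (sgn xi $ j) * of_real (sgn xi $ j)) * fourier (p0 (Space i)) xi - of_real (sgn xi $ i) * (SUM j:UNIV. of_real (sgn xi $ j) * fourier (p0 (Space j)) xi)"
    unfolding one by simp
   also have "... = (SUM j:UNIV. of_real (sgn xi $ j) * (of_real (sgn xi $ j) * fourier (p0 (Space i)) xi - of_real (sgn xi $ i) * fourier (p0 (Space j)) xi))"
    by (simp add: sum_distrib_left sum_distrib_right right_diff_distrib sum_subtractf mult_ac)
   also have "... = (SUM j:UNIV. of_real (sgn xi $ j) * (- \<i> * fourier (c j) xi / of_real (norm xi)))"
    unfolding fc s by (intro sum.cong refl) (simp add: diff_divide_distrib)
   also have "norm ... <= (SUM j:UNIV. norm (fourier (c j) xi) / norm xi)"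
   proof (rule sum_norm_le)
    fix j
    have "\<bar>sgn xi $ j\<bar> <= 1" using component_le_norm_cart[of "sgn xi" j] norm_sgn[of xi] by (auto split: if_splits)
    then show "norm (of_real (sgn xi $ j) * (- \<i> * fourier (c j) xi / of_real (norm xi))) <= norm (fourier (c j) xi) / norm xi"
     using mult_right_mono[of "\<bar>sgn xi $ j\<bar>" 1 "norm (fourier (c j) xi) / norm xi"] by (simp add: norm_mult norm_divide)
   qed
   finally show "ennreal (norm (fourier (p0 (Space i)) xi - of_real (sgn xi $ i) * (SUM j:UNIV. of_real (sgn xi $ j) * fourier (p0 (Space j)) xi)))
    <= (SUM j:UNIV. ennreal (norm (fourier (c j) xi) / norm xi))" by (simp add: sum_ennreal ennreal_leI)
  qed
  also have "... = (SUM j:UNIV. \<integral>\<^sup>+xi. ennreal (norm (fourier (c j) xi) / norm xi) \<partial>lborel)"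
   by (rule nn_integral_sum) simp
  also have "... <= (SUM j:(UNIV::3 set). ennreal (92 * (6 * e) * (3 * pi)))"
   using fourier_borel[OF ic] e0 L by (intro sum_mono weighted_L1) auto
  also have "... = ennreal (3 * (552 * e * (3 * pi)))"
   using e0 by (simp add: ennreal_mult[symmetric] ennreal_numeral[symmetric] mult_ac del: ennreal_numeral)
  finally show ?thesis .
 qed
 have "norm (p0 mu x) <= 32 * ?J + 3 * (552 * e * (3 * pi))"
 proof (rule reconstruct[OF ip0 has_gradient_continuous(1)[OF gp0] ih _ _ curl])
  fix eps :: real assume eps: "eps = 1 \<or> eps = -1"
  show "(\<integral>\<^sup>+w. norm (LINT r|radial_measure. cis (r * (x \<bullet> w)) * half_wave eps p0 w (r *\<^sub>R w)) \<partial>sphere_measure)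
   <= ennreal (32 * ?J)"
   by (rule core_energy[OF W0 W1 q0_def iE ih t eps _ _ _ _ _ b0 b1' b2[unfolded mult_1] b3 b4 K(1,2) K(3,4)[OF eps]]) (use N0 e0 t in auto)
 qed (use N0 e0 t K in auto)
 then show ?thesis by (simp add: p0_def)
qed

end

section \<open>Removal of the cutoff and the estimate without localization\<close>

lemma L2_norm_bound:
 assumes "L2_norm g <= ennreal A" "A >= 0"
 shows "(\<integral>\<^sup>+x. ennreal ((norm (g x))^2) \<partial>lborel) <= ennreal (A^2)"
proof -
 let ?I = "\<integral>\<^sup>+x. ennreal ((norm (g x))^2) \<partial>lborel"
 have fin: "?I ~= \<infinity>" using assms(1) unfolding L2_norm_def Let_def by (auto split: if_splits simp: top_unique)
 then have "sqrt (enn2real ?I) <= A" using assms unfolding L2_norm_def Let_def by simp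
 then have "(sqrt (enn2real ?I))^2 <= A^2" by (intro power_mono) simp_all
 then have "enn2real ?I <= A^2" by simp
 then show ?thesis using fin by (metis ennreal_enn2real ennreal_leI infinity_ennreal_def less_top)
qed

lemma square_mass_sum:
 fixes u :: "'w => space => 'b::{real_normed_vector, second_countable_topology}"
 assumes W: "finite W" and c: "!!w. w : W ==> continuous_on UNIV (u w)" and fin: "(SUM w:W. L2_norm (u w)) < \<infinity>"
 shows "square_mass (%x. SUM w:W. norm (u w x)) (real (card W) * enn2real (SUM w:W. L2_norm (u w)))"
 unfolding square_mass_def
proof (intro conjI L2_sum[OF W])
 let ?A = "SUM w:W. L2_norm (u w)"
 show "(\<integral>\<^sup>+x. ennreal ((norm (u w x))^2) \<partial>lborel) <= ennreal ((enn2real ?A)^2)" if "w : W" for w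
 proof (rule L2_norm_bound)
  have "L2_norm (u w) <= ?A" using W that by (intro member_le_sum) auto
  then show "L2_norm (u w) <= ennreal (enn2real ?A)" using fin by simp
 qed simp
 show "(%x. norm (u w x)) : borel_measurable lborel" if "w : W" for w
  using c[OF that] by (auto intro!: borel_measurable_continuous_onI continuous_intros)
 show "(%x. SUM w:W. norm (u w x)) : borel_measurable borel"
  using c by (intro borel_measurable_continuous_onI continuous_intros)
qed simp_all

context energy_data
begin

text \<open>Dominated convergence: \<open>cutoff_error\<close> is at most 2 and tends to 0 at every
  x, and 2 G is square integrable. No rate is obtained, so t is fixed before eta tends to 0.\<close>

lemma cutoff_error_limit:
 obtains e where "!!n. square_mass (%x. cutoff_error (1 / real (Suc n)) x * G x) (e n)" "e \<longlonglongrightarrow> 0"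
proof -
 have [measurable]: "G : borel_measurable borel" using G by (simp add: square_mass_def)
 have [measurable]: "cutoff_error eta : borel_measurable borel" for eta unfolding cutoff_error_def by measurable
 define eta where "eta n = 1 / real (Suc n)" for n
 define I where "I n = (\<integral>\<^sup>+x. ennreal ((cutoff_error (eta n) x * G x)^2) \<partial>lborel)" for n
 have eta: "0 <= eta n" "eta n <= 1" for n by (auto simp: eta_def)
 have ce: "0 <= cutoff_error (eta n) x" "cutoff_error (eta n) x <= 2" for n x
  using eta[of n] by (auto simp: cutoff_error_def min_def)
 have fin: "(\<integral>\<^sup>+x. ennreal ((2 * G x)^2) \<partial>lborel) < \<infinity>"
  using square_mass_scale[OF G, of 2] by (auto simp: square_mass_def intro: le_less_trans)
 have le: "ennreal ((cutoff_error (eta n) x * G x)^2) <= ennreal ((2 * G x)^2)" for n x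
  using ce[of n x] G_nonneg[of x] by (intro ennreal_leI power_mono mult_right_mono) auto
 have "I \<longlonglongrightarrow> (\<integral>\<^sup>+x. 0 \<partial>(lborel::space measure))"
  unfolding I_def
 proof (rule nn_integral_dominated_convergence[OF _ _ _ _ fin])
  show "AE x in lborel. (%n. ennreal ((cutoff_error (eta n) x * G x)^2)) \<longlonglongrightarrow> 0"
  proof (intro AE_I2)
   fix x :: space
   have "eta \<longlonglongrightarrow> 0" unfolding eta_def by (rule LIMSEQ_Suc[OF lim_1_over_n])
   then have "(%n. ((eta n + min 1 ((eta n * norm x)^2)) * G x)^2) \<longlonglongrightarrow> ((0 + min 1 ((0 * norm x)^2)) * G x)\<^sup>2"
    by (intro tendsto_intros)
   then show "(%n. ennreal ((cutoff_error (eta n) x * G x)^2)) \<longlonglongrightarrow> 0"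
    unfolding cutoff_error_def using tendsto_ennrealI by fastforce
  qed
  show "AE x in lborel. ennreal ((cutoff_error (eta n) x * G x)^2) <= ennreal ((2 * G x)^2)" for n
   by (intro AE_I2 le)
 qed measurable
 then have I0: "I \<longlonglongrightarrow> 0" by simp
 have If: "I n < \<infinity>" for n
  unfolding I_def by (rule le_less_trans[OF nn_integral_mono fin]) (rule le)
 have "(%n. enn2real (I n)) \<longlonglongrightarrow> 0" using tendsto_enn2real[of I 0 sequentially] I0 by simp
 then have "(%n. sqrt (enn2real (I n))) \<longlonglongrightarrow> sqrt 0" by (rule tendsto_real_sqrt)
 then have 2: "(%n. sqrt (enn2real (I n))) \<longlonglongrightarrow> 0" by simp
 have 1: "square_mass (%x. cutoff_error (1 / real (Suc n)) x * G x) (sqrt (enn2real (I n)))" for n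
  using If[of n] unfolding square_mass_def eta_def[symmetric] I_def[symmetric] by (auto simp: less_top[symmetric])
 show ?thesis by (rule that[OF 1 2])
qed

lemma pointwise_estimate:
 assumes K: "K3 >= 0" "K2 >= 0"
   "!!eps. eps = 1 \<or> eps = -1 ==> (\<integral>\<^sup>+w. ennreal ((decay3 (x \<bullet> w + eps * t))^2) \<partial>sphere_measure) <= ennreal (K3^2)"
   "!!eps. eps = 1 \<or> eps = -1 ==> (\<integral>\<^sup>+w. ennreal ((decay2 (x \<bullet> w + eps * t))^2) \<partial>sphere_measure) <= ennreal (K2^2)"
 shows "norm (pd mu phi t x) <= 100096 * N * K3 + 13984 * t * M * K2"
proof -
 let ?A = "pd mu phi t"
 obtain e where e: "!!n. square_mass (%x. cutoff_error (1 / real (Suc n)) x * G x) (e n)" "e \<longlonglongrightarrow> 0"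
  by (rule cutoff_error_limit) (rule that)
 define B where "B n = 32 * ((1840 * N + 736 * N + 552 * N) * K3 + t * ((2 * (184 * M + 6256 * t * e n)) + 69 * M) * K2) + 3 * (552 * e n * (3 * pi))" for n
 have "B \<longlonglongrightarrow> 32 * ((1840 * N + 736 * N + 552 * N) * K3 + t * ((2 * (184 * M + 6256 * t * 0)) + 69 * M) * K2) + 3 * (552 * 0 * (3 * pi))"
  unfolding B_def by (intro tendsto_intros e(2))
 \<comment> \<open>Without the error the constants are 32 times 1840 + 736 + 552, which is 100096,
   and 32 times 2 * 184 + 69, which is 13984.\<close>
 then have BL: "B \<longlonglongrightarrow> 100096 * N * K3 + 13984 * t * M * K2" by (simp add: algebra_simps)
 have "(%n. norm (cut (1 / real (Suc n)) x * ?A x)) \<longlonglongrightarrow> norm (of_real 1 * ?A x)"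
  unfolding cut_def by (intro tendsto_intros gauss_tendsto_1)
 then have "(%n. norm (cut (1 / real (Suc n)) x * ?A x)) \<longlonglongrightarrow> norm (?A x)" by simp
 then show ?thesis
 proof (rule LIMSEQ_le[OF _ BL])
  \<comment> \<open>Only sufficiently large n satisfy eta t <= 1, which is harmless for the
    limit.\<close>
  have "norm (cut (1 / real (Suc n)) x * ?A x) <= B n" if "n >= nat \<lceil>t\<rceil>" for n
   unfolding B_def
  proof (rule cutoff_estimate[OF _ _ _ e(1) K])
   show "1 / real (Suc n) * t <= 1" using that t by (simp add: divide_le_eq)
  qed auto
  then show "\<exists>N. \<forall>n\<ge>N. norm (cut (1 / real (Suc n)) x * ?A x) <= B n" by blast
 qed
qed

text \<open>K3 and K2 are the roots of the bounds in \<open>angular_3\<close> and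
  \<open>angular_2\<close>: 256 and 64 give 16 and 8, and 1/t gives t^(-1/2), which the factor t of
  the forcing turns into t^(1/2). The sum over four components yields 64 * 100096 and 32 *
  13984.\<close>

lemma decay_estimate:
 "norm (grad phi t x) <= 6406144 * (1 / sqrt t * (if norm x <= t then 1 / jap (t - norm x) else 1)) * N + 447488 * sqrt t * M"
proof -
 define k where "k = (if norm x <= t then 1 / jap (t - norm x) else 1)"
 have k0: "k >= 0" by (auto simp: k_def jap_def)
 have kk: "k^2 = (if norm x <= t then 1 / (1 + (t - norm x)^2) else 1)"
  by (simp add: k_def jap_def power_divide)
 have st: "sqrt t > 0" "(sqrt t)^2 = t" using t by auto
 have "norm (pd mu phi t x) <= 100096 * N * (16 / sqrt t * k) + 13984 * t * M * (8 / sqrt t)" for mu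
 proof (rule pointwise_estimate)
  fix eps :: real assume eps: "eps = 1 \<or> eps = -1"
  show "(\<integral>\<^sup>+w. ennreal ((decay3 (x \<bullet> w + eps * t))^2) \<partial>sphere_measure) <= ennreal ((16 / sqrt t * k)^2)"
   using angular_3[OF t eps, of x] unfolding decay3_square power_mult_distrib kk power_divide st by simp
  show "(\<integral>\<^sup>+w. ennreal ((decay2 (x \<bullet> w + eps * t))^2) \<partial>sphere_measure) <= ennreal ((8 / sqrt t)^2)"
   using angular_2[of t 1, OF _ _ eps, of x] t unfolding decay2_square power_divide st by simp
 qed (use st k0 in auto)
 also have "100096 * N * (16 / sqrt t * k) + 13984 * t * M * (8 / sqrt t) = 1601536 * (1 / sqrt t * k) * N + 111872 * sqrt t * M"
  using st(1) real_sqrt_mult_self[of t] t by (simp add: field_simps power2_eq_square[symmetric])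
 finally have le: "norm (pd mu phi t x) <= 1601536 * (1 / sqrt t * k) * N + 111872 * sqrt t * M" for mu .
 have "norm (grad phi t x) <= (SUM mu:UNIV. norm (pd mu phi t x))" by (rule norm_grad_le)
 also have "... <= (SUM mu:(UNIV::coord set). 1601536 * (1 / sqrt t * k) * N + 111872 * sqrt t * M)" by (intro sum_mono le)
 finally show ?thesis by (simp add: card_coord k_def[symmetric])
qed

end

lemma pd_grad_le: "norm (pd mu psi t x) <= norm (grad psi t x)"
 using Finite_Cartesian_Product.norm_nth_le[of "grad psi t x" mu] by (simp add: grad_def)

lemma C_k_foldr_Gam: "C_k (length w + k) psi ==> C_k k (foldr Gam w psi)"
proof (induction w arbitrary: k)
 case (Cons g w)
 have "C_k (length w + Suc k) psi" using Cons.prems by (simp del: C_k.simps)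
 from C_k_Gam[OF Cons.IH[OF this]] show ?case by (simp del: C_k.simps)
qed (simp del: C_k.simps)

lemma continuous_grad: "C_k 1 psi ==> continuous_on UNIV (grad psi t)"
 unfolding grad_def[abs_def] by (intro continuous_on_vec_lambda C_k_continuous_slice[of 0] C_k_pd) simp

text \<open>Once space derivatives are commuted past \<partial>_mu, every function in
  \<open>energy_data\<close> bounded by G is a component of the gradient of a word in the first sum.
  The forcing of S \<phi> is S f + 2 f, both of whose terms are words in the second.\<close>

lemma energy_dataI:
 assumes C: "C_k 5 phi" and t: "t >= 1"
  and f1: "(SUM w:words 3. L2_norm (grad (foldr Gam w phi) t)) < \<infinity>"
  and f2: "(SUM w:words 2. L2_norm (foldr Gam w (box phi) t)) < \<infinity>"
 shows "energy_data phi t (real (card (words 3)) * enn2real (SUM w:words 3. L2_norm (grad (foldr Gam w phi) t)))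
   (real (card (words 2)) * enn2real (SUM w:words 2. L2_norm (foldr Gam w (box phi) t)))
   (%x. SUM w:words 3. norm (grad (foldr Gam w phi) t x)) (%x. SUM w:words 2. norm (foldr Gam w (box phi) t x))"
proof
 let ?A = "Gam Scaling phi"
 show "C_k 5 phi" "t >= 1" by (fact C t)+
 have C2: "C_k 2 phi" "C_k 2 (pd mu phi)" "C_k 2 ?A" for mu
  using C C_k_pd[of 4 phi mu] C_k_Gam[of 4 phi Scaling] by (auto intro: C_k_mono simp: numeral_eq_Suc simp del: C_k.simps)
 have Cb: "C_k 3 (box phi)" by (rule C_k_box) (use C in \<open>simp add: numeral_eq_Suc\<close>)
 have "continuous_on UNIV (grad (foldr Gam w phi) t)" if "w : words 3" for w
  using that by (intro continuous_grad C_k_foldr_Gam C_k_mono[OF C]) (simp add: words_def)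
 then show "square_mass (%x. SUM w:words 3. norm (grad (foldr Gam w phi) t x)) (real (card (words 3)) * enn2real (SUM w:words 3. L2_norm (grad (foldr Gam w phi) t)))"
  by (intro square_mass_sum finite_words f1)
 have "continuous_on UNIV (foldr Gam w (box phi) t)" if "w : words 2" for w
  using that by (intro C_k_continuous_slice[of 0] C_k_foldr_Gam C_k_mono[OF Cb]) (simp add: words_def)
 then show "square_mass (%x. SUM w:words 2. norm (foldr Gam w (box phi) t x)) (real (card (words 2)) * enn2real (SUM w:words 2. L2_norm (foldr Gam w (box phi) t)))"
  by (intro square_mass_sum finite_words f2)
 fix x
 have w: "norm (pd mu (foldr Gam w phi) t x) <= (SUM w:words 3. norm (grad (foldr Gam w phi) t x))" if "length w <= 3" for w mu
  using that finite_words by (intro order_trans[OF pd_grad_le] member_le_sum) (auto simp: words_def)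
 fix mu
 show "norm (pd mu phi t x) <= (SUM w:words 3. norm (grad (foldr Gam w phi) t x))" using w[of "[]"] by simp
 show "norm (pd mu ?A t x) <= (SUM w:words 3. norm (grad (foldr Gam w phi) t x))" using w[of "[Scaling]"] by simp
 show "norm (pd mu (Gam Scaling ?A) t x) <= (SUM w:words 3. norm (grad (foldr Gam w phi) t x))" using w[of "[Scaling, Scaling]"] by simp
 have h: "norm (foldr Gam w (box phi) t x) <= (SUM w:words 2. norm (foldr Gam w (box phi) t x))" if "length w <= 2" for w
  using that finite_words by (intro member_le_sum[where f = "%w. norm (foldr Gam w (box phi) t x)"]) (auto simp: words_def)
 show "norm (box phi t x) <= (SUM w:words 2. norm (foldr Gam w (box phi) t x))" using h[of "[]"] by simp
 have "box ?A t x = Gam Scaling (box phi) t x + 2 * box phi t x"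
  by (subst box_Scaling) (use C_k_mono[OF C] in auto)
 then have "norm (box ?A t x) <= norm (Gam Scaling (box phi) t x) + 2 * norm (box phi t x)"
  using norm_triangle_ineq[of "Gam Scaling (box phi) t x" "2 * box phi t x"] by (simp add: norm_mult)
 then show "norm (box ?A t x) <= 3 * (SUM w:words 2. norm (foldr Gam w (box phi) t x))"
  using h[of "[]"] h[of "[Scaling]"] by simp
 fix i
 show "norm (pd (Space i) (box phi) t x) <= (SUM w:words 2. norm (foldr Gam w (box phi) t x))" using h[of "[Transl i]"] by simp
 show "norm (pd (Space i) (pd mu phi) t x) <= (SUM w:words 3. norm (grad (foldr Gam w phi) t x))"
  using w[of "[Transl i]"] pd_commute[OF C2(1), of "Space i" mu] by simp
 show "norm (pd (Space i) (pd (Space i) (pd mu phi)) t x) <= (SUM w:words 3. norm (grad (foldr Gam w phi) t x))"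
  using w[of "[Transl i, Transl i]"] pd_commute[OF C2(1), of "Space i" mu] pd_commute[OF C2(2)[of "Space i"], of "Space i" mu] by simp
 show "norm (pd (Space i) (pd mu ?A) t x) <= (SUM w:words 3. norm (grad (foldr Gam w phi) t x))"
  using w[of "[Transl i, Scaling]"] pd_commute[OF C2(3), of "Space i" mu] by simp
qed

lemma inhomogeneous_decay:
 assumes s: "solves_wave phi f phi0 phi1" and t: "t > 1" and dlt: "0 < dlt" "dlt <= 1"
 shows "ennreal (norm (grad phi t x)) \<le>
     ennreal ((12812288 * (real (card (words 3)) + real (card (words 2)))) * inverse dlt) *
     (ennreal (jap t powr (-1/2) *
       (jap (t - norm x) powr (-1 + dlt) * indicator {y. norm y <= t} x
       + indicator {y. norm y > t} x))
      * (SUM w:words 3. L2_norm (grad (foldr Gam w phi) t))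
     + ennreal (jap t powr (1/2)) * (SUM w:words 2. L2_norm (foldr Gam w f t)))"
proof -
 let ?D = "inverse dlt"
 define A where "A = (SUM w:words 3. L2_norm (grad (foldr Gam w phi) t))"
 define B where "B = (SUM w:words 2. L2_norm (foldr Gam w f t))"
 define kk where "kk = jap (t - norm x) powr (-1 + dlt) * indicator {y. norm y <= t} x + (indicator {y. norm y > t} x :: real)"
 define C where "C = 12812288 * (real (card (words 3)) + real (card (words 2)))"
 let ?E = "ennreal (C * ?D)"
 have C5: "C_k 5 phi" and f: "f = box phi" using s by (auto simp: solves_wave_def fun_eq_iff)
 have j1: "1 <= jap y" for y by (simp add: jap_def)
 have j0: "0 < jap y" for y using j1[of y] by linarith
 have kpos: "0 < kk" using j0[of "t - norm x"] by (auto simp: kk_def indicator_def)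
 have "[] : words 3" "[] : words 2" by (auto simp: words_def)
 then have cp: "0 < card (words 3)" "0 < card (words 2)" using finite_words by (auto simp: card_gt_0_iff)
 have C0: "C > 0" using cp by (simp add: C_def)
 have jt: "t <= jap t" "jap t <= 2 * t" using jap_bounds[of t] t by auto
 show ?thesis
  unfolding A_def[symmetric] B_def[symmetric] kk_def[symmetric] C_def[symmetric]
 proof (cases "A = \<infinity> \<or> B = \<infinity>")
  case True
  \<comment> \<open>In the extended nonnegative numbers 0 times infinity is 0; positive coefficients
    ensure that an infinite norm makes the right side infinite.\<close>
  have "0 < jap t powr (-1/2) * kk" using kpos j0[of t] by simp
  moreover have "0 < jap t powr (1/2)" using j0[of t] by simp
  moreover have "0 < C * ?D" using C0 dlt by simp
  ultimately have "?E * (ennreal (jap t powr (-1/2) * kk) * A + ennreal (jap t powr (1/2)) * B) = \<infinity>"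
   using True by (auto simp: ennreal_mult_eq_top_iff ennreal_eq_0_iff not_le)
  then show "ennreal (norm (grad phi t x)) <= ?E * (ennreal (jap t powr (-1/2) * kk) * A + ennreal (jap t powr (1/2)) * B)" by simp
 next
  case False
  then have fin: "A < \<infinity>" "B < \<infinity>" by (auto simp: less_top)
  obtain a b where ab: "A = ennreal a" "B = ennreal b" "a >= 0" "b >= 0"
   using False by (metis ennreal_cases infinity_ennreal_def)
  interpret energy_data phi t "real (card (words 3)) * enn2real A" "real (card (words 2)) * enn2real B"
   "%x. SUM w:words 3. norm (grad (foldr Gam w phi) t x)" "%x. SUM w:words 2. norm (foldr Gam w (box phi) t x)"
   unfolding A_def B_def f by (rule energy_dataI[OF C5]) (use t fin in \<open>auto simp: A_def B_def f\<close>)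
  define n3 n2 where "n3 = real (card (words 3))" and "n2 = real (card (words 2))"
  have n: "n3 >= 0" "n2 >= 0" by (auto simp: n3_def n2_def)
  have "norm (grad phi t x) <= 6406144 * (1 / sqrt t * (if norm x <= t then 1 / jap (t - norm x) else 1)) * (n3 * a) + 447488 * sqrt t * (n2 * b)"
   using decay_estimate[of x] ab by (simp add: n3_def n2_def)
  also have "... <= 6406144 * (2 * jap t powr (-1/2) * kk) * (n3 * a) + 447488 * jap t powr (1/2) * (n2 * b)"
  proof (intro add_mono mult_right_mono mult_left_mono mult_mono)
   \<comment> \<open>From \<open>jap t <= 2 * t\<close>, hence at most 4 t; the factor 2 turns
     6406144 into 12812288.\<close>
   have "1 / sqrt t = 2 / sqrt (4 * t)" by (simp add: real_sqrt_mult)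
   also have "... <= 2 / sqrt (jap t)" using jt t j0[of t] by (intro divide_left_mono) auto
   also have "... = 2 * jap t powr (-1/2)" using j0[of t] by (simp add: powr_minus_divide powr_half_sqrt less_imp_le)
   finally show "1 / sqrt t <= 2 * jap t powr (-1/2)" .
   show "sqrt t <= jap t powr (1/2)" using jt t by (simp add: powr_half_sqrt less_imp_le[OF j0])
   \<comment> \<open>The base is at least 1 and dlt is positive, so the power with exponent -1 from
     \<open>decay_estimate\<close> is at most the one with exponent -1 + dlt.\<close>
   have "1 / jap (t - norm x) = jap (t - norm x) powr (-1)" using less_imp_le[OF j0[of "t - norm x"]] by (simp add: powr_minus_divide)
   also have "... <= jap (t - norm x) powr (-1 + dlt)" using j1 dlt by (intro powr_mono) auto
   finally show "(if norm x <= t then 1 / jap (t - norm x) else 1) <= kk" by (auto simp: kk_def)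
  qed (use n ab j0 in \<open>auto simp: less_imp_le\<close>)
  also have "... <= C * (jap t powr (-1/2) * kk * a + jap t powr (1/2) * b)"
  proof -
   define X where "X = jap t powr (-1/2) * kk * a"
   define Y where "Y = jap t powr (1/2) * b"
   have XY: "X >= 0" "Y >= 0" using kpos ab by (auto simp: X_def Y_def)
   have "0 <= n3 * X" "0 <= n3 * Y" "0 <= n2 * X" "0 <= n2 * Y" using n XY by auto
   then have "12812288 * (n3 * X) + 447488 * (n2 * Y) <= 12812288 * (n3 * X + n3 * Y + n2 * X + n2 * Y)" unfolding distrib_left by linarith
   also have "... = C * (X + Y)" unfolding C_def n3_def n2_def by (simp add: algebra_simps)
   finally show ?thesis unfolding X_def Y_def by (simp add: mult_ac)
  qed
  also have "... = 1 * (C * (jap t powr (-1/2) * kk * a + jap t powr (1/2) * b))" by simp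
  also have "... <= ?D * (C * (jap t powr (-1/2) * kk * a + jap t powr (1/2) * b))"
   using dlt C0 kpos ab by (intro mult_right_mono) (auto simp: one_le_inverse less_imp_le)
  finally have "ennreal (norm (grad phi t x)) <= ennreal (?D * (C * (jap t powr (-1/2) * kk * a + jap t powr (1/2) * b)))"
   by (rule ennreal_leI)
  also have "... = ?E * (ennreal (jap t powr (-1/2) * kk) * A + ennreal (jap t powr (1/2)) * B)"
  proof -
   have p: "0 <= jap t powr (-1/2) * kk" "0 <= C * ?D" using kpos C0 dlt by auto
   have "?E * (ennreal (jap t powr (-1/2) * kk) * A + ennreal (jap t powr (1/2)) * B)
    = ennreal (C * ?D * (jap t powr (-1/2) * kk * a + jap t powr (1/2) * b))"
    unfolding ab using p ab(3,4) by (subst ennreal_mult, simp, simp, subst ennreal_plus, simp, simp, subst ennreal_mult[OF p(1)], simp, subst ennreal_mult[of "jap t powr (1/2)"], simp_all)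
   then show ?thesis by (simp add: mult_ac)
  qed
  finally show "ennreal (norm (grad phi t x)) <= ?E * (ennreal (jap t powr (-1/2) * kk) * A + ennreal (jap t powr (1/2)) * B)" .
 qed
qed

section \<open>Frequency localized waves\<close>

lemma radial_integral_compact:
 fixes f :: "real => complex"
 assumes c: "continuous_on UNIV f" and z: "!!r. r \<notin> {a..b} ==> f r = 0" and a: "0 < a"
 shows "(LINT r|radial_measure. f r) = integral {a..b} (%r. of_real (r^2) * f r)"
proof -
 have [measurable]: "f : borel_measurable borel" by (rule borel_measurable_continuous_onI[OF c])
 have dens: "radial_measure = density lborel (%r. ennreal (r^2 * indicator {0<..} r))"
  unfolding radial_measure_def by (intro density_cong AE_I2) (auto split: split_indicator)
 have "(LINT r|radial_measure. f r) = (LINT r|lborel. (r^2 * indicator {0<..} r) *\<^sub>R f r)"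
  unfolding dens by (subst integral_density) auto
 also have "... = (LINT r|lborel. indicator {a..b} r *\<^sub>R (of_real (r^2) * f r))"
  using a z by (intro Bochner_Integration.integral_cong refl) (auto simp: scaleR_conv_of_real split: split_indicator)
 also have "... = integral {a..b} (%r. of_real (r^2) * f r)"
 proof -
  have "set_integrable lborel {a..b} (%r. of_real (r^2) * f r)"
   by (rule borel_integrable_atLeastAtMost') (intro continuous_intros continuous_on_subset[OF c], simp)
  from set_borel_integral_eq_integral(2)[OF this] show ?thesis unfolding set_lebesgue_integral_def .
 qed
 finally show ?thesis .
qed

text \<open>The analogue of \<open>ray_bound\<close> on a fixed range of frequencies. Sup bounds
  replace weighted L^2 bounds, so each integration by parts gains a full 1/|s|. V0 vanishes at both
  ends. Before the second step V1 is exchanged for the cut version \<open>W1\<close> at distance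
  \<open>e\<close>; the cutoff has spoilt the exact localization, so the boundary terms of
  \<open>W1\<close> stay and are bounded through N.\<close>

lemma localized_ray:
 fixes V0 V1 W1 W2 P0 P1 :: "real => complex"
 assumes ab: "0 < a" "a <= b" and t: "t >= 0" and s: "s ~= 0"
  and d0: "!!l. l > 0 ==> ((%l. of_real (l^2) * V0 l) has_vector_derivative - (of_real l * (V1 l + of_real t * P0 l))) (at l)"
  and d1: "!!l. l > 0 ==> ((%l. of_real l * W1 l) has_vector_derivative - (W1 l + W2 l + of_real t * P1 l)) (at l)"
  and z: "V0 a = 0" "V0 b = 0"
  and c: "continuous_on {a..b} V1" "continuous_on {a..b} W1" "continuous_on {a..b} W2" "continuous_on {a..b} P0" "continuous_on {a..b} P1"
  and bd: "!!l. norm (V1 l - W1 l) <= e" "!!l. norm (W1 l) <= N" "!!l. norm (W2 l) <= N"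
  and al: "al0 >= 0" "al1 >= 0"
  and b0: "integral {a..b} (%l. (l * norm (P0 l))^2) <= al0^2"
  and b1: "integral {a..b} (%l. (l * norm (P1 l))^2) <= al1^2"
 shows "\<bar>s\<bar> * norm (integral {a..b} (%l. cis (l * s) * (of_real (l^2) * V0 l)))
   <= b^2 * e + (4 * b * N + t * (sqrt b * al1 / a)) / \<bar>s\<bar> + t * (sqrt b * al0)"
proof -
 let ?B = "integral {a..b}"
 let ?K = "?B (%l. norm (- (W1 l + W2 l + of_real t * P1 l)))"
 let ?I = "norm (?B (%l. cis (l * s) * (of_real (l^2) * V0 l)))"
 let ?H = "norm (?B (%l. cis (l * s) * - (W1 l + W2 l + of_real t * P1 l)))"
 let ?G = "?B (%l. norm (P1 l))"
 let ?F = "?B (%l. norm (of_real l * (- (V1 l - W1 l)) + - (of_real t * (of_real l * P0 l))))"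
 let ?E = "?B (%l. l * norm (P0 l))"
 let ?D = "?B (%l. cis (l * s) * (of_real l * (- (V1 l - W1 l)) + - (of_real t * (of_real l * P0 l))))"
 let ?C = "?B (%l. cis (l * s) * - (of_real l * (V1 l + of_real t * P0 l)))"
 have e0: "e >= 0" "N >= 0" using bd(1,2)[of a] norm_ge_zero order_trans by blast+
 have cr: "continuous_on A complex_of_real" for A by (intro continuous_intros)
 have i0: "?E <= sqrt b * al0"
 proof -
  have "?B (%l. norm (of_real l * P0 l)) <= al0 * sqrt (b - a)"
  proof (rule l1_bound_length[OF ab(2) _ al(1)])
   have "?B (%l. (norm (of_real l * P0 l))^2) = ?B (%l. (l * norm (P0 l))^2)"
    by (rule integral_cong) (simp add: norm_mult power_mult_distrib)
   with b0 show "?B (%l. (norm (of_real l * P0 l))^2) <= al0^2" by simp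
  qed (intro continuous_intros c)
  moreover have "?B (%l. norm (of_real l * P0 l)) = ?E"
   by (rule integral_cong) (use ab in \<open>simp add: norm_mult\<close>)
  moreover have "al0 * sqrt (b - a) <= al0 * sqrt b" using ab al by (intro mult_left_mono) auto
  ultimately show ?thesis by (simp add: mult.commute)
 qed
 have i1: "?G <= sqrt b * al1 / a"
 proof -
  have "?G <= (al1 / a) * sqrt (b - a)"
  proof (rule l1_bound_length[OF ab(2) c(5)])
   have "?B (%l. (norm (P1 l))^2) <= ?B (%l. (1 / a)^2 * (l * norm (P1 l))^2)"
   proof (rule integral_le)
    fix l assume "l : {a..b}"
    then have "1 * norm (P1 l) <= (1 / a * l) * norm (P1 l)" using ab by (intro mult_right_mono) (auto simp: field_simps)
    then have "(norm (P1 l))^2 <= (1 / a * l * norm (P1 l))^2" by (intro power_mono) auto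
    then show "(norm (P1 l))^2 <= (1 / a)^2 * (l * norm (P1 l))^2" by (simp add: power_mult_distrib power_divide)
   qed (intro integrable_continuous_interval continuous_intros c)+
   also have "... = (1 / a)^2 * ?B (%l. (l * norm (P1 l))^2)" by simp
   also have "... <= (1 / a)^2 * al1^2" using b1 by (intro mult_left_mono) auto
   finally show "?B (%l. (norm (P1 l))^2) <= (al1 / a)^2" by (simp add: power_divide)
  qed (use al ab in auto)
  also have "... <= (al1 / a) * sqrt b" using ab al by (intro mult_left_mono) auto
  finally show ?thesis by (simp add: mult.commute)
 qed
 define J where "J = ?B (%l. cis (l * s) * (of_real l * W1 l))"
 have J: "\<bar>s\<bar> * norm J <= 4 * b * N + t * (sqrt b * al1 / a)"
 proof -
  have "\<bar>s\<bar> * norm J <= norm (of_real b * W1 b) + norm (of_real a * W1 a) + ?H"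
   unfolding J_def by (rule oscillatory_ibp(2)[OF ab(2) d1]) (use ab in \<open>auto intro!: continuous_intros c\<close>)
  moreover have "norm (of_real b * W1 b) <= b * N" "norm (of_real a * W1 a) <= b * N"
   using ab e0 bd(2) by (auto simp: norm_mult intro!: mult_mono)
  moreover have "?H <= ?K"
   by (rule norm_integral_cis_le) (intro continuous_intros c)
  moreover have "?K <= ?B (%l. 2 * N + t * norm (P1 l))"
  proof (rule integral_le)
   fix l
   show "norm (- (W1 l + W2 l + of_real t * P1 l)) <= 2 * N + t * norm (P1 l)"
    using norm_triangle_ineq[of "W1 l + W2 l" "of_real t * P1 l"] norm_triangle_ineq[of "W1 l" "W2 l"] t bd(2,3)[of l]
    unfolding norm_minus_cancel by (simp add: norm_mult)
  qed (intro integrable_continuous_interval continuous_intros c)+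
  moreover have "?B (%l. 2 * N + t * norm (P1 l)) = (b - a) * (2 * N) + t * ?G"
   using ab by (subst integral_add) (auto intro!: integrable_continuous_interval continuous_intros c)
  moreover have "(b - a) * (2 * N) <= b * (2 * N)" using ab e0 by (intro mult_right_mono) auto
  moreover have "t * ?G <= t * (sqrt b * al1 / a)" by (rule mult_left_mono[OF i1 t])
  ultimately show ?thesis by linarith
 qed
 have "\<bar>s\<bar> * ?I
  <= norm (of_real (b^2) * V0 b) + norm (of_real (a^2) * V0 a) + norm ?C"
  by (rule oscillatory_ibp(2)[OF ab(2) d0]) (use ab in \<open>auto intro!: continuous_intros c\<close>)
 then have 1: "\<bar>s\<bar> * ?I <= norm ?C"
  by (simp add: z)
 have cc: "continuous_on A (%l. cis (l * s))" for A by (auto intro!: continuous_intros simp: cis_conv_exp)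
 have "?C
  = ?B (%l. cis (l * s) * (of_real l * (- (V1 l - W1 l)) + - (of_real t * (of_real l * P0 l))) - cis (l * s) * (of_real l * W1 l))"
  by (rule integral_cong) (simp add: algebra_simps)
 also have "... = ?D - J"
  unfolding J_def by (intro Henstock_Kurzweil_Integration.integral_diff integrable_continuous_interval continuous_intros c cc)
 finally have "norm ?C <= norm ?D + norm J"
  using norm_triangle_ineq4 by simp
 moreover have "norm ?D <= ?F"
  by (rule norm_integral_cis_le) (intro continuous_intros c)
 moreover have "?F <= ?B (%l. b * e + t * (l * norm (P0 l)))"
 proof (rule integral_le)
  fix l assume l: "l : {a..b}"
  have "norm (of_real l * (- (V1 l - W1 l))) <= b * e"
   unfolding norm_mult norm_minus_cancel using l ab bd(1)[of l] e0 by (intro mult_mono) auto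
  moreover have "norm (- (of_real t * (of_real l * P0 l))) = t * (l * norm (P0 l))" using t l ab by (simp add: norm_mult)
  ultimately show "norm (of_real l * (- (V1 l - W1 l)) + - (of_real t * (of_real l * P0 l))) <= b * e + t * (l * norm (P0 l))"
   using norm_triangle_ineq[of "of_real l * (- (V1 l - W1 l))" "- (of_real t * (of_real l * P0 l))"] by linarith
 qed (intro integrable_continuous_interval continuous_intros c)+
 moreover have "?B (%l. b * e + t * (l * norm (P0 l))) = (b - a) * (b * e) + t * ?E"
  using ab by (subst integral_add) (auto intro!: integrable_continuous_interval continuous_intros c)
 moreover have "(b - a) * (b * e) <= b * (b * e)" using ab e0 by (intro mult_right_mono) auto
 moreover have "t * ?E <= t * (sqrt b * al0)" by (rule mult_left_mono[OF i0 t])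
 moreover have "norm J <= (4 * b * N + t * (sqrt b * al1 / a)) / \<bar>s\<bar>" using J s by (simp add: field_simps)
 moreover have "b * (b * e) = b^2 * e" by (simp add: power2_eq_square)
 ultimately show ?thesis using 1 by linarith
qed

text \<open>The ray estimates are expressed in \<open>kap\<close>, of size 1/(beta |s|) but capped
  at 1, before \<open>angular_2\<close> integrates its square over the directions; beta |s| = 1
  separates the two regimes.\<close>

lemma angular_factor:
 fixes beta s :: real
 assumes beta: "beta > 0" 
 defines "kap \<equiv> 1 / sqrt (1 + (beta * s)^2)"
 shows "0 < kap" "kap <= 1" "kap^2 = 1 / (1 + (beta * s)^2)" "\<bar>beta * s\<bar> <= 1 ==> 1 <= 2 * kap^2"
  "\<bar>beta * s\<bar> >= 1 ==> 1 / \<bar>s\<bar> <= 2 * beta * kap"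
proof -
 let ?A = "1 + (beta * s)^2"
 have p: "1 <= sqrt ?A" by simp
 have p': "0 < 1 + (beta * s)^2" by (simp add: add_pos_nonneg)
 show "0 < kap" "kap <= 1" using p by (auto simp: kap_def divide_le_eq add_pos_nonneg)
 show k: "kap^2 = 1 / ?A" by (simp add: kap_def power_divide)
 { assume "\<bar>beta * s\<bar> <= 1"
  then have "(beta * s)^2 <= 1" by (metis abs_1 abs_le_square_iff one_power2)
  then show "1 <= 2 * kap^2" unfolding k using p' by (simp add: le_divide_eq) }
 { assume 1: "\<bar>beta * s\<bar> >= 1"
  then have "1 <= (beta * s)^2" by (metis abs_1 abs_le_square_iff one_power2)
  then have "sqrt ?A <= 2 * \<bar>beta * s\<bar>" by (intro real_le_lsqrt) (auto simp: power_mult_distrib)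
  then have "sqrt ?A <= 2 * beta * \<bar>s\<bar>" using beta by (simp add: abs_mult)
  moreover have "\<bar>s\<bar> > 0" using 1 by auto
  moreover have "0 < sqrt ?A" using p by linarith
  moreover have "1 / \<bar>s\<bar> <= 2 * beta * (1 / S)" if "S <= 2 * beta * \<bar>s\<bar>" "\<bar>s\<bar> > 0" "0 < S" for S
   using that by (simp add: field_simps)
  ultimately show "1 / \<bar>s\<bar> <= 2 * beta * kap" unfolding kap_def by blast }
qed

text \<open>Two integrations by parts give the square of \<open>kap\<close> for the terms with sup
  norms, which \<open>angular_2\<close> integrates to 64/(beta t). Forcing terms carry one
  \<open>kap\<close> and a ray norm, so Cauchy-Schwarz over the directions gives the root of this.
  The annulus is chosen wider than the one of \<open>freq_localized\<close>, so that the half wave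
  of p vanishes at both ends of the radial interval.\<close>

lemma localized_core:
 assumes W: "wave_system t p Dp q F" and W1: "wave_system t p1 Dp1 q1 F1"
  and t: "t >= 1" and eps: "eps = 1 \<or> eps = -1" and beta: "beta > 0" and A: "A >= 1"
  and supp: "!!mu xi. norm xi <= beta / (2 * A) \<or> norm xi >= 2 * A * beta ==> fourier (p mu) xi = 0"
  and sup: "!!mu xi. norm (fourier (p mu) xi) <= N" "!!mu xi. norm (fourier (q mu) xi) <= N"
   "!!mu xi. norm (fourier (q mu) xi - fourier (p1 mu) xi) <= e" "!!mu xi. norm (fourier (q1 mu) xi) <= N + e"
  and M: "M0 >= 0" "M1 >= 0"
   "(\<integral>\<^sup>+xi. ennreal ((norm (fourier F xi))^2) \<partial>lborel) <= ennreal (M0^2)"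
   "(\<integral>\<^sup>+xi. ennreal ((norm (fourier F1 xi))^2) \<partial>lborel) <= ennreal (M1^2)"
 shows "(\<integral>\<^sup>+w. norm (LINT r|radial_measure. cis (r * (x \<bullet> w)) * half_wave eps p w (r *\<^sub>R w)) \<partial>sphere_measure)
  <= ennreal (80 * (2 * A * beta) ^ 3 * (N + e) * (64 / (beta * t)) + 2 * beta * t * sqrt (2 * A * beta) * (M0 + 4 * A * M1) * (8 / sqrt (beta * t)) + 128 * pi * (2 * A * beta) ^ 3 * e)"
proof -
 let ?K = "64 / (beta * t)"
 let ?J = "integrable lborel"
 let ?H = "half_wave eps"
 let ?E = "borel_measurable borel"
 let ?D = "continuous_on UNIV"
 let ?B = "8 / sqrt (beta * t)"
 define a where "a = beta / (2 * A)"
 define b where "b = 2 * A * beta"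
 let ?R = "16 * b * (N + e)"
 let ?O = "integral {a..b}"
 let ?L = "4 * b^2 * e"
 let ?I = "ennreal (32 * b ^ 3 * e)"
 have A0: "A > 0" using A by simp
 have a: "0 < a" and b0: "0 < b" using beta A0 by (auto simp: a_def b_def)
 have "beta / (2 * A) <= beta" using beta A by (simp add: divide_le_eq)
 moreover have betab: "beta <= b" using mult_right_mono[of 1 "2 * A" beta] beta A by (simp add: b_def)
 ultimately have ab: "a <= b" by (simp add: a_def)
 have betaa: "beta / a = 2 * A" using beta A0 by (simp add: a_def)
 have ee: "eps * eps = 1" using eps by auto
 have ip: "?J (p mu)" and ip1: "?J (p1 mu)" and iF: "?J F" and iF1: "?J F1" for mu
  using W W1 by (auto simp: wave_system_def)
 have iq: "?J (q mu)" and iq1: "?J (q1 mu)" for mu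
  by (rule wave_system_q_integrable[OF W] wave_system_q_integrable[OF W1])+
 have cf: "?D (fourier (p mu))" "?D (fourier (p1 mu))" "?D (fourier (q mu))" "?D (fourier (q1 mu))"
   "?D (fourier F)" "?D (fourier F1)" for mu
  by (intro fourier_continuous ip ip1 iq iq1 iF iF1)+
 have Ne: "0 <= N" "0 <= e" using sup(1,3) norm_ge_zero order_trans by blast+
 define h0 where "h0 xi = norm (fourier F xi)" for xi
 define h1 where "h1 xi = norm (fourier F1 xi)" for xi
 have mh: "h0 : ?E" "h1 : ?E"
  unfolding h0_def h1_def by (intro borel_measurable_continuous_onI continuous_intros cf)+
 obtain al0 where a0: "al0 : ?E" "!!w. al0 w >= 0"
   "AE w in sphere_measure. (\<integral>\<^sup>+r. ennreal ((h0 (r *\<^sub>R w))^2) \<partial>radial_measure) <= ennreal ((al0 w)^2)" "(\<integral>\<^sup>+w. ennreal ((al0 w)^2) \<partial>sphere_measure) <= ennreal (M0^2)"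
  by (rule slice_norm[OF mh(1) M(3)[folded h0_def]]) (rule that)
 obtain al1 where a1: "al1 : ?E" "!!w. al1 w >= 0"
   "AE w in sphere_measure. (\<integral>\<^sup>+r. ennreal ((h1 (r *\<^sub>R w))^2) \<partial>radial_measure) <= ennreal ((al1 w)^2)" "(\<integral>\<^sup>+w. ennreal ((al1 w)^2) \<partial>sphere_measure) <= ennreal (M1^2)"
  by (rule slice_norm[OF mh(2) M(4)[folded h1_def]]) (rule that)
 define kap where "kap w = 1 / sqrt (1 + (beta * (x \<bullet> w + eps * t))^2)" for w
 define Q where "Q w = 80 * b ^ 3 * (N + e) * (kap w)^2 + 2 * beta * t * sqrt b * ((al0 w * kap w) + 4 * A * (al1 w * kap w)) + 32 * b ^ 3 * e" for w
 have main: "AE w in sphere_measure. norm (LINT r|radial_measure. cis (r * (x \<bullet> w)) * ?H p w (r *\<^sub>R w)) <= Q w"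
  using AE_sphere_measure a0(3) a1(3)
 proof eventually_elim
  fix w :: space
  assume w: "norm w = 1"
   and s0: "(\<integral>\<^sup>+r. ennreal ((h0 (r *\<^sub>R w))^2) \<partial>radial_measure) <= ennreal ((al0 w)^2)"
   and s1: "(\<integral>\<^sup>+r. ennreal ((h1 (r *\<^sub>R w))^2) \<partial>radial_measure) <= ennreal ((al1 w)^2)"
  define s where "s = x \<bullet> w + eps * t"
  define k where "k = kap w"
  have kdef: "k = 1 / sqrt (1 + (beta * s)^2)" by (simp add: k_def kap_def s_def)
  note kk = angular_factor[OF beta, of s, folded kdef]
  define V where "V p l = cis (- (eps * t * l)) * ?H p w (l *\<^sub>R w)" for p l
  define P where "P F l = cis (- (eps * t * l)) * fourier F (l *\<^sub>R w)" for F l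
  have cc: "continuous_on A (%l. cis (- (eps * t * l)))" for A
   by (auto intro!: continuous_intros simp: cis_conv_exp)
  have cw: "continuous_on A (%l. f (l *\<^sub>R w))" if "?D f" for A and f :: "space => complex"
   by (rule continuous_on_compose2[OF that]) (auto intro!: continuous_intros)
  have cV: "continuous_on A (V p)" if "!!mu. ?D (fourier (p mu))" for A p
   unfolding V_def half_wave_def by (intro continuous_intros cc cw that)
  have cP: "continuous_on A (P F)" if "?D (fourier F)" for A F
   unfolding P_def by (intro continuous_intros cc cw that)
  have Vb: "norm (V p l) <= 4 * C" if "!!mu xi. norm (fourier (p mu) xi) <= C" for p l C
  proof -
   have "norm (V p l) <= amp p (l *\<^sub>R w)" unfolding V_def by (simp add: norm_mult half_wave_le_amp[OF w eps])
   also have "... <= (SUM mu:(UNIV::coord set). C)" unfolding amp_def by (intro sum_mono that)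
   finally show ?thesis by (simp add: card_coord)
  qed
  have V0z: "V p l = 0" if "l \<notin> {a<..<b}" "l > 0" for l
   using supp[of "l *\<^sub>R w"] that w unfolding V_def half_wave_def a_def b_def by auto
  define G where "G = ?O (%l. cis (l * s) * (of_real (l^2) * V p l))"
  have cis1: "continuous_on A (%l. cis (l * y))" for A y
   by (auto intro!: continuous_intros simp: cis_conv_exp)
  have Geq: "(LINT r|radial_measure. cis (r * (x \<bullet> w)) * ?H p w (r *\<^sub>R w)) = G"
  proof -
   have eq: "cis (r * (x \<bullet> w)) * ?H p w (r *\<^sub>R w) = cis (r * s) * V p r" for r
    unfolding V_def s_def mult.assoc[symmetric] cis_mult by (simp add: algebra_simps)
   \<comment> \<open>For negative r the point r w lies on the opposite ray, where the transform need
     not vanish; \<open>max r 0\<close> replaces it by the origin, where it does.\<close>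
   define f where "f r = cis (r * s) * V p (max r 0)" for r
   have f: "?D f" "f r = 0" if "r \<notin> {a..b}" for r
   proof -
    show "?D f" unfolding f_def
     by (intro continuous_on_mult cis1 continuous_on_compose2[OF cV[OF cf(1), of UNIV]]) (auto intro!: continuous_intros)
    have "norm (max r 0 *\<^sub>R w) <= beta / (2 * A) \<or> norm (max r 0 *\<^sub>R w) >= 2 * A * beta"
     using that a w by (auto simp: a_def b_def max_def)
    then have "V p (max r 0) = 0" unfolding V_def half_wave_def using supp by simp
    then show "f r = 0" by (simp add: f_def)
   qed
   have "f : borel_measurable radial_measure" "(%r. cis (r * s) * V p r) : borel_measurable radial_measure"
    using f(1)[of "a - 1"] by (auto intro!: borel_measurable_continuous_onI continuous_on_mult cis1 cV cf simp: measurable_cong_sets[OF sets_radial_measure refl])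
   then have "(LINT r|radial_measure. cis (r * s) * V p r) = (LINT r|radial_measure. f r)"
   proof (intro integral_cong_AE)
    show "AE r in radial_measure. cis (r * s) * V p r = f r"
     using AE_radial_measure by eventually_elim (simp add: f_def)
   qed
   also have "... = ?O (%r. of_real (r^2) * f r)"
    by (rule radial_integral_compact[OF f(1)[of "a - 1"] f(2) a]) auto
   also have "... = G"
    unfolding G_def f_def by (rule integral_cong) (use a in \<open>simp add: max_def mult_ac\<close>)
   finally show ?thesis unfolding eq .
  qed
  have Gs: "norm G <= 4 * b ^ 3 * N"
  proof -
   have "norm G <= ?O (%l. norm (of_real (l^2) * V p l))"
    unfolding G_def by (rule norm_integral_cis_le) (intro continuous_intros cV cf)
   also have "... <= ?O (%l. b^2 * (4 * N))"
   proof (rule integral_le)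
    fix l assume l: "l : {a..b}"
    then have "l^2 <= b^2" using a by (intro power_mono) auto
    then show "norm (of_real (l^2) * V p l) <= b^2 * (4 * N)"
     unfolding norm_mult using Vb[of p N l, OF sup(1)] by (intro mult_mono) (auto simp: norm_power)
   qed (intro integrable_continuous_interval continuous_intros cV cf)+
   also have "... = (b - a) * (b^2 * (4 * N))" using ab by simp
   also have "... <= b * (b^2 * (4 * N))" using a Ne by (intro mult_right_mono) auto
   finally show ?thesis by (simp add: power2_eq_square power3_eq_cube)
  qed
  have Q0: "0 <= 2 * beta * t * sqrt b * ((al0 w * k) + 4 * A * (al1 w * k))" "0 <= 32 * b ^ 3 * e" "0 <= 80 * b ^ 3 * (N + e) * k^2"
   using beta t b0 a0(2) a1(2) kk(1) A0 Ne by auto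
  have "norm G <= Q w"
  proof (cases "\<bar>beta * s\<bar> <= 1")
   case True
   have "4 * b ^ 3 * N * 1 <= 4 * b ^ 3 * N * (2 * k^2)" using kk(4)[OF True] b0 Ne by (intro mult_left_mono) auto
   also have "... = 8 * (b ^ 3 * k^2 * N)" by simp
   also have "... <= 80 * (b ^ 3 * k^2 * (N + e))" using b0 Ne by (intro mult_mono mult_left_mono) auto
   finally have "norm G <= 80 * b ^ 3 * (N + e) * k^2" using Gs by (simp add: mult_ac)
   then show ?thesis unfolding Q_def k_def[symmetric] using Q0 by linarith
  next
   case False
   then have s: "s ~= 0" "\<bar>s\<bar> > 0" "\<bar>beta * s\<bar> >= 1" by auto
   have "\<bar>s\<bar> * norm G <= b^2 * (4 * e) + (4 * b * (4 * (N + e)) + t * (sqrt b * al1 w / a)) / \<bar>s\<bar> + t * (sqrt b * al0 w)"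
    unfolding G_def
   proof (rule localized_ray[OF a ab _ s(1)])
    show "((%l. of_real (l^2) * V p l) has_vector_derivative - (of_real l * (V q l + of_real t * P F l))) (at l)" if "l > 0" for l
     unfolding V_def P_def by (rule half_wave_twisted_deriv(1)[OF W ee w that])
    show "((%l. of_real l * V p1 l) has_vector_derivative - (V p1 l + V q1 l + of_real t * P F1 l)) (at l)" if "l > 0" for l
     unfolding V_def P_def by (rule half_wave_twisted_deriv(2)[OF W1 ee w that])
    show "V p a = 0" "V p b = 0" using V0z a b0 by auto
    show "norm (V q l - V p1 l) <= 4 * e" for l
    proof -
     have "V q l - V p1 l = V (%mu x. q mu x - p1 mu x) l"
      unfolding V_def half_wave_def by (simp add: fourier_diff iq ip1 algebra_simps sum_subtractf)
     then show ?thesis using Vb[of "%mu x. q mu x - p1 mu x" e l] sup(3) by (simp add: fourier_diff iq ip1)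
    qed
    show "norm (V p1 l) <= 4 * (N + e)" for l
    proof (rule Vb)
     fix mu xi
     show "norm (fourier (p1 mu) xi) <= N + e"
      using sup(2)[of mu xi] sup(3)[of mu xi] norm_triangle_ineq4[of "fourier (q mu) xi" "fourier (q mu) xi - fourier (p1 mu) xi"] by simp
    qed
    show "norm (V q1 l) <= 4 * (N + e)" for l by (rule Vb[OF sup(4)])
    have mr: "(%r. h (r *\<^sub>R w)) : ?E" if "h : ?E" for h :: "space => real"
     using measurable_compose[OF _ that, of "%r. r *\<^sub>R w" borel] by simp
    show "?O (%l. (l * norm (P F l))^2) <= (al0 w)^2"
     by (rule radial_slice[OF a _ _ mr[OF mh(1)] s0]) (use a in \<open>auto intro!: continuous_intros cw[OF cf(5)] cw[OF cf(6)] simp: abs_mult h0_def P_def norm_mult\<close>)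
    show "?O (%l. (l * norm (P F1 l))^2) <= (al1 w)^2"
     by (rule radial_slice[OF a _ _ mr[OF mh(2)] s1]) (use a in \<open>auto intro!: continuous_intros cw[OF cf(5)] cw[OF cf(6)] simp: abs_mult h1_def P_def norm_mult\<close>)
   qed (use t a0(2) a1(2) in \<open>auto intro!: cV cP cf\<close>)
   define u where "u = 1 / \<bar>s\<bar>"
   have u: "0 <= u" "u <= 2 * beta * k" using kk(5)[OF s(3)] by (auto simp: u_def)
   have u1: "u <= 2 * beta" using u(2) kk(2) beta by (smt (verit) mult_left_le)
   have ux: "z / \<bar>s\<bar> = u * z" for z by (simp add: u_def)
   have us: "u * \<bar>s\<bar> = 1" using s by (simp add: u_def)
   have "u * (\<bar>s\<bar> * norm G) <= u * (b^2 * (4 * e) + (4 * b * (4 * (N + e)) + t * (sqrt b * al1 w / a)) / \<bar>s\<bar> + t * (sqrt b * al0 w))"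
    using u(1) by (rule mult_left_mono[rotated]) fact
   also have "... = u * ?L + (u * u) * ?R + (u * u) * (t * sqrt b * al1 w / a) + u * (t * sqrt b * al0 w)"
    unfolding ux by (simp add: algebra_simps)
   also have "u * (\<bar>s\<bar> * norm G) = norm G" using us by (simp add: mult.assoc[symmetric])
   finally have g: "norm G <= u * ?L + (u * u) * ?R + (u * u) * (t * sqrt b * al1 w / a) + u * (t * sqrt b * al0 w)" .
   \<comment> \<open>Of the two factors 1/|s| in the second forcing term only one is kept as
     \<open>k\<close>. The other is at most 2 beta and offsets the 1/a there, since beta / a = 2
     A.\<close>
   have uu: "u * u <= (2 * beta * k) * (2 * beta * k)" "u * u <= (2 * beta * k) * (2 * beta)"
    by (rule mult_mono; use u u1 beta kk(1) in simp)+
   have n: "0 <= 4 * b^2 * e" "0 <= 16 * b * (N + e)" "0 <= t * sqrt b * al1 w / a" "0 <= t * sqrt b * al0 w"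
    using b0 Ne t a a0(2) a1(2) by auto
   have g1: "u * ?L <= 32 * b ^ 3 * e"
   proof -
    have "u * ?L <= (2 * b) * ?L" using u1 betab n by (intro mult_right_mono) auto
    also have "... = 8 * (b ^ 3 * e)" by (simp add: power2_eq_square power3_eq_cube)
    also have "... <= 32 * (b ^ 3 * e)" using b0 Ne by (intro mult_right_mono) auto
    finally show ?thesis by (simp add: mult.assoc)
   qed
   have g2: "(u * u) * ?R <= 80 * b ^ 3 * (N + e) * k^2"
   proof -
    have "(u * u) * ?R <= ((2 * beta * k) * (2 * beta * k)) * ?R" using uu(1) n(2) by (rule mult_right_mono)
    also have "... = (beta * beta) * (64 * b * (N + e) * k^2)" by (simp add: power2_eq_square)
    also have "... <= (b * b) * (64 * b * (N + e) * k^2)" using betab beta b0 Ne by (intro mult_right_mono mult_mono) auto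
    also have "... = 64 * (b ^ 3 * (N + e) * k^2)" by (simp add: power3_eq_cube)
    also have "... <= 80 * (b ^ 3 * (N + e) * k^2)" using b0 Ne by (intro mult_right_mono) auto
    finally show ?thesis by (simp add: mult.assoc)
   qed
   have g3: "(u * u) * (t * sqrt b * al1 w / a) <= 2 * beta * t * sqrt b * (4 * A * (al1 w * k))"
   proof -
    have "(u * u) * (t * sqrt b * al1 w / a) <= ((2 * beta * k) * (2 * beta)) * (t * sqrt b * al1 w / a)" using uu(2) n(3) by (rule mult_right_mono)
    also have "... = 2 * beta * t * sqrt b * (2 * (beta / a) * (al1 w * k))" by simp
    finally show ?thesis unfolding betaa by simp
   qed
   have g4: "u * (t * sqrt b * al0 w) <= 2 * beta * t * sqrt b * (al0 w * k)"
   proof -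
    have "u * (t * sqrt b * al0 w) <= (2 * beta * k) * (t * sqrt b * al0 w)" using u(2) n(4) by (rule mult_right_mono)
    then show ?thesis by (simp add: mult_ac)
   qed
   have "2 * beta * t * sqrt b * (al0 w * k + 4 * A * (al1 w * k)) = 2 * beta * t * sqrt b * (al0 w * k) + 2 * beta * t * sqrt b * (4 * A * (al1 w * k))"
    by (rule distrib_left)
   then show ?thesis unfolding Q_def k_def[symmetric] using g g1 g2 g3 g4 by linarith
  qed
  then show "norm (LINT r|radial_measure. cis (r * (x \<bullet> w)) * ?H p w (r *\<^sub>R w)) <= Q w" unfolding Geq .
 qed
 have mkap[measurable]: "kap : ?E" unfolding kap_def by measurable
 note [measurable] = a0(1) a1(1)
 have kap0: "0 <= kap w" for w by (auto simp: kap_def)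
 have k2: "(\<integral>\<^sup>+w. ennreal ((kap w)^2) \<partial>sphere_measure) <= ennreal ?K"
  using angular_2[of t beta eps x] t beta eps by (simp add: kap_def power_divide)
 have k2': "(\<integral>\<^sup>+w. ennreal ((kap w)^2) \<partial>sphere_measure) <= ennreal (?B^2)"
  using k2 beta t by (simp add: power_divide)
 have cs: "(\<integral>\<^sup>+w. ennreal (al w * kap w) \<partial>sphere_measure) <= ennreal (M * ?B)"
  if "al : ?E" "!!w. al w >= 0" "M >= 0" "(\<integral>\<^sup>+w. ennreal ((al w)^2) \<partial>sphere_measure) <= ennreal (M^2)" for al :: "space => real" and M
  by (rule cauchy_schwarz_nn[OF _ _ _ _ that(4) k2']) (use that beta t kap0 in auto)
 define c1 c2 where "c1 = 80 * b ^ 3 * (N + e)" and "c2 = 2 * beta * t * sqrt b"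
 have c: "c1 >= 0" "c2 >= 0" "0 <= 32 * b ^ 3 * e" "0 <= 4 * A" using b0 Ne beta t A0 by (auto simp: c1_def c2_def)
 have "(\<integral>\<^sup>+w. norm (LINT r|radial_measure. cis (r * (x \<bullet> w)) * ?H p w (r *\<^sub>R w)) \<partial>sphere_measure)
  <= (\<integral>\<^sup>+w. ennreal c1 * ennreal ((kap w)^2) + ennreal c2 * (ennreal (al0 w * kap w) + ennreal (4 * A) * ennreal (al1 w * kap w)) + ?I \<partial>sphere_measure)"
 proof (rule nn_integral_mono_AE, rule eventually_mono[OF main])
  fix w assume *: "norm (LINT r|radial_measure. cis (r * (x \<bullet> w)) * ?H p w (r *\<^sub>R w)) <= Q w"
  have nn: "0 <= c1 * (kap w)^2" "0 <= al0 w * kap w" "0 <= al1 w * kap w" using c a0(2) a1(2) kap0 by auto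
  have "ennreal (Q w) = ennreal c1 * ennreal ((kap w)^2) + ennreal c2 * (ennreal (al0 w * kap w) + ennreal (4 * A) * ennreal (al1 w * kap w)) + ?I"
   unfolding Q_def c1_def[symmetric] c2_def[symmetric] using c nn A0
   by (simp add: ennreal_plus ennreal_mult add_nonneg_nonneg mult_nonneg_nonneg del: ennreal_numeral)
  then show "ennreal (norm (LINT r|radial_measure. cis (r * (x \<bullet> w)) * ?H p w (r *\<^sub>R w))) <= ennreal c1 * ennreal ((kap w)^2) + ennreal c2 * (ennreal (al0 w * kap w) + ennreal (4 * A) * ennreal (al1 w * kap w)) + ?I"
   using * by (metis ennreal_leI)
 qed
 also have "... = ennreal c1 * (\<integral>\<^sup>+w. ennreal ((kap w)^2) \<partial>sphere_measure) + ennreal c2 * ((\<integral>\<^sup>+w. ennreal (al0 w * kap w) \<partial>sphere_measure) + ennreal (4 * A) * (\<integral>\<^sup>+w. ennreal (al1 w * kap w) \<partial>sphere_measure)) + ?I * ennreal (4 * pi)"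
  by (simp add: nn_integral_add nn_integral_cmult emeasure_sphere_measure del: ennreal_numeral)
 also have "... <= ennreal c1 * ennreal ?K + ennreal c2 * (ennreal (M0 * ?B) + ennreal (4 * A) * ennreal (M1 * ?B)) + ?I * ennreal (4 * pi)"
  by (intro add_mono mult_left_mono k2 cs a0 a1 M order_refl) auto
 also have "... = ennreal (c1 * ?K + c2 * (M0 * ?B + 4 * A * (M1 * ?B)) + 32 * b ^ 3 * e * (4 * pi))"
 proof -
  have "ennreal y1 * ennreal y2 + ennreal y3 * (ennreal y4 + ennreal y5 * ennreal y6) + ennreal y7 * ennreal y8 = ennreal (y1 * y2 + y3 * (y4 + y5 * y6) + y7 * y8)"
   if "0 <= y1" "0 <= y2" "0 <= y3" "0 <= y4" "0 <= y5" "0 <= y6" "0 <= y7" "0 <= y8" for y1 y2 y3 y4 y5 y6 y7 y8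
   using that by (simp add: ennreal_plus ennreal_mult)
  then show ?thesis by this (use c beta t M in auto)
 qed
 also have "c1 * ?K + c2 * (M0 * ?B + 4 * A * (M1 * ?B)) + 32 * b ^ 3 * e * (4 * pi)
  = 80 * b ^ 3 * (N + e) * ?K + 2 * beta * t * sqrt b * (M0 + 4 * A * M1) * ?B + 128 * pi * b ^ 3 * e"
  unfolding c1_def c2_def by (simp add: algebra_simps)
 finally show ?thesis unfolding b_def .
qed

section \<open>Consequences of the decay assumed for localized waves\<close>

lemma AE_continuous_le:
 fixes h :: "space => real"
 assumes "continuous_on UNIV h" "AE x in lborel. h x <= N"
 shows "h x <= N"
proof -
 have "closed {x. h x <= N}" by (intro closed_Collect_le assms continuous_intros)
 moreover have "AE x in lborel. x : {x. h x <= N}" using assms(2) by simp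
 ultimately have "x : {x. h x <= N}" by (intro mem_closed_if_AE_lebesgue AE_completion)
 then show ?thesis by simp
qed

text \<open>Fourier transforms of integrable functions are continuous, so a bound on the essential
  supremum holds at every frequency.\<close>

lemma Linf_fourier_bound:
 assumes i: "!!mu. integrable lborel (%x. g x $ mu)" and N: "Linf_norm (fourier_vec g) <= ennreal N" "N >= 0"
 shows "norm (fourier (%x. g x $ (mu :: coord)) xi) <= N"
proof (rule AE_continuous_le)
 show "continuous_on UNIV (%xi. norm (fourier (%x. g x $ mu) xi))" by (intro continuous_intros fourier_continuous i)
 have "AE xi in lborel. ennreal (norm (fourier_vec g xi)) <= ennreal N"
  using esssup_AE[of "%xi. ennreal (norm (fourier_vec g xi))" lborel] N(1) unfolding Linf_norm_def by (auto elim: eventually_mono)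
 then show "AE xi in lborel. norm (fourier (%x. g x $ mu) xi) <= N"
 proof eventually_elim
  case (elim xi)
  then have "norm (fourier_vec g xi) <= N" using N(2) by simp
  then show ?case using Finite_Cartesian_Product.norm_nth_le[of "fourier_vec g xi" mu] by (simp add: fourier_vec_def)
 qed
qed

lemma locally_dominated_integrable:
 assumes "locally_dominated psi" "C_k k psi" shows "integrable lborel (psi t)"
proof -
 obtain G where G: "integrable lborel G" "\<forall>s\<in>{t..t}. \<forall>x. norm (psi s x) <= G x"
  using assms(1) unfolding locally_dominated_def by blast
 show ?thesis
 proof (rule Bochner_Integration.integrable_bound[OF G(1)])
  show "psi t : borel_measurable lborel"
   using borel_measurable_continuous_onI[OF C_k_continuous_slice[OF assms(2)]] by simp
  have "norm (psi t x) <= norm (G x)" for x using G(2) order_trans[OF _ abs_ge_self[of "G x"]] by simp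
  then show "AE x in lborel. norm (psi t x) <= norm (G x)" by simp
 qed
qed

text \<open>Transfers the frequency localization from \<phi> to \<partial>_t \<phi>: the difference
  quotients in time have vanishing transform at \<xi>, and local domination of the time derivative
  allows the limit under the integral.\<close>

lemma fourier_time_derivative_eq_0:
 assumes C: "C_k 1 psi" and d: "locally_dominated psi" "locally_dominated (pd Time psi)"
  and z: "!!s. fourier (psi s) xi = 0"
 shows "fourier (pd Time psi t) xi = 0"
proof -
 let ?A = "pd Time psi"
 have s1: "smooth1 psi" and C0: "C_k 0 ?A" using C by (auto simp: C_k_Suc_iff)
 obtain G where G: "integrable lborel G" "!!s x. s : {t..t + 1} ==> norm (?A s x) <= G x"
  using d(2)[unfolded locally_dominated_def, THEN spec, THEN spec, of t "t + 1"] by blast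
 define h where "h n = 1 / real (Suc n)" for n
 have h: "0 < h n" "h n <= 1" for n by (auto simp: h_def)
 have dv: "((%s. psi s x) has_vector_derivative ?A s x) (at s)" for s x
  using pd_line[OF s1, of "(0, x)" Time s] by (simp add: coord_dir_def)
 have i: "integrable lborel (psi s)" for s by (rule locally_dominated_integrable[OF d(1) C])
 define q where "q n x = (1 / h n) *\<^sub>R (psi (t + h n) x - psi t x)" for n x
 have fq: "fourier (q n) xi = 0" for n
  unfolding q_def fourier_scaleR by (simp add: fourier_diff i z)
 have qG: "norm (q n x) <= G x" for n x
 proof -
  have "((%s. ?A s x) has_integral psi (t + h n) x - psi t x) {t..t + h n}"
   by (rule fundamental_theorem_of_calculus) (use h[of n] in \<open>auto intro: has_vector_derivative_at_within[OF dv]\<close>)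
  note int = this[unfolded box_real(2)[symmetric]]
  have "norm (psi (t + h n) x - psi t x) <= G x * measure lborel (cbox t (t + h n))"
  proof (rule has_integral_bound[OF _ int])
   have "norm (?A t x) <= G x" using G(2)[of t x] by simp
   then show "0 <= G x" by (rule order_trans[OF norm_ge_zero])
   show "norm (?A s x) <= G x" if "s : cbox t (t + h n)" for s using that G(2)[of s x] h[of n] by auto
  qed
  then show ?thesis using h[of n] by (simp add: q_def divide_le_eq mult.commute)
 qed
 have lim: "(%n. q n x) \<longlonglongrightarrow> ?A t x" for x
 proof -
  let ?d = "?A t x"
  have "((%y. norm (psi (t + y) x - psi t x - y *\<^sub>R ?d) / norm y) \<longlongrightarrow> 0) (at 0)"
   using dv[of x t] unfolding has_vector_derivative_def has_derivative_at by simp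
  moreover have "filterlim h (at 0) sequentially"
   unfolding filterlim_at h_def using LIMSEQ_Suc[OF lim_1_over_n] by auto
  ultimately have "(%n. norm (psi (t + h n) x - psi t x - h n *\<^sub>R ?d) / norm (h n)) \<longlonglongrightarrow> 0" by (rule filterlim_compose)
  moreover have "norm (psi (t + h n) x - psi t x - h n *\<^sub>R ?d) / norm (h n) = norm (q n x - ?d)" for n
  proof -
   have "q n x - ?d = (1 / h n) *\<^sub>R (psi (t + h n) x - psi t x - h n *\<^sub>R ?d)"
    using h[of n] by (simp add: q_def scaleR_diff_right)
   then show ?thesis using h[of n] by simp
  qed
  ultimately show ?thesis using LIM_zero_cancel[OF tendsto_norm_zero_cancel] by simp
 qed
 have "(%n. fourier (q n) xi) \<longlonglongrightarrow> fourier (?A t) xi"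
  unfolding fourier_def
 proof (rule integral_dominated_convergence[OF _ _ G(1)])
  have [measurable]: "psi s : borel_measurable borel" "?A s : borel_measurable borel" for s
   using C_k_continuous_slice[OF C] C_k_continuous_slice[OF C0] by (auto intro: borel_measurable_continuous_onI)
  show "(%x. cis (- (x \<bullet> xi)) * ?A t x) : borel_measurable lborel" by measurable
  show "(%x. cis (- (x \<bullet> xi)) * q n x) : borel_measurable lborel" for n unfolding q_def by measurable
  show "AE x in lborel. (%n. cis (- (x \<bullet> xi)) * q n x) \<longlonglongrightarrow> cis (- (x \<bullet> xi)) * ?A t x"
   by (intro AE_I2 tendsto_intros lim)
  show "AE x in lborel. norm (cis (- (x \<bullet> xi)) * q n x) <= G x" for n
   using qG by (intro AE_I2) (simp add: norm_mult)
 qed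
 then show ?thesis unfolding fq by (simp add: LIMSEQ_const_iff)
qed

lemma rapid_times_integrable:
 assumes m: "rapid m" and v: "integrable lborel v"
 shows "integrable lborel (%x. m x * v x)"
proof -
 obtain K d where K: "K >= 0" "d > 0" "!!x. norm (m x) <= K * gauss d x" and c: "continuous_on UNIV m"
  using m unfolding rapid_def by blast
 have [measurable]: "m : borel_measurable borel" using c by (rule borel_measurable_continuous_onI)
 have [measurable]: "v : borel_measurable borel" using v by auto
 have mK: "norm (m x) <= K" for x
  using K(3)[of x] mult_left_mono[OF gauss_le_1[of d x] K(1)] by simp
 show ?thesis
 proof (rule Bochner_Integration.integrable_bound)
  show "integrable lborel (%x. K * norm (v x))" using v by (intro integrable_mult_right integrable_norm)
  show "AE x in lborel. norm (m x * v x) <= norm (K * norm (v x))"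
   using mK K(1) by (intro AE_I2) (simp add: norm_mult mult_right_mono)
 qed measurable
qed

text \<open>The system without cutoff. The weighted term x.grad \<partial>\<psi> is integrable
  because it equals \<partial> S \<psi> minus \<partial>\<psi> minus t \<partial>_t
  \<partial>\<psi>.\<close>

lemma gradient_wave_system:
 assumes C: "C_k 2 psi" and i: "!!mu. integrable lborel (pd mu psi t)" "!!mu nu. integrable lborel (pd nu (pd mu psi) t)"
  and iS: "!!mu. integrable lborel (pd mu (Gam Scaling psi) t)"
 shows "wave_system t (%mu. pd mu psi t) (%mu i. pd (Space i) (pd mu psi) t) (%mu. pd mu (Gam Scaling psi) t) (box psi t)"
proof -
 have C1: "C_k 1 (pd mu psi)" for mu using C by (auto simp: numeral_2_eq_2 C_k_Suc_iff)
 have com: "pd Time (pd mu psi) = pd mu (pd Time psi)" for mu by (rule pd_commute[OF C])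
 have Sc: "pd mu (Gam Scaling psi) t x = (t *\<^sub>R pd Time (pd mu psi) t x + (SUM i:UNIV. (x $ i) *\<^sub>R pd (Space i) (pd mu psi) t x)) + pd mu psi t x" for mu x
  unfolding pd_Scaling[OF C] by (simp add: Gam.simps(1))
 have ds: "(%x. SUM k:UNIV. (x $ k) *\<^sub>R pd (Space k) (pd mu psi) t x) = (%x. pd mu (Gam Scaling psi) t x - pd mu psi t x - t *\<^sub>R pd Time (pd mu psi) t x)" for mu
  unfolding Sc by (simp add: fun_eq_iff)
 show ?thesis
  unfolding wave_system_def
 proof (intro conjI allI)
  show "has_gradient (pd mu psi t) (%i. pd (Space i) (pd mu psi) t)" for mu by (rule C_k_has_gradient[OF C1])
  show "integrable lborel (%x. SUM k:UNIV. (x $ k) *\<^sub>R pd (Space k) (pd mu psi) t x)" for mu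
   unfolding ds by (intro Bochner_Integration.integrable_diff integrable_scaleR_right i iS)
  have "box psi t = (%x. - pd Time (pd Time psi) t x + (SUM i:UNIV. pd (Space i) (pd (Space i) psi) t x))"
   by (simp add: box_def fun_eq_iff)
  then show "integrable lborel (box psi t)"
   by (simp only:) (intro Bochner_Integration.integrable_add Bochner_Integration.integrable_minus Bochner_Integration.integrable_sum i)
  show "pd (Space i) (Gam Scaling psi) t x = t *\<^sub>R pd (Space i) (pd Time psi) t x + pd (Space i) psi t x + (SUM k:UNIV. (x $ k) *\<^sub>R pd (Space k) (pd (Space i) psi) t x)" for i x
   unfolding Sc com by simp
  show "pd Time (Gam Scaling psi) t x = pd Time psi t x + t *\<^sub>R (SUM i:UNIV. pd (Space i) (pd (Space i) psi) t x) + (SUM k:UNIV. (x $ k) *\<^sub>R pd (Space k) (pd Time psi) t x) - t *\<^sub>R box psi t x" for x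
   unfolding Sc box_def by (simp add: algebra_simps)
 qed (rule i)+
qed

text \<open>\<partial>\<phi> is used without cutoff, which keeps its Fourier support exact.
  \<open>fourier_admissible\<close> does not directly control \<partial>_t^2 S \<phi>, so the system
  of S \<phi> is cut. Here the majorant G is integrable, and the errors of the cutoff are measured
  in L^1, hence uniformly in frequency; they vanish in the limit.\<close>

lemma localized_pointwise:
 assumes C: "C_k 5 phi" and adm: "fourier_admissible phi" and loc: "freq_localized A k phi" and A: "A >= 1" and t: "t >= 1"
  and N: "!!w mu xi. w : words 2 ==> norm (fourier (pd mu (foldr Gam w phi) t) xi) <= N"
  and H: "square_mass H M" "!!x. norm (box phi t x) <= H x" "!!x. norm (box (Gam Scaling phi) t x) <= 3 * H x"
 shows "norm (pd mu phi t x) <= 40960 * A ^ 3 * (2 powi k)^2 / t * N + 9568 * A^2 * 2 powi k * sqrt t * M"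
proof -
 let ?F = "23 * M + 4 * A * (23 * (3 * M))"
 define beta :: real where "beta = 2 powi k"
 let ?E = "2 * A * beta"
 have beta: "beta > 0" by (simp add: beta_def)
 have M0: "M >= 0" using H(1) by (simp add: square_mass_def)
 have N0: "N >= 0" by (rule order_trans[OF norm_ge_zero N[of "[]" Time 0]]) (simp add: words_def)
 define S where "S = Gam Scaling phi"
 let ?D = "Gam Scaling S"
 have C5: "C_k (Suc 4) phi" using C by (simp add: numeral_eq_Suc)
 have CS: "C_k 4 S" and Cp: "C_k 4 (pd mu phi)" for mu unfolding S_def by (rule C_k_Gam[OF C5] C_k_pd[OF C5])+
 have CS': "C_k (Suc 3) S" and Cp': "C_k (Suc 3) (pd mu phi)" for mu using CS Cp by (simp_all add: numeral_eq_Suc)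
 have CSS: "C_k 3 ?D" and CpS: "C_k 3 (pd mu S)" and Cpp: "C_k 3 (pd nu (pd mu phi))" for mu nu
  by (rule C_k_Gam[OF CS'] C_k_pd[OF CS'] C_k_pd[OF Cp'])+
 have CSS': "C_k (Suc 2) ?D" and CpS': "C_k (Suc 2) (pd mu S)" for mu using CSS CpS by (simp_all add: numeral_eq_Suc)
 have CpSS: "C_k 2 (pd mu ?D)" and CppS: "C_k 2 (pd nu (pd mu S))" for mu nu
  by (rule C_k_pd[OF CSS'] C_k_pd[OF CpS'])+
 have C2: "C_k 2 phi" "C_k 2 S" by (rule C_k_mono[OF C] C_k_mono[OF CS], simp)+
 have ldv: "locally_dominated (foldr pd v phi)" if "length v <= 3" for v
  using adm that by (auto simp: fourier_admissible_def)
 have ldw: "locally_dominated (pd mu (foldr Gam w phi))" if "length w <= 2" for w mu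
  using adm that by (auto simp: fourier_admissible_def words_def)
 have ld: "locally_dominated phi" "locally_dominated (pd mu phi)" for mu using ldv[of "[]"] ldv[of "[mu]"] by auto
 have i0: "integrable lborel (phi s)" for s by (rule locally_dominated_integrable[OF ld(1) C])
 have i1: "integrable lborel (pd mu phi s)" for mu s by (rule locally_dominated_integrable[OF ld(2) Cp])
 have i2: "integrable lborel (pd nu (pd mu phi) t)" for mu nu
  using ldv[of "[nu, mu]"] by (intro locally_dominated_integrable[OF _ Cpp]) simp
 have iS: "integrable lborel (pd mu S t)" for mu
  using ldw[of "[Scaling]"] by (intro locally_dominated_integrable[OF _ CpS]) (simp add: S_def)
 have iSS: "integrable lborel (pd mu ?D t)" for mu
  using ldw[of "[Scaling, Scaling]"] by (intro locally_dominated_integrable[OF _ CpSS]) (simp add: S_def)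
 have iS1: "integrable lborel (pd (Space i) (pd mu S) t)" for mu i
  using ldw[of "[Transl i, Scaling]" mu] pd_commute[OF C2(2), of "Space i" mu]
  by (intro locally_dominated_integrable[OF _ CppS]) (simp add: S_def)
 have W: "wave_system t (%mu. pd mu phi t) (%mu i. pd (Space i) (pd mu phi) t) (%mu. pd mu S t) (box phi t)"
  unfolding S_def by (rule gradient_wave_system[OF C2(1) i1 i2 iS[unfolded S_def]])
 have iF: "integrable lborel (box phi t)" using W by (simp add: wave_system_def)
 have NS: "norm (fourier (pd mu phi t) xi) <= N" "norm (fourier (pd mu S t) xi) <= N" "norm (fourier (pd mu ?D t) xi) <= N" for mu xi
  using N[of "[]" mu xi] N[of "[Scaling]" mu xi] N[of "[Scaling, Scaling]" mu xi] by (auto simp: words_def S_def)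
 have supp0: "fourier (phi s) xi = 0" if "norm xi <= beta / (2 * A) \<or> norm xi >= 2 * A * beta" for s xi
 proof (rule ccontr)
  assume "fourier (phi s) xi ~= 0"
  then have "xi : {xi. fourier (phi s) xi ~= 0}" by simp
  then have "xi : closure {xi. fourier (phi s) xi ~= 0}" by (rule subsetD[OF closure_subset])
  moreover have "closure {xi. fourier (phi s) xi ~= 0} \<subseteq> {xi. norm xi <= A * beta \<and> beta <= A * norm xi}"
   using loc unfolding freq_localized_def beta_def by (rule spec)
  ultimately have "xi : {xi. norm xi <= A * beta \<and> beta <= A * norm xi}" by (rule rev_subsetD)
  then have *: "norm xi <= A * beta" "beta <= A * norm xi" by simp_all
  have "0 < A * beta" using A beta by simp
  moreover have "norm xi <= beta / (2 * A) ==> A * norm xi <= beta / 2" using A by (simp add: field_simps)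
  ultimately show False using * that beta by linarith
 qed
 have g0: "has_gradient (phi t) (%i. pd (Space i) phi t)" by (rule C_k_has_gradient[OF C_k_mono[OF C]]) simp
 have fs: "fourier (pd (Space i) phi t) xi = \<i> * of_real (xi $ i) * fourier (phi t) xi" for i xi
  by (rule fourier_deriv[OF g0 i0 i1])
 have supp: "fourier (pd mu phi t) xi = 0" if "norm xi <= beta / (2 * A) \<or> norm xi >= 2 * A * beta" for mu xi
 proof (cases mu)
  case Time
  show ?thesis unfolding Time
   by (rule fourier_time_derivative_eq_0[OF C_k_mono[OF C] ld(1) ld(2) supp0[OF that]]) simp
 qed (simp add: fs supp0[OF that])
 have cf: "continuous_on UNIV (fourier (pd mu phi t))" for mu by (rule fourier_continuous[OF i1])
 have ih: "integrable lborel (fourier (pd mu phi t))" for mu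
 proof (rule Bochner_Integration.integrable_bound)
  show "integrable lborel (%xi::space. N * indicator (cball 0 ?E) xi)"
   by (intro integrable_mult_right integrable_real_indicator) (use emeasure_lborel_cball_finite[of 0 "2 * A * beta"] in \<open>auto simp: less_top\<close>)
  show "AE xi in lborel. norm (fourier (pd mu phi t) xi) <= norm (N * indicator (cball 0 ?E) xi)"
  proof (intro AE_I2)
   fix xi :: space
   show "norm (fourier (pd mu phi t) xi) <= norm (N * indicator (cball 0 ?E) xi)"
   proof (cases "norm xi >= 2 * A * beta")
    case True then show ?thesis using supp[of xi mu] by simp
   next
    case False then show ?thesis using NS(1)[of mu xi] N0 by simp
   qed
  qed
 qed (use cf in \<open>auto intro: borel_measurable_continuous_onI\<close>)
 \<comment> \<open>Without cutoff the field is an exact gradient: its transform is parallel to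
   \<xi>, and the defect is 0.\<close>
 have curl: "(\<integral>\<^sup>+xi. norm (fourier (pd (Space i) phi t) xi - of_real (sgn xi $ i) * (SUM j:UNIV. of_real (sgn xi $ j) * fourier (pd (Space j) phi t) xi)) \<partial>lborel) <= ennreal 0" for i
 proof -
  have "fourier (pd (Space i) phi t) xi - of_real (sgn xi $ i) * (SUM j:UNIV. of_real (sgn xi $ j) * fourier (pd (Space j) phi t) xi) = 0" for xi
  proof -
   have x: "xi $ j = norm xi * (sgn xi $ j)" for j by (cases "xi = 0") (simp_all add: sgn_div_norm)
   have 1: "(SUM j:UNIV. sgn xi $ j * (xi $ j)) = norm xi"
   proof -
    have "(SUM j:UNIV. sgn xi $ j * (xi $ j)) = sgn xi \<bullet> xi" by (simp add: inner_vec_def)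
    also have "... = norm xi" by (cases "xi = 0") (simp_all add: sgn_div_norm dot_square_norm power2_eq_square)
    finally show ?thesis .
   qed
   have "(SUM j:UNIV. of_real (sgn xi $ j) * fourier (pd (Space j) phi t) xi) = (SUM j:UNIV. of_real (sgn xi $ j * (xi $ j))) * (\<i> * fourier (phi t) xi)"
    unfolding fs sum_distrib_right by (intro sum.cong refl) (simp add: mult_ac)
   also have "... = of_real (norm xi) * (\<i> * fourier (phi t) xi)" by (simp only: of_real_sum[symmetric] 1)
   finally show ?thesis unfolding fs x[of i] by (simp add: mult_ac)
  qed
  then show ?thesis by simp
 qed

 define G where "G x = (SUM mu:UNIV. norm (pd mu S t x) + norm (pd mu ?D t x))" for x
 have iG: "integrable lborel G" unfolding G_def by (intro Bochner_Integration.integrable_sum Bochner_Integration.integrable_add integrable_norm iS iSS)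
 have GS: "norm (pd mu S t x) <= G x" "norm (pd mu ?D t x) <= G x" for mu x
 proof -
  have "norm (pd mu S t x) + norm (pd mu ?D t x) <= G x"
   unfolding G_def by (rule member_le_sum[of mu UNIV "%mu. norm (pd mu S t x) + norm (pd mu ?D t x)"]) auto
  then show "norm (pd mu S t x) <= G x" "norm (pd mu ?D t x) <= G x"
   using norm_ge_zero[of "pd mu S t x"] norm_ge_zero[of "pd mu ?D t x"] by linarith+
 qed
 have G0: "G x >= 0" for x using GS(1)[of Time x] norm_ge_zero order_trans by blast
 have [measurable]: "G : borel_measurable borel" using iG by auto
 define eta where "eta n = 1 / real (Suc n)" for n
 have eta: "0 < eta n" "eta n <= 1" for n by (auto simp: eta_def)
 \<comment> \<open>The first part is the loss from cutting \<partial> S \<phi> and \<partial> S^2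
   \<phi>, the second is the bound of \<open>cutE_bounds\<close> for the commutator.\<close>
 define ome where "ome n x = (1 - gauss (eta n) x) + 17 * t * cutoff_error (eta n) x" for n x
 have [measurable]: "ome n : borel_measurable borel" for n unfolding ome_def cutoff_error_def by measurable
 have ce: "0 <= cutoff_error (eta n) x" "cutoff_error (eta n) x <= 2" for n x
  using eta[of n] by (auto simp: cutoff_error_def min_def)
 have tce: "0 <= 17 * t * cutoff_error (eta n) x" "17 * t * cutoff_error (eta n) x <= 17 * t * 2" for n x
  using ce[of n x] t by (auto intro!: mult_left_mono)
 have omeb: "0 <= ome n x" "ome n x <= 1 + 34 * t" for n x
  using tce[of n x] gauss_pos[of "eta n" x] gauss_le_1[of "eta n" x] unfolding ome_def by linarith+
 have omelim: "(%n. ome n x) \<longlonglongrightarrow> 0" for x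
 proof -
  have "eta \<longlonglongrightarrow> 0" unfolding eta_def by (rule LIMSEQ_Suc[OF lim_1_over_n])
  then have "(%n. (1 - gauss (eta n) x) + 17 * t * (eta n + min 1 ((eta n * norm x)^2))) \<longlonglongrightarrow> (1 - 1) + 17 * t * (0 + min 1 ((0 * norm x)^2))"
   using gauss_tendsto_1[of x] unfolding eta_def by (intro tendsto_intros)
  then show ?thesis unfolding ome_def cutoff_error_def by simp
 qed
 define e where "e n = (LINT x|lborel. ome n x * G x)" for n
 have iome: "integrable lborel (%x. ome n x * G x)" for n
 proof (rule Bochner_Integration.integrable_bound)
  show "integrable lborel (%x. (1 + 34 * t) * G x)" by (intro integrable_mult_right iG)
  show "AE x in lborel. norm (ome n x * G x) <= norm ((1 + 34 * t) * G x)"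
   using omeb G0 t by (intro AE_I2) (simp add: abs_mult mult_right_mono)
 qed measurable
 have elim: "e \<longlonglongrightarrow> 0"
 proof -
  have "(%n. LINT x|lborel. ome n x * G x) \<longlonglongrightarrow> (LINT x|(lborel::space measure). 0)"
  proof (rule integral_dominated_convergence)
   show "integrable lborel (%x. (1 + 34 * t) * G x)" by (intro integrable_mult_right iG)
   show "AE x in lborel. norm (ome n x * G x) <= (1 + 34 * t) * G x" for n
    using omeb G0 t by (intro AE_I2) (simp add: abs_mult mult_right_mono)
   show "AE x in lborel. (%n. ome n x * G x) \<longlonglongrightarrow> 0"
    by (intro AE_I2 tendsto_mult_left_zero omelim)
  qed measurable
  then show ?thesis by (simp add: e_def[abs_def])
 qed
 have fle: "norm (fourier g xi) <= e n" if "integrable lborel g" "!!x. norm (g x) <= ome n x * G x" for g xi n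
  unfolding e_def by (rule order_trans[OF fourier_bound[OF that(1)]]) (intro integral_mono integrable_norm that iome)

 define B where "B n = 80 * ?E ^ 3 * (N + e n) * (64 / (beta * t)) + 2 * beta * t * sqrt ?E * ?F * (8 / sqrt (beta * t)) + 128 * pi * ?E ^ 3 * e n" for n
 have e0: "e n >= 0" for n unfolding e_def using omeb G0 by (intro integral_nonneg_AE AE_I2) auto
 have pB: "norm (pd mu phi t x) <= B n" for n
 proof -
  define p1 where "p1 mu x = cut (eta n) x * pd mu S t x" for mu x
  define q1 where "q1 mu x = cut (eta n) x * pd mu ?D t x + cutE (eta n) S t mu x" for mu x
  define F1 where "F1 x = cut (eta n) x * box S t x" for x
  define Dp1 where "Dp1 mu i x = cut1 (eta n) i x * pd mu S t x + cut (eta n) x * pd (Space i) (pd mu S) t x" for mu i x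
  have cb: "continuous_on UNIV (box S t)"
   using C_k_continuous_slice[OF CppS] unfolding box_def[abs_def] by (intro continuous_intros)
  have iF1: "integrable lborel (%x. cut (eta n) x * box S t x)"
   by (rule rapid_integrable_majorized[OF H(1) rapid_cut[OF eta(1)] cb, where c = 3]) (use H(3) in \<open>simp_all add: S_def\<close>)
  note sys = cutoff_system_general[OF C2(2) eta(1)[of n] rapid_times_integrable[OF _ iS] rapid_times_integrable[OF _ iS1] iF1]
  have W1: "wave_system t p1 Dp1 q1 F1"
   unfolding p1_def[abs_def] Dp1_def[abs_def] q1_def[abs_def] F1_def[abs_def] by (rule sys(1))
  have ip1: "integrable lborel (p1 mu)" and iq1: "integrable lborel (q1 mu)" and iF1': "integrable lborel F1" for mu
   using W1 wave_system_q_integrable[OF W1] by (auto simp: wave_system_def)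
  have c1: "norm (1 - cut (eta n) x) = 1 - gauss (eta n) x" for x
  proof -
   have "1 - cut (eta n) x = of_real (1 - gauss (eta n) x)" by (simp add: cut_def)
   then show ?thesis using gauss_le_1[of "eta n" x] by (simp only: norm_of_real)
  qed
  have g1: "(1 - gauss (eta n) x) * norm v <= (1 - gauss (eta n) x) * G x" if "norm v <= G x" for v :: complex and x
   using that gauss_le_1[of "eta n" x] by (intro mult_left_mono) auto
  have om: "ome n x * G x = (1 - gauss (eta n) x) * G x + 17 * t * (cutoff_error (eta n) x * G x)" for x
   by (simp add: ome_def algebra_simps)
  have om1: "0 <= 17 * t * (cutoff_error (eta n) x * G x)" for x using ce(1)[of n x] G0[of x] t by auto
  have d1: "norm (fourier (pd mu S t) xi - fourier (p1 mu) xi) <= e n" for mu xi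
   unfolding fourier_diff[OF iS ip1, symmetric]
  proof (rule fle)
   show "norm (pd mu S t x - p1 mu x) <= ome n x * G x" for x
   proof -
    have "pd mu S t x - p1 mu x = (1 - cut (eta n) x) * pd mu S t x" by (simp add: p1_def algebra_simps)
    then have "norm (pd mu S t x - p1 mu x) = (1 - gauss (eta n) x) * norm (pd mu S t x)" by (simp add: norm_mult c1)
    then show ?thesis using g1[OF GS(1)] om om1 by (smt (verit))
   qed
  qed (intro Bochner_Integration.integrable_diff iS ip1)
  have d2: "norm (fourier (q1 mu) xi) <= N + e n" for mu xi
  proof -
   have "norm (fourier (%x. pd mu ?D t x - q1 mu x) xi) <= e n"
   proof (rule fle)
    show "norm (pd mu ?D t x - q1 mu x) <= ome n x * G x" for x
    proof -
     have "pd mu ?D t x - q1 mu x = (1 - cut (eta n) x) * pd mu ?D t x - cutE (eta n) S t mu x"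
      by (simp add: q1_def algebra_simps)
     then have "norm (pd mu ?D t x - q1 mu x) <= (1 - gauss (eta n) x) * norm (pd mu ?D t x) + norm (cutE (eta n) S t mu x)"
      using norm_triangle_ineq4[of "(1 - cut (eta n) x) * pd mu ?D t x" "cutE (eta n) S t mu x"] by (simp add: norm_mult c1)
     also have "... <= (1 - gauss (eta n) x) * G x + 17 * t * (cutoff_error (eta n) x * G x)"
      by (intro add_mono g1 GS cutE_bounds(1)[OF eta t])
     finally show ?thesis unfolding om .
    qed
   qed (intro Bochner_Integration.integrable_diff iSS iq1)
   then have "norm (fourier (pd mu ?D t) xi - fourier (q1 mu) xi) <= e n" by (simp add: fourier_diff iSS iq1)
   then show ?thesis using NS(3)[of mu xi] norm_triangle_ineq4[of "fourier (pd mu ?D t) xi" "fourier (pd mu ?D t) xi - fourier (q1 mu) xi"] by simp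
  qed
  have m0: "(\<integral>\<^sup>+xi. ennreal ((norm (fourier (box phi t) xi))^2) \<partial>lborel) <= ennreal ((23 * M)^2)"
   by (rule L2_fourier[OF iF H(2)]) (use H(1) in \<open>simp add: square_mass_def\<close>)
  have m1: "(\<integral>\<^sup>+xi. ennreal ((norm (fourier F1 xi))^2) \<partial>lborel) <= ennreal ((23 * (3 * M))^2)"
  proof (rule L2_fourier[OF iF1'])
   show "norm (F1 x) <= 3 * H x" for x
    unfolding F1_def norm_mult using mult_mono[OF cut_bounds(1)[OF eta(1)[of n] eta(2)[of n], of x] H(3)[of x]] by (simp add: S_def)
   show "(\<integral>\<^sup>+x. ennreal ((3 * H x)^2) \<partial>lborel) <= ennreal ((3 * M)^2)" using square_mass_scale[OF H(1), of 3] by (simp add: square_mass_def)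
  qed
  have "norm (pd mu phi t x) <= B n + 0"
  proof (rule reconstruct[OF i1 _ ih _ _ curl])
   show "continuous_on UNIV (pd mu phi t)" for mu by (rule C_k_continuous_slice[OF Cp])
   show "(\<integral>\<^sup>+w. norm (LINT r|radial_measure. cis (r * (x \<bullet> w)) * half_wave eps (%mu. pd mu phi t) w (r *\<^sub>R w)) \<partial>sphere_measure) <= ennreal (B n)" if "eps = 1 \<or> eps = -1" for eps
    unfolding B_def by (rule localized_core[OF W W1 t that beta A supp NS(1) NS(2) d1 d2 _ _ m0 m1]) (use M0 in auto)
   show "0 <= B n" unfolding B_def using A beta t N0 M0 e0[of n] by simp
  qed simp
  then show ?thesis by simp
 qed
 have "B \<longlonglongrightarrow> 80 * ?E ^ 3 * (N + 0) * (64 / (beta * t)) + 2 * beta * t * sqrt ?E * ?F * (8 / sqrt (beta * t)) + 128 * pi * ?E ^ 3 * 0"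
  unfolding B_def by (intro tendsto_intros elim)
 then have "norm (pd mu phi t x) <= 80 * ?E ^ 3 * (N + 0) * (64 / (beta * t)) + 2 * beta * t * sqrt ?E * ?F * (8 / sqrt (beta * t)) + 128 * pi * ?E ^ 3 * 0"
  by (rule LIMSEQ_le_const) (use pB in auto)
 \<comment> \<open>40960 is 80 * 8 * 64, where one beta of the cube cancels against 1/(beta t); 276
   is 4 * 69.\<close>
 also have "... = 40960 * A ^ 3 * beta^2 / t * N + 16 * beta * (t / sqrt t) * sqrt (2 * A) * ((23 + 276 * A) * M)"
  using beta t by (simp add: real_sqrt_mult field_simps power2_eq_square power3_eq_cube)
 also have "... <= 40960 * A ^ 3 * beta^2 / t * N + 16 * beta * sqrt t * (2 * A) * ((299 * A) * M)"
 proof (intro add_left_mono mult_mono mult_right_mono)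
  show "t / sqrt t <= sqrt t" using t by (simp add: real_div_sqrt)
  show "sqrt (2 * A) <= 2 * A" using A by (intro real_le_lsqrt) (auto simp: power2_eq_square)
 qed (use A beta t M0 in auto)
 also have "... = 40960 * A ^ 3 * beta^2 / t * N + 9568 * A^2 * beta * sqrt t * M" by (simp add: power2_eq_square)
 finally show ?thesis unfolding beta_def .
qed

text \<open>\<open>localized_pointwise\<close> is summed over four components. The constants are 8 *
  40960, with a further 2 from \<open>jap t <= 2 * t\<close>, and 4 * 9568; the number of words
  enters through \<open>square_mass_sum\<close>.\<close>

lemma localized_decay:
 assumes s: "solves_wave phi f phi0 phi1" and adm: "fourier_admissible phi" and loc: "freq_localized A k phi" and A: "A >= 1" and t: "t > 1"
 shows "ennreal (norm (grad phi t x)) \<le>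
     ennreal (327680 * A ^ 3 + 38272 * A^2 * real (card (words 1))) *
     (ennreal (jap t powr (-1) * 2 powi (2 * k))
      * (SUM w:words 2. Linf_norm (fourier_vec (grad (foldr Gam w phi) t)))
     + ennreal (jap t powr (1/2) * 2 powi k)
      * (SUM w:words 1. L2_norm (foldr Gam w f t)))"
proof -
 define P where "P = (SUM w:words 2. Linf_norm (fourier_vec (grad (foldr Gam w phi) t)))"
 define Q where "Q = (SUM w:words 1. L2_norm (foldr Gam w f t))"
 define c where "c = real (card (words 1))"
 define C where "C = 327680 * A ^ 3 + 38272 * A^2 * c"
 define beta :: real where "beta = 2 powi k"
 let ?B = "ennreal (jap t powr (-1) * beta^2) * P + ennreal (jap t powr (1/2) * beta) * Q"
 have beta: "beta > 0" "2 powi (2 * k) = beta^2"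
  by (simp add: beta_def) (simp only: beta_def mult.commute[of 2 k] power_int_mult power_int_numeral)
 have C5: "C_k 5 phi" and f: "f = box phi" using s by (auto simp: solves_wave_def fun_eq_iff)
 have jt: "t <= jap t" "jap t <= 2 * t" "0 < jap t" using jap_bounds[of t] t by auto
 have c0: "c >= 0" by (simp add: c_def)
 have C0: "C > 0" using A c0 by (simp add: C_def add_pos_nonneg)
 show ?thesis
  unfolding P_def[symmetric] Q_def[symmetric] c_def[symmetric] C_def[symmetric] beta(2) beta_def[symmetric]
 proof (cases "P = \<infinity> \<or> Q = \<infinity>")
  case True
  have "0 < jap t powr (-1) * beta^2" "0 < jap t powr (1/2) * beta" using jt beta by auto
  then have "ennreal C * ?B = \<infinity>"
   using True C0 by (auto simp: ennreal_mult_eq_top_iff ennreal_eq_0_iff not_le)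
  then show "ennreal (norm (grad phi t x)) <= ennreal C * ?B" by simp
 next
  case False
  obtain a b where ab: "P = ennreal a" "Q = ennreal b" "a >= 0" "b >= 0"
   using False by (metis ennreal_cases infinity_ennreal_def)
  have Cb: "C_k 3 (box phi)" by (rule C_k_box) (use C5 in \<open>simp add: numeral_eq_Suc\<close>)
  define H where "H x = (SUM w:words 1. norm (foldr Gam w (box phi) t x))" for x
  have "continuous_on UNIV (foldr Gam w (box phi) t)" if "w : words 1" for w
   using that by (intro C_k_continuous_slice[of 0] C_k_foldr_Gam C_k_mono[OF Cb]) (simp add: words_def)
  then have "square_mass H (real (card (words 1)) * enn2real (SUM w:words 1. L2_norm (foldr Gam w (box phi) t)))"
   unfolding H_def by (intro square_mass_sum finite_words) (use ab in \<open>simp_all add: Q_def f\<close>)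
  then have H: "square_mass H (c * b)" using ab by (simp add: c_def Q_def f)
  have h: "norm (foldr Gam w (box phi) t x) <= H x" if "length w <= 1" for w x
   unfolding H_def using that finite_words by (intro member_le_sum[where f = "%w. norm (foldr Gam w (box phi) t x)"]) (auto simp: words_def)
  have H0: "norm (box phi t x) <= H x" for x using h[of "[]" x] by simp
  have HS: "norm (box (Gam Scaling phi) t x) <= 3 * H x" for x
  proof -
   have "box (Gam Scaling phi) t x = Gam Scaling (box phi) t x + 2 * box phi t x"
    by (subst box_Scaling) (use C_k_mono[OF C5] in auto)
   then have "norm (box (Gam Scaling phi) t x) <= norm (Gam Scaling (box phi) t x) + 2 * norm (box phi t x)"
    using norm_triangle_ineq[of "Gam Scaling (box phi) t x" "2 * box phi t x"] by (simp add: norm_mult)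
   then show ?thesis using h[of "[]" x] h[of "[Scaling]" x] by simp
  qed
  have N: "norm (fourier (pd mu (foldr Gam w phi) t) xi) <= a" if w: "w : words 2" for w mu xi
  proof -
   have "C_k 1 (foldr Gam w phi)" using w by (intro C_k_foldr_Gam C_k_mono[OF C5]) (simp add: words_def)
   then have C0: "C_k 0 (pd nu (foldr Gam w phi))" for nu by (simp add: C_k_Suc_iff)
   have "locally_dominated (pd nu (foldr Gam w phi))" for nu using adm w by (auto simp: fourier_admissible_def)
   then have i: "integrable lborel (pd nu (foldr Gam w phi) t)" for nu by (rule locally_dominated_integrable[OF _ C0])
   have "Linf_norm (fourier_vec (grad (foldr Gam w phi) t)) <= P"
    unfolding P_def using w finite_words by (intro member_le_sum) auto
   then have *: "Linf_norm (fourier_vec (grad (foldr Gam w phi) t)) <= ennreal a" by (simp add: ab)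
   have "norm (fourier (%x. grad (foldr Gam w phi) t x $ mu) xi) <= a"
    by (rule Linf_fourier_bound[OF _ * ab(3)]) (simp add: grad_def i)
   then show ?thesis by (simp add: grad_def)
  qed
  have pt: "norm (pd mu phi t x) <= 40960 * A ^ 3 * beta^2 / t * a + 9568 * A^2 * beta * sqrt t * (c * b)" for mu
   unfolding beta_def by (rule localized_pointwise[OF C5 adm loc A _ N H H0 HS]) (use t in simp_all)
  have "norm (grad phi t x) <= (SUM mu:UNIV. norm (pd mu phi t x))" by (rule norm_grad_le)
  also have "... <= (SUM mu:(UNIV::coord set). 40960 * A ^ 3 * beta^2 / t * a + 9568 * A^2 * beta * sqrt t * (c * b))" by (intro sum_mono pt)
  also have "... = 163840 * A ^ 3 * (1 / t) * (beta^2 * a) + 38272 * A^2 * c * sqrt t * (beta * b)" by (simp add: card_coord)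
  also have "... <= 163840 * A ^ 3 * (2 * jap t powr (-1)) * (beta^2 * a) + 38272 * A^2 * c * jap t powr (1/2) * (beta * b)"
  proof (intro add_mono mult_right_mono mult_left_mono)
   show "1 / t <= 2 * jap t powr (-1)" using jt t by (simp add: powr_minus_divide field_simps)
   show "sqrt t <= jap t powr (1/2)" using jt t by (simp add: powr_half_sqrt)
  qed (use A c0 ab beta in auto)
  also have "... <= C * (jap t powr (-1) * beta^2 * a + jap t powr (1/2) * beta * b)"
  proof -
   define X where "X = jap t powr (-1) * beta^2 * a"
   define Y where "Y = jap t powr (1/2) * beta * b"
   have XY: "X >= 0" "Y >= 0" using beta ab by (auto simp: X_def Y_def)
   define u v where "u = 327680 * A ^ 3" and "v = 38272 * A^2 * c"
   have "u >= 0" "v >= 0" using A c0 by (auto simp: u_def v_def)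
   then have "0 <= u * Y" "0 <= v * X" using XY by auto
   then have "u * X + v * Y <= (u + v) * (X + Y)" by (simp add: algebra_simps)
   then show ?thesis unfolding C_def X_def Y_def u_def v_def by (simp add: mult_ac)
  qed
  finally have "ennreal (norm (grad phi t x)) <= ennreal (C * (jap t powr (-1) * beta^2 * a + jap t powr (1/2) * beta * b))" by (rule ennreal_leI)
  also have "... = ennreal C * ?B"
  proof -
   have "ennreal C * (ennreal y1 * ennreal a + ennreal y2 * ennreal b) = ennreal (C * (y1 * a + y2 * b))" if "y1 >= 0" "y2 >= 0" for y1 y2
    using that C0 ab(3,4) by (simp add: ennreal_mult ennreal_plus)
   then show ?thesis unfolding ab using beta by simp
  qed
  finally show "ennreal (norm (grad phi t x)) <= ennreal C * ?B" .
 qed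
qed

theorem theorem1p2:
  shows "\<exists>T0>0.
    (\<exists>\<delta>0>0. \<exists>C>0. \<forall>\<delta> \<phi> f \<phi>0 \<phi>1 t x.
       0 < \<delta> \<longrightarrow> \<delta> \<le> \<delta>0 \<longrightarrow> solves_wave \<phi> f \<phi>0 \<phi>1 \<longrightarrow> t > T0 \<longrightarrow>
       ennreal (norm (grad \<phi> t x)) \<le>
         ennreal (C * inverse \<delta>) *
         (ennreal (jap t powr (-1/2) *
             (jap (t - norm x) powr (-1 + \<delta>) * indicator {y. norm y \<le> t} x
              + indicator {y. norm y > t} x))
            * (\<Sum>w\<in>words 3. L2_norm (grad (foldr Gam w \<phi>) t))
          + ennreal (jap t powr (1/2)) * (\<Sum>w\<in>words 2. L2_norm (foldr Gam w f t))))
    \<and>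
    (\<forall>A\<ge>1. \<exists>C>0. \<forall>(k::int) \<phi> f \<phi>0 \<phi>1 t x.
       solves_wave \<phi> f \<phi>0 \<phi>1 \<longrightarrow> fourier_admissible \<phi> \<longrightarrow> freq_localized A k \<phi> \<longrightarrow> t > T0 \<longrightarrow>
       ennreal (norm (grad \<phi> t x)) \<le>
         ennreal C *
         (ennreal (jap t powr (-1) * 2 powi (2 * k))
            * (\<Sum>w\<in>words 2. Linf_norm (fourier_vec (grad (foldr Gam w \<phi>) t)))
          + ennreal (jap t powr (1/2) * 2 powi k)
            * (\<Sum>w\<in>words 1. L2_norm (foldr Gam w f t))))
    \<and>
    (\<exists>C>0. \<forall>\<phi> \<phi>0 \<phi>1 t.
       solves_wave \<phi> (\<lambda>_ _. 0) \<phi>0 \<phi>1 \<longrightarrow> t > T0 \<longrightarrow>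
       Linf_norm (grad \<phi> t) \<le>
         ennreal (C * jap t powr (-1)) *
         ((\<Sum>w\<in>words 4. L1_norm (foldr data_Gam w \<phi>0))
          + (\<Sum>w\<in>words 4. L1_norm (foldr data_Gam w \<phi>1))))"
\<comment> \<open>With T0 = 1 the values t and \<open>jap t\<close> are comparable by
  \<open>jap_bounds\<close>.\<close>
proof (rule exI[of _ 1], intro conjI, goal_cases)
  case 1
  show ?case by simp
next
  case 2
  \<comment> \<open>\<open>words 3\<close> contains the empty word, so the constant is positive; the
    admissible range of \<delta> ends at 1.\<close>
  have "0 < card (words 3)" using finite_words[of 3] by (auto simp: card_gt_0_iff words_def intro: exI[of _ "[]"])
  then show ?case
    by (intro exI[of _ 1] exI[of _ "12812288 * (real (card (words 3)) + real (card (words 2)))"] conjI allI impI inhomogeneous_decay) auto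
next
  case 3
  show ?case
  proof (intro allI impI, goal_cases)
    case (1 A)
    have "0 < 327680 * A ^ 3 + 38272 * A\<^sup>2 * real (card (words 1))" using 1 by (intro add_pos_nonneg) auto
    then show ?case using localized_decay[OF _ _ _ 1] by blast
  qed
next
  case 4
  show ?case by (intro exI[of _ 480] conjI allI impI homogeneous_decay) auto
qed

end
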